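(* Let $A$ be a brick-finite finite dimensional algebra over a field $k$. If $\operatorname{tors} A$ is extremal (equivalently, left modular), then the following lattices are also extremal: (1) $\operatorname{tors}(A/J)$, for any two-sided ideal $J$ of $A$; (2) $\operatorname{tors}(eAe)$, for any idempotent $e$ of $A$; (3) $\operatorname{tors} B$, for any algebra $B$ which is a $\tau$-reduction of $A$.
   Context: $\operatorname{mod} A$ is the category of finitely generated left $A$-modules. $A$ is brick-finite if there are only finitely many isomorphism classes of bricks (modules in $\operatorname{mod} A$ whose endomorphism algebra is a division algebra); equivalently, the lattice $\operatorname{tors} A$ of torsion classes in $\operatorname{mod} A$, ordered by inclusion, is finite. Let $L$ be a finite lattice of length $m$ (the maximal $r$ such that there is a chain $x_0<\cdots<x_r$). $L$ is extremal if it has exactly $m$ join-irreducible and exactly $m$ meet-irreducible elements ($0$ is not considered join-irreducible and $1$ is not considered meet-irreducible). An element $x\in L$ is left modular if $(y\vee x)\wedge z=y\vee(x\wedge z)$ for all $y\le z$; $L$ is left modular if it has a maximal chain of left modular elements. $\tau$-reduction (Jasso's $\tau$-tilting reduction): let $U\in\operatorname{mod} A$ be a $\tau$-rigid module, i.e. $\operatorname{Hom}_A(U,\tau U)=0$ with $\tau$ the Auslander–Reiten translation. Let $T$ be the Bongartz completion of $U$, i.e. the basic $\tau$-tilting module that is the direct sum of the indecomposable Ext-projective objects of the torsion class ${}^{\perp}(\tau U)=\{X\mid \operatorname{Hom}_A(X,\tau U)=0\}$; it has $U$ (taken basic) as a direct summand. Let $E=\operatorname{End}_A(T)^{\mathrm{op}}$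 and let $e_U\in E$ be the idempotent corresponding to the projection onto $U$. The algebra $B=E/\langle e_U\rangle$ is called the $\tau$-reduction of $A$ at $U$; its module category is equivalent to the wide subcategory $U^{\perp}\cap{}^{\perp}(\tau U)$ of $\operatorname{mod} A$. *)

theory Defs
  imports "HOL-Algebra.QuotRing" "HOL-Algebra.Module" "HOL-Algebra.Lattice"
begin

section \<open>Finite lattices\<close>

locale finite_lattice = bounded_lattice L for L (structure) +
  assumes finite_carrier: "finite (carrier L)"

definition lattice_length :: "('a, 'x) gorder_scheme \<Rightarrow> nat" where
  "lattice_length L =
     Max {r. \<exists>x :: nat \<Rightarrow> 'a. (\<forall>i\<le>r. x i \<in> carrier L) \<and> (\<forall>i<r. x i \<sqsubset>\<^bsub>L\<^esub> x (Suc i))}"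

definition join_irreducible :: "('a, 'x) gorder_scheme \<Rightarrow> 'a \<Rightarrow> bool" where
  "join_irreducible L x \<longleftrightarrow> x \<in> carrier L \<and> x \<noteq> \<bottom>\<^bsub>L\<^esub> \<and>
     (\<forall>y\<in>carrier L. \<forall>z\<in>carrier L. x = y \<squnion>\<^bsub>L\<^esub> z \<longrightarrow> x = y \<or> x = z)"

definition meet_irreducible :: "('a, 'x) gorder_scheme \<Rightarrow> 'a \<Rightarrow> bool" where
  "meet_irreducible L x \<longleftrightarrow> x \<in> carrier L \<and> x \<noteq> \<top>\<^bsub>L\<^esub> \<and>
     (\<forall>y\<in>carrier L. \<forall>z\<in>carrier L. x = y \<sqinter>\<^bsub>L\<^esub> z \<longrightarrow> x = y \<or> x = z)"

definition extremal_lattice :: "('a, 'x) gorder_scheme \<Rightarrow> bool" where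
  "extremal_lattice L \<longleftrightarrow> finite_lattice L \<and>
     card {x. join_irreducible L x} = lattice_length L \<and>
     card {x. meet_irreducible L x} = lattice_length L"

definition left_modular_element :: "('a, 'x) gorder_scheme \<Rightarrow> 'a \<Rightarrow> bool" where
  "left_modular_element L x \<longleftrightarrow> x \<in> carrier L \<and>
     (\<forall>y\<in>carrier L. \<forall>z\<in>carrier L. y \<sqsubseteq>\<^bsub>L\<^esub> z \<longrightarrow>
        (y \<squnion>\<^bsub>L\<^esub> x) \<sqinter>\<^bsub>L\<^esub> z = y \<squnion>\<^bsub>L\<^esub> (x \<sqinter>\<^bsub>L\<^esub> z))"

definition maximal_chain :: "('a, 'x) gorder_scheme \<Rightarrow> 'a set \<Rightarrow> bool" where
  "maximal_chain L C \<longleftrightarrow> C \<subseteq> carrier L \<and>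
     (\<forall>x\<in>C. \<forall>y\<in>C. x \<sqsubseteq>\<^bsub>L\<^esub> y \<or> y \<sqsubseteq>\<^bsub>L\<^esub> x) \<and>
     (\<forall>z\<in>carrier L. (\<forall>x\<in>C. x \<sqsubseteq>\<^bsub>L\<^esub> z \<or> z \<sqsubseteq>\<^bsub>L\<^esub> x) \<longrightarrow> z \<in> C)"

definition left_modular_lattice :: "('a, 'x) gorder_scheme \<Rightarrow> bool" where
  "left_modular_lattice L \<longleftrightarrow> finite_lattice L \<and>
     (\<exists>C. maximal_chain L C \<and> (\<forall>x\<in>C. left_modular_element L x))"


section \<open>Left modules over non-commutative rings\<close>

text \<open>
  The locale \<^locale>\<open>module\<close> of the library requires commutative scalars. Its record type and its
  locale \<^locale>\<open>submodule\<close> do not, and are reused here. The fields \<open>mult\<close> and \<open>one\<close> of a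
  module record play no role when it is regarded as a left module.
\<close>

locale left_module = R: ring R + M: abelian_group M
  for R :: "('a, 'x) ring_scheme" and M :: "('a, 'm, 'y) module_scheme" +
  assumes smult_closed [simp, intro]:
      "\<lbrakk>a \<in> carrier R; x \<in> carrier M\<rbrakk> \<Longrightarrow> a \<odot>\<^bsub>M\<^esub> x \<in> carrier M"
    and smult_l_distr:
      "\<lbrakk>a \<in> carrier R; b \<in> carrier R; x \<in> carrier M\<rbrakk> \<Longrightarrow>
         (a \<oplus>\<^bsub>R\<^esub> b) \<odot>\<^bsub>M\<^esub> x = a \<odot>\<^bsub>M\<^esub> x \<oplus>\<^bsub>M\<^esub> b \<odot>\<^bsub>M\<^esub> x"
    and smult_r_distr:
      "\<lbrakk>a \<in> carrier R; x \<in> carrier M; y \<in> carrier M\<rbrakk> \<Longrightarrow>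
         a \<odot>\<^bsub>M\<^esub> (x \<oplus>\<^bsub>M\<^esub> y) = a \<odot>\<^bsub>M\<^esub> x \<oplus>\<^bsub>M\<^esub> a \<odot>\<^bsub>M\<^esub> y"
    and smult_assoc:
      "\<lbrakk>a \<in> carrier R; b \<in> carrier R; x \<in> carrier M\<rbrakk> \<Longrightarrow>
         (a \<otimes>\<^bsub>R\<^esub> b) \<odot>\<^bsub>M\<^esub> x = a \<odot>\<^bsub>M\<^esub> (b \<odot>\<^bsub>M\<^esub> x)"
    and smult_one [simp]: "x \<in> carrier M \<Longrightarrow> \<one>\<^bsub>R\<^esub> \<odot>\<^bsub>M\<^esub> x = x"

definition fin_gen :: "('a, 'x) ring_scheme \<Rightarrow> ('a, 'm, 'y) module_scheme \<Rightarrow> bool" where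
  "fin_gen R M \<longleftrightarrow> (\<exists>S. finite S \<and> S \<subseteq> carrier M \<and>
     (\<forall>H. submodule H R M \<and> S \<subseteq> H \<longrightarrow> H = carrier M))"

text \<open>
  The objects of \<open>mod R\<close> are the finitely generated left modules with carrier in the type
  \<^typ>\<open>'a list\<close>, where \<^typ>\<open>'a\<close> is the type of the elements of \<open>R\<close>. A finitely generated module
  is a quotient of a free module of finite rank, so it has an isomorphic copy of this kind;
  see \<open>ex_iso_fgmod\<close> below.
\<close>

definition fgmod :: "('a, 'x) ring_scheme \<Rightarrow> ('a, 'a list) module set" where
  "fgmod R = {M. left_module R M \<and> fin_gen R M}"

text \<open>
  Homomorphisms are extensional functions, so that each homomorphism is represented once.
\<close>

definition mod_hom ::
    "('a, 'x) ring_scheme \<Rightarrow> ('a, 'm, 'y) module_scheme \<Rightarrow> ('a, 'n, 'z) module_scheme \<Rightarrow> ('m \<Rightarrow> 'n) set"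
  where
  "mod_hom R M N = {h \<in> carrier M \<rightarrow>\<^sub>E carrier N.
     (\<forall>x\<in>carrier M. \<forall>y\<in>carrier M. h (x \<oplus>\<^bsub>M\<^esub> y) = h x \<oplus>\<^bsub>N\<^esub> h y) \<and>
     (\<forall>a\<in>carrier R. \<forall>x\<in>carrier M. h (a \<odot>\<^bsub>M\<^esub> x) = a \<odot>\<^bsub>N\<^esub> h x)}"

definition mod_iso ::
    "('a, 'x) ring_scheme \<Rightarrow> ('a, 'm, 'y) module_scheme \<Rightarrow> ('a, 'n, 'z) module_scheme \<Rightarrow> bool"
  where
  "mod_iso R M N \<longleftrightarrow> (\<exists>h\<in>mod_hom R M N. bij_betw h (carrier M) (carrier N))"

lemma (in left_module) smult_zero_r: assumes "a \<in> carrier R" shows "a \<odot>\<^bsub>M\<^esub> \<zero>\<^bsub>M\<^esub> = \<zero>\<^bsub>M\<^esub>"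
proof -
  have "a \<odot>\<^bsub>M\<^esub> \<zero>\<^bsub>M\<^esub> \<oplus>\<^bsub>M\<^esub> a \<odot>\<^bsub>M\<^esub> \<zero>\<^bsub>M\<^esub> = a \<odot>\<^bsub>M\<^esub> \<zero>\<^bsub>M\<^esub>"
    using assms smult_r_distr[of a "\<zero>\<^bsub>M\<^esub>" "\<zero>\<^bsub>M\<^esub>"] by simp
  then show ?thesis using assms M.add.r_cancel_one' by (metis M.zero_closed smult_closed)
qed

lemma (in left_module) smult_zero_l: assumes "x \<in> carrier M" shows "\<zero>\<^bsub>R\<^esub> \<odot>\<^bsub>M\<^esub> x = \<zero>\<^bsub>M\<^esub>"
proof -
  have "\<zero>\<^bsub>R\<^esub> \<odot>\<^bsub>M\<^esub> x \<oplus>\<^bsub>M\<^esub> \<zero>\<^bsub>R\<^esub> \<odot>\<^bsub>M\<^esub> x = \<zero>\<^bsub>R\<^esub> \<odot>\<^bsub>M\<^esub> x"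
    using assms smult_l_distr[of "\<zero>\<^bsub>R\<^esub>" "\<zero>\<^bsub>R\<^esub>" x] by simp
  then show ?thesis using assms M.add.r_cancel_one' by (metis R.zero_closed smult_closed)
qed

lemma (in left_module) smult_minus_one: assumes "x \<in> carrier M"
  shows "(\<ominus>\<^bsub>R\<^esub> \<one>\<^bsub>R\<^esub>) \<odot>\<^bsub>M\<^esub> x = \<ominus>\<^bsub>M\<^esub> x"
proof -
  have "(\<ominus>\<^bsub>R\<^esub> \<one>\<^bsub>R\<^esub>) \<odot>\<^bsub>M\<^esub> x \<oplus>\<^bsub>M\<^esub> x = \<zero>\<^bsub>M\<^esub>"
    using assms smult_l_distr[of "\<ominus>\<^bsub>R\<^esub> \<one>\<^bsub>R\<^esub>" "\<one>\<^bsub>R\<^esub>" x] by (simp add: R.l_neg smult_zero_l)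
  then show ?thesis using assms by (metis M.minus_equality R.a_inv_closed R.one_closed smult_closed)
qed

lemma (in left_module) submoduleI:
  assumes "H \<subseteq> carrier M" "\<zero>\<^bsub>M\<^esub> \<in> H"
    and "\<And>x y. \<lbrakk>x \<in> H; y \<in> H\<rbrakk> \<Longrightarrow> x \<oplus>\<^bsub>M\<^esub> y \<in> H"
    and sm: "\<And>a x. \<lbrakk>a \<in> carrier R; x \<in> H\<rbrakk> \<Longrightarrow> a \<odot>\<^bsub>M\<^esub> x \<in> H"
  shows "submodule H R M"
proof -
  have "\<ominus>\<^bsub>M\<^esub> x \<in> H" if "x \<in> H" for x
    using sm[of "\<ominus>\<^bsub>R\<^esub> \<one>\<^bsub>R\<^esub>" x] that smult_minus_one[of x] assms(1) by auto
  then show ?thesis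
    by (intro submodule.intro subgroup.intro submodule_axioms.intro) (use assms in \<open>auto simp: a_inv_def\<close>)
qed

lemma (in left_module) ex_submodule_into_lists:
  assumes "finite S" "S \<subseteq> carrier M"
  shows "\<exists>H f. submodule H R M \<and> S \<subseteq> H \<and> inj_on (f :: 'm \<Rightarrow> 'a list) H"
  using assms
proof (induction S rule: finite_induct)
  case empty
  have "submodule {\<zero>\<^bsub>M\<^esub>} R M" by (rule submoduleI) (auto simp: smult_zero_r)
  then show ?case by (intro exI[of _ "{\<zero>\<^bsub>M\<^esub>}"] exI[of _ "\<lambda>_. []"]) auto
next
  case (insert x S)
  then obtain H and f :: "'m \<Rightarrow> 'a list" where H: "submodule H R M" "S \<subseteq> H" "inj_on f H" by auto
  have x: "x \<in> carrier M" using insert by simp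
  interpret H: submodule H R M by fact
  have Hc: "h \<in> carrier M" if "h \<in> H" for h using H.subset that by auto
  have Hz: "\<zero>\<^bsub>M\<^esub> \<in> H" using H.one_closed by simp
  have Ha: "h \<oplus>\<^bsub>M\<^esub> h' \<in> H" if "h \<in> H" "h' \<in> H" for h h' using H.m_closed that by simp
  define H' where "H' = {a \<odot>\<^bsub>M\<^esub> x \<oplus>\<^bsub>M\<^esub> h | a h. a \<in> carrier R \<and> h \<in> H}"
  have "submodule H' R M"
  proof (rule submoduleI)
    show "H' \<subseteq> carrier M" unfolding H'_def using x Hc by auto
    show "\<zero>\<^bsub>M\<^esub> \<in> H'" unfolding H'_def using x Hz
      by (auto intro!: exI[of _ "\<zero>\<^bsub>R\<^esub>"] exI[of _ "\<zero>\<^bsub>M\<^esub>"] simp: smult_zero_l)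
  next
    fix u v assume "u \<in> H'" "v \<in> H'"
    then obtain a h b k where *: "a \<in> carrier R" "h \<in> H" "b \<in> carrier R" "k \<in> H"
      "u = a \<odot>\<^bsub>M\<^esub> x \<oplus>\<^bsub>M\<^esub> h" "v = b \<odot>\<^bsub>M\<^esub> x \<oplus>\<^bsub>M\<^esub> k" unfolding H'_def by auto
    have "u \<oplus>\<^bsub>M\<^esub> v = (a \<oplus>\<^bsub>R\<^esub> b) \<odot>\<^bsub>M\<^esub> x \<oplus>\<^bsub>M\<^esub> (h \<oplus>\<^bsub>M\<^esub> k)"
      using * x Hc by (simp add: smult_l_distr M.a_ac)
    then show "u \<oplus>\<^bsub>M\<^esub> v \<in> H'" unfolding H'_def using * Ha by blast
  next
    fix c u assume c: "c \<in> carrier R" and "u \<in> H'"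
    then obtain a h where *: "a \<in> carrier R" "h \<in> H" "u = a \<odot>\<^bsub>M\<^esub> x \<oplus>\<^bsub>M\<^esub> h" unfolding H'_def by auto
    have "c \<odot>\<^bsub>M\<^esub> u = (c \<otimes>\<^bsub>R\<^esub> a) \<odot>\<^bsub>M\<^esub> x \<oplus>\<^bsub>M\<^esub> c \<odot>\<^bsub>M\<^esub> h"
      using * c x Hc by (simp add: smult_r_distr smult_assoc)
    then show "c \<odot>\<^bsub>M\<^esub> u \<in> H'" unfolding H'_def using * c H.smult_closed by blast
  qed
  moreover have "insert x S \<subseteq> H'"
  proof -
    have H'I: "a \<odot>\<^bsub>M\<^esub> x \<oplus>\<^bsub>M\<^esub> h \<in> H'" if "a \<in> carrier R" "h \<in> H" for a h
      unfolding H'_def using that by blast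
    have "x \<in> H'" using H'I[of "\<one>\<^bsub>R\<^esub>" "\<zero>\<^bsub>M\<^esub>"] Hz x by simp
    moreover have "H \<subseteq> H'"
    proof
      fix h assume "h \<in> H"
      then show "h \<in> H'" using H'I[of "\<zero>\<^bsub>R\<^esub>" h] Hc x by (simp add: smult_zero_l)
    qed
    ultimately show ?thesis using H by auto
  qed
  moreover have "\<exists>f' :: 'm \<Rightarrow> 'a list. inj_on f' H'"
  proof -
    have "\<forall>u\<in>H'. \<exists>p. fst p \<in> carrier R \<and> snd p \<in> H \<and> fst p \<odot>\<^bsub>M\<^esub> x \<oplus>\<^bsub>M\<^esub> snd p = u"
      unfolding H'_def by auto
    then obtain p where p: "\<forall>u\<in>H'. fst (p u) \<in> carrier R \<and> snd (p u) \<in> H \<and>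
        fst (p u) \<odot>\<^bsub>M\<^esub> x \<oplus>\<^bsub>M\<^esub> snd (p u) = u" by (rule bchoice[THEN exE])
    have "inj_on (\<lambda>u. fst (p u) # f (snd (p u))) H'"
    proof (rule inj_onI)
      fix u v assume uv: "u \<in> H'" "v \<in> H'" "fst (p u) # f (snd (p u)) = fst (p v) # f (snd (p v))"
      then have "fst (p u) = fst (p v)" "snd (p u) = snd (p v)"
        using H(3) p unfolding inj_on_def by auto
      then show "u = v" using p uv by metis
    qed
    then show ?thesis by blast
  qed
  ultimately show ?case by blast
qed

lemma ex_iso_fgmod:
  fixes R :: "('a, 'x) ring_scheme" and M :: "('a, 'm, 'y) module_scheme"
  assumes "left_module R M" "fin_gen R M"
  shows "\<exists>N\<in>fgmod R. mod_iso R M N"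
proof -
  interpret left_module R M by fact
  obtain S where S: "finite S" "S \<subseteq> carrier M"
    and gen: "\<forall>H. submodule H R M \<and> S \<subseteq> H \<longrightarrow> H = carrier M"
    using assms(2) unfolding fin_gen_def by (elim exE conjE)
  obtain H and f :: "'m \<Rightarrow> 'a list" where Hf: "submodule H R M" "S \<subseteq> H" "inj_on f H"
    using ex_submodule_into_lists[OF S] by (elim exE conjE)
  have "H = carrier M" using gen Hf by simp
  with Hf have f: "inj_on f (carrier M)" by simp
  define g where "g = inv_into (carrier M) f"
  have gf: "g (f x) = x" if "x \<in> carrier M" for x using f that unfolding g_def by simp
  define N :: "('a, 'a list) module" where "N = \<lparr>carrier = f ` carrier M, mult = undefined, one = undefined,
    zero = f \<zero>\<^bsub>M\<^esub>, add = (\<lambda>u v. f (g u \<oplus>\<^bsub>M\<^esub> g v)), smult = (\<lambda>a u. f (a \<odot>\<^bsub>M\<^esub> g u))\<rparr>"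
  have N: "carrier N = f ` carrier M" "\<zero>\<^bsub>N\<^esub> = f \<zero>\<^bsub>M\<^esub>"
    "\<And>x y. \<lbrakk>x \<in> carrier M; y \<in> carrier M\<rbrakk> \<Longrightarrow> f x \<oplus>\<^bsub>N\<^esub> f y = f (x \<oplus>\<^bsub>M\<^esub> y)"
    "\<And>a x. x \<in> carrier M \<Longrightarrow> a \<odot>\<^bsub>N\<^esub> f x = f (a \<odot>\<^bsub>M\<^esub> x)" by (auto simp: N_def gf)
  have "abelian_group N"
  proof (rule abelian_groupI)
    fix x assume "x \<in> carrier N"
    then obtain y where y: "y \<in> carrier M" "x = f y" using N by auto
    then show "\<exists>z\<in>carrier N. z \<oplus>\<^bsub>N\<^esub> x = \<zero>\<^bsub>N\<^esub>"
      by (intro bexI[of _ "f (\<ominus>\<^bsub>M\<^esub> y)"]) (auto simp: N M.l_neg)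
  qed (auto simp: N M.a_ac)
  then have lm: "left_module R N"
    by (intro left_module.intro left_module_axioms.intro R.ring_axioms)
      (auto simp: N smult_l_distr smult_r_distr smult_assoc)
  have "fin_gen R N" unfolding fin_gen_def
  proof (intro exI[of _ "f ` S"] conjI allI impI)
    fix H assume H: "submodule H R N \<and> f ` S \<subseteq> H"
    interpret H: submodule H R N using H by simp
    have HN: "H \<subseteq> f ` carrier M" using H.subset N by simp
    let ?H = "{x \<in> carrier M. f x \<in> H}"
    have "submodule ?H R M"
    proof (rule submoduleI)
      fix x y assume "x \<in> ?H" "y \<in> ?H"
      then show "x \<oplus>\<^bsub>M\<^esub> y \<in> ?H" using H.m_closed[of "f x" "f y"] by (simp add: N)
    next
      fix a x assume "a \<in> carrier R" "x \<in> ?H"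
      then show "a \<odot>\<^bsub>M\<^esub> x \<in> ?H" using H.smult_closed[of a "f x"] by (simp add: N)
    qed (use H.one_closed N in auto)
    then have "?H = carrier M" using S H by (intro gen[rule_format]) auto
    then show "H = carrier N" using HN N by auto
  qed (use S N in auto)
  with lm have "N \<in> fgmod R" by (simp add: fgmod_def)
  moreover have "restrict f (carrier M) \<in> mod_hom R M N" by (auto simp: mod_hom_def N)
  moreover have "bij_betw (restrict f (carrier M)) (carrier M) (carrier N)"
    using f N by (auto simp: bij_betw_def inj_on_def)
  ultimately show ?thesis unfolding mod_iso_def by blast
qed

definition hom_vanishes ::
    "('a, 'x) ring_scheme \<Rightarrow> ('a, 'm, 'y) module_scheme \<Rightarrow> ('a, 'n, 'z) module_scheme \<Rightarrow> bool"
  where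
  "hom_vanishes R M N \<longleftrightarrow> mod_hom R M N = {\<lambda>x\<in>carrier M. \<zero>\<^bsub>N\<^esub>}"

definition short_exact ::
    "('a, 'x) ring_scheme \<Rightarrow> ('a, 'l, 'u) module_scheme \<Rightarrow> ('l \<Rightarrow> 'm) \<Rightarrow> ('a, 'm, 'v) module_scheme \<Rightarrow>
     ('m \<Rightarrow> 'n) \<Rightarrow> ('a, 'n, 'w) module_scheme \<Rightarrow> bool"
  where
  "short_exact R L f M g N \<longleftrightarrow> f \<in> mod_hom R L M \<and> g \<in> mod_hom R M N \<and>
     inj_on f (carrier L) \<and> f ` carrier L = a_kernel M N g \<and> g ` carrier M = carrier N"

definition direct_sum :: "'i set \<Rightarrow> ('i \<Rightarrow> ('a, 'm) module) \<Rightarrow> ('a, 'i \<Rightarrow> 'm) module" where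
  "direct_sum I X = \<lparr>carrier = (\<Pi>\<^sub>E i\<in>I. carrier (X i)),
     mult = undefined, one = undefined,
     zero = (\<lambda>i\<in>I. \<zero>\<^bsub>X i\<^esub>),
     add = (\<lambda>u v. \<lambda>i\<in>I. u i \<oplus>\<^bsub>X i\<^esub> v i),
     smult = (\<lambda>a u. \<lambda>i\<in>I. a \<odot>\<^bsub>X i\<^esub> u i)\<rparr>"

abbreviation direct_sum2 ::
    "('a, 'm) module \<Rightarrow> ('a, 'm) module \<Rightarrow> ('a, bool \<Rightarrow> 'm) module" where
  "direct_sum2 X Y \<equiv> direct_sum UNIV (\<lambda>b. if b then X else Y)"

definition direct_summand ::
    "('a, 'x) ring_scheme \<Rightarrow> ('a, 'a list) module \<Rightarrow> ('a, 'a list) module \<Rightarrow> bool" where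
  "direct_summand R X M \<longleftrightarrow> X \<in> fgmod R \<and> (\<exists>Y\<in>fgmod R. mod_iso R M (direct_sum2 X Y))"

definition indecomposable :: "('a, 'x) ring_scheme \<Rightarrow> ('a, 'a list) module \<Rightarrow> bool" where
  "indecomposable R X \<longleftrightarrow> X \<in> fgmod R \<and> carrier X \<noteq> {\<zero>\<^bsub>X\<^esub>} \<and>
     (\<forall>Y\<in>fgmod R. \<forall>Z\<in>fgmod R. mod_iso R X (direct_sum2 Y Z) \<longrightarrow>
        carrier Y = {\<zero>\<^bsub>Y\<^esub>} \<or> carrier Z = {\<zero>\<^bsub>Z\<^esub>})"

definition End_ring :: "('a, 'x) ring_scheme \<Rightarrow> ('a, 'm, 'y) module_scheme \<Rightarrow> ('m \<Rightarrow> 'm) ring" where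
  "End_ring R M = \<lparr>carrier = mod_hom R M M,
     mult = (\<lambda>f g. compose (carrier M) f g),
     one = (\<lambda>x\<in>carrier M. x),
     zero = (\<lambda>x\<in>carrier M. \<zero>\<^bsub>M\<^esub>),
     add = (\<lambda>f g. \<lambda>x\<in>carrier M. f x \<oplus>\<^bsub>M\<^esub> g x)\<rparr>"

definition quotient_module ::
    "('a, 'm, 'y) module_scheme \<Rightarrow> 'm set \<Rightarrow> ('a, 'm set) module" where
  "quotient_module M H = \<lparr>carrier = a_rcosets\<^bsub>M\<^esub> H,
     mult = undefined, one = undefined,
     zero = H,
     add = set_add M,
     smult = (\<lambda>a C. \<Union>x\<in>C. H +>\<^bsub>M\<^esub> (a \<odot>\<^bsub>M\<^esub> x))\<rparr>"


section \<open>Bricks and torsion classes\<close>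

definition division_ring :: "('a, 'x) ring_scheme \<Rightarrow> bool" where
  "division_ring R \<longleftrightarrow> ring R \<and> Units R = carrier R - {\<zero>\<^bsub>R\<^esub>}"

definition brick :: "('a, 'x) ring_scheme \<Rightarrow> ('a, 'a list) module \<Rightarrow> bool" where
  "brick R M \<longleftrightarrow> M \<in> fgmod R \<and> division_ring (End_ring R M)"

definition brick_finite :: "('a, 'x) ring_scheme \<Rightarrow> bool" where
  "brick_finite R \<longleftrightarrow>
     finite ({M. brick R M} // {(M, N). brick R M \<and> brick R N \<and> mod_iso R M N})"

definition torsion_class :: "('a, 'x) ring_scheme \<Rightarrow> ('a, 'a list) module set \<Rightarrow> bool" where
  "torsion_class R T \<longleftrightarrow> T \<subseteq> fgmod R \<and> T \<noteq> {} \<and>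
     (\<forall>M\<in>T. \<forall>N\<in>fgmod R. \<forall>g\<in>mod_hom R M N. g ` carrier M = carrier N \<longrightarrow> N \<in> T) \<and>
     (\<forall>L\<in>T. \<forall>N\<in>T. \<forall>M\<in>fgmod R. \<forall>f g. short_exact R L f M g N \<longrightarrow> M \<in> T)"

definition tors :: "('a, 'x) ring_scheme \<Rightarrow> ('a, 'a list) module set gorder" where
  "tors R = \<lparr>carrier = {T. torsion_class R T}, eq = (=), le = (\<subseteq>)\<rparr>"


section \<open>Finite dimensional algebras\<close>

text \<open>
  The library's \<^locale>\<open>algebra\<close> is commutative. Over a field, finitely generated
  means finite dimensional.
\<close>

locale fd_algebra = K: field K + module K A + A: ring A
  for K :: "('k, 'x) ring_scheme" and A :: "('k, 'a, 'y) module_scheme" +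
  assumes smult_mult_left:
      "\<lbrakk>c \<in> carrier K; x \<in> carrier A; y \<in> carrier A\<rbrakk> \<Longrightarrow>
         (c \<odot>\<^bsub>A\<^esub> x) \<otimes>\<^bsub>A\<^esub> y = c \<odot>\<^bsub>A\<^esub> (x \<otimes>\<^bsub>A\<^esub> y)"
    and smult_mult_right:
      "\<lbrakk>c \<in> carrier K; x \<in> carrier A; y \<in> carrier A\<rbrakk> \<Longrightarrow>
         x \<otimes>\<^bsub>A\<^esub> (c \<odot>\<^bsub>A\<^esub> y) = c \<odot>\<^bsub>A\<^esub> (x \<otimes>\<^bsub>A\<^esub> y)"
    and finite_dimensional: "fin_gen K A"

definition corner_ring :: "('a, 'x) ring_scheme \<Rightarrow> 'a \<Rightarrow> ('a, 'x) ring_scheme" where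
  "corner_ring R e = R\<lparr>carrier := {e \<otimes>\<^bsub>R\<^esub> a \<otimes>\<^bsub>R\<^esub> e | a. a \<in> carrier R}, one := e\<rparr>"

definition opposite_ring :: "('a, 'x) ring_scheme \<Rightarrow> ('a, 'x) ring_scheme" where
  "opposite_ring R = R\<lparr>mult := (\<lambda>x y. y \<otimes>\<^bsub>R\<^esub> x)\<rparr>"


section \<open>The Auslander--Reiten translation\<close>

text \<open>Right \<open>R\<close>-modules are represented as left modules over \<^term>\<open>opposite_ring R\<close>.\<close>

definition regular_module :: "('a, 'x) ring_scheme \<Rightarrow> ('a, 'a) module" where
  "regular_module R = \<lparr>carrier = carrier R, mult = mult R, one = one R,
     zero = zero R, add = add R, smult = mult R\<rparr>"

text \<open>The right module \<open>Hom\<^sub>R(P, R)\<close>.\<close>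

definition hom_to_ring ::
    "('a, 'x) ring_scheme \<Rightarrow> ('a, 'm, 'y) module_scheme \<Rightarrow> ('a, 'm \<Rightarrow> 'a) module" where
  "hom_to_ring R P = \<lparr>carrier = mod_hom R P (regular_module R),
     mult = undefined, one = undefined,
     zero = (\<lambda>p\<in>carrier P. \<zero>\<^bsub>R\<^esub>),
     add = (\<lambda>u v. \<lambda>p\<in>carrier P. u p \<oplus>\<^bsub>R\<^esub> v p),
     smult = (\<lambda>a u. \<lambda>p\<in>carrier P. u p \<otimes>\<^bsub>R\<^esub> a)\<rparr>"

text \<open>
  The standard duality \<open>D = Hom\<^sub>K(-, K)\<close>, from left modules over a \<open>K\<close>-algebra \<open>R\<close> to right
  ones. A scalar \<open>c\<close> acts on a left \<open>R\<close>-module as the element \<open>c 1\<close> of \<open>R\<close>.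
\<close>

definition K_dual ::
    "('k, 'x) ring_scheme \<Rightarrow> ('k, 'a, 'y) module_scheme \<Rightarrow> ('a, 'm, 'z) module_scheme \<Rightarrow>
     ('a, 'm \<Rightarrow> 'k) module" where
  "K_dual K R M = \<lparr>carrier = {u \<in> carrier M \<rightarrow>\<^sub>E carrier K.
       (\<forall>x\<in>carrier M. \<forall>y\<in>carrier M. u (x \<oplus>\<^bsub>M\<^esub> y) = u x \<oplus>\<^bsub>K\<^esub> u y) \<and>
       (\<forall>c\<in>carrier K. \<forall>x\<in>carrier M. u ((c \<odot>\<^bsub>R\<^esub> \<one>\<^bsub>R\<^esub>) \<odot>\<^bsub>M\<^esub> x) = c \<otimes>\<^bsub>K\<^esub> u x)},
     mult = undefined, one = undefined,
     zero = (\<lambda>x\<in>carrier M. \<zero>\<^bsub>K\<^esub>),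
     add = (\<lambda>u v. \<lambda>x\<in>carrier M. u x \<oplus>\<^bsub>K\<^esub> v x),
     smult = (\<lambda>a u. \<lambda>x\<in>carrier M. u (a \<odot>\<^bsub>M\<^esub> x))\<rparr>"

definition projective :: "('a, 'x) ring_scheme \<Rightarrow> ('a, 'a list) module \<Rightarrow> bool" where
  "projective R P \<longleftrightarrow> P \<in> fgmod R \<and>
     (\<forall>M\<in>fgmod R. \<forall>N\<in>fgmod R. \<forall>g\<in>mod_hom R M N. \<forall>h\<in>mod_hom R P N.
        g ` carrier M = carrier N \<longrightarrow> (\<exists>l\<in>mod_hom R P M. compose (carrier P) g l = h))"

definition projective_cover ::
    "('a, 'x) ring_scheme \<Rightarrow> ('a, 'a list) module \<Rightarrow> ('a list \<Rightarrow> 'a list) \<Rightarrow>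
     ('a, 'a list) module \<Rightarrow> bool" where
  "projective_cover R P g M \<longleftrightarrow> projective R P \<and> g \<in> mod_hom R P M \<and> g ` carrier P = carrier M \<and>
     (\<forall>H. submodule H R P \<and> H <+>\<^bsub>P\<^esub> a_kernel P M g = carrier P \<longrightarrow> H = carrier P)"

text \<open>\<open>P1 \<rightarrow> P0 \<rightarrow> M \<rightarrow> 0\<close>, with maps \<open>f\<close> and \<open>g\<close>.\<close>

definition minimal_projective_presentation ::
    "('a, 'x) ring_scheme \<Rightarrow> ('a, 'a list) module \<Rightarrow> ('a list \<Rightarrow> 'a list) \<Rightarrow> ('a, 'a list) module \<Rightarrow>
     ('a list \<Rightarrow> 'a list) \<Rightarrow> ('a, 'a list) module \<Rightarrow> bool" where
  "minimal_projective_presentation R P1 f P0 g M \<longleftrightarrow>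
     projective_cover R P0 g M \<and> projective_cover R P1 f (P0\<lparr>carrier := a_kernel P0 M g\<rparr>)"

text \<open>
  \<open>Tr M\<close> is the cokernel of \<open>Hom\<^sub>R(f, R) : Hom\<^sub>R(P0, R) \<rightarrow> Hom\<^sub>R(P1, R)\<close> for a minimal projective
  presentation of \<open>M\<close>, which is unique up to isomorphism.
\<close>

definition transpose_module ::
    "('a, 'x) ring_scheme \<Rightarrow> ('a, 'a list) module \<Rightarrow> ('a, ('a list \<Rightarrow> 'a) set) module" where
  "transpose_module R M =
     (let (P1, f, P0) = (SOME (P1, f, P0). \<exists>g. minimal_projective_presentation R P1 f P0 g M)
      in quotient_module (hom_to_ring R P1)
           ((\<lambda>u. compose (carrier P1) u f) ` carrier (hom_to_ring R P0)))"

definition AR_translate ::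
    "('k, 'x) ring_scheme \<Rightarrow> ('k, 'a, 'y) module_scheme \<Rightarrow> ('a, 'a list) module \<Rightarrow>
     ('a, ('a list \<Rightarrow> 'a) set \<Rightarrow> 'k) module" where
  "AR_translate K A M = K_dual K (opposite_ring A) (transpose_module A M)"


section \<open>Reduction at a tau-rigid module\<close>

definition tau_rigid ::
    "('k, 'x) ring_scheme \<Rightarrow> ('k, 'a, 'y) module_scheme \<Rightarrow> ('a, 'a list) module \<Rightarrow> bool" where
  "tau_rigid K A U \<longleftrightarrow> U \<in> fgmod A \<and> hom_vanishes A U (AR_translate K A U)"

definition left_perp ::
    "('a, 'x) ring_scheme \<Rightarrow> ('a, 'm, 'y) module_scheme \<Rightarrow> ('a, 'a list) module set" where
  "left_perp R V = {X \<in> fgmod R. hom_vanishes R X V}"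

text \<open>\<open>Ext\<^sup>1(X, Y) = 0\<close> in Yoneda's sense: every extension of \<open>X\<close> by \<open>Y\<close> splits.\<close>

definition Ext1_vanishes ::
    "('a, 'x) ring_scheme \<Rightarrow> ('a, 'a list) module \<Rightarrow> ('a, 'a list) module \<Rightarrow> bool" where
  "Ext1_vanishes R X Y \<longleftrightarrow> (\<forall>Z\<in>fgmod R. \<forall>f g. short_exact R Y f Z g X \<longrightarrow>
     (\<exists>s\<in>mod_hom R X Z. compose (carrier X) g s = (\<lambda>x\<in>carrier X. x)))"

definition Ext_projective ::
    "('a, 'x) ring_scheme \<Rightarrow> ('a, 'a list) module set \<Rightarrow> ('a, 'a list) module \<Rightarrow> bool" where
  "Ext_projective R T X \<longleftrightarrow> X \<in> T \<and> (\<forall>Y\<in>T. Ext1_vanishes R X Y)"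

text \<open>
  \<open>T\<close> is the direct sum of a system \<open>X 0, \<dots>, X (n - 1)\<close> of representatives of the isomorphism
  classes of indecomposable Ext-projective objects; in particular it is basic.
\<close>

definition Bongartz_completion ::
    "('k, 'x) ring_scheme \<Rightarrow> ('k, 'a, 'y) module_scheme \<Rightarrow> ('a, 'a list) module \<Rightarrow>
     ('a, 'a list) module \<Rightarrow> bool" where
  "Bongartz_completion K A U T \<longleftrightarrow> T \<in> fgmod A \<and>
     (\<exists>(n :: nat) X. let F = left_perp A (AR_translate K A U) in
        (\<forall>i<n. indecomposable A (X i) \<and> Ext_projective A F (X i)) \<and>
        (\<forall>i<n. \<forall>j<n. mod_iso A (X i) (X j) \<longrightarrow> i = j) \<and>
        (\<forall>Y. indecomposable A Y \<and> Ext_projective A F Y \<longrightarrow> (\<exists>i<n. mod_iso A Y (X i))) \<and>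
        mod_iso A T (direct_sum {..<n} X))"

definition same_indecomposable_summands ::
    "('a, 'x) ring_scheme \<Rightarrow> ('a, 'a list) module \<Rightarrow> ('a, 'a list) module \<Rightarrow> bool" where
  "same_indecomposable_summands R M N \<longleftrightarrow>
     (\<forall>X. indecomposable R X \<longrightarrow> (direct_summand R X M \<longleftrightarrow> direct_summand R X N))"

text \<open>
  \<open>U\<close> need not be basic. The image of the idempotent \<open>e\<close> is a direct summand of the basic module
  \<open>T\<close>, hence basic; requiring that it has the same indecomposable summands as \<open>U\<close> says
  that \<open>e\<close> is a projection of \<open>T\<close> onto the basic version of \<open>U\<close>.
\<close>

definition tau_reduction ::
    "('k, 'x) ring_scheme \<Rightarrow> ('k, 'a, 'y) module_scheme \<Rightarrow> ('a list \<Rightarrow> 'a list) set ring \<Rightarrow> bool" where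
  "tau_reduction K A B \<longleftrightarrow> (\<exists>U T e.
     tau_rigid K A U \<and> Bongartz_completion K A U T \<and>
     e \<in> mod_hom A T T \<and> compose (carrier T) e e = e \<and>
     same_indecomposable_summands A (T\<lparr>carrier := e ` carrier T\<rparr>) U \<and>
     (let E = opposite_ring (End_ring A T) in B = E Quot (Idl\<^bsub>E\<^esub> {e})))"

end

theory Submission
  imports Defs
begin

text \<open>
  Call the bricks of an algebra directed if they have a rank function with finitely many values
  that does not increase along nonzero homomorphisms and separates isomorphism classes. In a lattice
  of torsion classes with finitely many bricks, the join irreducibles are the classes \<open>T(S)\<close>
  generated by a brick \<open>S\<close> and the meet irreducibles are the classes \<open>\<^sup>\<bottom>S\<close>, so both are counted by the
  bricks. Each step of a chain of torsion classes is labelled by a brick, torsion for the larger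
  class and torsion-free for the smaller one, and there are no nonzero homomorphisms from an earlier
  label to a later one. Hence a chain as long as the number of bricks is the same as an ordering of
  the bricks, and extremality is directedness. Left modular torsion classes are those whose
  torsion pair splits every brick, and a maximal chain of these is again such an ordering.

  Directedness passes to an algebra \<open>R'\<close> along any assignment from bricks of \<open>R'\<close> to bricks of \<open>R\<close>
  that reflects isomorphisms and the vanishing of homomorphisms. For a quotient this is restriction
  of scalars, and for a corner \<open>eRe\<close> it is the intermediate extension. For a reduction, let \<open>T\<close> be the
  Bongartz completion. A module \<open>N\<close> over \<open>End(T)\<^sup>o\<^sup>p\<close> that is killed by \<open>e\<close> is sent to the quotient \<open>X\<close> of
  a power \<open>T\<^sup>S\<close>, mapping onto \<open>N\<close> under \<open>Hom(T, T\<^sup>S) \<rightarrow> N\<close>, by the trace of the kernel of this map; then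
  \<open>Hom(T, X) = N\<close>. The lifting properties needed here come from the criterion that \<open>Hom(X, \<tau>U) = 0\<close> iff
  every homomorphism \<open>P1 \<rightarrow> X\<close> extends along a minimal projective presentation \<open>P1 \<rightarrow> P0\<close> of \<open>U\<close>.
\<close>


section \<open>Linear maps, submodules and quotients\<close>

text \<open>The length and the numbers of irreducibles of the lattice may all change under the three
  constructions. Directedness speaks only of bricks and of the vanishing of homomorphisms, so it is
  inherited as soon as bricks can be carried back to \<open>A\<close>; brick-finiteness of the new
  algebra comes along with the rank function. One inequality always holds: the labels of a chain are
  pairwise nonisomorphic, so a chain is no longer than the number of bricks, and extremality asks
  for equality.

  Carrier types shape most statements. Objects of \<open>mod R\<close> live on lists over
  \<open>R\<close>, whereas coinduced modules, direct sums and pullbacks live elsewhere. Hence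
  linear maps, bricks and finite length are treated on arbitrary carriers, and a copy on lists is
  taken only where a definition quantifies over \<open>fgmod\<close>.

  For the reduction, the translate enters only through the vanishing of Hom(X, tau U), which is dual
  to the cokernel of Hom(P0, X) -> Hom(P1, X). Membership in the class left perpendicular to tau U
  thus becomes an extension property that can be checked for kernels and images.\<close>

lemma (in abelian_group) minus_zero_right [simp]: "x \<in> carrier G \<Longrightarrow> x \<ominus> \<zero> = x"
  using r_neg[of \<zero>] by (simp add: a_minus_def)

lemma (in abelian_group) minus_eq_zero_iff:
  assumes "x \<in> carrier G" "y \<in> carrier G"
  shows "x \<ominus> y = \<zero> \<longleftrightarrow> x = y"
  using assms by (metis a_minus_def minus_equality minus_minus r_neg a_inv_closed)

text \<open>Linearity without the extensionality built into \<open>mod_hom\<close>: composites and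
  pointwise sums are then plain lambda terms of the same kind. \<open>lin_mod_hom\<close> restricts
  to the carrier when an element of \<open>mod_hom\<close> is required.\<close>

definition lin ::
    "('a, 'x) ring_scheme \<Rightarrow> ('a, 'm, 'y) module_scheme \<Rightarrow> ('a, 'n, 'z) module_scheme \<Rightarrow> ('m \<Rightarrow> 'n) \<Rightarrow> bool"
  where
  "lin R M N h \<longleftrightarrow> (\<forall>x\<in>carrier M. h x \<in> carrier N) \<and>
     (\<forall>x\<in>carrier M. \<forall>y\<in>carrier M. h (x \<oplus>\<^bsub>M\<^esub> y) = h x \<oplus>\<^bsub>N\<^esub> h y) \<and>
     (\<forall>a\<in>carrier R. \<forall>x\<in>carrier M. h (a \<odot>\<^bsub>M\<^esub> x) = a \<odot>\<^bsub>N\<^esub> h x)"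

lemma linI:
  assumes "\<And>x. x \<in> carrier M \<Longrightarrow> h x \<in> carrier N"
    and "\<And>x y. \<lbrakk>x \<in> carrier M; y \<in> carrier M\<rbrakk> \<Longrightarrow> h (x \<oplus>\<^bsub>M\<^esub> y) = h x \<oplus>\<^bsub>N\<^esub> h y"
    and "\<And>a x. \<lbrakk>a \<in> carrier R; x \<in> carrier M\<rbrakk> \<Longrightarrow> h (a \<odot>\<^bsub>M\<^esub> x) = a \<odot>\<^bsub>N\<^esub> h x"
  shows "lin R M N h"
  using assms by (simp add: lin_def)

lemma lin_closed: "lin R M N h \<Longrightarrow> x \<in> carrier M \<Longrightarrow> h x \<in> carrier N"
  by (simp add: lin_def)

lemma lin_add: "lin R M N h \<Longrightarrow> x \<in> carrier M \<Longrightarrow> y \<in> carrier M \<Longrightarrow> h (x \<oplus>\<^bsub>M\<^esub> y) = h x \<oplus>\<^bsub>N\<^esub> h y"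
  by (simp add: lin_def)

lemma lin_smult: "lin R M N h \<Longrightarrow> a \<in> carrier R \<Longrightarrow> x \<in> carrier M \<Longrightarrow> h (a \<odot>\<^bsub>M\<^esub> x) = a \<odot>\<^bsub>N\<^esub> h x"
  by (simp add: lin_def)

lemma mod_hom_lin: "h \<in> mod_hom R M N \<Longrightarrow> lin R M N h"
  by (auto simp: mod_hom_def lin_def)

lemma lin_cong:
  assumes "left_module R M" "\<And>x. x \<in> carrier M \<Longrightarrow> h x = k x"
  shows "lin R M N h \<longleftrightarrow> lin R M N k"
proof -
  interpret M: left_module R M by fact
  show ?thesis by (auto simp: lin_def assms(2))
qed

lemma lin_mod_hom:
  assumes "left_module R M" "lin R M N h"
  shows "restrict h (carrier M) \<in> mod_hom R M N"
proof -
  interpret M: left_module R M by fact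
  show ?thesis using assms(2) by (auto simp: lin_def mod_hom_def)
qed

lemma lin_id: "lin R M M (\<lambda>x. x)"
  by (simp add: lin_def)

lemma lin_comp: "lin R M N h \<Longrightarrow> lin R N P g \<Longrightarrow> lin R M P (\<lambda>x. g (h x))"
  by (simp add: lin_def)

lemma lin_const_zero:
  assumes "left_module R N"
  shows "lin R M N (\<lambda>x. \<zero>\<^bsub>N\<^esub>)"
proof -
  interpret N: left_module R N by fact
  show ?thesis by (simp add: lin_def N.smult_zero_r)
qed

lemma lin_zero:
  assumes "left_module R M" "left_module R N" "lin R M N h"
  shows "h \<zero>\<^bsub>M\<^esub> = \<zero>\<^bsub>N\<^esub>"
proof -
  interpret M: left_module R M by fact
  interpret N: left_module R N by fact
  have "h \<zero>\<^bsub>M\<^esub> = h (\<zero>\<^bsub>R\<^esub> \<odot>\<^bsub>M\<^esub> \<zero>\<^bsub>M\<^esub>)" by (simp add: M.smult_zero_r)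
  also have "\<dots> = \<zero>\<^bsub>N\<^esub>" using lin_smult[OF assms(3), of "\<zero>\<^bsub>R\<^esub>" "\<zero>\<^bsub>M\<^esub>"] lin_closed[OF assms(3), of "\<zero>\<^bsub>M\<^esub>"]
    by (simp add: N.smult_zero_l)
  finally show ?thesis .
qed

lemma lin_minus:
  assumes "left_module R M" "left_module R N" "lin R M N h" "x \<in> carrier M"
  shows "h (\<ominus>\<^bsub>M\<^esub> x) = \<ominus>\<^bsub>N\<^esub> h x"
proof -
  interpret M: left_module R M by fact
  interpret N: left_module R N by fact
  show ?thesis using lin_smult[OF assms(3), of "\<ominus>\<^bsub>R\<^esub> \<one>\<^bsub>R\<^esub>" x] assms(4) lin_closed[OF assms(3,4)]
    by (simp add: M.smult_minus_one N.smult_minus_one)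
qed

lemma lin_diff:
  assumes "left_module R M" "left_module R N" "lin R M N h" "x \<in> carrier M" "y \<in> carrier M"
  shows "h (x \<ominus>\<^bsub>M\<^esub> y) = h x \<ominus>\<^bsub>N\<^esub> h y"
proof -
  interpret M: left_module R M by fact
  show ?thesis using assms by (simp add: a_minus_def lin_add lin_minus)
qed

lemma lin_sum:
  assumes "left_module R N" "lin R M N f" "lin R M N g"
  shows "lin R M N (\<lambda>x. f x \<oplus>\<^bsub>N\<^esub> g x)"
proof -
  interpret N: left_module R N by fact
  show ?thesis using assms(2,3) by (simp add: lin_def N.M.a_ac N.smult_r_distr)
qed

lemma (in left_module) smult_minus:
  assumes "a \<in> carrier R" "y \<in> carrier M"
  shows "a \<odot>\<^bsub>M\<^esub> (\<ominus>\<^bsub>M\<^esub> y) = \<ominus>\<^bsub>M\<^esub> (a \<odot>\<^bsub>M\<^esub> y)"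
proof -
  have "a \<odot>\<^bsub>M\<^esub> (\<ominus>\<^bsub>M\<^esub> y) \<oplus>\<^bsub>M\<^esub> a \<odot>\<^bsub>M\<^esub> y = \<zero>\<^bsub>M\<^esub>"
    using assms by (simp flip: smult_r_distr add: M.l_neg smult_zero_r)
  then show ?thesis using assms by (simp add: M.minus_equality)
qed

lemma (in left_module) smult_diff:
  assumes "a \<in> carrier R" "x \<in> carrier M" "y \<in> carrier M"
  shows "a \<odot>\<^bsub>M\<^esub> (x \<ominus>\<^bsub>M\<^esub> y) = a \<odot>\<^bsub>M\<^esub> x \<ominus>\<^bsub>M\<^esub> a \<odot>\<^bsub>M\<^esub> y"
  using assms by (simp add: a_minus_def smult_r_distr smult_minus)

lemma lin_difference:
  assumes "left_module R N" "lin R M N f" "lin R M N g"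
  shows "lin R M N (\<lambda>x. f x \<ominus>\<^bsub>N\<^esub> g x)"
proof -
  interpret N: left_module R N by fact
  show ?thesis using assms(2,3)
    by (simp add: lin_def a_minus_def N.smult_minus N.M.a_ac N.smult_r_distr N.M.minus_add)
qed

lemma lin_finsum:
  assumes "left_module R M" "left_module R N" "\<And>i. i \<in> I \<Longrightarrow> lin R M N (f i)"
  shows "lin R M N (\<lambda>x. finsum N (\<lambda>i. f i x) I)"
proof -
  interpret N: left_module R N by fact
  show ?thesis using assms(3)
  proof (induction I rule: infinite_finite_induct)
    case (infinite I)
    then show ?case by (simp add: N.M.finsum_infinite lin_const_zero[OF assms(2)])
  next
    case empty
    then show ?case by (simp add: lin_const_zero[OF assms(2)])
  next
    case (insert i I)
    have "lin R M N (\<lambda>x. f i x \<oplus>\<^bsub>N\<^esub> finsum N (\<lambda>i. f i x) I)"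
      using insert by (intro lin_sum[OF assms(2)]) auto
    moreover have "finsum N (\<lambda>i. f i x) (insert i I) = f i x \<oplus>\<^bsub>N\<^esub> finsum N (\<lambda>i. f i x) I"
      if "x \<in> carrier M" for x
      using insert that by (intro N.M.finsum_insert) (auto dest: lin_closed)
    ultimately show ?case by (subst lin_cong[OF assms(1)]) auto
  qed
qed

lemma lin_of_finsum:
  assumes "left_module R M" "left_module R N" "lin R M N h" "\<And>i. i \<in> I \<Longrightarrow> f i \<in> carrier M"
  shows "h (finsum M f I) = finsum N (\<lambda>i. h (f i)) I"
proof -
  interpret M: left_module R M by fact
  interpret N: left_module R N by fact
  show ?thesis using assms(4)
  proof (induction I rule: infinite_finite_induct)
    case (infinite I)
    then show ?case by (simp add: M.M.finsum_infinite N.M.finsum_infinite lin_zero[OF assms(1-3)])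
  next
    case empty
    then show ?case by (simp add: lin_zero[OF assms(1-3)])
  next
    case (insert i I)
    have "finsum M f (insert i I) = f i \<oplus>\<^bsub>M\<^esub> finsum M f I"
      using insert by (intro M.M.finsum_insert) auto
    moreover have "finsum N (\<lambda>i. h (f i)) (insert i I) = h (f i) \<oplus>\<^bsub>N\<^esub> finsum N (\<lambda>i. h (f i)) I"
      using insert by (intro N.M.finsum_insert) (auto dest: lin_closed[OF assms(3)])
    moreover have "finsum M f I \<in> carrier M" using insert by (intro M.M.finsum_closed) auto
    ultimately show ?case using insert lin_add[OF assms(3)] by simp
  qed
qed

lemma lin_inv:
  assumes "left_module R M" "lin R M N h" "bij_betw h (carrier M) (carrier N)"
  shows "lin R N M (inv_into (carrier M) h)"
proof -
  interpret M: left_module R M by fact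
  have i: "inv_into (carrier M) h (h x) = x" if "x \<in> carrier M" for x
    using assms(3) that by (simp add: bij_betw_def)
  have s: "\<exists>x\<in>carrier M. y = h x" if "y \<in> carrier N" for y
    using assms(3) that by (auto simp: bij_betw_def)
  show ?thesis
  proof (rule linI)
    fix x assume "x \<in> carrier N"
    then show "inv_into (carrier M) h x \<in> carrier M" using s[of x] by (auto simp: i)
  next
    fix x y assume "x \<in> carrier N" "y \<in> carrier N"
    then obtain u v where uv: "u \<in> carrier M" "v \<in> carrier M" "x = h u" "y = h v" using s by metis
    then have "x \<oplus>\<^bsub>N\<^esub> y = h (u \<oplus>\<^bsub>M\<^esub> v)" using assms(2) by (simp add: lin_add)
    then show "inv_into (carrier M) h (x \<oplus>\<^bsub>N\<^esub> y) = inv_into (carrier M) h x \<oplus>\<^bsub>M\<^esub> inv_into (carrier M) h y"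
      using uv by (simp add: i)
  next
    fix a x assume a: "a \<in> carrier R" "x \<in> carrier N"
    then obtain u where uv: "u \<in> carrier M" "x = h u" using s by metis
    then have "a \<odot>\<^bsub>N\<^esub> x = h (a \<odot>\<^bsub>M\<^esub> u)" using assms(2) a by (simp add: lin_smult)
    then show "inv_into (carrier M) h (a \<odot>\<^bsub>N\<^esub> x) = a \<odot>\<^bsub>M\<^esub> inv_into (carrier M) h x"
      using uv a by (simp add: i)
  qed
qed

section \<open>Isomorphisms and vanishing homomorphisms\<close>

lemma mod_iso_iff:
  assumes "left_module R M"
  shows "mod_iso R M N \<longleftrightarrow> (\<exists>h. lin R M N h \<and> bij_betw h (carrier M) (carrier N))"
proof
  assume "\<exists>h. lin R M N h \<and> bij_betw h (carrier M) (carrier N)"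
  then obtain h where h: "lin R M N h" "bij_betw h (carrier M) (carrier N)" by blast
  have "bij_betw (restrict h (carrier M)) (carrier M) (carrier N)"
    using h(2) by (simp add: bij_betw_def inj_on_def)
  with lin_mod_hom[OF assms h(1)] show "mod_iso R M N" unfolding mod_iso_def by blast
qed (auto simp: mod_iso_def dest: mod_hom_lin)

lemma mod_iso_sym:
  assumes "left_module R M" "left_module R N" "mod_iso R M N"
  shows "mod_iso R N M"
  using assms lin_inv[OF assms(1)] by (auto simp: mod_iso_iff intro: bij_betw_inv_into)

lemma mod_iso_refl: "left_module R M \<Longrightarrow> mod_iso R M M"
  by (auto simp: mod_iso_iff intro!: exI[of _ "\<lambda>x. x"] lin_id simp: bij_betw_def)

lemma mod_iso_trans:
  assumes "left_module R M" "left_module R N" "mod_iso R M N" "mod_iso R N P"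
  shows "mod_iso R M P"
proof -
  obtain f g where "lin R M N f" "bij_betw f (carrier M) (carrier N)" "lin R N P g" "bij_betw g (carrier N) (carrier P)"
    using assms by (auto simp: mod_iso_iff)
  then have "lin R M P (g \<circ> f)" "bij_betw (g \<circ> f) (carrier M) (carrier P)"
    by (simp_all add: lin_comp comp_def bij_betw_trans[unfolded comp_def])
  then show ?thesis using assms(1) by (auto simp: mod_iso_iff)
qed

definition no_hom ::
    "('a, 'x) ring_scheme \<Rightarrow> ('a, 'm, 'y) module_scheme \<Rightarrow> ('a, 'n, 'z) module_scheme \<Rightarrow> bool"
  where
  "no_hom R M N \<longleftrightarrow> (\<forall>h. lin R M N h \<longrightarrow> (\<forall>x\<in>carrier M. h x = \<zero>\<^bsub>N\<^esub>))"

text \<open>Of \<open>N\<close> only the linearity of the zero map is asked, because the lemma is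
  applied to the Auslander-Reiten translate, for which just this is verified.\<close>

lemma hom_vanishes_iff:
  assumes "left_module R M" "lin R M N (\<lambda>x. \<zero>\<^bsub>N\<^esub>)"
  shows "hom_vanishes R M N \<longleftrightarrow> no_hom R M N"
proof
  assume v: "hom_vanishes R M N"
  show "no_hom R M N" unfolding no_hom_def
  proof (intro allI impI ballI)
    fix h x assume "lin R M N h" "x \<in> carrier M"
    with lin_mod_hom[OF assms(1), of N h] v have "restrict h (carrier M) = (\<lambda>x\<in>carrier M. \<zero>\<^bsub>N\<^esub>)"
      by (simp add: hom_vanishes_def)
    then show "h x = \<zero>\<^bsub>N\<^esub>" using \<open>x \<in> carrier M\<close> by (metis restrict_apply')
  qed
next
  assume v: "no_hom R M N"
  have "h = (\<lambda>x\<in>carrier M. \<zero>\<^bsub>N\<^esub>)" if "h \<in> mod_hom R M N" for h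
  proof -
    have "h \<in> extensional (carrier M)" using that by (auto simp: mod_hom_def PiE_def)
    moreover have "h x = \<zero>\<^bsub>N\<^esub>" if "x \<in> carrier M" for x
      using v mod_hom_lin[OF \<open>h \<in> mod_hom R M N\<close>] that by (auto simp: no_hom_def)
    ultimately show ?thesis by (auto simp: extensional_def fun_eq_iff)
  qed
  then show "hom_vanishes R M N" unfolding hom_vanishes_def using lin_mod_hom[OF assms] by blast
qed

section \<open>Submodules, with negatives obtained from the scalar -1\<close>

lemma submodule_iff:
  assumes "left_module R M"
  shows "submodule H R M \<longleftrightarrow> H \<subseteq> carrier M \<and> \<zero>\<^bsub>M\<^esub> \<in> H \<and>
     (\<forall>x\<in>H. \<forall>y\<in>H. x \<oplus>\<^bsub>M\<^esub> y \<in> H) \<and> (\<forall>a\<in>carrier R. \<forall>x\<in>H. a \<odot>\<^bsub>M\<^esub> x \<in> H)"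
proof
  assume "submodule H R M"
  then interpret H: submodule H R M .
  show "H \<subseteq> carrier M \<and> \<zero>\<^bsub>M\<^esub> \<in> H \<and>
     (\<forall>x\<in>H. \<forall>y\<in>H. x \<oplus>\<^bsub>M\<^esub> y \<in> H) \<and> (\<forall>a\<in>carrier R. \<forall>x\<in>H. a \<odot>\<^bsub>M\<^esub> x \<in> H)"
    using H.subset H.one_closed H.m_closed by auto
next
  interpret M: left_module R M by fact
  assume "H \<subseteq> carrier M \<and> \<zero>\<^bsub>M\<^esub> \<in> H \<and>
     (\<forall>x\<in>H. \<forall>y\<in>H. x \<oplus>\<^bsub>M\<^esub> y \<in> H) \<and> (\<forall>a\<in>carrier R. \<forall>x\<in>H. a \<odot>\<^bsub>M\<^esub> x \<in> H)"
  then show "submodule H R M" by (intro M.submoduleI) auto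
qed

lemma submodule_minus:
  assumes "left_module R M" "submodule H R M" "x \<in> H"
  shows "\<ominus>\<^bsub>M\<^esub> x \<in> H"
proof -
  interpret M: left_module R M by fact
  show ?thesis using assms(2,3) M.smult_minus_one[of x]
    by (auto simp: submodule_iff[OF assms(1)]) (metis M.R.add.inv_closed M.R.one_closed subsetD)
qed

lemma submodule_diff:
  assumes "left_module R M" "submodule H R M" "x \<in> H" "y \<in> H"
  shows "x \<ominus>\<^bsub>M\<^esub> y \<in> H"
  using submodule_minus[OF assms(1,2,4)] assms by (auto simp: a_minus_def submodule_iff)

lemma left_module_sub:
  assumes "left_module R M" "submodule H R M"
  shows "left_module R (M\<lparr>carrier := H\<rparr>)"
proof -
  interpret M: left_module R M by fact
  have H: "H \<subseteq> carrier M" "\<zero>\<^bsub>M\<^esub> \<in> H" "\<And>x y. x \<in> H \<Longrightarrow> y \<in> H \<Longrightarrow> x \<oplus>\<^bsub>M\<^esub> y \<in> H"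
    "\<And>a x. a \<in> carrier R \<Longrightarrow> x \<in> H \<Longrightarrow> a \<odot>\<^bsub>M\<^esub> x \<in> H"
    using assms by (auto simp: submodule_iff)
  then have c: "x \<in> carrier M" if "x \<in> H" for x using that by auto
  have "abelian_group (M\<lparr>carrier := H\<rparr>)"
  proof (rule abelian_groupI)
    fix x assume x: "x \<in> carrier (M\<lparr>carrier := H\<rparr>)"
    then show "\<exists>y\<in>carrier (M\<lparr>carrier := H\<rparr>). y \<oplus>\<^bsub>M\<lparr>carrier := H\<rparr>\<^esub> x = \<zero>\<^bsub>M\<lparr>carrier := H\<rparr>\<^esub>"
      using submodule_minus[OF assms, of x] c[of x] by (auto intro!: bexI[of _ "\<ominus>\<^bsub>M\<^esub> x"] simp: M.M.l_neg)
  qed (auto simp: H c M.M.a_ac)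
  then show ?thesis
    by (intro left_module.intro left_module_axioms.intro M.R.ring_axioms)
      (auto simp: H c M.smult_l_distr M.smult_r_distr M.smult_assoc)
qed

lemma submodule_sub_iff:
  assumes "left_module R M" "submodule H R M"
  shows "submodule H' R (M\<lparr>carrier := H\<rparr>) \<longleftrightarrow> submodule H' R M \<and> H' \<subseteq> H"
  using assms by (auto simp: submodule_iff left_module_sub)

lemma submodule_carrier: "left_module R M \<Longrightarrow> submodule (carrier M) R M"
  by (auto simp: submodule_iff left_module.smult_closed abelian_groupE left_module_def)

lemma submodule_zero: "left_module R M \<Longrightarrow> submodule {\<zero>\<^bsub>M\<^esub>} R M"
proof -
  assume "left_module R M"
  then interpret M: left_module R M .
  show ?thesis by (rule M.submoduleI) (auto simp: M.smult_zero_r)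
qed

lemma submodule_image:
  assumes "left_module R M" "left_module R N" "lin R M N h" "submodule H R M"
  shows "submodule (h ` H) R N"
proof -
  have H: "H \<subseteq> carrier M" "\<zero>\<^bsub>M\<^esub> \<in> H" "\<And>x y. x \<in> H \<Longrightarrow> y \<in> H \<Longrightarrow> x \<oplus>\<^bsub>M\<^esub> y \<in> H"
    "\<And>a x. a \<in> carrier R \<Longrightarrow> x \<in> H \<Longrightarrow> a \<odot>\<^bsub>M\<^esub> x \<in> H"
    using assms(1,4) by (auto simp: submodule_iff)
  have "\<zero>\<^bsub>N\<^esub> \<in> h ` H" using lin_zero[OF assms(1-3)] H(2) by (metis imageI)
  moreover have "h x \<oplus>\<^bsub>N\<^esub> h y \<in> h ` H" if "x \<in> H" "y \<in> H" for x y
    using that H lin_add[OF assms(3), of x y] by (metis imageI subsetD)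
  moreover have "a \<odot>\<^bsub>N\<^esub> h x \<in> h ` H" if "a \<in> carrier R" "x \<in> H" for a x
    using that H lin_smult[OF assms(3), of a x] by (metis imageI subsetD)
  moreover have "h ` H \<subseteq> carrier N" using H lin_closed[OF assms(3)] by auto
  ultimately show ?thesis by (simp add: submodule_iff[OF assms(2)])
qed

lemma submodule_vimage:
  assumes "left_module R M" "left_module R N" "lin R M N h" "submodule H R N"
  shows "submodule {x \<in> carrier M. h x \<in> H} R M"
proof -
  interpret M: left_module R M by fact
  show ?thesis
    using assms lin_zero[OF assms(1-3)] by (auto simp: submodule_iff lin_add lin_smult)
qed

lemma submodule_ker:
  assumes "left_module R M" "left_module R N" "lin R M N h"
  shows "submodule {x \<in> carrier M. h x = \<zero>\<^bsub>N\<^esub>} R M"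
  using submodule_vimage[OF assms submodule_zero[OF assms(2)]] by simp

lemma submodule_range:
  assumes "left_module R M" "left_module R N" "lin R M N h"
  shows "submodule (h ` carrier M) R N"
  by (rule submodule_image[OF assms submodule_carrier[OF assms(1)]])

lemma submodule_Inter:
  assumes "left_module R M" "\<And>H. H \<in> \<H> \<Longrightarrow> submodule H R M" "\<H> \<noteq> {}"
  shows "submodule (\<Inter>\<H>) R M"
  using assms(2,3) unfolding submodule_iff[OF assms(1)] by blast

lemma submodule_Int:
  assumes "left_module R M" "submodule H R M" "submodule H' R M"
  shows "submodule (H \<inter> H') R M"
  using assms(2,3) unfolding submodule_iff[OF assms(1)] by blast

section \<open>Injectivity, factorisation through surjections, quotients\<close>

lemma lin_eq_iff:
  assumes "left_module R M" "left_module R N" "lin R M N h" "x \<in> carrier M" "y \<in> carrier M"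
  shows "h x = h y \<longleftrightarrow> h (x \<ominus>\<^bsub>M\<^esub> y) = \<zero>\<^bsub>N\<^esub>"
proof -
  interpret N: left_module R N by fact
  show ?thesis using lin_diff[OF assms] lin_closed[OF assms(3,4)] lin_closed[OF assms(3,5)]
    by (simp add: N.M.minus_eq_zero_iff)
qed

lemma lin_inj_iff:
  assumes "left_module R M" "left_module R N" "lin R M N h"
  shows "inj_on h (carrier M) \<longleftrightarrow> (\<forall>x\<in>carrier M. h x = \<zero>\<^bsub>N\<^esub> \<longrightarrow> x = \<zero>\<^bsub>M\<^esub>)"
proof -
  interpret M: left_module R M by fact
  show ?thesis
  proof
    assume "inj_on h (carrier M)"
    then show "\<forall>x\<in>carrier M. h x = \<zero>\<^bsub>N\<^esub> \<longrightarrow> x = \<zero>\<^bsub>M\<^esub>"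
      using lin_zero[OF assms] by (metis M.M.zero_closed inj_onD)
  next
    assume *: "\<forall>x\<in>carrier M. h x = \<zero>\<^bsub>N\<^esub> \<longrightarrow> x = \<zero>\<^bsub>M\<^esub>"
    show "inj_on h (carrier M)"
    proof (rule inj_onI)
      fix x y assume xy: "x \<in> carrier M" "y \<in> carrier M" "h x = h y"
      then have "x \<ominus>\<^bsub>M\<^esub> y = \<zero>\<^bsub>M\<^esub>" using * lin_eq_iff[OF assms xy(1,2)] by simp
      then show "x = y" using xy by (simp add: M.M.minus_eq_zero_iff)
    qed
  qed
qed

lemma lin_factor:
  assumes "left_module R M" "left_module R N" "left_module R P" "lin R M N g" "g ` carrier M = carrier N"
    and "lin R M P h" "\<And>x. x \<in> carrier M \<Longrightarrow> g x = \<zero>\<^bsub>N\<^esub> \<Longrightarrow> h x = \<zero>\<^bsub>P\<^esub>"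
  obtains k where "lin R N P k" "\<forall>x\<in>carrier M. k (g x) = h x"
proof -
  interpret M: left_module R M by fact
  define k where "k y = h (inv_into (carrier M) g y)" for y
  \<comment> \<open>The kernel hypothesis makes \<open>h\<close> constant on the fibres of
    \<open>g\<close>, so the choice of preimages in \<open>k\<close> does not matter.\<close>
  have eq: "h x = h y" if "x \<in> carrier M" "y \<in> carrier M" "g x = g y" for x y
    using lin_eq_iff[OF assms(1,2,4) that(1,2)] lin_eq_iff[OF assms(1,3,6) that(1,2)] that assms(7)[of "x \<ominus>\<^bsub>M\<^esub> y"]
    by auto
  have kg: "k (g x) = h x" if "x \<in> carrier M" for x
    unfolding k_def by (rule eq) (use that inv_into_into[of "g x" g "carrier M"] f_inv_into_f[of "g x" g "carrier M"] in auto)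
  have s: "\<exists>x\<in>carrier M. y = g x" if "y \<in> carrier N" for y using assms(5) that by auto
  have "lin R N P k"
  proof (rule linI)
    fix x assume "x \<in> carrier N"
    then show "k x \<in> carrier P" using s[of x] kg lin_closed[OF assms(6)] by auto
  next
    fix x y assume "x \<in> carrier N" "y \<in> carrier N"
    then obtain u v where uv: "u \<in> carrier M" "v \<in> carrier M" "x = g u" "y = g v" using s by metis
    then show "k (x \<oplus>\<^bsub>N\<^esub> y) = k x \<oplus>\<^bsub>P\<^esub> k y"
      by (simp add: kg lin_add[OF assms(6)] flip: lin_add[OF assms(4)])
  next
    fix a x assume "a \<in> carrier R" "x \<in> carrier N"
    moreover from this obtain u where uv: "u \<in> carrier M" "x = g u" using s by metis
    ultimately show "k (a \<odot>\<^bsub>N\<^esub> x) = a \<odot>\<^bsub>P\<^esub> k x"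
      by (simp add: kg lin_smult[OF assms(6)] flip: lin_smult[OF assms(4)])
  qed
  then show ?thesis using kg that by blast
qed

text \<open>The quotient by \<open>H\<close> is realised on a set of representatives, so that the carrier type does not change.\<close>

lemma ex_quotient:
  fixes M :: "('a, 'm, 'y) module_scheme"
  assumes "left_module R M" "submodule H R M"
  obtains N :: "('a, 'm) module" and q where "left_module R N" "lin R M N q" "q ` carrier M = carrier N"
    "\<forall>x\<in>carrier M. q x = \<zero>\<^bsub>N\<^esub> \<longleftrightarrow> x \<in> H"
proof -
  interpret M: left_module R M by fact
  have H: "H \<subseteq> carrier M" "\<zero>\<^bsub>M\<^esub> \<in> H" "\<And>x y. x \<in> H \<Longrightarrow> y \<in> H \<Longrightarrow> x \<oplus>\<^bsub>M\<^esub> y \<in> H"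
    "\<And>a x. a \<in> carrier R \<Longrightarrow> x \<in> H \<Longrightarrow> a \<odot>\<^bsub>M\<^esub> x \<in> H"
    using assms by (auto simp: submodule_iff)
  have Hm: "\<ominus>\<^bsub>M\<^esub> x \<in> H" if "x \<in> H" for x using submodule_minus[OF assms that] .
  define c where "c x = (SOME y. y \<in> carrier M \<and> y \<ominus>\<^bsub>M\<^esub> x \<in> H)" for x
  have c: "c x \<in> carrier M \<and> c x \<ominus>\<^bsub>M\<^esub> x \<in> H" if "x \<in> carrier M" for x
    unfolding c_def by (rule someI[of _ x]) (use that H M.M.minus_eq_zero_iff[of x x] in simp)
  have cc: "c x \<in> carrier M" if "x \<in> carrier M" for x using c that by simp
  have trans: "x \<ominus>\<^bsub>M\<^esub> z \<in> H" if "x \<in> carrier M" "y \<in> carrier M" "z \<in> carrier M" "x \<ominus>\<^bsub>M\<^esub> y \<in> H" "y \<ominus>\<^bsub>M\<^esub> z \<in> H" for x y z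
  proof -
    have "x \<ominus>\<^bsub>M\<^esub> z = (x \<ominus>\<^bsub>M\<^esub> y) \<oplus>\<^bsub>M\<^esub> (y \<ominus>\<^bsub>M\<^esub> z)"
      using that(1-3) by (simp add: a_minus_def M.M.a_assoc M.M.r_neg1)
    then show ?thesis using H that by simp
  qed
  have sym: "y \<ominus>\<^bsub>M\<^esub> x \<in> H" if "x \<in> carrier M" "y \<in> carrier M" "x \<ominus>\<^bsub>M\<^esub> y \<in> H" for x y
    using Hm[OF that(3)] that(1,2) by (simp add: a_minus_def M.M.minus_add M.M.a_comm)
  have ceq: "c x = c y \<longleftrightarrow> x \<ominus>\<^bsub>M\<^esub> y \<in> H" if "x \<in> carrier M" "y \<in> carrier M" for x y
  proof
    assume "c x = c y"
    then show "x \<ominus>\<^bsub>M\<^esub> y \<in> H" using c[OF that(1)] c[OF that(2)] trans[of x "c x" y] sym that by metis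
  next
    assume xy: "x \<ominus>\<^bsub>M\<^esub> y \<in> H"
    \<comment> \<open>On one coset the two predicates under \<open>SOME\<close> are equal, hence so
      are the chosen representatives.\<close>
    have "(\<lambda>z. z \<in> carrier M \<and> z \<ominus>\<^bsub>M\<^esub> x \<in> H) = (\<lambda>z. z \<in> carrier M \<and> z \<ominus>\<^bsub>M\<^esub> y \<in> H)"
      using that xy trans sym by (intro ext) blast
    then show "c x = c y" by (simp add: c_def)
  qed
  define N :: "('a, 'm) module" where "N = \<lparr>carrier = c ` carrier M, mult = undefined, one = undefined,
    zero = c \<zero>\<^bsub>M\<^esub>, add = (\<lambda>u v. c (u \<oplus>\<^bsub>M\<^esub> v)), smult = (\<lambda>a u. c (a \<odot>\<^bsub>M\<^esub> u))\<rparr>"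
  have [simp]: "c x \<oplus>\<^bsub>N\<^esub> c y = c (x \<oplus>\<^bsub>M\<^esub> y)" if "x \<in> carrier M" "y \<in> carrier M" for x y
  proof -
    have "(c x \<oplus>\<^bsub>M\<^esub> c y) \<ominus>\<^bsub>M\<^esub> (x \<oplus>\<^bsub>M\<^esub> y) = (c x \<ominus>\<^bsub>M\<^esub> x) \<oplus>\<^bsub>M\<^esub> (c y \<ominus>\<^bsub>M\<^esub> y)"
      using that cc by (simp add: a_minus_def M.M.minus_add M.M.a_ac)
    then show ?thesis using that c H by (simp add: N_def ceq)
  qed
  have [simp]: "a \<odot>\<^bsub>N\<^esub> c x = c (a \<odot>\<^bsub>M\<^esub> x)" if "a \<in> carrier R" "x \<in> carrier M" for a x
  proof -
    have "(a \<odot>\<^bsub>M\<^esub> c x) \<ominus>\<^bsub>M\<^esub> (a \<odot>\<^bsub>M\<^esub> x) = a \<odot>\<^bsub>M\<^esub> (c x \<ominus>\<^bsub>M\<^esub> x)"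
      using that cc by (simp add: M.smult_diff)
    then show ?thesis using that c H by (simp add: N_def ceq)
  qed
  have [simp]: "carrier N = c ` carrier M" "\<zero>\<^bsub>N\<^esub> = c \<zero>\<^bsub>M\<^esub>" by (auto simp: N_def)
  have "abelian_group N"
  proof (rule abelian_groupI)
    fix x assume "x \<in> carrier N"
    then obtain y where y: "y \<in> carrier M" "x = c y" by auto
    then show "\<exists>z\<in>carrier N. z \<oplus>\<^bsub>N\<^esub> x = \<zero>\<^bsub>N\<^esub>"
      by (intro bexI[of _ "c (\<ominus>\<^bsub>M\<^esub> y)"]) (auto simp: M.M.l_neg)
  qed (auto simp: M.M.a_ac)
  then have "left_module R N"
    by (intro left_module.intro left_module_axioms.intro M.R.ring_axioms)
      (auto simp: M.smult_l_distr M.smult_r_distr M.smult_assoc)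
  moreover have "lin R M N c" by (rule linI) auto
  moreover have "\<forall>x\<in>carrier M. c x = \<zero>\<^bsub>N\<^esub> \<longleftrightarrow> x \<in> H"
    by (simp add: ceq)
  ultimately show thesis by (intro that[of N c]) auto
qed

section \<open>Finite generation\<close>

lemma fin_genE:
  assumes "fin_gen R M"
  obtains S where "finite S" "S \<subseteq> carrier M"
    "\<forall>H. submodule H R M \<longrightarrow> S \<subseteq> H \<longrightarrow> H = carrier M"
  using assms unfolding fin_gen_def by (elim exE conjE) simp

lemma fin_genI:
  assumes "finite S" "S \<subseteq> carrier M"
    "\<And>H. submodule H R M \<Longrightarrow> S \<subseteq> H \<Longrightarrow> H = carrier M"
  shows "fin_gen R M"
  unfolding fin_gen_def using assms by (intro exI[of _ S]) simp

lemma fin_gen_surj: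
  assumes "left_module R M" "left_module R N" "lin R M N h" "h ` carrier M = carrier N" "fin_gen R M"
  shows "fin_gen R N"
proof -
  obtain S where S: "finite S" "S \<subseteq> carrier M"
    and gen: "\<forall>H. submodule H R M \<longrightarrow> S \<subseteq> H \<longrightarrow> H = carrier M"
    by (rule fin_genE[OF assms(5)]) (rule that)
  have "H = carrier N" if "submodule H R N" "h ` S \<subseteq> H" for H
  proof -
    have "{x \<in> carrier M. h x \<in> H} = carrier M"
      using submodule_vimage[OF assms(1-3) that(1)] S that(2) by (intro gen[rule_format]) auto
    then have "h ` carrier M \<subseteq> H" by auto
    then show ?thesis using assms(4) that(1) by (simp add: submodule_iff[OF assms(2)])
  qed
  then show ?thesis
    by (intro fin_genI[of "h ` S"]) (use S assms(3) in \<open>auto dest: lin_closed\<close>)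
qed

lemma fin_gen_sub_surj:
  assumes "left_module R M" "left_module R N" "lin R M N h" "fin_gen R M"
  shows "fin_gen R (N\<lparr>carrier := h ` carrier M\<rparr>)"
  by (rule fin_gen_surj[OF assms(1) _ _ _ assms(4), where h = h])
    (use assms submodule_range[OF assms(1-3)] in \<open>auto simp: lin_def left_module_sub\<close>)

text \<open>Generators of the kernel together with preimages of generators of \<open>N\<close>
  suffice: a submodule containing them contains the kernel and maps onto \<open>N\<close>.\<close>

lemma fin_gen_extension:
  assumes "left_module R M" "left_module R N" "lin R M N g" "g ` carrier M = carrier N"
    and "fin_gen R N" "fin_gen R (M\<lparr>carrier := {x \<in> carrier M. g x = \<zero>\<^bsub>N\<^esub>}\<rparr>)"
  shows "fin_gen R M"
proof -
  interpret M: left_module R M by fact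
  let ?Z = "{x \<in> carrier M. g x = \<zero>\<^bsub>N\<^esub>}"
  have Z: "submodule ?Z R M" by (rule submodule_ker[OF assms(1-3)])
  obtain S where S: "finite S" "S \<subseteq> ?Z"
    and gen: "\<forall>H. submodule H R (M\<lparr>carrier := ?Z\<rparr>) \<longrightarrow> S \<subseteq> H \<longrightarrow> H = ?Z"
    using fin_genE[OF assms(6)] by auto
  obtain S' where S': "finite S'" "S' \<subseteq> carrier N"
    and gen': "\<forall>H. submodule H R N \<longrightarrow> S' \<subseteq> H \<longrightarrow> H = carrier N"
    by (rule fin_genE[OF assms(5)]) (rule that)
  define S'' where "S'' = inv_into (carrier M) g ` S'"
  have S'': "S'' \<subseteq> carrier M" "g ` S'' = S'"
    unfolding S''_def using S'(2) assms(4) by (auto intro!: inv_into_into simp: image_image f_inv_into_f subset_iff)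
  have "H = carrier M" if H: "submodule H R M" and sub: "S \<union> S'' \<subseteq> H" for H
  proof -
    have "submodule (H \<inter> ?Z) R (M\<lparr>carrier := ?Z\<rparr>)"
      using submodule_Int[OF assms(1) H Z] by (simp add: submodule_sub_iff[OF assms(1) Z])
    then have Z_H: "?Z \<subseteq> H" using gen sub S(2) by blast
    have gH: "g ` H = carrier N" using submodule_image[OF assms(1-3) H] sub S'' by (intro gen'[rule_format]) auto
    have Hc: "H \<subseteq> carrier M" using H by (simp add: submodule_iff[OF assms(1)])
    have "x \<in> H" if x: "x \<in> carrier M" for x
    proof -
      have "g x \<in> g ` H" using lin_closed[OF assms(3) x] gH by simp
      then obtain y where y: "y \<in> H" "g x = g y" by auto
      moreover from this have yc: "y \<in> carrier M" using Hc by auto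
      ultimately have "x \<ominus>\<^bsub>M\<^esub> y \<in> H"
        using lin_eq_iff[OF assms(1-3) x yc] Z_H M.M.minus_closed[OF x yc] by auto
      then have "(x \<ominus>\<^bsub>M\<^esub> y) \<oplus>\<^bsub>M\<^esub> y \<in> H" using y H by (simp add: submodule_iff[OF assms(1)])
      moreover have "(x \<ominus>\<^bsub>M\<^esub> y) \<oplus>\<^bsub>M\<^esub> y = x" using x y Hc by (auto simp: a_minus_def M.M.a_assoc M.M.l_neg)
      ultimately show ?thesis by simp
    qed
    then show ?thesis using Hc by auto
  qed
  then show ?thesis
    by (intro fin_genI[of "S \<union> S''"]) (use S S' S'' in \<open>auto simp: S''_def\<close>)
qed

lemma fin_gen_iso:
  assumes "left_module R M" "left_module R N" "mod_iso R M N" "fin_gen R M"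
  shows "fin_gen R N"
  using assms fin_gen_surj[OF assms(1,2)] by (auto simp: mod_iso_iff bij_betw_def)

lemma ex_fgmod:
  fixes M :: "('a, 'm, 'y) module_scheme"
  assumes "left_module R M" "fin_gen R M"
  obtains N :: "('a, 'a list) module" and h where "N \<in> fgmod R" "left_module R N"
    "lin R M N h" "bij_betw h (carrier M) (carrier N)"
  using ex_iso_fgmod[OF assms] by (auto simp: mod_iso_iff[OF assms(1)] fgmod_def)

section \<open>Modules of finite length\<close>

lemma (in abelian_group) diff_add_cancel_right:
  "x \<in> carrier G \<Longrightarrow> y \<in> carrier G \<Longrightarrow> (x \<ominus> y) \<oplus> y = x"
  by (simp add: a_minus_def a_assoc l_neg)

text \<open>Finite length, witnessed by a bounded function that increases strictly along proper
  inclusions. Both chain conditions follow at once, no composition series is chosen, and any such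
  measure, for instance one coming from a field of scalars, may serve.\<close>

definition FL :: "('a, 'x) ring_scheme \<Rightarrow> ('a, 'm, 'y) module_scheme \<Rightarrow> bool" where
  "FL R M \<longleftrightarrow> (\<exists>(d :: 'm set \<Rightarrow> nat) n. (\<forall>H. submodule H R M \<longrightarrow> d H \<le> n) \<and>
     (\<forall>H H'. submodule H R M \<longrightarrow> submodule H' R M \<longrightarrow> H \<subset> H' \<longrightarrow> d H < d H'))"

lemma FL_E:
  fixes M :: "('a, 'm, 'y) module_scheme"
  assumes "FL R M"
  obtains d :: "'m set \<Rightarrow> nat" and n where "\<forall>H. submodule H R M \<longrightarrow> d H \<le> n"
    "\<forall>H H'. submodule H R M \<longrightarrow> submodule H' R M \<longrightarrow> H \<subset> H' \<longrightarrow> d H < d H'"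
  using assms unfolding FL_def by (elim exE conjE) simp

lemma FL_I:
  fixes M :: "('a, 'm, 'y) module_scheme" and d :: "'m set \<Rightarrow> nat"
  assumes "\<And>H. submodule H R M \<Longrightarrow> d H \<le> n"
    "\<And>H H'. submodule H R M \<Longrightarrow> submodule H' R M \<Longrightarrow> H \<subset> H' \<Longrightarrow> d H < d H'"
  shows "FL R M"
  unfolding FL_def using assms by (intro exI[of _ d] exI[of _ n]) simp

lemma FL_inj:
  assumes "left_module R M" "left_module R N" "lin R M N h" "inj_on h (carrier M)" "FL R N"
  shows "FL R M"
proof -
  obtain d and n :: nat where d0: "\<forall>H. submodule H R N \<longrightarrow> d H \<le> n"
    "\<forall>H H'. submodule H R N \<longrightarrow> submodule H' R N \<longrightarrow> H \<subset> H' \<longrightarrow> d H < d H'"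
    by (rule FL_E[OF assms(5)]) (rule that)
  note d = d0(1)[rule_format] d0(2)[rule_format]
  show ?thesis
  proof (rule FL_I[of R M "\<lambda>H. d (h ` H)" n])
    fix H assume "submodule H R M"
    then show "d (h ` H) \<le> n" by (intro d(1) submodule_image[OF assms(1-3)])
  next
    fix H H' assume H: "submodule H R M" "submodule H' R M" "H \<subset> H'"
    have "H' \<subseteq> carrier M" using H(2) by (simp add: submodule_iff[OF assms(1)])
    then have "h ` H \<subset> h ` H'" using H(3) assms(4) by (metis image_strict_mono inj_on_subset)
    then show "d (h ` H) < d (h ` H')" using H by (intro d(2) submodule_image[OF assms(1-3)])
  qed
qed

lemma FL_iso:
  assumes "left_module R M" "left_module R N" "mod_iso R M N" "FL R N"
  shows "FL R M"
  using assms FL_inj[OF assms(1,2)] by (auto simp: mod_iso_iff bij_betw_def)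

lemma FL_sub:
  assumes "left_module R M" "submodule H R M" "FL R M"
  shows "FL R (M\<lparr>carrier := H\<rparr>)"
  by (rule FL_inj[OF left_module_sub[OF assms(1,2)] assms(1) _ _ assms(3), of "\<lambda>x. x"])
    (use assms(1,2) in \<open>auto simp: lin_def submodule_iff\<close>)

lemma FL_max:
  assumes "FL R M" "P H" "\<And>H. P H \<Longrightarrow> submodule H R M"
  obtains H' where "P H'" "\<And>H''. P H'' \<Longrightarrow> H' \<subseteq> H'' \<Longrightarrow> H'' = H'"
proof -
  obtain d and n :: nat where d0: "\<forall>H. submodule H R M \<longrightarrow> d H \<le> n"
    "\<forall>H H'. submodule H R M \<longrightarrow> submodule H' R M \<longrightarrow> H \<subset> H' \<longrightarrow> d H < d H'"
    by (rule FL_E[OF assms(1)]) (rule that)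
  note d = d0(1)[rule_format] d0(2)[rule_format]
  have "\<exists>H'. P H' \<and> (\<forall>H''. P H'' \<longrightarrow> d H'' \<le> d H')"
    using ex_has_greatest_nat[of P H d "Suc n"] assms(2,3) d(1) by (metis le_imp_less_Suc)
  then show ?thesis using that d(2) assms(3) by (metis not_le psubsetI)
qed

lemma FL_min:
  assumes "FL R M" "P H" "\<And>H. P H \<Longrightarrow> submodule H R M"
  obtains H' where "P H'" "\<And>H''. P H'' \<Longrightarrow> H'' \<subseteq> H' \<Longrightarrow> H'' = H'"
proof -
  obtain d and n :: nat where d0: "\<forall>H. submodule H R M \<longrightarrow> d H \<le> n"
    "\<forall>H H'. submodule H R M \<longrightarrow> submodule H' R M \<longrightarrow> H \<subset> H' \<longrightarrow> d H < d H'"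
    by (rule FL_E[OF assms(1)]) (rule that)
  note d = d0(1)[rule_format] d0(2)[rule_format]
  obtain H' where "P H'" "\<And>H''. P H'' \<Longrightarrow> d H' \<le> d H''"
    using ex_has_least_nat[of P H d] assms(2) by metis
  then show ?thesis using that d(2) assms(3) by (metis not_le psubsetI)
qed

text \<open>A maximal finitely generated submodule absorbs every further generator, so it is the
  whole module.\<close>

lemma FL_fin_gen:
  assumes "left_module R M" "FL R M"
  shows "fin_gen R M"
proof -
  define gen where "gen S = \<Inter>{H. submodule H R M \<and> S \<subseteq> H}" for S
  have gen: "submodule (gen S) R M" "S \<subseteq> gen S" if "S \<subseteq> carrier M" for S
    using that submodule_carrier[OF assms(1)] unfolding gen_def
    by (auto intro!: submodule_Inter[OF assms(1)])
  have min: "gen S \<subseteq> H" if "submodule H R M" "S \<subseteq> H" for S H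
    using that by (auto simp: gen_def)
  obtain H where H: "\<exists>S. finite S \<and> S \<subseteq> carrier M \<and> H = gen S"
    "\<And>H'. \<exists>S. finite S \<and> S \<subseteq> carrier M \<and> H' = gen S \<Longrightarrow> H \<subseteq> H' \<Longrightarrow> H' = H"
    by (rule FL_max[OF assms(2), of "\<lambda>H. \<exists>S. finite S \<and> S \<subseteq> carrier M \<and> H = gen S" "gen {}"])
      (use gen in auto)
  obtain S where S: "finite S" "S \<subseteq> carrier M" "H = gen S" using H(1) by blast
  have "x \<in> H" if x: "x \<in> carrier M" for x
  proof -
    have xS: "insert x S \<subseteq> carrier M" using x S by simp
    have "gen S \<subseteq> gen (insert x S)" using gen[OF xS] by (intro min) auto
    then have "gen (insert x S) = H" using S xS by (intro H(2)) auto
    then show ?thesis using gen(2)[OF xS] by auto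
  qed
  then have "carrier M \<subseteq> H" by blast
  moreover have "H' \<subseteq> carrier M" if "submodule H' R M" for H'
    using that by (simp add: submodule_iff[OF assms(1)])
  ultimately show ?thesis using min unfolding S(3) by (intro fin_genI[OF S(1,2)]) blast
qed

text \<open>For a surjection with nonzero kernel, the iterated preimages of zero form a strictly
  increasing chain without end, against the bound on \<open>d\<close>.\<close>

lemma FL_surj_bij:
  assumes "left_module R M" "FL R M" "lin R M M h" "h ` carrier M = carrier M"
  shows "bij_betw h (carrier M) (carrier M)"
proof (rule ccontr)
  assume "\<not> bij_betw h (carrier M) (carrier M)"
  then have "\<not> inj_on h (carrier M)" using assms(4) by (simp add: bij_betw_def)
  then obtain z where z: "z \<in> carrier M" "h z = \<zero>\<^bsub>M\<^esub>" "z \<noteq> \<zero>\<^bsub>M\<^esub>"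
    using lin_inj_iff[OF assms(1,1,3)] by auto
  obtain d and n :: nat where d0: "\<forall>H. submodule H R M \<longrightarrow> d H \<le> n"
    "\<forall>H H'. submodule H R M \<longrightarrow> submodule H' R M \<longrightarrow> H \<subset> H' \<longrightarrow> d H < d H'"
    by (rule FL_E[OF assms(2)]) (rule that)
  note d = d0(1)[rule_format] d0(2)[rule_format]
  define pre where "pre H = {x \<in> carrier M. h x \<in> H}" for H
  have pre: "submodule (pre H) R M" if "submodule H R M" for H
    unfolding pre_def by (rule submodule_vimage[OF assms(1,1,3) that])
  have "\<exists>H. submodule H R M \<and> H \<subset> pre H \<and> k \<le> d H" for k
  proof (induction k)
    case 0
    have "{\<zero>\<^bsub>M\<^esub>} \<subset> pre {\<zero>\<^bsub>M\<^esub>}"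
      using z lin_zero[OF assms(1,1,3)] submodule_zero[OF assms(1)]
      by (auto simp: pre_def submodule_iff[OF assms(1)])
    then show ?case using submodule_zero[OF assms(1)] by blast
  next
    case (Suc k)
    then obtain H where H: "submodule H R M" "H \<subset> pre H" "k \<le> d H" by blast
    \<comment> \<open>Surjectivity keeps the inclusion strict: an element of \<open>pre H\<close>
      outside \<open>H\<close> has a preimage under \<open>h\<close>, and that preimage lies outside
      \<open>pre H\<close>.\<close>
    have "pre H \<subset> pre (pre H)"
    proof
      show "pre H \<subseteq> pre (pre H)" using H(2) by (auto simp: pre_def)
      obtain x where x: "x \<in> pre H" "x \<notin> H" using H(2) by blast
      then have "x \<in> h ` carrier M" using assms(4) by (auto simp: pre_def)
      then show "pre H \<noteq> pre (pre H)" using x by (auto simp: pre_def)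
    qed
    moreover have "Suc k \<le> d (pre H)" using d(2)[OF H(1) pre[OF H(1)] H(2)] H(3) by simp
    ultimately show ?case using pre[OF H(1)] by blast
  qed
  then show False using d(1) by (meson Suc_n_not_le_n order_trans)
qed

section \<open>Finite dimensional vector spaces\<close>

primrec spn :: "('a, 'x) ring_scheme \<Rightarrow> ('a, 'm, 'y) module_scheme \<Rightarrow> 'm list \<Rightarrow> 'm set" where
  "spn R M [] = {\<zero>\<^bsub>M\<^esub>}"
| "spn R M (v # vs) = {a \<odot>\<^bsub>M\<^esub> v \<oplus>\<^bsub>M\<^esub> m | a m. a \<in> carrier R \<and> m \<in> spn R M vs}"

lemma submodule_adjoin:
  assumes "left_module R M" "submodule H R M" "v \<in> carrier M"
  shows "submodule {a \<odot>\<^bsub>M\<^esub> v \<oplus>\<^bsub>M\<^esub> m | a m. a \<in> carrier R \<and> m \<in> H} R M" (is "submodule ?A R M")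
    "insert v H \<subseteq> {a \<odot>\<^bsub>M\<^esub> v \<oplus>\<^bsub>M\<^esub> m | a m. a \<in> carrier R \<and> m \<in> H}"
proof -
  interpret M: left_module R M by fact
  have H: "H \<subseteq> carrier M" "\<zero>\<^bsub>M\<^esub> \<in> H" "\<And>x y. x \<in> H \<Longrightarrow> y \<in> H \<Longrightarrow> x \<oplus>\<^bsub>M\<^esub> y \<in> H"
    "\<And>a x. a \<in> carrier R \<Longrightarrow> x \<in> H \<Longrightarrow> a \<odot>\<^bsub>M\<^esub> x \<in> H"
    using assms(2) by (auto simp: submodule_iff[OF assms(1)])
  have c: "x \<in> carrier M" if "x \<in> H" for x using H(1) that by auto
  have I: "a \<odot>\<^bsub>M\<^esub> v \<oplus>\<^bsub>M\<^esub> m \<in> ?A" if "a \<in> carrier R" "m \<in> H" for a m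
    using that by blast
  have "m \<in> ?A" if "m \<in> H" for m
    using I[of "\<zero>\<^bsub>R\<^esub>" m] assms(3) that c by (simp add: M.smult_zero_l)
  moreover have "v \<in> ?A" using I[of "\<one>\<^bsub>R\<^esub>" "\<zero>\<^bsub>M\<^esub>"] assms(3) H(2) by simp
  ultimately show sub: "insert v H \<subseteq> ?A" by blast
  show "submodule ?A R M"
  proof (rule M.submoduleI)
    show "?A \<subseteq> carrier M" using assms(3) c by auto
    show "\<zero>\<^bsub>M\<^esub> \<in> ?A" using sub H(2) by blast
  next
    fix x y assume "x \<in> ?A" "y \<in> ?A"
    then obtain a m b k where *: "a \<in> carrier R" "m \<in> H" "b \<in> carrier R" "k \<in> H"
      "x = a \<odot>\<^bsub>M\<^esub> v \<oplus>\<^bsub>M\<^esub> m" "y = b \<odot>\<^bsub>M\<^esub> v \<oplus>\<^bsub>M\<^esub> k" by auto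
    have "x \<oplus>\<^bsub>M\<^esub> y = (a \<oplus>\<^bsub>R\<^esub> b) \<odot>\<^bsub>M\<^esub> v \<oplus>\<^bsub>M\<^esub> (m \<oplus>\<^bsub>M\<^esub> k)"
      using * assms(3) c by (simp add: M.smult_l_distr M.M.a_ac)
    then show "x \<oplus>\<^bsub>M\<^esub> y \<in> ?A" using I[of "a \<oplus>\<^bsub>R\<^esub> b" "m \<oplus>\<^bsub>M\<^esub> k"] * H(3) by simp
  next
    fix a x assume a: "a \<in> carrier R" and "x \<in> ?A"
    then obtain b m where *: "b \<in> carrier R" "m \<in> H" "x = b \<odot>\<^bsub>M\<^esub> v \<oplus>\<^bsub>M\<^esub> m" by auto
    have "a \<odot>\<^bsub>M\<^esub> x = (a \<otimes>\<^bsub>R\<^esub> b) \<odot>\<^bsub>M\<^esub> v \<oplus>\<^bsub>M\<^esub> a \<odot>\<^bsub>M\<^esub> m"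
      using * a assms(3) c by (simp add: M.smult_r_distr M.smult_assoc)
    then show "a \<odot>\<^bsub>M\<^esub> x \<in> ?A" using I[of "a \<otimes>\<^bsub>R\<^esub> b" "a \<odot>\<^bsub>M\<^esub> m"] * a H(4) by simp
  qed
qed

lemma submodule_spn:
  assumes "left_module R M" "set vs \<subseteq> carrier M"
  shows "submodule (spn R M vs) R M \<and> set vs \<subseteq> spn R M vs"
  using assms(2)
proof (induction vs)
  case Nil
  then show ?case using submodule_zero[OF assms(1)] by simp
next
  case (Cons v vs)
  then have H: "submodule (spn R M vs) R M" "v \<in> carrier M" "set vs \<subseteq> spn R M vs" by auto
  show ?case using submodule_adjoin[OF assms(1) H(1,2)] H(3) unfolding spn.simps by auto
qed

text \<open>A subspace is measured by its set of pivot positions with respect to a spanning list.\<close>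

lemma FL_field:
  assumes "field K" "left_module K M" "fin_gen K M"
  shows "FL K M"
proof -
  interpret K: field K by fact
  interpret M: left_module K M by fact
  obtain S where S: "finite S" "S \<subseteq> carrier M"
    and gen: "\<forall>H. submodule H K M \<longrightarrow> S \<subseteq> H \<longrightarrow> H = carrier M"
    by (rule fin_genE[OF assms(3)]) (rule that)
  obtain vs where vs: "set vs = S" using S(1) finite_list by blast
  \<comment> \<open>A flag from the whole space \<open>F 0\<close> down to zero, each step dropping
    one spanning vector. The list may be linearly dependent; \<open>J H\<close> then contains no
    index of a trivial step.\<close>
  define F where "F i = spn K M (drop i vs)" for i
  have F: "submodule (F i) K M" for i
    unfolding F_def using submodule_spn[OF assms(2), of "drop i vs"] S vs set_drop_subset[of i vs] by auto
  have F0: "F 0 = carrier M" unfolding F_def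
    using submodule_spn[OF assms(2), of vs] S vs gen by auto
  define J where "J H = {i. i < length vs \<and> (\<exists>h\<in>H. h \<in> F i \<and> h \<notin> F (Suc i))}" for H
  have fin: "finite (J H)" for H unfolding J_def by simp
  show ?thesis
  proof (rule FL_I[of K M "\<lambda>H. card (J H)" "length vs"])
    fix H
    have "J H \<subseteq> {..<length vs}" by (auto simp: J_def)
    then show "card (J H) \<le> length vs" using card_mono[of "{..<length vs}" "J H"] by simp
  next
    fix H H' assume H: "submodule H K M" "submodule H' K M" "H \<subset> H'"
    have Hs: "H' \<subseteq> carrier M" "H \<subseteq> carrier M" using H by (auto simp: submodule_iff[OF assms(2)])
    have "J H \<noteq> J H'"
    proof
      assume JJ: "J H = J H'"
      \<comment> \<open>Equal pivots force equality. By downward induction on \<open>i\<close>, an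
        element of \<open>H'\<close> at level \<open>i\<close> is moved to level
        \<open>i + 1\<close> by subtracting a multiple of an element of \<open>H\<close> with the
        same pivot.\<close>
      have "h' \<in> H" if "h' \<in> H'" "h' \<in> F i" "i \<le> length vs" for h' i
        using that(3,1,2)
      proof (induction i arbitrary: h' rule: inc_induct)
        case base
        then show ?case using H(1) by (simp add: F_def submodule_iff[OF assms(2)])
      next
        case (step i)
        show ?case
        proof (cases "h' \<in> F (Suc i)")
          case True
          then show ?thesis using step by blast
        next
          case False
          then have "i \<in> J H" using step JJ by (auto simp: J_def)
          then obtain h where h: "h \<in> H" "h \<in> F i" "h \<notin> F (Suc i)" by (auto simp: J_def)
          define v where "v = vs ! i"
          have v: "v \<in> carrier M" using S vs step(2) by (auto simp: v_def)
          have Fi: "F i = {a \<odot>\<^bsub>M\<^esub> v \<oplus>\<^bsub>M\<^esub> m | a m. a \<in> carrier K \<and> m \<in> F (Suc i)}"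
            using step(2) by (simp add: F_def v_def flip: Cons_nth_drop_Suc)
          obtain a m' where h': "h' = a \<odot>\<^bsub>M\<^esub> v \<oplus>\<^bsub>M\<^esub> m'" "a \<in> carrier K" "m' \<in> F (Suc i)"
            using step.prems Fi by auto
          obtain b m where hb: "h = b \<odot>\<^bsub>M\<^esub> v \<oplus>\<^bsub>M\<^esub> m" "b \<in> carrier K" "m \<in> F (Suc i)"
            using h Fi by auto
          have mc: "m \<in> carrier M" "m' \<in> carrier M" using h'(3) hb(3) F[of "Suc i"]
            by (auto simp: submodule_iff[OF assms(2)])
          have "b \<noteq> \<zero>\<^bsub>K\<^esub>"
          proof
            assume "b = \<zero>\<^bsub>K\<^esub>"
            then have "h = m" using hb mc v by (simp add: M.smult_zero_l)
            then show False using h hb by simp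
          qed
          then have b: "b \<in> Units K" using hb by (simp add: K.field_Units)
          \<comment> \<open>The quotient of the two leading coefficients; \<open>b\<close> is
            invertible because \<open>h\<close> is not in \<open>F (Suc i)\<close>.\<close>
          define c where "c = a \<otimes>\<^bsub>K\<^esub> inv\<^bsub>K\<^esub> b"
          have c: "c \<in> carrier K" "c \<otimes>\<^bsub>K\<^esub> b = a"
            using b h' hb by (auto simp: c_def K.m_assoc)
          have ch: "c \<odot>\<^bsub>M\<^esub> h = a \<odot>\<^bsub>M\<^esub> v \<oplus>\<^bsub>M\<^esub> c \<odot>\<^bsub>M\<^esub> m"
            using hb c v mc by (simp add: M.smult_r_distr flip: M.smult_assoc)
          have chH: "c \<odot>\<^bsub>M\<^esub> h \<in> H" "c \<odot>\<^bsub>M\<^esub> m \<in> F (Suc i)"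
            using c h hb H(1) F[of "Suc i"] by (auto simp: submodule_iff[OF assms(2)])
          have "h' \<ominus>\<^bsub>M\<^esub> c \<odot>\<^bsub>M\<^esub> h = m' \<ominus>\<^bsub>M\<^esub> c \<odot>\<^bsub>M\<^esub> m"
          proof -
            have "h' \<ominus>\<^bsub>M\<^esub> c \<odot>\<^bsub>M\<^esub> h = (a \<odot>\<^bsub>M\<^esub> v \<oplus>\<^bsub>M\<^esub> \<ominus>\<^bsub>M\<^esub> (a \<odot>\<^bsub>M\<^esub> v)) \<oplus>\<^bsub>M\<^esub> (m' \<oplus>\<^bsub>M\<^esub> \<ominus>\<^bsub>M\<^esub> (c \<odot>\<^bsub>M\<^esub> m))"
              unfolding ch h'(1) a_minus_def using h'(2) c(1) v mc by (simp add: M.M.minus_add M.M.a_ac)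
            then show ?thesis using h'(2) c(1) v mc by (simp add: M.M.r_neg a_minus_def)
          qed
          then have "h' \<ominus>\<^bsub>M\<^esub> c \<odot>\<^bsub>M\<^esub> h \<in> F (Suc i)"
            using submodule_diff[OF assms(2) F h'(3) chH(2)] by simp
          moreover have "h' \<ominus>\<^bsub>M\<^esub> c \<odot>\<^bsub>M\<^esub> h \<in> H'"
            using submodule_diff[OF assms(2) H(2) step.prems(1)] chH H(3) by auto
          ultimately have "h' \<ominus>\<^bsub>M\<^esub> c \<odot>\<^bsub>M\<^esub> h \<in> H" using step.IH by blast
          then have "(h' \<ominus>\<^bsub>M\<^esub> c \<odot>\<^bsub>M\<^esub> h) \<oplus>\<^bsub>M\<^esub> c \<odot>\<^bsub>M\<^esub> h \<in> H"
            using chH H(1) by (simp add: submodule_iff[OF assms(2)])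
          moreover have "(h' \<ominus>\<^bsub>M\<^esub> c \<odot>\<^bsub>M\<^esub> h) \<oplus>\<^bsub>M\<^esub> c \<odot>\<^bsub>M\<^esub> h = h'"
            using M.M.diff_add_cancel_right[of h' "c \<odot>\<^bsub>M\<^esub> h"] step.prems(1) chH Hs by auto
          ultimately show ?thesis by simp
        qed
      qed
      from this[of _ 0] have "H' \<subseteq> H" using Hs F0 by auto
      then show False using H(3) by auto
    qed
    moreover have "J H \<subseteq> J H'" using H(3) by (auto simp: J_def)
    ultimately show "card (J H) < card (J H')" using fin by (intro psubset_card_mono) auto
  qed
qed

section \<open>Restriction of scalars\<close>

text \<open>Restriction of scalars serves both to regard modules as vector spaces and to inflate
  modules from a quotient ring. Carrier and addition stay literally the same, so submodules and maps
  need no transport.\<close>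

definition restr :: "('k \<Rightarrow> 'a) \<Rightarrow> ('a, 'm, 'y) module_scheme \<Rightarrow> ('k, 'm) module" where
  "restr \<rho> M = \<lparr>carrier = carrier M, mult = mult M, one = one M, zero = zero M, add = add M,
     smult = (\<lambda>c x. \<rho> c \<odot>\<^bsub>M\<^esub> x)\<rparr>"

lemma restr_simps [simp]: "carrier (restr \<rho> M) = carrier M" "\<zero>\<^bsub>restr \<rho> M\<^esub> = \<zero>\<^bsub>M\<^esub>"
  "x \<oplus>\<^bsub>restr \<rho> M\<^esub> y = x \<oplus>\<^bsub>M\<^esub> y" "c \<odot>\<^bsub>restr \<rho> M\<^esub> x = \<rho> c \<odot>\<^bsub>M\<^esub> x"
  by (simp_all add: restr_def)

lemma left_module_restr:
  assumes "left_module R M" "ring K" "\<rho> \<in> ring_hom K R"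
  shows "left_module K (restr \<rho> M)"
proof -
  interpret M: left_module R M by fact
  interpret K: ring K by fact
  have \<rho>: "\<And>c. c \<in> carrier K \<Longrightarrow> \<rho> c \<in> carrier R" using assms(3) by (auto simp: ring_hom_def)
  have "abelian_group (restr \<rho> M)"
    by (rule abelian_groupI) (auto simp: M.M.a_ac intro!: bexI[of _ "\<ominus>\<^bsub>M\<^esub> _"] M.M.l_neg)
  then show ?thesis
    by (intro left_module.intro left_module_axioms.intro K.ring_axioms)
      (use assms(3) in \<open>auto simp: \<rho> M.smult_l_distr M.smult_r_distr M.smult_assoc
        ring_hom_add ring_hom_mult ring_hom_one\<close>)
qed

lemma submodule_restr:
  assumes "left_module R M" "ring K" "\<rho> \<in> ring_hom K R" "submodule H R M"
  shows "submodule H K (restr \<rho> M)"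
  using assms(4) ring_hom_closed[OF assms(3)]
  by (simp add: submodule_iff[OF assms(1)] submodule_iff[OF left_module_restr[OF assms(1-3)]])

lemma submodule_restr_surj:
  assumes "left_module R M" "ring K" "\<rho> \<in> ring_hom K R" "\<rho> ` carrier K = carrier R"
    "submodule H K (restr \<rho> M)"
  shows "submodule H R M"
proof -
  have "a \<odot>\<^bsub>M\<^esub> x \<in> H" if "a \<in> carrier R" "x \<in> H" for a x
  proof -
    have "a \<in> \<rho> ` carrier K" using that(1) assms(4) by simp
    then obtain c where "c \<in> carrier K" "a = \<rho> c" by (elim imageE)
    then show ?thesis using that assms(5) by (simp add: submodule_iff[OF left_module_restr[OF assms(1-3)]])
  qed
  then show ?thesis using assms(5)
    by (simp add: submodule_iff[OF assms(1)] submodule_iff[OF left_module_restr[OF assms(1-3)]])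
qed

lemma lin_restr:
  assumes "\<rho> \<in> ring_hom K R" "lin R M N h"
  shows "lin K (restr \<rho> M) (restr \<rho> N) h"
  using assms(2) ring_hom_closed[OF assms(1)] by (simp add: lin_def)

lemma lin_restr_surj:
  assumes "left_module R M" "\<rho> ` carrier K = carrier R" "lin K (restr \<rho> M) (restr \<rho> N) h"
  shows "lin R M N h"
proof -
  have "h (a \<odot>\<^bsub>M\<^esub> x) = a \<odot>\<^bsub>N\<^esub> h x" if "a \<in> carrier R" "x \<in> carrier M" for a x
  proof -
    have "a \<in> \<rho> ` carrier K" using that(1) assms(2) by simp
    then obtain c where "c \<in> carrier K" "a = \<rho> c" by (elim imageE)
    then show ?thesis using that assms(3) by (simp add: lin_def)
  qed
  then show ?thesis using assms(3) by (simp add: lin_def)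
qed

lemma regular_module_simps [simp]: "carrier (regular_module R) = carrier R" "\<zero>\<^bsub>regular_module R\<^esub> = \<zero>\<^bsub>R\<^esub>"
  "x \<oplus>\<^bsub>regular_module R\<^esub> y = x \<oplus>\<^bsub>R\<^esub> y" "a \<odot>\<^bsub>regular_module R\<^esub> x = a \<otimes>\<^bsub>R\<^esub> x"
  by (simp_all add: regular_module_def)

lemma left_module_regular:
  assumes "ring R"
  shows "left_module R (regular_module R)"
proof -
  interpret R: ring R by fact
  have "abelian_group (regular_module R)"
    by (rule abelian_groupI) (auto simp: R.a_ac intro!: bexI[of _ "\<ominus>\<^bsub>R\<^esub> _"] R.l_neg)
  then show ?thesis
    by (intro left_module.intro left_module_axioms.intro R.ring_axioms)
      (auto simp: R.l_distr R.r_distr R.m_assoc)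
qed

text \<open>The structure map is kept as a bare function into \<open>R\<close>, so that quotients,
  corners and endomorphism rings qualify without being given an algebra record. Centrality of the
  scalars is a separate condition, \<open>central_fd_over\<close>.\<close>

definition fd_over :: "('k, 'x) ring_scheme \<Rightarrow> ('a, 'y) ring_scheme \<Rightarrow> ('k \<Rightarrow> 'a) \<Rightarrow> bool" where
  "fd_over K R \<rho> \<longleftrightarrow> field K \<and> ring R \<and> \<rho> \<in> ring_hom K R \<and> fin_gen K (restr \<rho> (regular_module R))"

text \<open>The products of generators of \<open>R\<close> over \<open>K\<close> with generators of
  \<open>M\<close> over \<open>R\<close> span \<open>M\<close>.\<close>

lemma fin_gen_restr:
  assumes "fd_over K R \<rho>" "left_module R M" "fin_gen R M"
  shows "fin_gen K (restr \<rho> M)"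
proof -
  interpret M: left_module R M by fact
  have K: "ring K" using assms(1) by (simp add: fd_over_def field_def domain_def cring_def)
  have \<rho>: "\<rho> \<in> ring_hom K R" and fg: "fin_gen K (restr \<rho> (regular_module R))"
    using assms(1) by (auto simp: fd_over_def)
  note lr = left_module_restr[OF left_module_regular[OF M.R.ring_axioms] K \<rho>]
  note lm = left_module_restr[OF assms(2) K \<rho>]
  obtain S where S: "finite S" "S \<subseteq> carrier M"
    and gen: "\<forall>H. submodule H R M \<longrightarrow> S \<subseteq> H \<longrightarrow> H = carrier M"
    by (rule fin_genE[OF assms(3)]) (rule that)
  obtain B where B: "finite B" "B \<subseteq> carrier (restr \<rho> (regular_module R))"
    and genB: "\<forall>H. submodule H K (restr \<rho> (regular_module R)) \<longrightarrow> B \<subseteq> H \<longrightarrow>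
      H = carrier (restr \<rho> (regular_module R))"
    by (rule fin_genE[OF fg]) (rule that)
  have cr: "carrier (restr \<rho> (regular_module R)) = carrier R" by simp
  show ?thesis
  proof (rule fin_genI[of "(\<lambda>(b, s). b \<odot>\<^bsub>M\<^esub> s) ` (B \<times> S)"])
    show "finite ((\<lambda>(b, s). b \<odot>\<^bsub>M\<^esub> s) ` (B \<times> S))" using S B by simp
    show "(\<lambda>(b, s). b \<odot>\<^bsub>M\<^esub> s) ` (B \<times> S) \<subseteq> carrier (restr \<rho> M)" using S B cr by auto
  next
    fix H assume H: "submodule H K (restr \<rho> M)" "(\<lambda>(b, s). b \<odot>\<^bsub>M\<^esub> s) ` (B \<times> S) \<subseteq> H"
    have Hc: "H \<subseteq> carrier M" "\<zero>\<^bsub>M\<^esub> \<in> H" "\<And>x y. x \<in> H \<Longrightarrow> y \<in> H \<Longrightarrow> x \<oplus>\<^bsub>M\<^esub> y \<in> H"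
      "\<And>c x. c \<in> carrier K \<Longrightarrow> x \<in> H \<Longrightarrow> \<rho> c \<odot>\<^bsub>M\<^esub> x \<in> H"
      using H(1) by (auto simp: submodule_iff[OF lm])
    have rs: "r \<odot>\<^bsub>M\<^esub> s \<in> H" if "r \<in> carrier R" "s \<in> S" for r s
    proof -
      have s: "s \<in> carrier M" using that S by auto
      have "submodule {r \<in> carrier R. r \<odot>\<^bsub>M\<^esub> s \<in> H} K (restr \<rho> (regular_module R))"
        using s Hc \<rho> ring_hom_closed[OF \<rho>]
        by (auto simp: submodule_iff[OF lr] M.smult_zero_l M.smult_l_distr M.smult_assoc)
      moreover have "B \<subseteq> {r \<in> carrier R. r \<odot>\<^bsub>M\<^esub> s \<in> H}" using H(2) that B(2) cr by auto
      ultimately show ?thesis using genB that(1) cr by blast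
    qed
    \<comment> \<open>The largest \<open>R\<close>-submodule inside the subspace \<open>H\<close>;
      it contains \<open>S\<close>, so it is everything.\<close>
    define H' where "H' = {h \<in> H. \<forall>r\<in>carrier R. r \<odot>\<^bsub>M\<^esub> h \<in> H}"
    have "submodule H' R M"
      unfolding H'_def using Hc
      by (auto simp: submodule_iff[OF assms(2)] M.smult_zero_r M.smult_r_distr subset_iff simp flip: M.smult_assoc)
    moreover have "S \<subseteq> H'"
    proof
      fix s assume s: "s \<in> S"
      then have "s \<in> carrier M" using S by auto
      then show "s \<in> H'" using rs[OF M.R.one_closed s] rs s by (auto simp: H'_def)
    qed
    ultimately have "H' = carrier M" using gen by blast
    then show "H = carrier (restr \<rho> M)" using Hc(1) by (auto simp: H'_def)
  qed
qed

lemma fd_over_FL_restr: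
  assumes "fd_over K R \<rho>" "left_module R M" "fin_gen R M"
  shows "FL K (restr \<rho> M)"
proof -
  have K: "field K" "ring K" "\<rho> \<in> ring_hom K R"
    using assms(1) by (simp_all add: fd_over_def field_def domain_def cring_def)
  show ?thesis by (rule FL_field[OF K(1) left_module_restr[OF assms(2) K(2,3)] fin_gen_restr[OF assms]])
qed

lemma fd_over_FL:
  assumes "fd_over K R \<rho>" "left_module R M" "fin_gen R M"
  shows "FL R M"
proof -
  have K: "ring K" and \<rho>: "\<rho> \<in> ring_hom K R"
    using assms(1) by (simp_all add: fd_over_def field_def domain_def cring_def)
  obtain d and n :: nat where d0: "\<forall>H. submodule H K (restr \<rho> M) \<longrightarrow> d H \<le> n"
    "\<forall>H H'. submodule H K (restr \<rho> M) \<longrightarrow> submodule H' K (restr \<rho> M) \<longrightarrow> H \<subset> H' \<longrightarrow> d H < d H'"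
    by (rule FL_E[OF fd_over_FL_restr[OF assms]]) (rule that)
  note d = d0(1)[rule_format] d0(2)[rule_format]
  show ?thesis by (rule FL_I[of R M d n]) (use d submodule_restr[OF assms(2) K \<rho>] in auto)
qed

text \<open>The one finiteness property on which the theory of torsion classes below rests, free of
  any field of scalars.\<close>

definition artin :: "('a, 'x) ring_scheme \<Rightarrow> bool" where
  "artin R \<longleftrightarrow> ring R \<and> (\<forall>M\<in>fgmod R. FL R M)"

lemma fd_over_artin:
  assumes "fd_over K R \<rho>"
  shows "artin R"
proof -
  have "ring R" using assms by (simp add: fd_over_def)
  moreover have "FL R M" if "M \<in> fgmod R" for M
    using that by (intro fd_over_FL[OF assms]) (simp_all add: fgmod_def)
  ultimately show ?thesis by (simp add: artin_def)
qed

lemma artin_FL: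
  assumes "artin R" "left_module R M" "fin_gen R M"
  shows "FL R M"
proof -
  obtain N where "N \<in> fgmod R" "mod_iso R M N" using ex_iso_fgmod[OF assms(2,3)] by blast
  then show ?thesis using FL_iso[OF assms(2)] assms(1) by (auto simp: artin_def fgmod_def)
qed

lemma artin_fin_gen_sub:
  assumes "artin R" "left_module R M" "fin_gen R M" "submodule H R M"
  shows "fin_gen R (M\<lparr>carrier := H\<rparr>)"
  by (rule FL_fin_gen[OF left_module_sub[OF assms(2,4)] FL_sub[OF assms(2,4) artin_FL[OF assms(1-3)]]])

lemma fgmod_sub:
  assumes "artin R" "M \<in> fgmod R" "submodule H R M"
  shows "M\<lparr>carrier := H\<rparr> \<in> fgmod R"
  using assms(2) artin_fin_gen_sub[OF assms(1) _ _ assms(3)] left_module_sub[OF _ assms(3)] by (simp add: fgmod_def)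

lemma fgmod_quotient:
  assumes "M \<in> fgmod R" "submodule H R M"
  obtains N q where "N \<in> fgmod R" "lin R M N q" "q ` carrier M = carrier N"
    "\<forall>x\<in>carrier M. q x = \<zero>\<^bsub>N\<^esub> \<longleftrightarrow> x \<in> H"
proof -
  have M: "left_module R M" "fin_gen R M" using assms by (auto simp: fgmod_def)
  obtain N :: "('a, 'a list) module" and q where "left_module R N" "lin R M N q" "q ` carrier M = carrier N"
    "\<forall>x\<in>carrier M. q x = \<zero>\<^bsub>N\<^esub> \<longleftrightarrow> x \<in> H"
    by (rule ex_quotient[OF M(1) assms(2)]) (rule that)
  moreover from this have "fin_gen R N" using fin_gen_surj[OF M(1) _ _ _ M(2)] by blast
  ultimately show thesis using that by (simp add: fgmod_def)
qed

lemma fgmod_range: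
  assumes "artin R" "M \<in> fgmod R" "N \<in> fgmod R" "lin R M N h"
  shows "N\<lparr>carrier := h ` carrier M\<rparr> \<in> fgmod R"
  by (rule fgmod_sub[OF assms(1,3) submodule_range[OF _ _ assms(4)]]) (use assms in \<open>simp_all add: fgmod_def\<close>)

section \<open>Bricks\<close>

lemma mod_hom_eqI:
  assumes "f \<in> mod_hom R M N" "g \<in> mod_hom R M N" "\<And>x. x \<in> carrier M \<Longrightarrow> f x = g x"
  shows "f = g"
  using assms by (auto simp: mod_hom_def PiE_def intro: extensionalityI)

lemma hom_space:
  assumes "left_module R M" "left_module R N"
  shows "(\<lambda>x\<in>carrier M. \<zero>\<^bsub>N\<^esub>) \<in> mod_hom R M N"
    "\<And>f g. f \<in> mod_hom R M N \<Longrightarrow> g \<in> mod_hom R M N \<Longrightarrow> (\<lambda>x\<in>carrier M. f x \<oplus>\<^bsub>N\<^esub> g x) \<in> mod_hom R M N"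
  using lin_mod_hom[OF assms(1) lin_const_zero[OF assms(2)]]
    lin_mod_hom[OF assms(1) lin_sum[OF assms(2) mod_hom_lin mod_hom_lin]] by simp_all

text \<open>Stated for every record with these three components, since groups of homomorphisms occur
  below with different multiplications and scalar actions.\<close>

lemma abelian_group_hom_space:
  fixes H :: "('m \<Rightarrow> 'n, 'z) ring_scheme"
  assumes M: "left_module R M" and N: "left_module R N" and H: "carrier H = mod_hom R M N"
    "\<zero>\<^bsub>H\<^esub> = (\<lambda>x\<in>carrier M. \<zero>\<^bsub>N\<^esub>)" "\<And>f g. f \<oplus>\<^bsub>H\<^esub> g = (\<lambda>x\<in>carrier M. f x \<oplus>\<^bsub>N\<^esub> g x)"
  shows "abelian_group H"
proof -
  interpret N: left_module R N by fact
  have c: "f x \<in> carrier N" if "f \<in> mod_hom R M N" "x \<in> carrier M" for f x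
    using that by (auto dest: mod_hom_lin simp: lin_def)
  note zero = hom_space(1)[OF M N] and add = hom_space(2)[OF M N]
  show ?thesis
  proof (rule abelian_groupI)
    fix f assume "f \<in> carrier H"
    then have f: "f \<in> mod_hom R M N" by (simp add: H)
    have "lin R M N (\<lambda>x. \<zero>\<^bsub>N\<^esub> \<ominus>\<^bsub>N\<^esub> f x)"
      by (rule lin_difference[OF N lin_const_zero[OF N] mod_hom_lin[OF f]])
    then have g: "(\<lambda>x\<in>carrier M. \<zero>\<^bsub>N\<^esub> \<ominus>\<^bsub>N\<^esub> f x) \<in> carrier H" using lin_mod_hom[OF M] by (simp add: H)
    have "(\<lambda>x\<in>carrier M. \<zero>\<^bsub>N\<^esub> \<ominus>\<^bsub>N\<^esub> f x) \<oplus>\<^bsub>H\<^esub> f = \<zero>\<^bsub>H\<^esub>"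
      using c[OF f] by (auto simp: H fun_eq_iff a_minus_def N.M.l_neg)
    with g show "\<exists>g\<in>carrier H. g \<oplus>\<^bsub>H\<^esub> f = \<zero>\<^bsub>H\<^esub>" by blast
  next
    fix f assume f: "f \<in> carrier H"
    then show "\<zero>\<^bsub>H\<^esub> \<oplus>\<^bsub>H\<^esub> f = f" using add[OF zero] c
      by (intro mod_hom_eqI[of _ R M N]) (simp_all add: H)
  qed (use add zero c in \<open>auto simp: H fun_eq_iff N.M.a_ac\<close>)
qed

lemma End_ring_simps [simp]:
  "carrier (End_ring R M) = mod_hom R M M" "f \<otimes>\<^bsub>End_ring R M\<^esub> g = compose (carrier M) f g"
  "\<one>\<^bsub>End_ring R M\<^esub> = (\<lambda>x\<in>carrier M. x)" "\<zero>\<^bsub>End_ring R M\<^esub> = (\<lambda>x\<in>carrier M. \<zero>\<^bsub>M\<^esub>)"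
  "f \<oplus>\<^bsub>End_ring R M\<^esub> g = (\<lambda>x\<in>carrier M. f x \<oplus>\<^bsub>M\<^esub> g x)"
  by (simp_all add: End_ring_def)

lemma ring_End_ring:
  assumes "left_module R M"
  shows "ring (End_ring R M)"
proof -
  interpret M: left_module R M by fact
  let ?E = "End_ring R M"
  have l: "lin R M M f" "\<And>x. x \<in> carrier M \<Longrightarrow> f x \<in> carrier M" if "f \<in> carrier ?E" for f
    using that by (auto dest: mod_hom_lin simp: lin_def)
  have add: "f \<oplus>\<^bsub>?E\<^esub> g \<in> carrier ?E" if "f \<in> carrier ?E" "g \<in> carrier ?E" for f g
    using lin_mod_hom[OF assms lin_sum[OF assms l(1)[OF that(1)] l(1)[OF that(2)]]] by simp
  have comp: "f \<otimes>\<^bsub>?E\<^esub> g \<in> carrier ?E" if "f \<in> carrier ?E" "g \<in> carrier ?E" for f g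
    using lin_mod_hom[OF assms lin_comp[OF l(1)[OF that(2)] l(1)[OF that(1)]]] by (simp add: compose_def)
  have id: "\<one>\<^bsub>?E\<^esub> \<in> carrier ?E" using lin_mod_hom[OF assms lin_id] by simp
  have zero: "\<zero>\<^bsub>?E\<^esub> \<in> carrier ?E" using lin_mod_hom[OF assms lin_const_zero[OF assms]] by simp
  have eqI: "f = g" if "f \<in> carrier ?E" "g \<in> carrier ?E" "\<And>x. x \<in> carrier M \<Longrightarrow> f x = g x" for f g
    using that by (auto intro: mod_hom_eqI)
  have "abelian_group ?E" by (rule abelian_group_hom_space[OF assms assms]) simp_all
  moreover have "Group.monoid ?E"
  proof (rule monoidI)
    fix f g h assume f: "f \<in> carrier ?E" "g \<in> carrier ?E" "h \<in> carrier ?E"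
    show "(f \<otimes>\<^bsub>?E\<^esub> g) \<otimes>\<^bsub>?E\<^esub> h = f \<otimes>\<^bsub>?E\<^esub> (g \<otimes>\<^bsub>?E\<^esub> h)"
      by (rule eqI[OF comp[OF comp] comp[OF _ comp]]) (use f l in \<open>auto simp: compose_def\<close>)
  next
    fix f assume f: "f \<in> carrier ?E"
    show "\<one>\<^bsub>?E\<^esub> \<otimes>\<^bsub>?E\<^esub> f = f" by (rule eqI[OF comp[OF id]]) (use f l in \<open>auto simp: compose_def\<close>)
    show "f \<otimes>\<^bsub>?E\<^esub> \<one>\<^bsub>?E\<^esub> = f" by (rule eqI[OF comp[OF _ id]]) (use f l in \<open>auto simp: compose_def\<close>)
  qed (fact comp id)+
  ultimately show ?thesis
  proof (rule ringI)
    fix f g h assume f: "f \<in> carrier ?E" "g \<in> carrier ?E" "h \<in> carrier ?E"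
    show "(f \<oplus>\<^bsub>?E\<^esub> g) \<otimes>\<^bsub>?E\<^esub> h = f \<otimes>\<^bsub>?E\<^esub> h \<oplus>\<^bsub>?E\<^esub> g \<otimes>\<^bsub>?E\<^esub> h"
      by (rule eqI[OF comp[OF add] add[OF comp comp]]) (use f l in \<open>auto simp: compose_def\<close>)
    show "h \<otimes>\<^bsub>?E\<^esub> (f \<oplus>\<^bsub>?E\<^esub> g) = h \<otimes>\<^bsub>?E\<^esub> f \<oplus>\<^bsub>?E\<^esub> h \<otimes>\<^bsub>?E\<^esub> g"
      by (rule eqI[OF comp[OF _ add] add[OF comp comp]]) (use f l lin_add[OF l(1)] in \<open>auto simp: compose_def\<close>)
  qed
qed

text \<open>The brick condition on an arbitrary carrier type, in terms of maps rather than units,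
  for the modules built later that do not live on lists.\<close>

definition gbrick :: "('a, 'x) ring_scheme \<Rightarrow> ('a, 'm, 'y) module_scheme \<Rightarrow> bool" where
  "gbrick R M \<longleftrightarrow> left_module R M \<and> fin_gen R M \<and> (\<exists>x\<in>carrier M. x \<noteq> \<zero>\<^bsub>M\<^esub>) \<and>
     (\<forall>h. lin R M M h \<and> (\<exists>x\<in>carrier M. h x \<noteq> \<zero>\<^bsub>M\<^esub>) \<longrightarrow> bij_betw h (carrier M) (carrier M))"

lemma brick_iff: "brick R M \<longleftrightarrow> M \<in> fgmod R \<and> gbrick R M"
proof (cases "M \<in> fgmod R")
  case True
  then have M: "left_module R M" "fin_gen R M" by (auto simp: fgmod_def)
  interpret M: left_module R M by (fact M)
  let ?E = "End_ring R M"
  interpret E: ring ?E by (rule ring_End_ring[OF M(1)])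
  have nz: "f \<noteq> \<zero>\<^bsub>?E\<^esub> \<longleftrightarrow> (\<exists>x\<in>carrier M. f x \<noteq> \<zero>\<^bsub>M\<^esub>)" if "f \<in> carrier ?E" for f
    using mod_hom_eqI[of f R M M "\<zero>\<^bsub>?E\<^esub>"] that E.zero_closed by auto
  have un: "f \<in> Units ?E \<longleftrightarrow> bij_betw f (carrier M) (carrier M)" if f: "f \<in> carrier ?E" for f
  proof
    assume "f \<in> Units ?E"
    then obtain g where g: "g \<in> carrier ?E" "g \<otimes>\<^bsub>?E\<^esub> f = \<one>\<^bsub>?E\<^esub>" "f \<otimes>\<^bsub>?E\<^esub> g = \<one>\<^bsub>?E\<^esub>"
      by (auto simp: Units_def)
    have "g (f x) = x" "f (g x) = x" if "x \<in> carrier M" for x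
      using fun_cong[OF g(2), of x] fun_cong[OF g(3), of x] that by (auto simp: compose_def)
    moreover have "f x \<in> carrier M" "g x \<in> carrier M" if "x \<in> carrier M" for x
      using that f g by (auto dest!: mod_hom_lin simp: lin_def)
    ultimately show "bij_betw f (carrier M) (carrier M)" by (intro bij_betw_byWitness[of _ g]) auto
  next
    assume b: "bij_betw f (carrier M) (carrier M)"
    have l: "lin R M M f" using f by (simp add: mod_hom_lin)
    let ?g = "restrict (inv_into (carrier M) f) (carrier M)"
    have g: "?g \<in> carrier ?E" using lin_mod_hom[OF M(1) lin_inv[OF M(1) l b]] by simp
    have i: "inv_into (carrier M) f (f x) = x" "f (inv_into (carrier M) f x) = x" if "x \<in> carrier M" for x
      using b that by (auto simp: bij_betw_def f_inv_into_f)
    have c: "f x \<in> carrier M" "inv_into (carrier M) f x \<in> carrier M" if "x \<in> carrier M" for x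
      using b that by (auto simp: bij_betw_def intro: inv_into_into)
    have "?g \<otimes>\<^bsub>?E\<^esub> f = \<one>\<^bsub>?E\<^esub>" "f \<otimes>\<^bsub>?E\<^esub> ?g = \<one>\<^bsub>?E\<^esub>"
      using i c by (auto simp: compose_def fun_eq_iff restrict_def)
    then show "f \<in> Units ?E" using f g by (auto simp: Units_def)
  qed
  have "division_ring ?E \<longleftrightarrow> (\<forall>f\<in>carrier ?E. f \<in> Units ?E \<longleftrightarrow> f \<noteq> \<zero>\<^bsub>?E\<^esub>)"
    using E.ring_axioms E.Units_closed by (auto simp: division_ring_def simp del: End_ring_simps)
  also have "\<dots> \<longleftrightarrow> gbrick R M"
  proof
    assume L: "\<forall>f\<in>carrier ?E. f \<in> Units ?E \<longleftrightarrow> f \<noteq> \<zero>\<^bsub>?E\<^esub>"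
    have "bij_betw h (carrier M) (carrier M)" if h: "lin R M M h" "\<exists>x\<in>carrier M. h x \<noteq> \<zero>\<^bsub>M\<^esub>" for h
    proof -
      let ?f = "restrict h (carrier M)"
      have f: "?f \<in> carrier ?E" using lin_mod_hom[OF M(1) h(1)] by simp
      then have "bij_betw ?f (carrier M) (carrier M)" using L un[OF f] nz[OF f] h(2) by auto
      then show ?thesis by (simp add: bij_betw_def inj_on_def)
    qed
    \<comment> \<open>That the module is nonzero is the condition that one differs from zero in the
      endomorphism ring.\<close>
    moreover have "\<exists>x\<in>carrier M. x \<noteq> \<zero>\<^bsub>M\<^esub>"
      using L[rule_format, OF E.one_closed] E.Units_one_closed nz[OF E.one_closed] by auto
    ultimately show "gbrick R M" using M by (simp add: gbrick_def)
  next
    assume g: "gbrick R M"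
    show "\<forall>f\<in>carrier ?E. f \<in> Units ?E \<longleftrightarrow> f \<noteq> \<zero>\<^bsub>?E\<^esub>"
    proof
      fix f assume f: "f \<in> carrier ?E"
      then have l: "lin R M M f" by (simp add: mod_hom_lin)
      obtain x where x: "x \<in> carrier M" "x \<noteq> \<zero>\<^bsub>M\<^esub>" using g by (auto simp: gbrick_def)
      have "\<exists>x\<in>carrier M. f x \<noteq> \<zero>\<^bsub>M\<^esub>" if "bij_betw f (carrier M) (carrier M)"
        using that x lin_inj_iff[OF M(1) M(1) l] by (auto simp: bij_betw_def)
      then show "f \<in> Units ?E \<longleftrightarrow> f \<noteq> \<zero>\<^bsub>?E\<^esub>" using un[OF f] nz[OF f] g l by (auto simp: gbrick_def)
    qed
  qed
  finally show ?thesis using True by (simp add: brick_def)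
qed (simp add: brick_def)

section \<open>Torsion pairs and bricks\<close>

definition perp :: "('a, 'x) ring_scheme \<Rightarrow> ('a, 'a list) module set \<Rightarrow> ('a, 'a list) module set" where
  "perp R \<S> = {X \<in> fgmod R. \<forall>S\<in>\<S>. no_hom R X S}"

definition rperp :: "('a, 'x) ring_scheme \<Rightarrow> ('a, 'a list) module set \<Rightarrow> ('a, 'a list) module set" where
  "rperp R \<T> = {F \<in> fgmod R. \<forall>X\<in>\<T>. no_hom R X F}"

definition nonzero :: "('a, 'm, 'y) module_scheme \<Rightarrow> bool" where
  "nonzero M \<longleftrightarrow> (\<exists>x\<in>carrier M. x \<noteq> \<zero>\<^bsub>M\<^esub>)"

lemma no_hom_I: "(\<And>h x. lin R M N h \<Longrightarrow> x \<in> carrier M \<Longrightarrow> h x = \<zero>\<^bsub>N\<^esub>) \<Longrightarrow> no_hom R M N"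
  by (simp add: no_hom_def)

lemma no_hom_D: "no_hom R M N \<Longrightarrow> lin R M N h \<Longrightarrow> x \<in> carrier M \<Longrightarrow> h x = \<zero>\<^bsub>N\<^esub>"
  by (simp add: no_hom_def)

lemma not_no_hom_E:
  assumes "\<not> no_hom R M N"
  obtains h x where "lin R M N h" "x \<in> carrier M" "h x \<noteq> \<zero>\<^bsub>N\<^esub>"
  using assms by (auto simp: no_hom_def)

lemma no_hom_self: "no_hom R M M \<Longrightarrow> \<not> nonzero M"
  using no_hom_D[OF _ lin_id] by (auto simp: nonzero_def)

lemma no_hom_surj:
  assumes "lin R M M' q" "q ` carrier M = carrier M'" "no_hom R M N"
  shows "no_hom R M' N"
proof (rule no_hom_I)
  fix h x assume h: "lin R M' N h" and "x \<in> carrier M'"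
  then have "x \<in> q ` carrier M" using assms(2) by simp
  then obtain y where "y \<in> carrier M" "x = q y" by (elim imageE)
  then show "h x = \<zero>\<^bsub>N\<^esub>" using no_hom_D[OF assms(3) lin_comp[OF assms(1) h]] by simp
qed

lemma no_hom_inj:
  assumes "left_module R N'" "left_module R N" "lin R N' N j" "inj_on j (carrier N')" "no_hom R M N"
  shows "no_hom R M N'"
proof (rule no_hom_I)
  fix h x assume h: "lin R M N' h" and x: "x \<in> carrier M"
  have "j (h x) = \<zero>\<^bsub>N\<^esub>" using no_hom_D[OF assms(5) lin_comp[OF h assms(3)] x] .
  then show "h x = \<zero>\<^bsub>N'\<^esub>" using lin_inj_iff[OF assms(1-3)] assms(4) lin_closed[OF h x] by blast
qed

lemma no_hom_iso:
  assumes "left_module R M" "left_module R M'" "left_module R N" "left_module R N'"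
    "mod_iso R M M'" "mod_iso R N N'"
  shows "no_hom R M N \<longleftrightarrow> no_hom R M' N'"
proof -
  obtain f where f: "lin R M M' f" "bij_betw f (carrier M) (carrier M')"
    using assms(1,5) by (auto simp: mod_iso_iff)
  obtain f' where f': "lin R M' M f'" "bij_betw f' (carrier M') (carrier M)"
    using mod_iso_sym[OF assms(1,2,5)] assms(2) by (auto simp: mod_iso_iff)
  obtain g where g: "lin R N N' g" "bij_betw g (carrier N) (carrier N')"
    using assms(3,6) by (auto simp: mod_iso_iff)
  obtain g' where g': "lin R N' N g'" "bij_betw g' (carrier N') (carrier N)"
    using mod_iso_sym[OF assms(3,4,6)] assms(4) by (auto simp: mod_iso_iff)
  show ?thesis
    using no_hom_surj[OF f(1), of N'] no_hom_inj[OF assms(4,3) g'(1), of M]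
      no_hom_surj[OF f'(1), of N] no_hom_inj[OF assms(3,4) g(1), of M'] f(2) g(2) f'(2) g'(2)
    by (auto simp: bij_betw_def)
qed

section \<open>Torsion classes and perpendicular classes\<close>

lemma fgmodD: "M \<in> fgmod R \<Longrightarrow> left_module R M" "M \<in> fgmod R \<Longrightarrow> fin_gen R M"
  by (auto simp: fgmod_def)

lemma torsion_classD:
  assumes "torsion_class R T"
  shows "T \<subseteq> fgmod R" "T \<noteq> {}"
    "\<forall>M\<in>T. \<forall>N\<in>fgmod R. \<forall>g\<in>mod_hom R M N. g ` carrier M = carrier N \<longrightarrow> N \<in> T"
    "\<forall>L\<in>T. \<forall>N\<in>T. \<forall>M\<in>fgmod R. \<forall>f g. short_exact R L f M g N \<longrightarrow> M \<in> T"
proof -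
  note c = assms[unfolded torsion_class_def]
  show "T \<subseteq> fgmod R" by (rule c[THEN conjunct1])
  show "T \<noteq> {}" by (rule c[THEN conjunct2, THEN conjunct1])
  show "\<forall>M\<in>T. \<forall>N\<in>fgmod R. \<forall>g\<in>mod_hom R M N. g ` carrier M = carrier N \<longrightarrow> N \<in> T"
    by (rule c[THEN conjunct2, THEN conjunct2, THEN conjunct1])
  show "\<forall>L\<in>T. \<forall>N\<in>T. \<forall>M\<in>fgmod R. \<forall>f g. short_exact R L f M g N \<longrightarrow> M \<in> T"
    by (rule c[THEN conjunct2, THEN conjunct2, THEN conjunct2])
qed

lemma torsion_fgmod: "torsion_class R T \<Longrightarrow> X \<in> T \<Longrightarrow> X \<in> fgmod R"
  using torsion_classD(1) by (rule subsetD)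

lemma torsion_quot:
  assumes "torsion_class R T" "M \<in> T" "N \<in> fgmod R" "lin R M N g" "g ` carrier M = carrier N"
  shows "N \<in> T"
proof -
  have "restrict g (carrier M) \<in> mod_hom R M N"
    using lin_mod_hom[OF fgmodD(1)[OF torsion_fgmod[OF assms(1,2)]] assms(4)] .
  moreover have "restrict g (carrier M) ` carrier M = carrier N" using assms(5) by simp
  ultimately show ?thesis using torsion_classD(3)[OF assms(1)] assms(2,3) by metis
qed

lemma torsion_iso:
  assumes "torsion_class R T" "M \<in> T" "N \<in> fgmod R" "mod_iso R M N"
  shows "N \<in> T"
proof -
  have "left_module R M" using torsion_fgmod[OF assms(1,2)] by (rule fgmodD)
  then show ?thesis using assms torsion_quot[OF assms(1-3)] by (auto simp: mod_iso_iff bij_betw_def)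
qed

text \<open>Closure under extensions in the form used below: a submodule and any surjection with it
  as kernel, in place of a short exact sequence of extensional maps.\<close>

lemma torsion_ext:
  assumes "torsion_class R T" "M \<in> fgmod R" "submodule H R M" "M\<lparr>carrier := H\<rparr> \<in> T" "N \<in> T"
    "lin R M N q" "q ` carrier M = carrier N" "\<forall>x\<in>carrier M. q x = \<zero>\<^bsub>N\<^esub> \<longleftrightarrow> x \<in> H"
  shows "M \<in> T"
proof -
  have M: "left_module R M" using assms(2) by (rule fgmodD)
  have H: "H \<subseteq> carrier M" using assms(3) by (simp add: submodule_iff[OF M])
  let ?L = "M\<lparr>carrier := H\<rparr>"
  have "lin R ?L M (\<lambda>x. x)" using H by (auto simp: lin_def)
  then have f: "restrict (\<lambda>x. x) H \<in> mod_hom R ?L M"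
    using lin_mod_hom[OF left_module_sub[OF M assms(3)]] by simp
  have g: "restrict q (carrier M) \<in> mod_hom R M N" using lin_mod_hom[OF M assms(6)] .
  have "short_exact R ?L (restrict (\<lambda>x. x) H) M (restrict q (carrier M)) N"
    unfolding short_exact_def using f g assms(7,8) H by (auto simp: a_kernel_def' inj_on_def)
  then show ?thesis using torsion_classD(4)[OF assms(1)] assms(2,4,5) by metis
qed

lemma zero_module_fgmod:
  assumes "ring R"
  shows "\<exists>Z\<in>fgmod R. carrier Z = {\<zero>\<^bsub>Z\<^esub>}"
proof -
  interpret R: ring R by fact
  define Z :: "('a, 'a list) module" where "Z = \<lparr>carrier = {[]}, mult = undefined, one = undefined,
    zero = [], add = (\<lambda>_ _. []), smult = (\<lambda>_ _. [])\<rparr>"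
  have "abelian_group Z" by (rule abelian_groupI) (auto simp: Z_def)
  then have Z: "left_module R Z"
    by (intro left_module.intro left_module_axioms.intro R.ring_axioms) (auto simp: Z_def)
  have cZ: "carrier Z = {\<zero>\<^bsub>Z\<^esub>}" by (simp add: Z_def)
  then have "fin_gen R Z"
    by (intro fin_genI[of "{}"]) (auto simp: submodule_iff[OF Z])
  with Z cZ show ?thesis by (intro bexI[of _ Z]) (simp_all add: fgmod_def)
qed

lemma torsion_zero:
  assumes "torsion_class R T" "Z \<in> fgmod R" "\<not> nonzero Z"
  shows "Z \<in> T"
proof -
  obtain M where M: "M \<in> T" using torsion_classD(2)[OF assms(1)] by blast
  interpret M: left_module R M using torsion_fgmod[OF assms(1) M] by (rule fgmodD)
  interpret Z: left_module R Z using assms(2) by (rule fgmodD)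
  have "(\<lambda>_. \<zero>\<^bsub>Z\<^esub>) ` carrier M = carrier Z"
    using assms(3) M.M.zero_closed Z.M.zero_closed by (auto simp: nonzero_def)
  then show ?thesis
    by (rule torsion_quot[OF assms(1) M assms(2) lin_const_zero[OF fgmodD(1)[OF assms(2)]]])
qed

lemma torsion_perp:
  assumes "ring R" "\<S> \<subseteq> fgmod R"
  shows "torsion_class R (perp R \<S>)"
  unfolding torsion_class_def
proof (intro conjI ballI allI impI)
  show "perp R \<S> \<subseteq> fgmod R" by (auto simp: perp_def)
next
  obtain Z where Z: "Z \<in> fgmod R" "carrier Z = {\<zero>\<^bsub>Z\<^esub>}" using zero_module_fgmod[OF assms(1)] by blast
  have "no_hom R Z S" if "S \<in> \<S>" for S
  proof (rule no_hom_I)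
    fix h x assume "lin R Z S h" "x \<in> carrier Z"
    then show "h x = \<zero>\<^bsub>S\<^esub>" using lin_zero[of R Z S h] Z that assms(2) fgmodD(1) by auto
  qed
  then have "Z \<in> perp R \<S>" using Z by (simp add: perp_def)
  then show "perp R \<S> \<noteq> {}" by blast
next
  fix M N g assume "M \<in> perp R \<S>" "N \<in> fgmod R" "g \<in> mod_hom R M N" "g ` carrier M = carrier N"
  then show "N \<in> perp R \<S>" using no_hom_surj[OF mod_hom_lin, of g R M N] by (auto simp: perp_def)
next
  fix L N M f g assume LN: "L \<in> perp R \<S>" "N \<in> perp R \<S>" and M: "M \<in> fgmod R" and "short_exact R L f M g N"
  then have f: "lin R L M f" "lin R M N g" "f ` carrier L = a_kernel M N g" "g ` carrier M = carrier N"
    by (auto simp: short_exact_def mod_hom_lin)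
  have "no_hom R M S" if S: "S \<in> \<S>" for S
  proof (rule no_hom_I)
    fix h x assume h: "lin R M S h" "x \<in> carrier M"
    have lm: "left_module R M" "left_module R N" "left_module R S"
      using M LN S assms(2) by (auto simp: perp_def fgmod_def)
    \<comment> \<open>A map to \<open>S\<close> vanishes on the submodule, hence factors through the
      quotient, and there it vanishes as well.\<close>
    have z: "h y = \<zero>\<^bsub>S\<^esub>" if "y \<in> carrier M" "g y = \<zero>\<^bsub>N\<^esub>" for y
    proof -
      have "y \<in> f ` carrier L" using that f(3) by (simp add: a_kernel_def')
      then obtain z where "z \<in> carrier L" "y = f z" by (elim imageE)
      then show ?thesis using no_hom_D[of R L S, OF _ lin_comp[OF f(1) h(1)]] LN(1) S by (simp add: perp_def)
    qed
    obtain k where k: "lin R N S k" "\<forall>x\<in>carrier M. k (g x) = h x"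
      by (rule lin_factor[OF lm f(2,4) h(1) z]) (assumption, assumption, rule that)
    have "no_hom R N S" using LN(2) S by (simp add: perp_def)
    then have "k (g x) = \<zero>\<^bsub>S\<^esub>" using no_hom_D[OF _ k(1) lin_closed[OF f(2) h(2)]] by simp
    then show "h x = \<zero>\<^bsub>S\<^esub>" using k(2) h(2) by simp
  qed
  then show "M \<in> perp R \<S>" using M by (simp add: perp_def)
qed

lemma torsion_Int:
  assumes "ring R" "torsion_class R T" "torsion_class R T'"
  shows "torsion_class R (T \<inter> T')"
proof -
  obtain Z where Z: "Z \<in> fgmod R" "carrier Z = {\<zero>\<^bsub>Z\<^esub>}" using zero_module_fgmod[OF assms(1)] by blast
  then have "Z \<in> T \<inter> T'" using torsion_zero[OF assms(2) Z(1)] torsion_zero[OF assms(3) Z(1)] by (simp add: nonzero_def)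
  moreover have "T \<inter> T' \<subseteq> fgmod R" using torsion_fgmod[OF assms(2)] by blast
  ultimately show ?thesis
    unfolding torsion_class_def
    using torsion_classD(3,4)[OF assms(2)] torsion_classD(3,4)[OF assms(3)]
    by (intro conjI) (blast, blast, metis IntE IntI, metis IntE IntI)
qed

lemma torsion_all: "ring R \<Longrightarrow> torsion_class R (fgmod R)"
  using torsion_perp[of R "{}"] by (simp add: perp_def)

lemma torsion_range:
  assumes "artin R" "torsion_class R T" "M \<in> T" "N \<in> fgmod R" "lin R M N h"
  shows "N\<lparr>carrier := h ` carrier M\<rparr> \<in> T"
proof (rule torsion_quot[OF assms(2,3) _ _ ])
  show "N\<lparr>carrier := h ` carrier M\<rparr> \<in> fgmod R"
    by (rule fgmod_range[OF assms(1) torsion_fgmod[OF assms(2,3)] assms(4,5)])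
  show "lin R M (N\<lparr>carrier := h ` carrier M\<rparr>) h" using assms(5) by (simp add: lin_def)
qed simp

lemma rperp_sub:
  assumes "artin R" "F \<in> rperp R \<T>" "submodule H R F"
  shows "F\<lparr>carrier := H\<rparr> \<in> rperp R \<T>"
proof -
  have F: "F \<in> fgmod R" "left_module R F" using assms(2) by (auto simp: rperp_def fgmod_def)
  have "lin R (F\<lparr>carrier := H\<rparr>) F (\<lambda>x. x)" using assms(3) by (auto simp: lin_def submodule_iff[OF F(2)])
  then have "no_hom R X (F\<lparr>carrier := H\<rparr>)" if "X \<in> \<T>" for X
    using that assms(2) by (intro no_hom_inj[OF left_module_sub[OF F(2) assms(3)] F(2), of "\<lambda>x. x"])
      (simp_all add: rperp_def)
  then show ?thesis using fgmod_sub[OF assms(1) F(1) assms(3)] by (simp add: rperp_def)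
qed

text \<open>The canonical sequence of a torsion pair. A maximal submodule in \<open>T\<close> works:
  for a map from a member of \<open>T\<close> to the quotient, the preimage of its image is an
  extension inside \<open>T\<close>, hence no larger, and so the map is zero.\<close>

lemma torsion_part:
  assumes "artin R" "torsion_class R T" "M \<in> fgmod R"
  obtains H N q where "submodule H R M" "M\<lparr>carrier := H\<rparr> \<in> T" "N \<in> rperp R T"
    "lin R M N q" "q ` carrier M = carrier N" "\<forall>x\<in>carrier M. q x = \<zero>\<^bsub>N\<^esub> \<longleftrightarrow> x \<in> H"
proof -
  have M: "left_module R M" "FL R M" using assms by (auto simp: artin_def fgmod_def)
  let ?P = "\<lambda>H. submodule H R M \<and> M\<lparr>carrier := H\<rparr> \<in> T"
  have "M\<lparr>carrier := {\<zero>\<^bsub>M\<^esub>}\<rparr> \<in> T"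
    by (rule torsion_zero[OF assms(2) fgmod_sub[OF assms(1,3) submodule_zero[OF M(1)]]]) (simp add: nonzero_def)
  then obtain H where H: "?P H" "\<And>H'. ?P H' \<Longrightarrow> H \<subseteq> H' \<Longrightarrow> H' = H"
    using FL_max[OF M(2), of ?P "{\<zero>\<^bsub>M\<^esub>}"] submodule_zero[OF M(1)] by metis
  have sH: "submodule H R M" and HT: "M\<lparr>carrier := H\<rparr> \<in> T" using H(1) by auto
  obtain N q where q: "N \<in> fgmod R" "lin R M N q" "q ` carrier M = carrier N"
    and ker: "\<forall>x\<in>carrier M. q x = \<zero>\<^bsub>N\<^esub> \<longleftrightarrow> x \<in> H"
    by (rule fgmod_quotient[OF assms(3) sH]) (rule that)
  have N: "left_module R N" using q(1) by (rule fgmodD)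
  have Hc: "H \<subseteq> carrier M" using sH by (simp add: submodule_iff[OF M(1)])
  have "no_hom R X N" if X: "X \<in> T" for X
  proof (rule no_hom_I)
    fix h x assume h: "lin R X N h" and x: "x \<in> carrier X"
    let ?I = "h ` carrier X"
    have X': "X \<in> fgmod R" "left_module R X" using torsion_fgmod[OF assms(2) X] by (auto simp: fgmod_def)
    have I: "submodule ?I R N" by (rule submodule_range[OF X'(2) N h])
    let ?H = "{x \<in> carrier M. q x \<in> ?I}"
    have sH': "submodule ?H R M" by (rule submodule_vimage[OF M(1) N q(2) I])
    have z: "\<zero>\<^bsub>N\<^esub> \<in> ?I" using I by (simp add: submodule_iff[OF N])
    have HH: "H \<subseteq> ?H"
    proof
      fix y assume y: "y \<in> H"
      then have "q y = \<zero>\<^bsub>N\<^esub>" using Hc ker by blast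
      then show "y \<in> ?H" using y Hc z by auto
    qed
    have "M\<lparr>carrier := ?H\<rparr> \<in> T"
    proof (rule torsion_ext[OF assms(2), where H = H and N = "N\<lparr>carrier := ?I\<rparr>" and q = q])
      show "M\<lparr>carrier := ?H\<rparr> \<in> fgmod R" by (rule fgmod_sub[OF assms(1,3) sH'])
      show "submodule H R (M\<lparr>carrier := ?H\<rparr>)" using sH HH by (simp add: submodule_sub_iff[OF M(1) sH'])
      show "M\<lparr>carrier := ?H, carrier := H\<rparr> \<in> T" using HT by simp
      show "N\<lparr>carrier := ?I\<rparr> \<in> T" by (rule torsion_range[OF assms(1,2) X q(1) h])
      show "lin R (M\<lparr>carrier := ?H\<rparr>) (N\<lparr>carrier := ?I\<rparr>) q" using q(2) by (simp add: lin_def)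
      have "?I \<subseteq> q ` carrier M" using I q(3) by (simp add: submodule_iff[OF N])
      have "y \<in> q ` ?H" if y: "y \<in> ?I" for y
      proof -
        have "y \<in> q ` carrier M" using y \<open>?I \<subseteq> q ` carrier M\<close> by (rule subsetD[rotated])
        then obtain w where "w \<in> carrier M" "y = q w" by (elim imageE)
        then show ?thesis using y by simp
      qed
      moreover have "q ` ?H \<subseteq> ?I" by auto
      ultimately show "q ` carrier (M\<lparr>carrier := ?H\<rparr>) = carrier (N\<lparr>carrier := ?I\<rparr>)" by (simp add: subset_antisym subsetI)
    qed (use ker in auto)
    then have eq: "?H = H" using H(2)[of ?H] sH' HH by blast
    have "h x \<in> carrier N" using lin_closed[OF h x] .
    then have "h x \<in> q ` carrier M" using q(3) by simp
    then obtain y where y: "y \<in> carrier M" "h x = q y" by (elim imageE)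
    moreover have "q y \<in> ?I" using x by (simp flip: y(2))
    ultimately have "y \<in> ?H" by simp
    then have "y \<in> H" using eq by simp
    then show "h x = \<zero>\<^bsub>N\<^esub>" using ker y by simp
  qed
  then have "N \<in> rperp R T" using q(1) by (simp add: rperp_def)
  then show thesis using that sH HT q(2,3) ker by blast
qed

text \<open>A module without nonzero maps to torsion-free modules equals its torsion part, since it
  maps onto its torsion-free quotient.\<close>

lemma perp_rperp:
  assumes "artin R" "torsion_class R T"
  shows "perp R (rperp R T) = T"
proof
  show "T \<subseteq> perp R (rperp R T)" using torsion_fgmod[OF assms(2)] by (auto simp: perp_def rperp_def)
  show "perp R (rperp R T) \<subseteq> T"
  proof
    fix M assume M: "M \<in> perp R (rperp R T)"
    then have M': "M \<in> fgmod R" by (simp add: perp_def)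
    obtain H N q where H: "submodule H R M" "M\<lparr>carrier := H\<rparr> \<in> T" "N \<in> rperp R T"
      "lin R M N q" and ker: "\<forall>x\<in>carrier M. q x = \<zero>\<^bsub>N\<^esub> \<longleftrightarrow> x \<in> H"
      by (rule torsion_part[OF assms M']) (rule that)
    have "no_hom R M N" using M H(3) by (simp add: perp_def)
    then have "carrier M \<subseteq> H" using ker no_hom_D[OF _ H(4)] by blast
    then have "H = carrier M" using H(1) by (auto simp: submodule_iff[OF fgmodD(1)[OF M']])
    then show "M \<in> T" using H(2) by simp
  qed
qed

lemma brickD:
  assumes "brick R S"
  shows "S \<in> fgmod R" "left_module R S" "nonzero S"
    "\<And>h x. lin R S S h \<Longrightarrow> x \<in> carrier S \<Longrightarrow> h x \<noteq> \<zero>\<^bsub>S\<^esub> \<Longrightarrow> bij_betw h (carrier S) (carrier S)"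
  using assms by (auto simp: brick_iff gbrick_def nonzero_def)

text \<open>A minimal nonzero submodule in \<open>T\<close> is a brick: the image of a nonzero
  endomorphism is again such a submodule, so the endomorphism is onto and, by finite length,
  bijective. The minimality is exported for the uniqueness of labels.\<close>

lemma minimal_brick:
  assumes "artin R" "torsion_class R T" "N \<in> T" "N \<in> rperp R \<T>" "nonzero N"
  obtains H where "submodule H R N" "brick R (N\<lparr>carrier := H\<rparr>)" "N\<lparr>carrier := H\<rparr> \<in> T"
    "N\<lparr>carrier := H\<rparr> \<in> rperp R \<T>"
    "\<forall>H'. submodule H' R N \<longrightarrow> H' \<subseteq> H \<longrightarrow> N\<lparr>carrier := H'\<rparr> \<in> T \<longrightarrow> nonzero (N\<lparr>carrier := H'\<rparr>) \<longrightarrow> H' = H"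
proof -
  have N: "N \<in> fgmod R" "left_module R N" "FL R N"
    using torsion_fgmod[OF assms(2,3)] assms(1) by (auto simp: artin_def fgmod_def)
  let ?P = "\<lambda>H. submodule H R N \<and> N\<lparr>carrier := H\<rparr> \<in> T \<and> nonzero (N\<lparr>carrier := H\<rparr>)"
  have "?P (carrier N)" using assms(3,5) submodule_carrier[OF N(2)] by simp
  then obtain H where H: "?P H" "\<And>H'. ?P H' \<Longrightarrow> H' \<subseteq> H \<Longrightarrow> H' = H"
    using FL_min[OF N(3), of ?P "carrier N"] by metis
  let ?S = "N\<lparr>carrier := H\<rparr>"
  have sH: "submodule H R N" and ST: "?S \<in> T" and nz: "nonzero ?S" using H(1) by auto
  have S: "?S \<in> fgmod R" "left_module R ?S" using torsion_fgmod[OF assms(2) ST] by (auto simp: fgmod_def)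
  have "bij_betw h (carrier ?S) (carrier ?S)" if h: "lin R ?S ?S h" "x \<in> carrier ?S" "h x \<noteq> \<zero>\<^bsub>?S\<^esub>" for h x
  proof (rule FL_surj_bij[OF S(2) _ h(1)])
    show "FL R ?S" using S(1) assms(1) by (simp add: artin_def)
    have I: "submodule (h ` H) R N" "h ` H \<subseteq> H"
      using submodule_range[OF S(2) S(2) h(1)] by (simp_all add: submodule_sub_iff[OF N(2) sH])
    have "N\<lparr>carrier := h ` H\<rparr> \<in> T" using torsion_range[OF assms(1,2) ST S(1) h(1)] by simp
    moreover have "nonzero (N\<lparr>carrier := h ` H\<rparr>)" using h by (auto simp: nonzero_def)
    ultimately show "h ` carrier ?S = carrier ?S" using H(2)[of "h ` H"] I by simp
  qed
  then have "brick R ?S" using S nz by (auto simp: brick_iff gbrick_def nonzero_def fgmod_def)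
  then show thesis using that[of H] sH ST rperp_sub[OF assms(1,4) sH] H(2) by blast
qed

text \<open>A module in \<open>T\<close> outside \<open>T'\<close> has a nonzero quotient that is
  torsion-free for \<open>T'\<close>; it is still in \<open>T\<close> and contains the brick. This
  is the source of all labels, and it lets torsion classes be compared by their bricks.\<close>

lemma brick_between:
  assumes "artin R" "torsion_class R T" "torsion_class R T'" "\<not> T \<subseteq> T'"
  obtains S where "brick R S" "S \<in> T" "S \<in> rperp R T'"
proof -
  obtain M where M: "M \<in> T" "M \<notin> T'" using assms(4) by blast
  have M': "M \<in> fgmod R" "left_module R M" using torsion_fgmod[OF assms(2) M(1)] by (auto simp: fgmod_def)
  obtain H N q where H: "submodule H R M" "M\<lparr>carrier := H\<rparr> \<in> T'" "N \<in> rperp R T'"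
    "lin R M N q" "q ` carrier M = carrier N" and ker: "\<forall>x\<in>carrier M. q x = \<zero>\<^bsub>N\<^esub> \<longleftrightarrow> x \<in> H"
    by (rule torsion_part[OF assms(1,3) M'(1)]) (rule that)
  have "N \<in> fgmod R" using H(3) by (simp add: rperp_def)
  then have NT: "N \<in> T" by (rule torsion_quot[OF assms(2) M(1) _ H(4,5)])
  have "nonzero N"
  proof (rule ccontr)
    assume "\<not> nonzero N"
    then have "carrier M \<subseteq> H" using ker lin_closed[OF H(4)] by (auto simp: nonzero_def)
    then have "H = carrier M" using H(1) by (auto simp: submodule_iff[OF M'(2)])
    then show False using H(2) M(2) by simp
  qed
  then show thesis by (rule minimal_brick[OF assms(1,2) NT H(3)]) (rule that)
qed

section \<open>The torsion classes generated by a brick and left perpendicular to it\<close>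

lemma rperp_perp_disjoint: "X \<in> perp R \<S> \<Longrightarrow> X \<in> \<S> \<Longrightarrow> \<not> nonzero X"
  by (auto simp: perp_def no_hom_self)

lemma torsion_rperp_disjoint: "X \<in> T \<Longrightarrow> X \<in> rperp R T \<Longrightarrow> \<not> nonzero X"
  by (auto simp: rperp_def no_hom_self)

text \<open>The smallest torsion class containing \<open>S\<close>; as a double perpendicular it
  needs no filtrations by quotients of \<open>S\<close>.\<close>

definition gen_tors :: "('a, 'x) ring_scheme \<Rightarrow> ('a, 'a list) module \<Rightarrow> ('a, 'a list) module set" where
  "gen_tors R S = perp R (rperp R {S})"

lemma rperp_fgmod: "rperp R \<T> \<subseteq> fgmod R"
  by (auto simp: rperp_def)

lemma rperp_mono: "\<T> \<subseteq> \<T>' \<Longrightarrow> rperp R \<T>' \<subseteq> rperp R \<T>"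
  by (auto simp: rperp_def)

lemma perp_mono: "\<S> \<subseteq> \<S>' \<Longrightarrow> perp R \<S>' \<subseteq> perp R \<S>"
  by (auto simp: perp_def)

lemma artin_ring: "artin R \<Longrightarrow> ring R"
  by (simp add: artin_def)

lemma gen_tors:
  assumes "artin R" "S \<in> fgmod R"
  shows "torsion_class R (gen_tors R S)" "S \<in> gen_tors R S"
    "\<And>T. torsion_class R T \<Longrightarrow> S \<in> T \<Longrightarrow> gen_tors R S \<subseteq> T"
proof -
  show "torsion_class R (gen_tors R S)" unfolding gen_tors_def
    by (rule torsion_perp[OF artin_ring[OF assms(1)] rperp_fgmod])
  show "S \<in> gen_tors R S" using assms(2) by (auto simp: gen_tors_def perp_def rperp_def)
  fix T assume T: "torsion_class R T" "S \<in> T"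
  have "perp R (rperp R {S}) \<subseteq> perp R (rperp R T)" using T(2) by (intro perp_mono rperp_mono) simp
  then show "gen_tors R S \<subseteq> T" using perp_rperp[OF assms(1) T(1)] by (simp add: gen_tors_def)
qed

text \<open>Otherwise \<open>X\<close> would be right perpendicular to \<open>S\<close>, while it is
  left perpendicular to all such modules and in particular to itself.\<close>

lemma gen_tors_hom:
  assumes "S \<in> fgmod R" "X \<in> gen_tors R S" "nonzero X"
  shows "\<not> no_hom R S X"
proof
  assume "no_hom R S X"
  then have "X \<in> rperp R {S}" using assms(2) by (auto simp: gen_tors_def perp_def rperp_def)
  then show False using rperp_perp_disjoint assms(2,3) unfolding gen_tors_def by blast
qed

text \<open>A nonzero submodule in the class generated by \<open>S\<close> receives a nonzero map
  from \<open>S\<close>; followed by the inclusion it is a nonzero endomorphism, hence onto.\<close>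

lemma brick_no_proper_sub:
  assumes "artin R" "brick R S" "submodule I R S" "nonzero (S\<lparr>carrier := I\<rparr>)" "S\<lparr>carrier := I\<rparr> \<in> gen_tors R S"
  shows "I = carrier S"
proof -
  have I: "I \<subseteq> carrier S" using assms(3) by (simp add: submodule_iff[OF brickD(2)[OF assms(2)]])
  obtain g x where g: "lin R S (S\<lparr>carrier := I\<rparr>) g" "x \<in> carrier S" "g x \<noteq> \<zero>\<^bsub>S\<lparr>carrier := I\<rparr>\<^esub>"
    using gen_tors_hom[OF brickD(1)[OF assms(2)] assms(5,4)] by (rule not_no_hom_E)
  have "lin R S S g" using g(1) I by (auto simp: lin_def)
  then have "bij_betw g (carrier S) (carrier S)" using brickD(4)[OF assms(2), of g x] g by simp
  moreover have "g ` carrier S \<subseteq> I" using lin_closed[OF g(1)] by auto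
  ultimately show ?thesis using I by (auto simp: bij_betw_def)
qed

lemma brick_range_surj:
  assumes "artin R" "brick R S" "torsion_class R T" "T \<subseteq> gen_tors R S" "X \<in> T"
    "lin R X S f" "x \<in> carrier X" "f x \<noteq> \<zero>\<^bsub>S\<^esub>"
  shows "f ` carrier X = carrier S"
proof (rule brick_no_proper_sub[OF assms(1,2)])
  show "submodule (f ` carrier X) R S"
    by (rule submodule_range[OF fgmodD(1)[OF torsion_fgmod[OF assms(3,5)]] brickD(2)[OF assms(2)] assms(6)])
  show "nonzero (S\<lparr>carrier := f ` carrier X\<rparr>)" using assms(7,8) by (auto simp: nonzero_def)
  show "S\<lparr>carrier := f ` carrier X\<rparr> \<in> gen_tors R S"
    using torsion_range[OF assms(1,3,5) brickD(1)[OF assms(2)] assms(6)] assms(4) by blast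
qed

text \<open>A nonzero map to \<open>S\<close> from a member of \<open>T\<close> would be onto and
  put \<open>S\<close> into \<open>T\<close>. Consequently all torsion classes strictly below
  \<open>gen_tors R S\<close> lie in \<open>perp R {S}\<close>, which is the reason for join
  irreducibility.\<close>

lemma below_gen_tors:
  assumes "artin R" "brick R S" "torsion_class R T" "T \<subseteq> gen_tors R S" "S \<notin> T"
  shows "T \<subseteq> perp R {S}"
proof
  fix X assume X: "X \<in> T"
  have "no_hom R X S"
  proof (rule ccontr)
    assume "\<not> no_hom R X S"
    then obtain f x where f: "lin R X S f" "x \<in> carrier X" "f x \<noteq> \<zero>\<^bsub>S\<^esub>" by (rule not_no_hom_E)
    then show False
      using assms(5) torsion_quot[OF assms(3) X brickD(1)[OF assms(2)] f(1)] brick_range_surj[OF assms(1-4) X f] by blast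
  qed
  then show "X \<in> perp R {S}" using torsion_fgmod[OF assms(3) X] by (simp add: perp_def)
qed

text \<open>The counterpart for meet irreducibility. The torsion-free quotient \<open>N\<close> of
  \<open>S\<close> admits no nonzero map back to \<open>S\<close>, since the composite endomorphism
  would be bijective although it kills the image of \<open>f\<close>; so \<open>N\<close> lies in
  \<open>perp R {S}\<close>, hence in \<open>T\<close>, and is zero.\<close>

lemma above_perp:
  assumes "artin R" "brick R S" "torsion_class R T" "perp R {S} \<subseteq> T" "T \<noteq> perp R {S}"
  shows "S \<in> T"
proof -
  note S = brickD[OF assms(2)]
  obtain X where X: "X \<in> T" "X \<notin> perp R {S}" using assms(4,5) by blast
  then have "\<not> no_hom R X S" using torsion_fgmod[OF assms(3)] by (auto simp: perp_def)
  then obtain f x where f: "lin R X S f" "x \<in> carrier X" "f x \<noteq> \<zero>\<^bsub>S\<^esub>" by (rule not_no_hom_E)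
  obtain H N q where H: "submodule H R S" "S\<lparr>carrier := H\<rparr> \<in> T" "N \<in> rperp R T"
    "lin R S N q" "q ` carrier S = carrier N" and ker: "\<forall>x\<in>carrier S. q x = \<zero>\<^bsub>N\<^esub> \<longleftrightarrow> x \<in> H"
    by (rule torsion_part[OF assms(1,3) S(1)]) (rule that)
  have N: "N \<in> fgmod R" "left_module R N" using H(3) by (auto simp: rperp_def fgmod_def)
  have qf: "q (f x) = \<zero>\<^bsub>N\<^esub>"
    using no_hom_D[OF _ lin_comp[OF f(1) H(4)] f(2)] H(3) X(1) by (simp add: rperp_def)
  have "\<not> nonzero N"
  proof
    assume nz: "nonzero N"
    have "\<not> no_hom R N S"
    proof
      assume "no_hom R N S"
      then have "N \<in> T" using N assms(4) by (auto simp: perp_def)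
      then show False using torsion_rperp_disjoint H(3) nz by blast
    qed
    then obtain g y where g: "lin R N S g" "y \<in> carrier N" "g y \<noteq> \<zero>\<^bsub>S\<^esub>" by (rule not_no_hom_E)
    have "y \<in> q ` carrier S" using g(2) H(5) by simp
    then obtain z where z: "z \<in> carrier S" "y = q z" by (elim imageE)
    have "bij_betw (\<lambda>x. g (q x)) (carrier S) (carrier S)"
      using S(4)[OF lin_comp[OF H(4) g(1)] z(1)] g(3) z(2) by simp
    moreover have "g (q (f x)) = \<zero>\<^bsub>S\<^esub>" using qf lin_zero[OF N(2) S(2) g(1)] by simp
    ultimately show False
      using f(3) lin_closed[OF f(1,2)] lin_inj_iff[OF S(2,2) lin_comp[OF H(4) g(1)]] by (auto simp: bij_betw_def)
  qed
  then have "carrier S \<subseteq> H" using ker lin_closed[OF H(4)] by (auto simp: nonzero_def)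
  then have "H = carrier S" using H(1) by (auto simp: submodule_iff[OF S(2)])
  then show ?thesis using H(2) by simp
qed

lemma brick_not_in_perp: "brick R S \<Longrightarrow> S \<notin> perp R {S}"
  using rperp_perp_disjoint brickD(3) by blast

text \<open>Nonzero maps exist in both directions and are onto, so finite length makes them
  bijective.\<close>

lemma gen_tors_eq_imp_iso:
  assumes "artin R" "brick R S" "brick R S'" "gen_tors R S = gen_tors R S'"
  shows "mod_iso R S S'"
proof -
  have ex: "\<exists>f. lin R S S' f \<and> f ` carrier S = carrier S'"
    if "brick R S" "brick R S'" "gen_tors R S = gen_tors R S'" for S S'
  proof -
    note S = brickD[OF that(1)] and S' = brickD[OF that(2)]
    have "S' \<in> gen_tors R S" using gen_tors(2)[OF assms(1) S'(1)] that(3) by simp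
    then obtain f x where f: "lin R S S' f" "x \<in> carrier S" "f x \<noteq> \<zero>\<^bsub>S'\<^esub>"
      using gen_tors_hom[OF S(1) _ S'(3)] not_no_hom_E by metis
    have "f ` carrier S = carrier S'"
      using brick_range_surj[OF assms(1) that(2) gen_tors(1)[OF assms(1) S(1)] _ gen_tors(2)[OF assms(1) S(1)] f]
      by (simp add: that(3))
    then show ?thesis using f(1) by blast
  qed
  obtain f where f: "lin R S S' f" "f ` carrier S = carrier S'" using ex[OF assms(2-4)] by blast
  obtain g where g: "lin R S' S g" "g ` carrier S' = carrier S" using ex[OF assms(3,2) assms(4)[symmetric]] by blast
  note S = brickD[OF assms(2)]
  have "(\<lambda>x. g (f x)) ` carrier S = carrier S" using f(2) g(2) by (metis image_image)
  moreover have "FL R S" using assms(1) S(1) by (simp add: artin_def)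
  ultimately have "bij_betw (\<lambda>x. g (f x)) (carrier S) (carrier S)"
    by (intro FL_surj_bij[OF S(2) _ lin_comp[OF f(1) g(1)]])
  then have "inj_on f (carrier S)" by (auto simp: bij_betw_def inj_on_def)
  then show ?thesis using f by (auto simp: mod_iso_iff[OF S(2)] bij_betw_def)
qed

text \<open>Nonzero maps that are injective exist in both directions; their composite is a nonzero
  endomorphism of a brick, hence bijective.\<close>

lemma perp_eq_imp_iso:
  assumes "artin R" "brick R S" "brick R S'" "perp R {S} = perp R {S'}"
  shows "mod_iso R S S'"
proof -
  have ex: "\<exists>f. lin R S S' f \<and> inj_on f (carrier S)"
    if "brick R S" "brick R S'" "perp R {S} = perp R {S'}" for S S'
  proof -
    note S = brickD[OF that(1)] and S' = brickD[OF that(2)]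
    have "\<not> no_hom R S S'" using brick_not_in_perp[OF that(1)] S(1) that(3) by (auto simp: perp_def)
    then obtain f x where f: "lin R S S' f" "x \<in> carrier S" "f x \<noteq> \<zero>\<^bsub>S'\<^esub>" by (rule not_no_hom_E)
    let ?K = "{x \<in> carrier S. f x = \<zero>\<^bsub>S'\<^esub>}"
    have K: "submodule ?K R S" by (rule submodule_ker[OF S(2) S'(2) f(1)])
    obtain N q where q: "N \<in> fgmod R" "lin R S N q" "q ` carrier S = carrier N"
      and ker: "\<forall>x\<in>carrier S. q x = \<zero>\<^bsub>N\<^esub> \<longleftrightarrow> x \<in> ?K"
      by (rule fgmod_quotient[OF S(1) K]) (rule that)
    have N: "left_module R N" using q(1) by (rule fgmodD)
    obtain k where k: "lin R N S' k" "\<forall>x\<in>carrier S. k (q x) = f x"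
      by (rule lin_factor[OF S(2) N S'(2) q(2,3) f(1)]) (use ker that in auto)
    have "x = \<zero>\<^bsub>N\<^esub>" if "x \<in> carrier N" "k x = \<zero>\<^bsub>S'\<^esub>" for x
    proof -
      have "x \<in> q ` carrier S" using that q(3) by simp
      then obtain y where "y \<in> carrier S" "x = q y" by (elim imageE)
      then show ?thesis using k(2) ker that by simp
    qed
    then have ki: "inj_on k (carrier N)" by (simp add: lin_inj_iff[OF N S'(2) k(1)])
    have nz: "nonzero N" using f(2,3) ker lin_closed[OF q(2) f(2)] by (auto simp: nonzero_def intro!: bexI[of _ "q x"])
    \<comment> \<open>\<open>N\<close> is the image of \<open>f\<close>, embedded in
      \<open>S'\<close>; without maps to \<open>S\<close> it would lie in
      \<open>perp R {S'}\<close>, against this embedding.\<close>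
    have "\<not> no_hom R N S"
    proof
      assume "no_hom R N S"
      then have "N \<in> perp R {S'}" using q(1) that(3) by (auto simp: perp_def)
      then have "no_hom R N N" using no_hom_inj[OF N S'(2) k(1) ki, of N] by (simp add: perp_def)
      then show False using nz no_hom_self by blast
    qed
    then obtain g y where g: "lin R N S g" "y \<in> carrier N" "g y \<noteq> \<zero>\<^bsub>S\<^esub>" by (rule not_no_hom_E)
    have "y \<in> q ` carrier S" using g(2) q(3) by simp
    then obtain z where z: "z \<in> carrier S" "y = q z" by (elim imageE)
    have "bij_betw (\<lambda>x. g (q x)) (carrier S) (carrier S)"
      using S(4)[OF lin_comp[OF q(2) g(1)] z(1)] g(3) z(2) by simp
    then have "inj_on q (carrier S)" by (auto simp: bij_betw_def inj_on_def)
    then have "inj_on f (carrier S)"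
      using ker by (simp add: lin_inj_iff[OF S(2) S'(2) f(1)] lin_inj_iff[OF S(2) N q(2)])
    then show ?thesis using f(1) by blast
  qed
  obtain f where f: "lin R S S' f" "inj_on f (carrier S)" using ex[OF assms(2-4)] by blast
  obtain g where g: "lin R S' S g" "inj_on g (carrier S')" using ex[OF assms(3,2) assms(4)[symmetric]] by blast
  note S = brickD[OF assms(2)] and S' = brickD[OF assms(3)]
  obtain x where x: "x \<in> carrier S" "x \<noteq> \<zero>\<^bsub>S\<^esub>" using S(3) by (auto simp: nonzero_def)
  then have "f x \<noteq> \<zero>\<^bsub>S'\<^esub>" using f lin_inj_iff[OF S(2) S'(2) f(1)] by auto
  then have "g (f x) \<noteq> \<zero>\<^bsub>S\<^esub>" using g lin_inj_iff[OF S'(2) S(2) g(1)] lin_closed[OF f(1) x(1)] by auto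
  then have "bij_betw (\<lambda>x. g (f x)) (carrier S) (carrier S)"
    using S(4)[OF lin_comp[OF f(1) g(1)] x(1)] by simp
  then have gf: "(\<lambda>x. g (f x)) ` carrier S = carrier S" by (simp add: bij_betw_def)
  have "carrier S \<subseteq> g ` carrier S'"
  proof
    fix z assume "z \<in> carrier S"
    then have "z \<in> (\<lambda>x. g (f x)) ` carrier S" using gf by simp
    then obtain y where "y \<in> carrier S" "z = g (f y)" by (elim imageE)
    then show "z \<in> g ` carrier S'" using lin_closed[OF f(1)] by simp
  qed
  then have "bij_betw g (carrier S') (carrier S)" using g lin_closed[OF g(1)] by (auto simp: bij_betw_def)
  then have "mod_iso R S' S" using g(1) by (auto simp: mod_iso_iff[OF S'(2)])
  then show ?thesis by (rule mod_iso_sym[OF S'(2) S(2)])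
qed

lemma iso_imp_gen_tors_eq:
  assumes "artin R" "brick R S" "brick R S'" "mod_iso R S S'"
  shows "gen_tors R S = gen_tors R S'"
proof -
  note S = brickD[OF assms(2)] and S' = brickD[OF assms(3)]
  have "S' \<in> gen_tors R S" using torsion_iso[OF gen_tors(1,2)[OF assms(1) S(1)] S'(1) assms(4)] .
  moreover have "S \<in> gen_tors R S'"
    using torsion_iso[OF gen_tors(1,2)[OF assms(1) S'(1)] S(1) mod_iso_sym[OF S(2) S'(2) assms(4)]] .
  ultimately show ?thesis using gen_tors(1,3)[OF assms(1)] S(1) S'(1) by blast
qed

lemma iso_imp_perp_eq:
  assumes "artin R" "brick R S" "brick R S'" "mod_iso R S S'"
  shows "perp R {S} = perp R {S'}"
  using no_hom_iso[OF _ _ brickD(2)[OF assms(2)] brickD(2)[OF assms(3)] mod_iso_refl assms(4)]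
  by (auto simp: perp_def fgmod_def)

text \<open>Any two labels of a cover have nonzero maps to each other, for otherwise a left
  perpendicular class cuts strictly in between. A nonzero map to a label that is minimal as a
  submodule is onto; with a map back the composite is a bijective endomorphism, so it is also
  injective.\<close>

lemma cover_brick_unique:
  assumes "artin R" "torsion_class R T" "torsion_class R T'" "T \<subseteq> T'"
    and cover: "\<And>Z. torsion_class R Z \<Longrightarrow> T \<subseteq> Z \<Longrightarrow> Z \<subseteq> T' \<Longrightarrow> Z = T \<or> Z = T'"
    and S: "brick R S" "S \<in> T'" "S \<in> rperp R T" and S': "brick R S'" "S' \<in> T'" "S' \<in> rperp R T"
  shows "mod_iso R S S'"
proof -
  obtain H where H: "submodule H R S" "brick R (S\<lparr>carrier := H\<rparr>)" "S\<lparr>carrier := H\<rparr> \<in> T'"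
    "S\<lparr>carrier := H\<rparr> \<in> rperp R T" and
    min: "\<forall>H'. submodule H' R S \<longrightarrow> H' \<subseteq> H \<longrightarrow> S\<lparr>carrier := H'\<rparr> \<in> T' \<longrightarrow>
      nonzero (S\<lparr>carrier := H'\<rparr>) \<longrightarrow> H' = H"
    by (rule minimal_brick[OF assms(1,3) S(2,3) brickD(3)[OF S(1)]]) (rule that)
  let ?S0 = "S\<lparr>carrier := H\<rparr>"
  have hom: "\<not> no_hom R X Y" if "brick R X" "X \<in> T'" "X \<in> rperp R T" "brick R Y" "Y \<in> T'" "Y \<in> rperp R T" for X Y
  proof
    assume "no_hom R X Y"
    then have XP: "X \<in> T' \<inter> perp R {Y}" using that by (auto simp: perp_def brickD(1))
    have t: "torsion_class R (T' \<inter> perp R {Y})"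
      using torsion_Int[OF artin_ring[OF assms(1)] assms(3) torsion_perp[OF artin_ring[OF assms(1)]]]
        brickD(1)[OF that(4)] by simp
    moreover have "T \<subseteq> T' \<inter> perp R {Y}"
      using assms(4) that(6) torsion_fgmod[OF assms(2)] by (auto simp: perp_def rperp_def)
    ultimately have "T' \<inter> perp R {Y} = T \<or> T' \<inter> perp R {Y} = T'" using cover by blast
    then show False
      using XP that torsion_rperp_disjoint[of X T R] brick_not_in_perp[of R Y] brickD(3)[of R X] by blast
  qed
  have iso: "mod_iso R X ?S0" if X: "brick R X" "X \<in> T'" "X \<in> rperp R T" for X
  proof -
    obtain h x where h: "lin R X ?S0 h" "x \<in> carrier X" "h x \<noteq> \<zero>\<^bsub>?S0\<^esub>"
      using hom[OF X H(2-4)] by (rule not_no_hom_E)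
    obtain g y where g: "lin R ?S0 X g" "y \<in> carrier ?S0" "g y \<noteq> \<zero>\<^bsub>X\<^esub>"
      using hom[OF H(2-4) X] by (rule not_no_hom_E)
    have "submodule (h ` carrier X) R ?S0" by (rule submodule_range[OF brickD(2)[OF X(1)] brickD(2)[OF H(2)] h(1)])
    then have I: "submodule (h ` carrier X) R S" "h ` carrier X \<subseteq> H"
      by (simp_all add: submodule_sub_iff[OF brickD(2)[OF S(1)] H(1)])
    have "S\<lparr>carrier := h ` carrier X\<rparr> \<in> T'" using torsion_range[OF assms(1,3) X(2) brickD(1)[OF H(2)] h(1)] by simp
    moreover have "nonzero (S\<lparr>carrier := h ` carrier X\<rparr>)" using h by (auto simp: nonzero_def)
    ultimately have hs: "h ` carrier X = H" using min[rule_format, OF I] by simp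
    then have "y \<in> h ` carrier X" using g(2) by simp
    then obtain z where z: "z \<in> carrier X" "y = h z" by (elim imageE)
    have "bij_betw (\<lambda>x. g (h x)) (carrier X) (carrier X)"
      using brickD(4)[OF X(1) lin_comp[OF h(1) g(1)] z(1)] g(3) z(2) by simp
    then have "inj_on h (carrier X)" by (auto simp: bij_betw_def inj_on_def)
    then show ?thesis using h(1) hs by (auto simp: mod_iso_iff[OF brickD(2)[OF X(1)]] bij_betw_def)
  qed
  show ?thesis
    using mod_iso_trans[OF brickD(2)[OF S(1)] brickD(2)[OF H(2)] iso[OF S]
        mod_iso_sym[OF brickD(2)[OF S'(1)] brickD(2)[OF H(2)] iso[OF S']]] .
qed

section \<open>The lattice of torsion classes\<close>

lemma tors_simps [simp]:
  "carrier (tors R) = {T. torsion_class R T}" "T \<sqsubseteq>\<^bsub>tors R\<^esub> T' \<longleftrightarrow> T \<subseteq> T'"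
  "T .=\<^bsub>tors R\<^esub> T' \<longleftrightarrow> T = T'" "T \<sqsubset>\<^bsub>tors R\<^esub> T' \<longleftrightarrow> T \<subset> T'"
  by (auto simp: tors_def lless_def)

lemma tors_partial_order: "partial_order (tors R)"
  by unfold_locales (auto simp: fun_eq_iff)

text \<open>The join as a double perpendicular, which spares closing the union under quotients and
  extensions.\<close>

definition tjoin :: "('a, 'x) ring_scheme \<Rightarrow> ('a, 'a list) module set \<Rightarrow> ('a, 'a list) module set \<Rightarrow>
    ('a, 'a list) module set" where
  "tjoin R T T' = perp R (rperp R (T \<union> T'))"

lemma tjoin:
  assumes "artin R" "torsion_class R T" "torsion_class R T'"
  shows "torsion_class R (tjoin R T T')" "T \<subseteq> tjoin R T T'" "T' \<subseteq> tjoin R T T'"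
    "\<And>Z. torsion_class R Z \<Longrightarrow> T \<subseteq> Z \<Longrightarrow> T' \<subseteq> Z \<Longrightarrow> tjoin R T T' \<subseteq> Z"
proof -
  show "torsion_class R (tjoin R T T')" unfolding tjoin_def
    by (rule torsion_perp[OF artin_ring[OF assms(1)] rperp_fgmod])
  show "T \<subseteq> tjoin R T T'" "T' \<subseteq> tjoin R T T'"
    using torsion_classD(1)[OF assms(2)] torsion_classD(1)[OF assms(3)]
    by (auto simp: tjoin_def perp_def rperp_def)
  fix Z assume Z: "torsion_class R Z" "T \<subseteq> Z" "T' \<subseteq> Z"
  then have "perp R (rperp R (T \<union> T')) \<subseteq> perp R (rperp R Z)" by (intro perp_mono rperp_mono) simp
  then show "tjoin R T T' \<subseteq> Z" using perp_rperp[OF assms(1) Z(1)] by (simp add: tjoin_def)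
qed

lemma least_Upper_tors:
  assumes "artin R" "torsion_class R T" "torsion_class R T'"
  shows "least (tors R) Z (Upper (tors R) {T, T'}) \<longleftrightarrow> Z = tjoin R T T'"
proof -
  have U: "Upper (tors R) {T, T'} = {Z. torsion_class R Z \<and> T \<subseteq> Z \<and> T' \<subseteq> Z}"
    using assms(2,3) by (auto simp: Upper_def)
  have l: "least (tors R) Z {Z. torsion_class R Z \<and> T \<subseteq> Z \<and> T' \<subseteq> Z} \<longleftrightarrow>
      torsion_class R Z \<and> T \<subseteq> Z \<and> T' \<subseteq> Z \<and> (\<forall>W. torsion_class R W \<and> T \<subseteq> W \<and> T' \<subseteq> W \<longrightarrow> Z \<subseteq> W)" for Z
    by (auto simp: least_def)
  show ?thesis unfolding U l
  proof
    assume "Z = tjoin R T T'"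
    then show "torsion_class R Z \<and> T \<subseteq> Z \<and> T' \<subseteq> Z \<and> (\<forall>W. torsion_class R W \<and> T \<subseteq> W \<and> T' \<subseteq> W \<longrightarrow> Z \<subseteq> W)"
      using tjoin(1-3)[OF assms] tjoin(4)[OF assms] by simp
  next
    assume Z: "torsion_class R Z \<and> T \<subseteq> Z \<and> T' \<subseteq> Z \<and> (\<forall>W. torsion_class R W \<and> T \<subseteq> W \<and> T' \<subseteq> W \<longrightarrow> Z \<subseteq> W)"
    then have "tjoin R T T' \<subseteq> Z" by (intro tjoin(4)[OF assms]) simp_all
    moreover have "Z \<subseteq> tjoin R T T'" using Z tjoin(1-3)[OF assms] by simp
    ultimately show "Z = tjoin R T T'" by (rule subset_antisym[rotated])
  qed
qed

lemma greatest_Lower_tors: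
  assumes "artin R" "torsion_class R T" "torsion_class R T'"
  shows "greatest (tors R) Z (Lower (tors R) {T, T'}) \<longleftrightarrow> Z = T \<inter> T'"
proof -
  have L: "Lower (tors R) {T, T'} = {Z. torsion_class R Z \<and> Z \<subseteq> T \<and> Z \<subseteq> T'}"
    using assms(2,3) by (auto simp: Lower_def)
  have l: "greatest (tors R) Z {Z. torsion_class R Z \<and> Z \<subseteq> T \<and> Z \<subseteq> T'} \<longleftrightarrow>
      torsion_class R Z \<and> Z \<subseteq> T \<and> Z \<subseteq> T' \<and> (\<forall>W. torsion_class R W \<and> W \<subseteq> T \<and> W \<subseteq> T' \<longrightarrow> W \<subseteq> Z)" for Z
    by (auto simp: greatest_def)
  have t: "torsion_class R (T \<inter> T')" by (rule torsion_Int[OF artin_ring[OF assms(1)] assms(2,3)])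
  show ?thesis unfolding L l
  proof
    assume "Z = T \<inter> T'"
    then show "torsion_class R Z \<and> Z \<subseteq> T \<and> Z \<subseteq> T' \<and> (\<forall>W. torsion_class R W \<and> W \<subseteq> T \<and> W \<subseteq> T' \<longrightarrow> W \<subseteq> Z)"
      using t by simp
  next
    assume Z: "torsion_class R Z \<and> Z \<subseteq> T \<and> Z \<subseteq> T' \<and> (\<forall>W. torsion_class R W \<and> W \<subseteq> T \<and> W \<subseteq> T' \<longrightarrow> W \<subseteq> Z)"
    then have "T \<inter> T' \<subseteq> Z" using t by simp
    then show "Z = T \<inter> T'" using Z by (simp add: subset_antisym)
  qed
qed

lemma bot_tors:
  assumes "artin R"
  shows "torsion_class R (perp R (fgmod R))" "\<And>T. torsion_class R T \<Longrightarrow> perp R (fgmod R) \<subseteq> T"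
proof -
  show "torsion_class R (perp R (fgmod R))" by (rule torsion_perp[OF artin_ring[OF assms]]) simp
  fix T assume "torsion_class R T"
  then show "perp R (fgmod R) \<subseteq> T" using rperp_perp_disjoint[of _ R "fgmod R"] torsion_zero[of R T]
    by (auto simp: perp_def)
qed

lemma tors_bounded_lattice:
  assumes "artin R"
  shows "bounded_lattice (tors R)"
proof -
  interpret partial_order "tors R" by (rule tors_partial_order)
  show ?thesis
  proof unfold_locales
    fix x y assume "x \<in> carrier (tors R)" "y \<in> carrier (tors R)"
    then show "\<exists>s. least (tors R) s (Upper (tors R) {x, y})" "\<exists>s. greatest (tors R) s (Lower (tors R) {x, y})"
      by (auto simp: least_Upper_tors[OF assms] greatest_Lower_tors[OF assms])
  next
    show "\<exists>x. least (tors R) x (carrier (tors R))"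
      using bot_tors[OF assms] by (auto simp: least_def)
    show "\<exists>x. greatest (tors R) x (carrier (tors R))"
      by (rule exI[of _ "fgmod R"]) (simp add: greatest_def torsion_all[OF artin_ring[OF assms]] torsion_classD(1))
  qed
qed

lemma tors_ops:
  assumes "artin R" "torsion_class R T" "torsion_class R T'"
  shows "T \<squnion>\<^bsub>tors R\<^esub> T' = tjoin R T T'" "T \<sqinter>\<^bsub>tors R\<^esub> T' = T \<inter> T'"
  by (simp_all add: join_def meet_def sup_def inf_def least_Upper_tors[OF assms] greatest_Lower_tors[OF assms])

lemma tors_bounds:
  assumes "artin R"
  shows "\<bottom>\<^bsub>tors R\<^esub> = perp R (fgmod R)" "\<top>\<^bsub>tors R\<^esub> = fgmod R"
proof -
  interpret bounded_lattice "tors R" by (rule tors_bounded_lattice[OF assms])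
  have "perp R (fgmod R) = \<bottom>\<^bsub>tors R\<^esub>" by (rule bottom_eq) (simp_all add: bot_tors[OF assms])
  then show "\<bottom>\<^bsub>tors R\<^esub> = perp R (fgmod R)" by simp
  have "fgmod R = \<top>\<^bsub>tors R\<^esub>"
    by (rule top_eq) (simp_all add: torsion_all[OF artin_ring[OF assms]] torsion_classD(1))
  then show "\<top>\<^bsub>tors R\<^esub> = fgmod R" by simp
qed

section \<open>Isomorphism classes of bricks and irreducible elements\<close>

definition brick_class :: "('a, 'x) ring_scheme \<Rightarrow> ('a, 'a list) module \<Rightarrow> ('a, 'a list) module set" where
  "brick_class R S = {S'. brick R S' \<and> mod_iso R S S'}"

definition brick_classes :: "('a, 'x) ring_scheme \<Rightarrow> ('a, 'a list) module set set" where
  "brick_classes R = brick_class R ` {S. brick R S}"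

lemma brick_class_eq_iff:
  assumes "brick R S" "brick R S'"
  shows "brick_class R S = brick_class R S' \<longleftrightarrow> mod_iso R S S'"
proof
  assume "brick_class R S = brick_class R S'"
  then have "S' \<in> brick_class R S" using assms mod_iso_refl[OF brickD(2)[OF assms(2)]] by (simp add: brick_class_def)
  then show "mod_iso R S S'" by (simp add: brick_class_def)
next
  note lm = brickD(2)[OF assms(1)] brickD(2)[OF assms(2)]
  assume iso: "mod_iso R S S'"
  show "brick_class R S = brick_class R S'"
    using mod_iso_trans[OF lm iso] mod_iso_trans[OF lm(2,1) mod_iso_sym[OF lm iso]] by (auto simp: brick_class_def)
qed

lemma brick_finite_iff: "brick_finite R \<longleftrightarrow> finite (brick_classes R)"
proof -
  have "{M. brick R M} // {(M, N). brick R M \<and> brick R N \<and> mod_iso R M N} = brick_classes R"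
    by (auto simp: quotient_def brick_classes_def brick_class_def)
  then show ?thesis by (simp add: brick_finite_def)
qed

text \<open>A torsion class is determined by the bricks in it, by
  \<open>brick_between\<close>.\<close>

lemma finite_tors:
  assumes "artin R" "brick_finite R"
  shows "finite {T. torsion_class R T}"
proof -
  let ?g = "\<lambda>T. brick_class R ` {S. brick R S \<and> S \<in> T}"
  have sub: "T \<subseteq> T'" if T: "torsion_class R T" "torsion_class R T'" and g: "?g T \<subseteq> ?g T'" for T T'
  proof (rule ccontr)
    assume "\<not> T \<subseteq> T'"
    then obtain S where S: "brick R S" "S \<in> T" "S \<in> rperp R T'" by (rule brick_between[OF assms(1) T])
    then have "brick_class R S \<in> ?g T" by simp
    then have "brick_class R S \<in> ?g T'" using g by (rule subsetD[rotated])
    then obtain S' where S': "brick R S'" "S' \<in> T'" "brick_class R S' = brick_class R S" by auto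
    then have "S \<in> T'" using torsion_iso[OF T(2) S'(2) brickD(1)[OF S(1)]] by (simp add: brick_class_eq_iff S)
    then show False using torsion_rperp_disjoint S(3) brickD(3)[OF S(1)] by blast
  qed
  have "inj_on ?g {T. torsion_class R T}"
  proof (rule inj_onI)
    fix T T' assume "T \<in> {T. torsion_class R T}" "T' \<in> {T. torsion_class R T}" "?g T = ?g T'"
    then show "T = T'" using sub[of T T'] sub[of T' T] by simp
  qed
  moreover have "?g ` {T. torsion_class R T} \<subseteq> Pow (brick_classes R)" by (auto simp: brick_classes_def)
  moreover have "finite (Pow (brick_classes R))" using assms(2) by (simp add: brick_finite_iff)
  ultimately show ?thesis by (rule inj_on_finite)
qed

lemma tors_finite_lattice:
  assumes "artin R" "brick_finite R"
  shows "finite_lattice (tors R)"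
  by (intro finite_lattice.intro finite_lattice_axioms.intro tors_bounded_lattice[OF assms(1)])
    (simp add: finite_tors[OF assms])

text \<open>For a maximal proper subclass \<open>Y\<close> of \<open>T\<close> with label
  \<open>S\<close>, \<open>T\<close> is the join of \<open>Y\<close> and
  \<open>gen_tors R S\<close>, so irreducibility gives the latter. Conversely, the classes strictly
  below \<open>gen_tors R S\<close> all lie in \<open>perp R {S}\<close>, and so do their
  joins.\<close>

lemma join_irreducible_tors_iff:
  assumes "artin R" "brick_finite R"
  shows "join_irreducible (tors R) T \<longleftrightarrow> (\<exists>S. brick R S \<and> T = gen_tors R S)"
proof
  assume ji: "join_irreducible (tors R) T"
  then have T: "torsion_class R T" "T \<noteq> perp R (fgmod R)"
    and irr: "\<And>Y Z. torsion_class R Y \<Longrightarrow> torsion_class R Z \<Longrightarrow> T = tjoin R Y Z \<Longrightarrow> T = Y \<or> T = Z"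
    by (auto simp: join_irreducible_def tors_bounds[OF assms(1)] tors_ops[OF assms(1)])
  let ?B = "{Y. torsion_class R Y \<and> Y \<subset> T}"
  have "finite ?B" using finite_tors[OF assms] by (rule rev_finite_subset) auto
  moreover have "perp R (fgmod R) \<in> ?B" using bot_tors[OF assms(1)] T by auto
  ultimately obtain Y where Y: "Y \<in> ?B" "\<forall>Z\<in>?B. Y \<subseteq> Z \<longrightarrow> Y = Z"
    using finite_has_maximal[of ?B] by blast
  then obtain S where S: "brick R S" "S \<in> T" "S \<in> rperp R Y"
    using brick_between[OF assms(1) T(1), of Y] by auto
  note g = gen_tors[OF assms(1) brickD(1)[OF S(1)]]
  have Yt: "torsion_class R Y" "Y \<subset> T" using Y by auto
  note j = tjoin[OF assms(1) Yt(1) g(1)]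
  have "tjoin R Y (gen_tors R S) \<subseteq> T" using j(4)[OF T(1)] g(3)[OF T(1) S(2)] Yt(2) by blast
  moreover have "tjoin R Y (gen_tors R S) \<noteq> Y"
    using j(3) g(2) torsion_rperp_disjoint S(3) brickD(3)[OF S(1)] by blast
  ultimately have "tjoin R Y (gen_tors R S) = T" using Y(2) j(1,2) by blast
  then have "T = Y \<or> T = gen_tors R S" using irr[OF Yt(1) g(1)] by simp
  then show "\<exists>S. brick R S \<and> T = gen_tors R S" using Yt(2) S(1) by blast
next
  assume "\<exists>S. brick R S \<and> T = gen_tors R S"
  then obtain S where S: "brick R S" "T = gen_tors R S" by blast
  note g = gen_tors[OF assms(1) brickD(1)[OF S(1)]]
  have P: "torsion_class R (perp R {S})"
    using torsion_perp[OF artin_ring[OF assms(1)], of "{S}"] brickD(1)[OF S(1)] by simp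
  have "T \<noteq> perp R (fgmod R)"
    using g(2) rperp_perp_disjoint brickD(1,3)[OF S(1)] unfolding S(2) by blast
  moreover have "T = Y \<or> T = Z" if YZ: "torsion_class R Y" "torsion_class R Z" "T = tjoin R Y Z" for Y Z
  proof (rule ccontr)
    assume n: "\<not> (T = Y \<or> T = Z)"
    note j = tjoin[OF assms(1) YZ(1,2)]
    have le: "Y \<subseteq> gen_tors R S" "Z \<subseteq> gen_tors R S" using j(2,3) YZ(3) S(2) by auto
    then have "S \<notin> Y" "S \<notin> Z" using g(3)[OF YZ(1)] g(3)[OF YZ(2)] n S(2) by auto
    then have "Y \<subseteq> perp R {S}" "Z \<subseteq> perp R {S}"
      using below_gen_tors[OF assms(1) S(1)] YZ le by auto
    then have "T \<subseteq> perp R {S}" using j(4)[OF P] YZ(3) by simp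
    then show False using g(2) S(2) brick_not_in_perp[OF S(1)] by auto
  qed
  ultimately show "join_irreducible (tors R) T"
    using g(1) S(2) by (auto simp: join_irreducible_def tors_bounds[OF assms(1)] tors_ops[OF assms(1)])
qed

text \<open>Dually, for a minimal class \<open>Y\<close> strictly above \<open>T\<close> with label
  \<open>S\<close>, \<open>T\<close> is the meet of \<open>Y\<close> and \<open>perp R {S}\<close>.
  Conversely, the classes strictly above \<open>perp R {S}\<close> contain \<open>S\<close>, and so
  do their meets.\<close>

lemma meet_irreducible_tors_iff:
  assumes "artin R" "brick_finite R"
  shows "meet_irreducible (tors R) T \<longleftrightarrow> (\<exists>S. brick R S \<and> T = perp R {S})"
proof
  assume mi: "meet_irreducible (tors R) T"
  then have T: "torsion_class R T" "T \<noteq> fgmod R"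
    and irr: "\<And>Y Z. torsion_class R Y \<Longrightarrow> torsion_class R Z \<Longrightarrow> T = Y \<inter> Z \<Longrightarrow> T = Y \<or> T = Z"
    by (auto simp: meet_irreducible_def tors_bounds[OF assms(1)] tors_ops[OF assms(1)])
  let ?B = "{Y. torsion_class R Y \<and> T \<subset> Y}"
  have "finite ?B" using finite_tors[OF assms] by (rule rev_finite_subset) auto
  moreover have "fgmod R \<in> ?B"
    using torsion_all[OF artin_ring[OF assms(1)]] T torsion_classD(1)[OF T(1)] by auto
  ultimately obtain Y where Y: "Y \<in> ?B" "\<forall>Z\<in>?B. Z \<subseteq> Y \<longrightarrow> Y = Z"
    using finite_has_minimal[of ?B] by blast
  have Yt: "torsion_class R Y" "T \<subset> Y" using Y by auto
  then obtain S where S: "brick R S" "S \<in> Y" "S \<in> rperp R T"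
    using brick_between[OF assms(1) Yt(1) T(1)] by auto
  have P: "torsion_class R (perp R {S})"
    using torsion_perp[OF artin_ring[OF assms(1)], of "{S}"] brickD(1)[OF S(1)] by simp
  have "T \<subseteq> Y \<inter> perp R {S}" using Yt(2) S(3) torsion_classD(1)[OF T(1)] by (auto simp: perp_def rperp_def)
  moreover have "Y \<inter> perp R {S} \<noteq> Y" using S(2) brick_not_in_perp[OF S(1)] by auto
  ultimately have "T = Y \<inter> perp R {S}" using Y(2) torsion_Int[OF artin_ring[OF assms(1)] Yt(1) P] by blast
  then have "T = Y \<or> T = perp R {S}" by (rule irr[OF Yt(1) P])
  then show "\<exists>S. brick R S \<and> T = perp R {S}" using Yt(2) S(1) by blast
next
  assume "\<exists>S. brick R S \<and> T = perp R {S}"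
  then obtain S where S: "brick R S" "T = perp R {S}" by blast
  have P: "torsion_class R (perp R {S})"
    using torsion_perp[OF artin_ring[OF assms(1)], of "{S}"] brickD(1)[OF S(1)] by simp
  have "T \<noteq> fgmod R" using S brick_not_in_perp[OF S(1)] brickD(1)[OF S(1)] by auto
  moreover have "T = Y \<or> T = Z" if YZ: "torsion_class R Y" "torsion_class R Z" "T = Y \<inter> Z" for Y Z
  proof (rule ccontr)
    assume "\<not> (T = Y \<or> T = Z)"
    then have "S \<in> Y" "S \<in> Z" using above_perp[OF assms(1) S(1)] YZ S(2) by auto
    then show False using brick_not_in_perp[OF S(1)] YZ(3) S(2) by auto
  qed
  ultimately show "meet_irreducible (tors R) T"
    using P S(2) by (auto simp: meet_irreducible_def tors_bounds[OF assms(1)] tors_ops[OF assms(1)])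
qed

section \<open>Counting irreducibles and labels of chains\<close>

lemma card_image_cong:
  assumes "\<And>x y. x \<in> A \<Longrightarrow> y \<in> A \<Longrightarrow> f x = f y \<longleftrightarrow> g x = g y"
  shows "card (f ` A) = card (g ` A)"
proof -
  have "bij_betw (\<lambda>z. g (inv_into A f z)) (f ` A) (g ` A)"
  proof (rule bij_betw_imageI)
    have eq: "g (inv_into A f (f x)) = g x" if "x \<in> A" for x
      using that assms[of "inv_into A f (f x)" x] by (simp add: inv_into_into f_inv_into_f)
    then show "inj_on (\<lambda>z. g (inv_into A f z)) (f ` A)"
      using assms by (auto simp: inj_on_def)
    show "(\<lambda>z. g (inv_into A f z)) ` f ` A = g ` A"
      using eq by (auto simp: image_image)
  qed
  then show ?thesis by (rule bij_betw_same_card)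
qed

lemma card_irreducibles_tors:
  assumes "artin R" "brick_finite R"
  shows "card {T. join_irreducible (tors R) T} = card (brick_classes R)"
    "card {T. meet_irreducible (tors R) T} = card (brick_classes R)"
proof -
  have "{T. join_irreducible (tors R) T} = gen_tors R ` {S. brick R S}"
    by (auto simp: join_irreducible_tors_iff[OF assms])
  moreover have "gen_tors R S = gen_tors R S' \<longleftrightarrow> brick_class R S = brick_class R S'"
    if "brick R S" "brick R S'" for S S'
    using gen_tors_eq_imp_iso[OF assms(1) that] iso_imp_gen_tors_eq[OF assms(1) that]
    unfolding brick_class_eq_iff[OF that] by (rule iffI)
  then have "card (gen_tors R ` {S. brick R S}) = card (brick_classes R)"
    unfolding brick_classes_def by (intro card_image_cong) simp
  ultimately show "card {T. join_irreducible (tors R) T} = card (brick_classes R)" by simp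
  have "{T. meet_irreducible (tors R) T} = (\<lambda>S. perp R {S}) ` {S. brick R S}"
    by (auto simp: meet_irreducible_tors_iff[OF assms])
  moreover have "perp R {S} = perp R {S'} \<longleftrightarrow> brick_class R S = brick_class R S'"
    if "brick R S" "brick R S'" for S S'
    using perp_eq_imp_iso[OF assms(1) that] iso_imp_perp_eq[OF assms(1) that]
    unfolding brick_class_eq_iff[OF that] by (rule iffI)
  then have "card ((\<lambda>S. perp R {S}) ` {S. brick R S}) = card (brick_classes R)"
    unfolding brick_classes_def by (intro card_image_cong) simp
  ultimately show "card {T. meet_irreducible (tors R) T} = card (brick_classes R)" by simp
qed

lemma chain_labels:
  assumes "artin R" "\<forall>i\<le>r. torsion_class R (x i)" "\<forall>i<r. x i \<subset> x (Suc i)"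
  obtains S where "\<forall>i<r. brick R (S i) \<and> S i \<in> x (Suc i) \<and> S i \<in> rperp R (x i)"
    "\<forall>i j. i < j \<longrightarrow> j < r \<longrightarrow> no_hom R (S i) (S j)" "inj_on (\<lambda>i. brick_class R (S i)) {..<r}"
proof -
  have "\<forall>i. \<exists>S. i < r \<longrightarrow> brick R S \<and> S \<in> x (Suc i) \<and> S \<in> rperp R (x i)"
  proof (intro allI)
    fix i
    have "\<exists>S. brick R S \<and> S \<in> x (Suc i) \<and> S \<in> rperp R (x i)" if "i < r"
    proof -
      have t: "torsion_class R (x (Suc i))" "torsion_class R (x i)" "\<not> x (Suc i) \<subseteq> x i"
        using assms(2,3) that by auto
      obtain S where "brick R S" "S \<in> x (Suc i)" "S \<in> rperp R (x i)" by (rule brick_between[OF assms(1) t])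
      then show ?thesis by blast
    qed
    then show "\<exists>S. i < r \<longrightarrow> brick R S \<and> S \<in> x (Suc i) \<and> S \<in> rperp R (x i)" by blast
  qed
  then obtain S where S0: "\<forall>i. i < r \<longrightarrow> brick R (S i) \<and> S i \<in> x (Suc i) \<and> S i \<in> rperp R (x i)"
    by (rule choice[THEN exE])
  then have S: "\<forall>i<r. brick R (S i) \<and> S i \<in> x (Suc i) \<and> S i \<in> rperp R (x i)" by blast
  have mono: "x i \<subseteq> x j" if "i \<le> j" "j \<le> r" for i j
    using that by (induction j rule: dec_induct) (use assms(3) in \<open>auto simp: Suc_le_eq\<close>)
  have no: "no_hom R (S i) (S j)" if "i < j" "j < r" for i j
  proof -
    \<comment> \<open>The earlier label lies in \<open>x (Suc i)\<close>, hence in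
      \<open>x j\<close>, for which the later label is torsion-free.\<close>
    have "S i \<in> x (Suc i)" "S j \<in> rperp R (x j)" using S that by auto
    then show ?thesis using mono[of "Suc i" j] that by (auto simp: rperp_def)
  qed
  have ne: "brick_class R (S i) \<noteq> brick_class R (S j)" if "i < j" "j < r" for i j
  proof
    assume "brick_class R (S i) = brick_class R (S j)"
    then have "mod_iso R (S i) (S j)" using S that by (simp add: brick_class_eq_iff)
    moreover have b: "brick R (S i)" "brick R (S j)" using S that by auto
    \<comment> \<open>An isomorphism between two labels would make the identity of the later one
      vanish.\<close>
    ultimately have "no_hom R (S j) (S j)"
      using no_hom_iso[OF brickD(2)[OF b(1)] brickD(2)[OF b(2)] brickD(2)[OF b(2)] brickD(2)[OF b(2)] _
        mod_iso_refl[OF brickD(2)[OF b(2)]]] no[OF that] by blast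
    then show False using no_hom_self brickD(3)[OF b(2)] by blast
  qed
  have "inj_on (\<lambda>i. brick_class R (S i)) {..<r}"
    by (rule inj_onI) (metis ne lessThan_iff linorder_neqE_nat)
  then show thesis using that S no by blast
qed

lemma chain_length_le:
  assumes "artin R" "brick_finite R" "\<forall>i\<le>r. torsion_class R (x i)" "\<forall>i<r. x i \<subset> x (Suc i)"
  shows "r \<le> card (brick_classes R)"
proof -
  obtain S where S: "\<forall>i<r. brick R (S i) \<and> S i \<in> x (Suc i) \<and> S i \<in> rperp R (x i)"
    "inj_on (\<lambda>i. brick_class R (S i)) {..<r}"
    by (rule chain_labels[OF assms(1,3,4)]) (rule that)
  have "(\<lambda>i. brick_class R (S i)) ` {..<r} \<subseteq> brick_classes R" using S(1) by (auto simp: brick_classes_def)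
  then have "card ((\<lambda>i. brick_class R (S i)) ` {..<r}) \<le> card (brick_classes R)"
    using assms(2) by (intro card_mono) (simp_all add: brick_finite_iff)
  then show ?thesis using card_image[OF S(2)] by simp
qed

text \<open>Both numbers of irreducibles equal the number of bricks, and no chain is longer, so
  extremality means that this length is attained.\<close>

lemma extremal_tors_iff:
  assumes "artin R" "brick_finite R"
  shows "extremal_lattice (tors R) \<longleftrightarrow> (\<exists>x. (\<forall>i\<le>card (brick_classes R). torsion_class R (x i)) \<and>
    (\<forall>i<card (brick_classes R). x i \<subset> x (Suc i)))"
proof -
  let ?n = "card (brick_classes R)"
  let ?C = "{r. \<exists>x. (\<forall>i\<le>r. torsion_class R (x i)) \<and> (\<forall>i<r. x i \<subset> x (Suc i))}"
  have len: "lattice_length (tors R) = Max ?C" by (simp add: lattice_length_def)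
  have le: "r \<le> ?n" if "r \<in> ?C" for r using that chain_length_le[OF assms] by blast
  then have fin: "finite ?C" by (meson finite_nat_set_iff_bounded_le)
  have "0 \<in> ?C" using torsion_all[OF artin_ring[OF assms(1)]] by (auto intro!: exI[of _ "\<lambda>_. fgmod R"])
  then have m: "Max ?C \<in> ?C" by (intro Max_in[OF fin]) blast
  have "?n = Max ?C \<longleftrightarrow> ?n \<in> ?C"
  proof
    assume "?n = Max ?C"
    then show "?n \<in> ?C" using m by (rule ssubst)
  next
    assume a: "?n \<in> ?C"
    show "?n = Max ?C" by (rule Max_eqI[OF fin _ a, symmetric]) (rule le)
  qed
  then show ?thesis
    by (simp add: extremal_lattice_def tors_finite_lattice[OF assms] card_irreducibles_tors[OF assms] len)
qed

section \<open>Directed bricks\<close>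

text \<open>A rank function witnesses that there are finitely many bricks, and no cycles of nonzero
  homomorphisms between nonisomorphic ones.\<close>

definition directed :: "('a, 'x) ring_scheme \<Rightarrow> bool" where
  "directed R \<longleftrightarrow> (\<exists>(\<rho> :: ('a, 'a list) module \<Rightarrow> nat) n. \<forall>S S'. brick R S \<longrightarrow> brick R S' \<longrightarrow>
     \<rho> S < n \<and> (\<not> no_hom R S S' \<longrightarrow> \<rho> S' \<le> \<rho> S) \<and> (\<rho> S = \<rho> S' \<longrightarrow> mod_iso R S S'))"

text \<open>The rank is constant on isomorphism classes, which the definition does not state:
  isomorphic bricks have nonzero maps in both directions.\<close>

lemma directedE:
  assumes "directed R"
  obtains \<rho> :: "('a, 'a list) module \<Rightarrow> nat" and n where
    "\<forall>S. brick (R :: ('a, 'x) ring_scheme) S \<longrightarrow> \<rho> S < n"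
    "\<forall>S S'. brick R S \<longrightarrow> brick R S' \<longrightarrow> \<not> no_hom R S S' \<longrightarrow> \<rho> S' \<le> \<rho> S"
    "\<forall>S S'. brick R S \<longrightarrow> brick R S' \<longrightarrow> \<rho> S = \<rho> S' \<longleftrightarrow> mod_iso R S S'"
proof -
  obtain \<rho> :: "('a, 'a list) module \<Rightarrow> nat" and n where
    \<rho>: "\<forall>S S'. brick R S \<longrightarrow> brick R S' \<longrightarrow>
     \<rho> S < n \<and> (\<not> no_hom R S S' \<longrightarrow> \<rho> S' \<le> \<rho> S) \<and> (\<rho> S = \<rho> S' \<longrightarrow> mod_iso R S S')"
    using assms unfolding directed_def by (elim exE)
  have le: "\<rho> S' \<le> \<rho> S" if "brick R S" "brick R S'" "mod_iso R S S'" for S S'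
  proof -
    note lm = brickD(2)[OF that(1)] brickD(2)[OF that(2)]
    have "\<not> no_hom R S S'"
      using no_hom_iso[OF lm(1) lm(1) lm(1) lm(2) mod_iso_refl[OF lm(1)] that(3)] no_hom_self[of R S]
        brickD(3)[OF that(1)] by blast
    then show ?thesis using \<rho> that by blast
  qed
  show thesis
  proof (rule that; intro allI impI)
    show "\<rho> S < n" if "brick R S" for S using \<rho> that by blast
    show "\<rho> S' \<le> \<rho> S" if "brick R S" "brick R S'" "\<not> no_hom R S S'" for S S' using \<rho> that by blast
    show "\<rho> S = \<rho> S' \<longleftrightarrow> mod_iso R S S'" if "brick R S" "brick R S'" for S S'
      using \<rho> that le[OF that] le[OF that(2,1)] mod_iso_sym[OF brickD(2) brickD(2), OF that] by (meson le_antisym)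
  qed
qed

lemma directedI:
  fixes \<rho> :: "('a, 'a list) module \<Rightarrow> nat"
  assumes "\<And>S. brick (R :: ('a, 'x) ring_scheme) S \<Longrightarrow> \<rho> S < n"
    "\<And>S S'. brick R S \<Longrightarrow> brick R S' \<Longrightarrow> \<not> no_hom R S S' \<Longrightarrow> \<rho> S' \<le> \<rho> S"
    "\<And>S S'. brick R S \<Longrightarrow> brick R S' \<Longrightarrow> \<rho> S = \<rho> S' \<Longrightarrow> mod_iso R S S'"
  shows "directed R"
  unfolding directed_def using assms by (intro exI[of _ \<rho>] exI[of _ n]) blast

lemma directed_brick_finite:
  assumes "directed R"
  shows "brick_finite R"
proof -
  obtain \<rho> :: "('a, 'a list) module \<Rightarrow> nat" and n where
    \<rho>0: "\<forall>S. brick R S \<longrightarrow> \<rho> S < n"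
    "\<forall>S S'. brick R S \<longrightarrow> brick R S' \<longrightarrow> \<not> no_hom R S S' \<longrightarrow> \<rho> S' \<le> \<rho> S"
    "\<forall>S S'. brick R S \<longrightarrow> brick R S' \<longrightarrow> \<rho> S = \<rho> S' \<longleftrightarrow> mod_iso R S S'"
    by (rule directedE[OF assms]) (rule that)
  note \<rho> = \<rho>0[rule_format]
  have "brick_classes R \<subseteq> (\<lambda>k. {S'. brick R S' \<and> k = \<rho> S'}) ` {..<n}"
    using \<rho>(1,3) by (auto simp: brick_classes_def brick_class_def image_iff intro!: bexI)
  then show ?thesis using finite_surj[of "{..<n}"] by (simp add: brick_finite_iff)
qed

text \<open>The \<open>i\<close>-th class is left perpendicular to the bricks of rank at least
  \<open>i\<close>. As nonzero homomorphisms do not raise the rank, a brick of smaller rank belongs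
  to it, while the others are torsion-free for it.\<close>

lemma directed_chain:
  assumes "artin R" "directed R"
  obtains x and \<sigma> :: "('a, 'a list) module \<Rightarrow> nat" where
    "\<forall>i. torsion_class (R :: ('a, 'x) ring_scheme) (x i)"
    "\<forall>i<card (brick_classes R). x i \<subset> x (Suc i)"
    "\<forall>S. brick R S \<longrightarrow> \<sigma> S < card (brick_classes R)"
    "\<forall>S i. brick R S \<longrightarrow> \<sigma> S < i \<longrightarrow> S \<in> x i" "\<forall>S i. brick R S \<longrightarrow> i \<le> \<sigma> S \<longrightarrow> S \<in> rperp R (x i)"
    "\<forall>S S'. brick R S \<longrightarrow> brick R S' \<longrightarrow> \<sigma> S = \<sigma> S' \<longrightarrow> mod_iso R S S'"
proof -
  obtain \<rho> :: "('a, 'a list) module \<Rightarrow> nat" and n where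
    \<rho>0: "\<forall>S. brick R S \<longrightarrow> \<rho> S < n"
    "\<forall>S S'. brick R S \<longrightarrow> brick R S' \<longrightarrow> \<not> no_hom R S S' \<longrightarrow> \<rho> S' \<le> \<rho> S"
    "\<forall>S S'. brick R S \<longrightarrow> brick R S' \<longrightarrow> \<rho> S = \<rho> S' \<longleftrightarrow> mod_iso R S S'"
    by (rule directedE[OF assms(2)]) (rule that)
  note \<rho> = \<rho>0[rule_format]
  let ?n = "card (brick_classes R)"
  define Q where "Q = \<rho> ` {S. brick R S}"
  have fin: "finite Q" 
  proof (rule finite_subset)
    show "Q \<subseteq> {..<n}" using \<rho>(1) by (auto simp: Q_def)
  qed simp
  have cQ: "card Q = ?n" unfolding Q_def brick_classes_def
    by (rule card_image_cong) (auto simp: \<rho>(3) brick_class_eq_iff)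
  \<comment> \<open>Ranks are compressed to an initial segment by counting the values below, so that
    every index is the rank of a brick and each inclusion is strict.\<close>
  define \<sigma> where "\<sigma> S = card {q \<in> Q. q < \<rho> S}" for S
  define x where "x i = perp R {S. brick R S \<and> i \<le> \<sigma> S}" for i
  have mono: "\<sigma> S \<le> \<sigma> S' \<longleftrightarrow> \<rho> S \<le> \<rho> S'" if S: "brick R S" "brick R S'" for S S'
  proof
    assume "\<rho> S \<le> \<rho> S'"
    then show "\<sigma> S \<le> \<sigma> S'" unfolding \<sigma>_def using fin by (intro card_mono) auto
  next
    show "\<rho> S \<le> \<rho> S'" if "\<sigma> S \<le> \<sigma> S'"
    proof (rule ccontr)
      assume "\<not> \<rho> S \<le> \<rho> S'"
      then have "\<rho> S' \<in> {q \<in> Q. q < \<rho> S}" "{q \<in> Q. q < \<rho> S'} \<subseteq> {q \<in> Q. q < \<rho> S}"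
        using S by (auto simp: Q_def)
      moreover have "\<rho> S' \<notin> {q \<in> Q. q < \<rho> S'}" by simp
      ultimately have "{q \<in> Q. q < \<rho> S'} \<subset> {q \<in> Q. q < \<rho> S}" by blast
      then have "\<sigma> S' < \<sigma> S" unfolding \<sigma>_def using fin by (intro psubset_card_mono) auto
      then show False using that by simp
    qed
  qed
  have lt: "\<sigma> S < ?n" if "brick R S" for S
  proof -
    have "{q \<in> Q. q < \<rho> S} \<subset> Q" using that by (auto simp: Q_def)
    then show ?thesis using psubset_card_mono[OF fin] cQ by (auto simp: \<sigma>_def)
  qed
  \<comment> \<open>\<open>\<sigma>\<close> is injective on one brick for each value of
    \<open>\<rho>\<close>, and there are as many such values as possible values of
    \<open>\<sigma>\<close>.\<close>
  have onto: "\<exists>S. brick R S \<and> \<sigma> S = i" if "i < ?n" for i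
  proof -
    have "inj_on \<sigma> (inv_into {S. brick R S} \<rho> ` Q)"
    proof (rule inj_onI)
      fix S S' assume "S \<in> inv_into {S. brick R S} \<rho> ` Q" "S' \<in> inv_into {S. brick R S} \<rho> ` Q" "\<sigma> S = \<sigma> S'"
      then obtain q q' where q: "q \<in> Q" "q' \<in> Q" "S = inv_into {S. brick R S} \<rho> q" "S' = inv_into {S. brick R S} \<rho> q'"
        by auto
      have b: "brick R S" "\<rho> S = q" "brick R S'" "\<rho> S' = q'"
        using q inv_into_into[of q \<rho> "{S. brick R S}"] inv_into_into[of q' \<rho> "{S. brick R S}"]
          f_inv_into_f[of q \<rho> "{S. brick R S}"] f_inv_into_f[of q' \<rho> "{S. brick R S}"] by (auto simp: Q_def)
      have "\<rho> S = \<rho> S'" using mono[OF b(1,3)] mono[OF b(3,1)] \<open>\<sigma> S = \<sigma> S'\<close> by simp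
      then show "S = S'" using b q by simp
    qed
    moreover have "inj_on (inv_into {S. brick R S} \<rho>) Q" unfolding Q_def by (rule inj_on_inv_into) simp
    ultimately have "card (\<sigma> ` inv_into {S. brick R S} \<rho> ` Q) = ?n" by (simp add: card_image cQ)
    moreover have br: "inv_into {S. brick R S} \<rho> ` Q \<subseteq> {S. brick R S}"
      unfolding Q_def by (metis image_subsetI inv_into_into)
    ultimately have "\<sigma> ` inv_into {S. brick R S} \<rho> ` Q = {..<?n}"
      using lt by (intro card_subset_eq) auto
    then have "i \<in> \<sigma> ` inv_into {S. brick R S} \<rho> ` Q" using that by simp
    then obtain S where S: "i = \<sigma> S" "S \<in> inv_into {S. brick R S} \<rho> ` Q" by (rule imageE)
    have "brick R S" using subsetD[OF br S(2)] by simp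
    then show ?thesis using S(1) by blast
  qed
  have t: "torsion_class R (x i)" for i
    unfolding x_def by (rule torsion_perp[OF artin_ring[OF assms(1)]]) (auto simp: brickD(1))
  have in_x: "S \<in> x i" if "brick R S" "\<sigma> S < i" for S i
    using that \<rho>(2) mono unfolding x_def perp_def by (fastforce simp: brickD(1))
  have rp: "S \<in> rperp R (x i)" if "brick R S" "i \<le> \<sigma> S" for S i
    using that unfolding x_def rperp_def perp_def by (simp add: brickD(1))
  have strict: "x i \<subset> x (Suc i)" if i: "i < ?n" for i
  proof
    show "x i \<subseteq> x (Suc i)" unfolding x_def by (rule perp_mono) auto
    obtain S where S: "brick R S" "\<sigma> S = i" using onto[OF i] by blast
    then show "x i \<noteq> x (Suc i)"
      using in_x[OF S(1), of "Suc i"] rp[OF S(1), of i] torsion_rperp_disjoint brickD(3)[OF S(1)] by blast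
  qed
  have inj: "mod_iso R S S'" if "brick R S" "brick R S'" "\<sigma> S = \<sigma> S'" for S S'
    using mono[OF that(1,2)] mono[OF that(2,1)] \<rho>(3)[OF that(1,2)] that(3) by simp
  show thesis by (rule that[of x \<sigma>]) (use t strict lt in_x rp inj in auto)
qed

lemma extremal_iff_directed:
  fixes R :: "('a, 'x) ring_scheme"
  assumes "artin R" "brick_finite R"
  shows "extremal_lattice (tors R) \<longleftrightarrow> directed R"
proof
  assume "directed R"
  then obtain x where "\<forall>i. torsion_class R (x i)" "\<forall>i<card (brick_classes R). x i \<subset> x (Suc i)"
    by (rule directed_chain[OF assms(1)]) (rule that)
  then show "extremal_lattice (tors R)" by (auto simp: extremal_tors_iff[OF assms])
next
  let ?n = "card (brick_classes R)"
  assume "extremal_lattice (tors R)"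
  then obtain x where x: "\<forall>i\<le>?n. torsion_class R (x i)" "\<forall>i<?n. x i \<subset> x (Suc i)"
    using extremal_tors_iff[OF assms] by blast
  obtain S where S: "\<forall>i<?n. brick R (S i) \<and> S i \<in> x (Suc i) \<and> S i \<in> rperp R (x i)"
    and no: "\<forall>i j. i < j \<longrightarrow> j < ?n \<longrightarrow> no_hom R (S i) (S j)" and inj: "inj_on (\<lambda>i. brick_class R (S i)) {..<?n}"
    by (rule chain_labels[OF assms(1) x]) (rule that)
  \<comment> \<open>There are as many pairwise nonisomorphic labels as bricks, so every brick is a
    label up to isomorphism, and its index becomes its rank.\<close>
  have "(\<lambda>i. brick_class R (S i)) ` {..<?n} = brick_classes R"
    using S card_image[OF inj] assms(2) by (intro card_subset_eq) (auto simp: brick_finite_iff brick_classes_def)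
  moreover have "brick_class R X \<in> brick_classes R" if "brick R X" for X
    using that by (simp add: brick_classes_def)
  ultimately have cl: "brick_class R X \<in> (\<lambda>i. brick_class R (S i)) ` {..<?n}" if "brick R X" for X
    using that by simp
  have ex: "\<exists>i. i < ?n \<and> mod_iso R X (S i)" if X: "brick R X" for X
  proof -
    obtain i where i: "i \<in> {..<?n}" "brick_class R X = brick_class R (S i)"
      using cl[OF X] by (elim imageE)
    then have "mod_iso R X (S i)" using S X by (simp add: brick_class_eq_iff)
    then show ?thesis using i(1) by blast
  qed
  define \<rho> :: "('a, 'a list) module \<Rightarrow> nat" where "\<rho> X = (SOME i. i < ?n \<and> mod_iso R X (S i))" for X
  have \<rho>: "\<rho> X < ?n" "mod_iso R X (S (\<rho> X))" if "brick R X" for X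
    using someI_ex[OF ex[OF that]] by (auto simp: \<rho>_def)
  have b: "brick R (S (\<rho> X))" if "brick R X" for X using S \<rho>(1)[OF that] by blast
  show "directed R"
  proof (rule directedI[of R \<rho> ?n])
    fix X Y assume XY: "brick R X" "brick R Y"
    note l = brickD(2)[OF XY(1)] brickD(2)[OF b[OF XY(1)]] brickD(2)[OF XY(2)] brickD(2)[OF b[OF XY(2)]]
    show "\<rho> Y \<le> \<rho> X" if "\<not> no_hom R X Y"
      using that no_hom_iso[OF l \<rho>(2)[OF XY(1)] \<rho>(2)[OF XY(2)]] no \<rho>(1)[OF XY(2)] by (metis not_le)
    show "mod_iso R X Y" if "\<rho> X = \<rho> Y"
    proof -
      have "mod_iso R (S (\<rho> X)) Y" using mod_iso_sym[OF l(3,4) \<rho>(2)[OF XY(2)]] that by simp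
      then show ?thesis by (rule mod_iso_trans[OF l(1,2) \<rho>(2)[OF XY(1)]])
    qed
  qed (rule \<rho>(1))
qed

text \<open>If the torsion part \<open>H\<close> and the torsion-free quotient \<open>N\<close> of
  \<open>S\<close> are both nonzero, modularity fails for \<open>gen_tors R S\<close> and its
  largest proper subclass. \<open>N\<close> lies in the latter and \<open>H\<close> in
  \<open>T\<close>, so \<open>S\<close> lies in their join, whereas \<open>T\<close> meets
  \<open>gen_tors R S\<close> only within \<open>perp R {S}\<close>.\<close>

lemma left_modular_splits:
  assumes "artin R" "left_modular_element (tors R) T" "brick R S"
  shows "S \<in> T \<or> S \<in> rperp R T"
proof (rule ccontr)
  assume n: "\<not> (S \<in> T \<or> S \<in> rperp R T)"
  note S = brickD[OF assms(3)] and g = gen_tors[OF assms(1) brickD(1)[OF assms(3)]]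
  have T: "torsion_class R T" using assms(2) by (simp add: left_modular_element_def)
  have lm: "tjoin R Y T \<inter> Z = tjoin R Y (T \<inter> Z)" if YZ: "torsion_class R Y" "torsion_class R Z" "Y \<subseteq> Z" for Y Z
  proof -
    have "(Y \<squnion>\<^bsub>tors R\<^esub> T) \<sqinter>\<^bsub>tors R\<^esub> Z = Y \<squnion>\<^bsub>tors R\<^esub> (T \<sqinter>\<^bsub>tors R\<^esub> Z)"
      using assms(2) YZ by (simp add: left_modular_element_def)
    then show ?thesis
      by (simp add: tors_ops[OF assms(1)] YZ T tjoin(1)[OF assms(1)] torsion_Int[OF artin_ring[OF assms(1)]])
  qed
  have P: "torsion_class R (perp R {S})"
    using torsion_perp[OF artin_ring[OF assms(1)], of "{S}"] S(1) by simp
  let ?Z = "gen_tors R S" and ?Y = "gen_tors R S \<inter> perp R {S}"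
  have Y: "torsion_class R ?Y" by (rule torsion_Int[OF artin_ring[OF assms(1)] g(1) P])
  have TZ: "torsion_class R (T \<inter> ?Z)" by (rule torsion_Int[OF artin_ring[OF assms(1)] T g(1)])
  have "T \<inter> ?Z \<subseteq> perp R {S}" using below_gen_tors[OF assms(1,3) TZ] n by blast
  then have "tjoin R ?Y (T \<inter> ?Z) \<subseteq> ?Y" by (intro tjoin(4)[OF assms(1) Y TZ Y]) auto
  then have "tjoin R ?Y T \<inter> ?Z \<subseteq> perp R {S}" using lm[OF Y g(1)] by auto
  moreover have "S \<in> tjoin R ?Y T"
  proof -
    note j = tjoin[OF assms(1) Y T]
    obtain H N q where H: "submodule H R S" "S\<lparr>carrier := H\<rparr> \<in> T" "N \<in> rperp R T"
      "lin R S N q" "q ` carrier S = carrier N" and ker: "\<forall>x\<in>carrier S. q x = \<zero>\<^bsub>N\<^esub> \<longleftrightarrow> x \<in> H"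
      by (rule torsion_part[OF assms(1) T S(1)]) (rule that)
    have N: "N \<in> fgmod R" "left_module R N" using H(3) by (auto simp: rperp_def fgmod_def)
    have "H \<noteq> {\<zero>\<^bsub>S\<^esub>}"
    proof
      assume "H = {\<zero>\<^bsub>S\<^esub>}"
      then have "inj_on q (carrier S)" using ker by (simp add: lin_inj_iff[OF S(2) N(2) H(4)])
      then have "S \<in> rperp R T" using H(3) S(1) by (auto simp: rperp_def intro: no_hom_inj[OF S(2) N(2) H(4)])
      then show False using n by simp
    qed
    then obtain z where z: "z \<in> H" "z \<noteq> \<zero>\<^bsub>S\<^esub>" using H(1) by (auto simp: submodule_iff[OF S(2)])
    have zc: "z \<in> carrier S" using z(1) H(1) by (auto simp: submodule_iff[OF S(2)])
    \<comment> \<open>Composed with \<open>q\<close>, a nonzero map would give a bijective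
      endomorphism of \<open>S\<close> that kills the nonzero \<open>H\<close>.\<close>
    have "no_hom R N S"
    proof (rule ccontr)
      assume "\<not> no_hom R N S"
      then obtain k y where k: "lin R N S k" "y \<in> carrier N" "k y \<noteq> \<zero>\<^bsub>S\<^esub>" by (rule not_no_hom_E)
      have "y \<in> q ` carrier S" using k(2) H(5) by simp
      then obtain w where w: "w \<in> carrier S" "y = q w" by (elim imageE)
      have "bij_betw (\<lambda>x. k (q x)) (carrier S) (carrier S)"
        using S(4)[OF lin_comp[OF H(4) k(1)] w(1)] k(3) w(2) by simp
      moreover have "q z = \<zero>\<^bsub>N\<^esub>" using ker z(1) zc by blast
      then have "k (q z) = \<zero>\<^bsub>S\<^esub>" using lin_zero[OF N(2) S(2) k(1)] by simp
      ultimately show False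
        using z(2) zc lin_inj_iff[OF S(2,2) lin_comp[OF H(4) k(1)]] by (auto simp: bij_betw_def)
    qed
    then have "N \<in> ?Y" using N(1) torsion_quot[OF g(1,2) N(1) H(4,5)] by (simp add: perp_def)
    then have "N \<in> tjoin R ?Y T" "S\<lparr>carrier := H\<rparr> \<in> tjoin R ?Y T" using j(2,3) H(2) by auto
    then show ?thesis using torsion_ext[OF j(1) S(1) H(1) _ _ H(4,5)] ker by blast
  qed
  ultimately show False using g(2) brick_not_in_perp[OF assms(3)] by blast
qed

text \<open>A brick witnessing a failure of modularity lies in \<open>Z\<close> and is torsion-free
  for the right-hand side. Were it in \<open>T\<close>, it would lie in that side; so it is
  torsion-free for \<open>T\<close>, as it is for \<open>Y\<close>, hence for their join, in which
  it lies.\<close>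

lemma splits_left_modular:
  assumes "artin R" "torsion_class R T" "\<And>S. brick R S \<Longrightarrow> S \<in> T \<or> S \<in> rperp R T"
  shows "left_modular_element (tors R) T"
proof -
  have "tjoin R Y T \<inter> Z = tjoin R Y (T \<inter> Z)" if YZ: "torsion_class R Y" "torsion_class R Z" "Y \<subseteq> Z" for Y Z
  proof
    have TZ: "torsion_class R (T \<inter> Z)" by (rule torsion_Int[OF artin_ring[OF assms(1)] assms(2) YZ(2)])
    note j = tjoin[OF assms(1) YZ(1) assms(2)] and j' = tjoin[OF assms(1) YZ(1) TZ]
    have JZ: "torsion_class R (tjoin R Y T \<inter> Z)" by (rule torsion_Int[OF artin_ring[OF assms(1)] j(1) YZ(2)])
    show "tjoin R Y (T \<inter> Z) \<subseteq> tjoin R Y T \<inter> Z"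
      using j(2,3) YZ(3) by (intro j'(4)[OF JZ]) auto
    show "tjoin R Y T \<inter> Z \<subseteq> tjoin R Y (T \<inter> Z)"
    proof (rule ccontr)
      assume "\<not> tjoin R Y T \<inter> Z \<subseteq> tjoin R Y (T \<inter> Z)"
      then obtain S where S: "brick R S" "S \<in> tjoin R Y T \<inter> Z" "S \<in> rperp R (tjoin R Y (T \<inter> Z))"
        by (rule brick_between[OF assms(1) JZ j'(1)])
      have P: "torsion_class R (perp R {S})"
        using torsion_perp[OF artin_ring[OF assms(1)], of "{S}"] brickD(1)[OF S(1)] by simp
      have "S \<notin> T"
      proof
        assume "S \<in> T"
        then have "S \<in> tjoin R Y (T \<inter> Z)" using S(2) j'(3) by blast
        then show False using S(3) torsion_rperp_disjoint brickD(3)[OF S(1)] by blast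
      qed
      then have "S \<in> rperp R T" using assms(3)[OF S(1)] by blast
      then have "T \<subseteq> perp R {S}" using torsion_classD(1)[OF assms(2)] by (auto simp: perp_def rperp_def)
      moreover have "Y \<subseteq> perp R {S}"
        using S(3) j'(2) torsion_classD(1)[OF YZ(1)] by (auto simp: perp_def rperp_def)
      ultimately have "tjoin R Y T \<subseteq> perp R {S}" by (intro j(4)[OF P])
      then show False using S(2) brick_not_in_perp[OF S(1)] by blast
    qed
  qed
  then show ?thesis using assms(2)
    by (simp add: left_modular_element_def tors_ops[OF assms(1)] tjoin(1)[OF assms(1)]
      torsion_Int[OF artin_ring[OF assms(1)]])
qed

lemma left_modular_iff_directed:
  fixes R :: "('a, 'x) ring_scheme"
  assumes "artin R" "brick_finite R"
  shows "left_modular_lattice (tors R) \<longleftrightarrow> directed R"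
proof
  let ?n = "card (brick_classes R)"
  assume "directed R"
  obtain x \<sigma> where x: "\<forall>i. torsion_class R (x i)" and strict: "\<forall>i<?n. x i \<subset> x (Suc i)"
    and lt: "\<forall>S. brick R S \<longrightarrow> \<sigma> S < ?n"
    and in_x: "\<forall>S i. brick R S \<longrightarrow> \<sigma> S < i \<longrightarrow> S \<in> x i"
    and rp: "\<forall>S i. brick R S \<longrightarrow> i \<le> \<sigma> S \<longrightarrow> S \<in> rperp R (x i)"
    and inj: "\<forall>S S'. brick R S \<longrightarrow> brick R S' \<longrightarrow> \<sigma> S = \<sigma> S' \<longrightarrow> mod_iso R S S'"
    by (rule directed_chain[OF assms(1) \<open>directed R\<close>]) (rule that)
  have not_in: "S \<notin> x i" if "brick R S" "i \<le> \<sigma> S" for S i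
    using rp that torsion_rperp_disjoint brickD(3)[OF that(1)] by blast
  have mono: "x i \<subseteq> x j" if "i \<le> j" "j \<le> ?n" for i j
    using that by (induction j rule: dec_induct) (use strict in \<open>auto simp: Suc_le_eq\<close>)
  \<comment> \<open>Maximality of the chain: a class strictly inside a step would split it into two
    steps whose labels have the same rank and are thus isomorphic.\<close>
  have "z \<in> x ` {..?n}" if z: "torsion_class R z" "\<forall>i\<le>?n. x i \<subseteq> z \<or> z \<subseteq> x i" for z
  proof (rule ccontr)
    assume nz: "z \<notin> x ` {..?n}"
    have x0: "x 0 \<subseteq> z"
    proof (rule ccontr)
      assume "\<not> x 0 \<subseteq> z"
      then obtain S where "brick R S" "S \<in> x 0" by (rule brick_between[OF assms(1) x[rule_format] z(1)]) (rule that)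
      then show False using not_in[of S 0] by simp
    qed
    have xn: "z \<subseteq> x ?n"
    proof (rule ccontr)
      assume "\<not> z \<subseteq> x ?n"
      then obtain S where "brick R S" "S \<in> rperp R (x ?n)" by (rule brick_between[OF assms(1) z(1) x[rule_format]]) (rule that)
      moreover from this have "S \<in> x ?n" using in_x lt by blast
      ultimately show False using torsion_rperp_disjoint brickD(3) by blast
    qed
    have "x i \<subseteq> z" if "i \<le> ?n" for i
      using that
    proof (induction i)
      case (Suc i)
      then have i: "x i \<subseteq> z" "i \<le> ?n" "Suc i \<le> ?n" by auto
      show ?case
      proof (rule ccontr)
        assume le: "\<not> x (Suc i) \<subseteq> z"
        then have zi: "z \<subseteq> x (Suc i)" using z(2) i by blast
        have "\<not> z \<subseteq> x i" using nz i by auto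
        then obtain S where S: "brick R S" "S \<in> z" "S \<in> rperp R (x i)"
          by (rule brick_between[OF assms(1) z(1) x[rule_format]])
        obtain S' where S': "brick R S'" "S' \<in> x (Suc i)" "S' \<in> rperp R z"
          using le by (rule brick_between[OF assms(1) x[rule_format] z(1)])
        have "S' \<in> rperp R (x i)" using S'(3) rperp_mono[OF i(1)] by blast
        \<comment> \<open>Membership in \<open>x (Suc i)\<close> bounds the rank from above,
          torsion-freeness for \<open>x i\<close> from below.\<close>
        have lab: "\<sigma> X = i" if "brick R X" "X \<in> x (Suc i)" "X \<in> rperp R (x i)" for X
        proof -
          have "\<not> Suc i \<le> \<sigma> X" using not_in[of X "Suc i"] that by blast
          moreover have "\<not> \<sigma> X < i" using in_x that torsion_rperp_disjoint[of X "x i" R] brickD(3)[of R X] by blast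
          ultimately show ?thesis by simp
        qed
        have "\<sigma> S = \<sigma> S'" using lab[of S] lab[of S'] S S' zi \<open>S' \<in> rperp R (x i)\<close> by auto
        then have "mod_iso R S S'" using inj S(1) S'(1) by blast
        then have "S' \<in> z" using torsion_iso[OF z(1) S(2) brickD(1)[OF S'(1)]] by simp
        then show False using S'(3) torsion_rperp_disjoint brickD(3)[OF S'(1)] by blast
      qed
    qed (rule x0)
    then have "z = x ?n" using xn by blast
    then show False using nz by auto
  qed
  moreover have "x i \<subseteq> x j \<or> x j \<subseteq> x i" if "i \<le> ?n" "j \<le> ?n" for i j
    using mono[of i j] mono[of j i] that by (cases "i \<le> j") auto
  ultimately have "maximal_chain (tors R) (x ` {..?n})"
    unfolding maximal_chain_def using x by (intro conjI) (simp_all add: image_subset_iff)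
  moreover have "left_modular_element (tors R) (x i)" for i
    by (rule splits_left_modular[OF assms(1) x[rule_format]]) (use in_x rp in \<open>meson not_le\<close>)
  ultimately show "left_modular_lattice (tors R)"
    unfolding left_modular_lattice_def using tors_finite_lattice[OF assms] by blast
next
  assume "left_modular_lattice (tors R)"
  then obtain C where C: "maximal_chain (tors R) C" "\<forall>T\<in>C. left_modular_element (tors R) T"
    unfolding left_modular_lattice_def by blast
  have t: "torsion_class R T" if "T \<in> C" for T using C(1) that by (auto simp: maximal_chain_def)
  have lin: "T \<subseteq> T' \<or> T' \<subseteq> T" if "T \<in> C" "T' \<in> C" for T T' using C(1) that by (simp add: maximal_chain_def)
  have max: "Z \<in> C" if "torsion_class R Z" "\<And>T. T \<in> C \<Longrightarrow> T \<subseteq> Z \<or> Z \<subseteq> T" for Z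
    using C(1) that by (simp add: maximal_chain_def)
  have split: "S \<in> T \<or> S \<in> rperp R T" if "T \<in> C" "brick R S" for S T
    using left_modular_splits[OF assms(1)] C(2) that by blast
  have fin: "finite C" using finite_tors[OF assms] t by (rule_tac finite_subset) auto
  have top: "fgmod R \<in> C"
    by (rule max[OF torsion_all[OF artin_ring[OF assms(1)]]]) (use torsion_classD(1)[OF t] in blast)
  have bot: "perp R (fgmod R) \<in> C"
    by (rule max[OF bot_tors(1)[OF assms(1)]]) (use bot_tors(2)[OF assms(1) t] in blast)
  \<comment> \<open>The position of a brick is the number of members of \<open>C\<close> omitting
    it. For a member that omits \<open>S'\<close>, the brick \<open>S'\<close> is torsion-free, so
    this member also omits every \<open>S\<close> with a nonzero map to \<open>S'\<close>.\<close>
  define \<rho> :: "('a, 'a list) module \<Rightarrow> nat" where "\<rho> S = card {T \<in> C. S \<notin> T}" for S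
  show "directed R"
  proof (rule directedI[of R \<rho> "Suc (card C)"])
    show "\<rho> S < Suc (card C)" for S
      unfolding \<rho>_def less_Suc_eq_le using fin by (intro card_mono) auto
  next
    fix S S' assume S: "brick R S" "brick R S'"
    show "\<rho> S' \<le> \<rho> S" if hom: "\<not> no_hom R S S'"
    proof -
      have "{T \<in> C. S' \<notin> T} \<subseteq> {T \<in> C. S \<notin> T}" using split[OF _ S(2)] hom by (auto simp: rperp_def)
      then show ?thesis unfolding \<rho>_def using fin by (intro card_mono) auto
    qed
    assume eq: "\<rho> S = \<rho> S'"
    have "{T \<in> C. S \<notin> T} \<subseteq> {T \<in> C. S' \<notin> T} \<or> {T \<in> C. S' \<notin> T} \<subseteq> {T \<in> C. S \<notin> T}"
      using lin by blast
    \<comment> \<open>The two sets are comparable because \<open>C\<close> is a chain, so equal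
      cardinality makes them equal.\<close>
    then have same: "{T \<in> C. S \<notin> T} = {T \<in> C. S' \<notin> T}"
    proof
      assume "{T \<in> C. S \<notin> T} \<subseteq> {T \<in> C. S' \<notin> T}"
      then show ?thesis by (rule card_subset_eq[rotated]) (use fin eq in \<open>simp_all add: \<rho>_def\<close>)
    next
      assume "{T \<in> C. S' \<notin> T} \<subseteq> {T \<in> C. S \<notin> T}"
      then show ?thesis by (intro card_subset_eq[symmetric]) (use fin eq in \<open>simp_all add: \<rho>_def\<close>)
    qed
    let ?U = "{T \<in> C. S \<in> T}" and ?L = "{T \<in> C. S \<notin> T}"
    have U: "finite ?U" "fgmod R \<in> ?U" using fin top brickD(1)[OF S(1)] by auto
    have L: "finite ?L" "perp R (fgmod R) \<in> ?L"
      using fin bot rperp_perp_disjoint[of S R "fgmod R"] brickD(1,3)[OF S(1)] by auto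
    \<comment> \<open>The smallest member containing \<open>S\<close> and the largest one omitting
      it. By maximality of the chain they are adjacent, and both bricks label this one
      cover.\<close>
    obtain Tp where "Tp \<in> ?U" and Tp: "\<forall>Z\<in>?U. Z \<subseteq> Tp \<longrightarrow> Tp = Z"
      using finite_has_minimal[OF U(1)] U(2) by blast
    obtain Tm where "Tm \<in> ?L" and Tm: "\<forall>Z\<in>?L. Tm \<subseteq> Z \<longrightarrow> Tm = Z"
      using finite_has_maximal[OF L(1)] L(2) by blast
    have p: "Tp \<in> C" "S \<in> Tp" and m: "Tm \<in> C" "S \<notin> Tm" using \<open>Tp \<in> ?U\<close> \<open>Tm \<in> ?L\<close> by auto
    have p': "S' \<in> Tp" and m': "S' \<notin> Tm" using same p m by blast+
    have pm: "Tp \<subseteq> Z" if "Z \<in> C" "S \<in> Z" for Z using Tp that lin[OF p(1) that(1)] by blast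
    have mm: "Z \<subseteq> Tm" if "Z \<in> C" "S \<notin> Z" for Z using Tm that lin[OF m(1) that(1)] by blast
    show "mod_iso R S S'"
    proof (rule cover_brick_unique[OF assms(1) t[OF m(1)] t[OF p(1)]])
      show "Tm \<subseteq> Tp" using lin[OF m(1) p(1)] m p by blast
      show "Z = Tm \<or> Z = Tp" if Z: "torsion_class R Z" "Tm \<subseteq> Z" "Z \<subseteq> Tp" for Z
      proof -
        have "Z \<in> C"
        proof (rule max[OF Z(1)])
          fix T assume "T \<in> C"
          then show "T \<subseteq> Z \<or> Z \<subseteq> T" using pm[of T] mm[of T] Z by blast
        qed
        then show ?thesis using pm[of Z] mm[of Z] Z by blast
      qed
      show "S \<in> rperp R Tm" "S' \<in> rperp R Tm" using split[OF m(1)] S m m' by blast+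
    qed (use S p p' in auto)
  qed
qed

section \<open>Transfer of directedness\<close>

lemma gbrick_iso:
  assumes "gbrick R M" "left_module R N" "mod_iso R M N"
  shows "gbrick R N"
proof -
  have M: "left_module R M" "fin_gen R M" using assms(1) by (auto simp: gbrick_def)
  obtain f where f: "lin R M N f" "bij_betw f (carrier M) (carrier N)" using assms(3) M(1) by (auto simp: mod_iso_iff)
  have fs: "f ` carrier M = carrier N" and fi: "inj_on f (carrier M)" using f(2) by (auto simp: bij_betw_def)
  let ?g = "inv_into (carrier M) f"
  have g: "lin R N M ?g" by (rule lin_inv[OF M(1) f])
  have gb: "bij_betw ?g (carrier N) (carrier M)" by (rule bij_betw_inv_into[OF f(2)])
  have "bij_betw h (carrier N) (carrier N)" if h: "lin R N N h" "x \<in> carrier N" "h x \<noteq> \<zero>\<^bsub>N\<^esub>" for h x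
  proof -
    have l: "lin R M M (\<lambda>x. ?g (h (f x)))" by (rule lin_comp[OF lin_comp[OF f(1) h(1)] g])
    have "x \<in> f ` carrier M" using h(2) fs by simp
    then obtain y where y: "y \<in> carrier M" "x = f y" by (elim imageE)
    have "?g (h x) \<noteq> \<zero>\<^bsub>M\<^esub>"
      using lin_inj_iff[OF assms(2) M(1) g] gb h(3) lin_closed[OF h(1,2)] by (auto simp: bij_betw_def)
    then have b: "bij_betw (\<lambda>x. ?g (h (f x))) (carrier M) (carrier M)"
      using assms(1) l y by (auto simp: gbrick_def)
    have "bij_betw (f \<circ> (\<lambda>x. ?g (h (f x))) \<circ> ?g) (carrier N) (carrier N)"
      by (intro bij_betw_trans[OF gb] bij_betw_trans[OF b] f(2))
    moreover have eq: "(f \<circ> (\<lambda>x. ?g (h (f x))) \<circ> ?g) z = h z" if "z \<in> carrier N" for z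
      using that fs lin_closed[OF h(1)] by (simp add: f_inv_into_f)
    ultimately show ?thesis by (simp only: bij_betw_cong[OF eq])
  qed
  moreover have "\<exists>x\<in>carrier N. x \<noteq> \<zero>\<^bsub>N\<^esub>"
  proof -
    obtain x where "x \<in> carrier M" "x \<noteq> \<zero>\<^bsub>M\<^esub>" using assms(1) by (auto simp: gbrick_def)
    then show ?thesis using lin_inj_iff[OF M(1) assms(2) f(1)] fi lin_closed[OF f(1)] by blast
  qed
  ultimately show ?thesis using assms(2) fin_gen_iso[OF M(1) assms(2,3) M(2)] by (auto simp: gbrick_def)
qed

text \<open>\<open>\<Phi>\<close> is a mere assignment on bricks with values on any carrier type;
  copies on lists supply the ranks. A bounded rank is pulled back, so brick-finiteness of
  \<open>R'\<close> is part of the conclusion.\<close>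

lemma directed_transfer:
  fixes R :: "('a, 'x) ring_scheme" and R' :: "('b, 'y) ring_scheme"
    and \<Phi> :: "('b, 'b list) module \<Rightarrow> ('a, 'm) module"
  assumes "directed R"
    and "\<And>N. brick R' N \<Longrightarrow> gbrick R (\<Phi> N)"
    and "\<And>N N'. brick R' N \<Longrightarrow> brick R' N' \<Longrightarrow> mod_iso R (\<Phi> N) (\<Phi> N') \<Longrightarrow> mod_iso R' N N'"
    and "\<And>N N'. brick R' N \<Longrightarrow> brick R' N' \<Longrightarrow> no_hom R (\<Phi> N) (\<Phi> N') \<Longrightarrow> no_hom R' N N'"
  shows "directed R'"
proof -
  obtain \<rho> :: "('a, 'a list) module \<Rightarrow> nat" and n where
    \<rho>0: "\<forall>S. brick R S \<longrightarrow> \<rho> S < n"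
    "\<forall>S S'. brick R S \<longrightarrow> brick R S' \<longrightarrow> \<not> no_hom R S S' \<longrightarrow> \<rho> S' \<le> \<rho> S"
    "\<forall>S S'. brick R S \<longrightarrow> brick R S' \<longrightarrow> \<rho> S = \<rho> S' \<longleftrightarrow> mod_iso R S S'"
    by (rule directedE[OF assms(1)]) (rule that)
  note \<rho> = \<rho>0[rule_format]
  define \<Psi> where "\<Psi> N = (SOME M. M \<in> fgmod R \<and> mod_iso R (\<Phi> N) M)" for N
  have lm: "left_module R (\<Phi> N)" "fin_gen R (\<Phi> N)" if "brick R' N" for N
    using assms(2)[OF that] by (auto simp: gbrick_def)
  have \<Psi>: "\<Psi> N \<in> fgmod R \<and> mod_iso R (\<Phi> N) (\<Psi> N)" if "brick R' N" for N
  proof -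
    have "\<exists>M. M \<in> fgmod R \<and> mod_iso R (\<Phi> N) M" using ex_iso_fgmod[OF lm[OF that]] by blast
    then show ?thesis unfolding \<Psi>_def by (rule someI_ex)
  qed
  have b: "brick R (\<Psi> N)" if "brick R' N" for N
    using gbrick_iso[OF assms(2)[OF that], of "\<Psi> N"] \<Psi>[OF that] by (simp add: brick_iff fgmod_def)
  show ?thesis
  proof (rule directedI[of R' "\<lambda>N. \<rho> (\<Psi> N)" n])
    fix N N' assume N: "brick R' N" "brick R' N'"
    note l = lm(1)[OF N(1)] brickD(2)[OF b[OF N(1)]] lm(1)[OF N(2)] brickD(2)[OF b[OF N(2)]]
    have iso: "mod_iso R (\<Phi> N) (\<Psi> N)" "mod_iso R (\<Phi> N') (\<Psi> N')" using \<Psi> N by auto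
    show "\<rho> (\<Psi> N') \<le> \<rho> (\<Psi> N)" if "\<not> no_hom R' N N'"
      using \<rho>(2)[OF b[OF N(1)] b[OF N(2)]] assms(4)[OF N] that no_hom_iso[OF l iso] by blast
    show "mod_iso R' N N'" if "\<rho> (\<Psi> N) = \<rho> (\<Psi> N')"
    proof (rule assms(3)[OF N])
      have "mod_iso R (\<Psi> N) (\<Psi> N')" using \<rho>(3)[OF b[OF N(1)] b[OF N(2)]] that by simp
      then have "mod_iso R (\<Psi> N) (\<Phi> N')" by (rule mod_iso_trans[OF l(2,4) _ mod_iso_sym[OF l(3,4) iso(2)]])
      then show "mod_iso R (\<Phi> N) (\<Phi> N')" by (rule mod_iso_trans[OF l(1,2) iso(1)])
    qed
  qed (use b \<rho>(1) in blast)
qed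

section \<open>Quotients of algebras\<close>

text \<open>Central scalars commute with an idempotent and act linearly on modules, as corners and
  spaces of homomorphisms require.\<close>

definition central_fd_over :: "('k, 'x) ring_scheme \<Rightarrow> ('a, 'y) ring_scheme \<Rightarrow> ('k \<Rightarrow> 'a) \<Rightarrow> bool" where
  "central_fd_over K R \<rho> \<longleftrightarrow> fd_over K R \<rho> \<and>
     (\<forall>c\<in>carrier K. \<forall>x\<in>carrier R. \<rho> c \<otimes>\<^bsub>R\<^esub> x = x \<otimes>\<^bsub>R\<^esub> \<rho> c)"

lemma fd_algebra_central_fd_over:
  assumes "fd_algebra K A"
  shows "central_fd_over K A (\<lambda>c. c \<odot>\<^bsub>A\<^esub> \<one>\<^bsub>A\<^esub>)"
proof -
  interpret fd_algebra K A by fact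
  let ?\<rho> = "\<lambda>c. c \<odot>\<^bsub>A\<^esub> \<one>\<^bsub>A\<^esub>"
  have mul: "?\<rho> c \<otimes>\<^bsub>A\<^esub> x = c \<odot>\<^bsub>A\<^esub> x" "x \<otimes>\<^bsub>A\<^esub> ?\<rho> c = c \<odot>\<^bsub>A\<^esub> x" if "c \<in> carrier K" "x \<in> carrier A" for c x
    using that smult_mult_left[of c "\<one>\<^bsub>A\<^esub>" x] smult_mult_right[of c x "\<one>\<^bsub>A\<^esub>"] by simp_all
  have \<rho>: "?\<rho> \<in> ring_hom K A"
    by (rule ring_hom_memI) (simp_all add: mul(1) smult_l_distr smult_assoc1)
  have lA: "left_module K A"
    by (intro left_module.intro left_module_axioms.intro K.ring_axioms abelian_group_axioms)
      (simp_all add: smult_l_distr smult_r_distr smult_assoc1)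
  have "lin K A (restr ?\<rho> (regular_module A)) (\<lambda>x. x)" by (simp add: lin_def mul)
  then have "fin_gen K (restr ?\<rho> (regular_module A))"
    by (rule fin_gen_surj[OF lA left_module_restr[OF left_module_regular[OF A.ring_axioms] K.ring_axioms \<rho>] _ _
      finite_dimensional]) simp
  then show ?thesis using \<rho> K.field_axioms A.ring_axioms by (simp add: central_fd_over_def fd_over_def mul)
qed

lemma fd_over_surj:
  assumes "fd_over K R \<rho>" "ring R'" "\<pi> \<in> ring_hom R R'" "\<pi> ` carrier R = carrier R'"
  shows "fd_over K R' (\<lambda>c. \<pi> (\<rho> c))"
proof -
  have K: "field K" "ring K" "ring R" and \<rho>: "\<rho> \<in> ring_hom K R"
    and fg: "fin_gen K (restr \<rho> (regular_module R))"
    using assms(1) by (simp_all add: fd_over_def field_def domain_def cring_def)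
  have \<pi>\<rho>: "(\<lambda>c. \<pi> (\<rho> c)) \<in> ring_hom K R'"
    using ring_hom_trans[OF \<rho> assms(3)] by (simp add: comp_def)
  have "lin K (restr \<rho> (regular_module R)) (restr (\<lambda>c. \<pi> (\<rho> c)) (regular_module R')) \<pi>"
    using assms(3) ring_hom_closed[OF \<rho>] by (simp add: lin_def ring_hom_closed ring_hom_add ring_hom_mult)
  then have "fin_gen K (restr (\<lambda>c. \<pi> (\<rho> c)) (regular_module R'))"
    by (rule fin_gen_surj[OF left_module_restr[OF left_module_regular[OF K(3)] K(2) \<rho>]
        left_module_restr[OF left_module_regular[OF assms(2)] K(2) \<pi>\<rho>] _ _ fg]) (simp add: assms(4))
  then show ?thesis using K \<pi>\<rho> assms(2) by (simp add: fd_over_def)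
qed

lemma fin_gen_restr_surj:
  assumes "left_module R' N" "ring R" "\<pi> \<in> ring_hom R R'" "\<pi> ` carrier R = carrier R'" "fin_gen R' N"
  shows "fin_gen R (restr \<pi> N)"
proof -
  obtain S where S: "finite S" "S \<subseteq> carrier N"
    and gen: "\<forall>H. submodule H R' N \<longrightarrow> S \<subseteq> H \<longrightarrow> H = carrier N"
    by (rule fin_genE[OF assms(5)]) (rule that)
  show ?thesis
    by (rule fin_genI[OF S(1)]) (use S gen submodule_restr_surj[OF assms(1-4)] in simp_all)
qed

lemma gbrick_restr_surj:
  assumes "gbrick R' N" "ring R" "\<pi> \<in> ring_hom R R'" "\<pi> ` carrier R = carrier R'"
  shows "gbrick R (restr \<pi> N)"
proof -
  have l: "left_module R' N" "fin_gen R' N" using assms(1) by (auto simp: gbrick_def)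
  show ?thesis
    using assms(1) left_module_restr[OF l(1) assms(2,3)] fin_gen_restr_surj[OF l(1) assms(2-4) l(2)]
      lin_restr_surj[OF l(1) assms(4), of N] by (simp add: gbrick_def)
qed

lemma mod_iso_restr_surj:
  assumes "left_module R' N" "ring R" "\<pi> \<in> ring_hom R R'" "\<pi> ` carrier R = carrier R'"
    "mod_iso R (restr \<pi> N) (restr \<pi> N')"
  shows "mod_iso R' N N'"
  using assms(5) lin_restr_surj[OF assms(1,4), of N']
  by (auto simp: mod_iso_iff[OF left_module_restr[OF assms(1-3)]] mod_iso_iff[OF assms(1)])

lemma no_hom_restr:
  assumes "\<pi> \<in> ring_hom R R'" "no_hom R (restr \<pi> N) (restr \<pi> N')"
  shows "no_hom R' N N'"
  using assms(2) lin_restr[OF assms(1), of N N'] by (simp add: no_hom_def)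

text \<open>Restriction along a surjection is full, since every scalar comes from \<open>R\<close>;
  therefore it preserves bricks and reflects isomorphisms.\<close>

lemma directed_surj:
  assumes "directed R" "ring R" "\<pi> \<in> ring_hom R R'" "\<pi> ` carrier R = carrier R'"
  shows "directed R'"
proof (rule directed_transfer[OF assms(1), of R' "\<lambda>N. restr \<pi> N"])
  fix N assume "brick R' N"
  then have "gbrick R' N" by (simp add: brick_iff)
  then show "gbrick R (restr \<pi> N)" by (rule gbrick_restr_surj[OF _ assms(2-4)])
next
  fix N N' assume "brick R' N"
  then show "mod_iso R' N N'" if "mod_iso R (restr \<pi> N) (restr \<pi> N')"
    using mod_iso_restr_surj[OF brickD(2) assms(2-4) that] by simp
next
  fix N N' assume "no_hom R (restr \<pi> N) (restr \<pi> N')"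
  then show "no_hom R' N N'" by (rule no_hom_restr[OF assms(3)])
qed

lemma quotient_map:
  assumes "ideal J R"
  shows "(\<lambda>a. J +>\<^bsub>R\<^esub> a) \<in> ring_hom R (R Quot J)" "(\<lambda>a. J +>\<^bsub>R\<^esub> a) ` carrier R = carrier (R Quot J)"
    "ring (R Quot J)"
proof -
  interpret ideal J R by fact
  show "(\<lambda>a. J +>\<^bsub>R\<^esub> a) \<in> ring_hom R (R Quot J)" by (rule rcos_ring_hom)
  show "(\<lambda>a. J +>\<^bsub>R\<^esub> a) ` carrier R = carrier (R Quot J)" by (auto simp: FactRing_def A_RCOSETS_def')
  show "ring (R Quot J)" by (rule quotient_is_ring)
qed

lemma Inter_submodules:
  assumes "left_module R M" "S \<subseteq> carrier M"
  shows "submodule (\<Inter>{H. submodule H R M \<and> S \<subseteq> H}) R M" "S \<subseteq> \<Inter>{H. submodule H R M \<and> S \<subseteq> H}"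
    "\<And>H. submodule H R M \<Longrightarrow> S \<subseteq> H \<Longrightarrow> \<Inter>{H. submodule H R M \<and> S \<subseteq> H} \<subseteq> H"
  using submodule_carrier[OF assms(1)] assms(2) by (auto intro!: submodule_Inter[OF assms(1)])

section \<open>Corner algebras\<close>

locale corner = R: ring R for R :: "('a, 'x) ring_scheme" (structure) and e +
  assumes e_closed [simp]: "e \<in> carrier R" and e_idem [simp]: "e \<otimes> e = e"
begin

abbreviation C where "C \<equiv> corner_ring R e"

lemma corner_simps [simp]: "x \<oplus>\<^bsub>C\<^esub> y = x \<oplus> y" "x \<otimes>\<^bsub>C\<^esub> y = x \<otimes> y" "\<zero>\<^bsub>C\<^esub> = \<zero>" "\<one>\<^bsub>C\<^esub> = e"
  by (simp_all add: corner_ring_def)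

lemma e_absorb: "x \<in> carrier R \<Longrightarrow> e \<otimes> (e \<otimes> x) = e \<otimes> x"
  by (simp flip: R.m_assoc)

lemma corner_carrier: "carrier C = {x \<in> carrier R. e \<otimes> x = x \<and> x \<otimes> e = x}"
proof -
  have "e \<otimes> (e \<otimes> a \<otimes> e) = e \<otimes> a \<otimes> e" "(e \<otimes> a \<otimes> e) \<otimes> e = e \<otimes> a \<otimes> e" if "a \<in> carrier R" for a
    using that by (simp_all add: R.m_assoc e_absorb)
  moreover have "\<exists>a\<in>carrier R. x = e \<otimes> a \<otimes> e" if "x \<in> carrier R" "e \<otimes> x = x" "x \<otimes> e = x" for x
    using that by (intro bexI[of _ x]) simp_all
  ultimately show ?thesis by (auto simp: corner_ring_def) blast
qed

lemma ring_corner: "ring C"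
proof (rule ringI)
  show "abelian_group C"
  proof (rule abelian_groupI)
    fix x assume "x \<in> carrier C"
    then show "\<exists>y\<in>carrier C. y \<oplus>\<^bsub>C\<^esub> x = \<zero>\<^bsub>C\<^esub>"
      by (intro bexI[of _ "\<ominus> x"]) (simp_all add: corner_carrier R.l_neg R.r_minus R.l_minus)
  qed (auto simp: corner_carrier R.a_ac R.l_distr R.r_distr)
  show "Group.monoid C"
  proof (rule monoidI)
    fix x y assume "x \<in> carrier C" "y \<in> carrier C"
    then show "x \<otimes>\<^bsub>C\<^esub> y \<in> carrier C" by (auto simp: corner_carrier R.m_assoc) (simp flip: R.m_assoc)
  qed (auto simp: corner_carrier R.m_assoc)
qed (auto simp: corner_carrier R.l_distr R.r_distr)

text \<open>The compression taking \<open>x\<close> to \<open>e x e\<close> is a surjection from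
  \<open>R\<close>, and it is linear over \<open>K\<close> because the scalars are central.\<close>

lemma central_fd_over_corner:
  assumes "central_fd_over K R \<rho>"
  shows "fd_over K C (\<lambda>c. \<rho> c \<otimes> e)"
proof -
  have K: "field K" "ring K" and \<rho>: "\<rho> \<in> ring_hom K R"
    and fg: "fin_gen K (restr \<rho> (regular_module R))"
    and cen: "\<And>c x. c \<in> carrier K \<Longrightarrow> x \<in> carrier R \<Longrightarrow> \<rho> c \<otimes> x = x \<otimes> \<rho> c"
    using assms by (simp_all add: central_fd_over_def fd_over_def field_def domain_def cring_def)
  have rc: "\<rho> c \<in> carrier R" if "c \<in> carrier K" for c using ring_hom_closed[OF \<rho> that] .
  have sw: "\<rho> c \<otimes> (x \<otimes> y) = x \<otimes> (\<rho> c \<otimes> y)" if "c \<in> carrier K" "x \<in> carrier R" "y \<in> carrier R" for c x y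
    using that rc cen[of c x] by (simp flip: R.m_assoc)
  have ee: "e \<otimes> (\<rho> c \<otimes> e) = \<rho> c \<otimes> e" if "c \<in> carrier K" for c
    using sw[OF that, of e e] by simp
  have \<rho>': "(\<lambda>c. \<rho> c \<otimes> e) \<in> ring_hom K C"
  proof (rule ring_hom_memI)
    fix c d assume cd: "c \<in> carrier K" "d \<in> carrier K"
    then have "\<rho> (c \<otimes>\<^bsub>K\<^esub> d) \<otimes> e = \<rho> c \<otimes> (\<rho> d \<otimes> e)" using \<rho> rc by (simp add: ring_hom_mult R.m_assoc)
    also have "\<dots> = \<rho> c \<otimes> e \<otimes> (\<rho> d \<otimes> e)" using cd rc by (simp add: R.m_assoc ee)
    finally show "\<rho> (c \<otimes>\<^bsub>K\<^esub> d) \<otimes> e = \<rho> c \<otimes> e \<otimes>\<^bsub>C\<^esub> (\<rho> d \<otimes> e)" by simp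
  qed (use \<rho> rc ee in \<open>simp_all add: corner_carrier ring_hom_add ring_hom_one R.l_distr R.m_assoc\<close>)
  have "lin K (restr \<rho> (regular_module R)) (restr (\<lambda>c. \<rho> c \<otimes> e) (regular_module C)) (\<lambda>x. e \<otimes> x \<otimes> e)"
  proof (rule linI)
    fix c x assume "c \<in> carrier K" "x \<in> carrier (restr \<rho> (regular_module R))"
    then show "e \<otimes> (c \<odot>\<^bsub>restr \<rho> (regular_module R)\<^esub> x) \<otimes> e =
        c \<odot>\<^bsub>restr (\<lambda>c. \<rho> c \<otimes> e) (regular_module C)\<^esub> (e \<otimes> x \<otimes> e)"
      using rc sw[of c e "x \<otimes> e"] by (simp add: R.m_assoc e_absorb)
  qed (simp_all add: corner_carrier R.l_distr R.r_distr R.m_assoc e_absorb)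
  moreover have "(\<lambda>x. e \<otimes> x \<otimes> e) ` carrier (restr \<rho> (regular_module R)) =
      carrier (restr (\<lambda>c. \<rho> c \<otimes> e) (regular_module C))"
    by (auto simp: corner_ring_def)
  ultimately have "fin_gen K (restr (\<lambda>c. \<rho> c \<otimes> e) (regular_module C))"
    by (rule fin_gen_surj[OF left_module_restr[OF left_module_regular[OF R.ring_axioms] K(2) \<rho>]
      left_module_restr[OF left_module_regular[OF ring_corner] K(2) \<rho>'] _ _ fg])
  then show ?thesis using K \<rho>' ring_corner by (simp add: fd_over_def)
qed

section \<open>Coinduction from a corner\<close>

definition eR :: "('a, 'a) module" where
  "eR = \<lparr>carrier = {x \<in> carrier R. e \<otimes> x = x}, mult = undefined, one = undefined, zero = \<zero>,
     add = (\<oplus>), smult = (\<otimes>)\<rparr>"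

lemma eR_simps [simp]: "x \<in> carrier eR \<longleftrightarrow> x \<in> carrier R \<and> e \<otimes> x = x" "\<zero>\<^bsub>eR\<^esub> = \<zero>"
  "x \<oplus>\<^bsub>eR\<^esub> y = x \<oplus> y" "c \<odot>\<^bsub>eR\<^esub> x = c \<otimes> x"
  by (simp_all add: eR_def)

text \<open>The coinduced module: maps from \<open>eR\<close> to \<open>N\<close> over the corner,
  on which \<open>R\<close> acts through right multiplication on \<open>eR\<close>.\<close>

definition coind :: "('a, 'n, 'y) module_scheme \<Rightarrow> ('a, 'a \<Rightarrow> 'n) module" where
  "coind N = \<lparr>carrier = mod_hom C eR N, mult = undefined, one = undefined,
     zero = (\<lambda>x\<in>carrier eR. \<zero>\<^bsub>N\<^esub>), add = (\<lambda>f g. \<lambda>x\<in>carrier eR. f x \<oplus>\<^bsub>N\<^esub> g x),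
     smult = (\<lambda>b g. \<lambda>x\<in>carrier eR. g (x \<otimes> b))\<rparr>"

lemma coind_simps [simp]: "carrier (coind N) = mod_hom C eR N" "\<zero>\<^bsub>coind N\<^esub> = (\<lambda>x\<in>carrier eR. \<zero>\<^bsub>N\<^esub>)"
  "f \<oplus>\<^bsub>coind N\<^esub> g = (\<lambda>x\<in>carrier eR. f x \<oplus>\<^bsub>N\<^esub> g x)" "b \<odot>\<^bsub>coind N\<^esub> g = (\<lambda>x\<in>carrier eR. g (x \<otimes> b))"
  by (simp_all add: coind_def)

lemma left_module_eR: "left_module C eR"
proof -
  have "abelian_group eR"
    by (rule abelian_groupI)
      (auto simp: R.a_ac R.r_distr R.r_minus R.r_neg intro!: bexI[of _ "\<ominus> _"])
  then show ?thesis
    by (intro left_module.intro left_module_axioms.intro ring_corner)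
      (auto simp: corner_carrier R.l_distr R.r_distr R.m_assoc simp flip: R.m_assoc)
qed

lemma eR_mult: "x \<in> carrier eR \<Longrightarrow> b \<in> carrier R \<Longrightarrow> x \<otimes> b \<in> carrier eR"
  by (simp flip: R.m_assoc)

lemma e_in_eR: "e \<in> carrier eR"
  by simp

lemma left_module_coind:
  assumes "left_module C N"
  shows "left_module R (coind N)"
proof -
  interpret N: left_module C N by fact
  have l: "lin C eR N f" if "f \<in> mod_hom C eR N" for f using that by (rule mod_hom_lin)
  have c: "f x \<in> carrier N" if "f \<in> mod_hom C eR N" "x \<in> carrier eR" for f x
    using lin_closed[OF l] that by blast
  note mh = lin_mod_hom[OF left_module_eR]
  have add: "f \<oplus>\<^bsub>coind N\<^esub> g \<in> mod_hom C eR N" if "f \<in> mod_hom C eR N" "g \<in> mod_hom C eR N" for f g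
    using mh[OF lin_sum[OF assms l[OF that(1)] l[OF that(2)]]] by simp
  have zero: "\<zero>\<^bsub>coind N\<^esub> \<in> mod_hom C eR N" using mh[OF lin_const_zero[OF assms]] by simp
  have sm: "b \<odot>\<^bsub>coind N\<^esub> f \<in> mod_hom C eR N" if "b \<in> carrier R" "f \<in> mod_hom C eR N" for b f
  proof -
    have "lin C eR eR (\<lambda>x. x \<otimes> b)"
      using that(1) eR_mult by (intro linI) (auto simp: R.l_distr R.m_assoc corner_carrier)
    from mh[OF lin_comp[OF this l[OF that(2)]]] show ?thesis by simp
  qed
  have ext: "f = g" if "f \<in> mod_hom C eR N" "g \<in> mod_hom C eR N" "\<And>x. x \<in> carrier eR \<Longrightarrow> f x = g x" for f g
    using that by (rule mod_hom_eqI)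
  have "abelian_group (coind N)" by (rule abelian_group_hom_space[OF left_module_eR assms]) simp_all
  then show ?thesis
  proof (intro left_module.intro left_module_axioms.intro R.ring_axioms)
    fix a f assume "a \<in> carrier R" "f \<in> carrier (coind N)"
    then show "a \<odot>\<^bsub>coind N\<^esub> f \<in> carrier (coind N)" using sm by simp
  next
    fix a b f assume ab: "a \<in> carrier R" "b \<in> carrier R" and "f \<in> carrier (coind N)"
    then have f: "f \<in> mod_hom C eR N" by simp
    show "(a \<oplus> b) \<odot>\<^bsub>coind N\<^esub> f = a \<odot>\<^bsub>coind N\<^esub> f \<oplus>\<^bsub>coind N\<^esub> b \<odot>\<^bsub>coind N\<^esub> f"
    proof (rule ext[OF sm[OF _ f] add[OF sm[OF ab(1) f] sm[OF ab(2) f]]])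
      fix x assume x: "x \<in> carrier eR"
      then have "f (x \<otimes> a \<oplus> x \<otimes> b) = f (x \<otimes> a) \<oplus>\<^bsub>N\<^esub> f (x \<otimes> b)"
        using lin_add[OF l[OF f] eR_mult[OF x ab(1)] eR_mult[OF x ab(2)]] by simp
      then show "((a \<oplus> b) \<odot>\<^bsub>coind N\<^esub> f) x = (a \<odot>\<^bsub>coind N\<^esub> f \<oplus>\<^bsub>coind N\<^esub> b \<odot>\<^bsub>coind N\<^esub> f) x"
        using x ab by (simp add: R.r_distr)
    qed (use ab in simp)
    show "(a \<otimes> b) \<odot>\<^bsub>coind N\<^esub> f = a \<odot>\<^bsub>coind N\<^esub> (b \<odot>\<^bsub>coind N\<^esub> f)"
      by (rule ext[OF sm[OF _ f] sm[OF ab(1) sm[OF ab(2) f]]])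
        (use ab eR_mult in \<open>auto simp: R.m_assoc\<close>)
  next
    fix a f g assume a: "a \<in> carrier R" and "f \<in> carrier (coind N)" "g \<in> carrier (coind N)"
    then have f: "f \<in> mod_hom C eR N" "g \<in> mod_hom C eR N" by simp_all
    show "a \<odot>\<^bsub>coind N\<^esub> (f \<oplus>\<^bsub>coind N\<^esub> g) = a \<odot>\<^bsub>coind N\<^esub> f \<oplus>\<^bsub>coind N\<^esub> a \<odot>\<^bsub>coind N\<^esub> g"
      by (rule ext[OF sm[OF a add[OF f]] add[OF sm[OF a f(1)] sm[OF a f(2)]]])
        (use a eR_mult in auto)
  next
    fix f assume "f \<in> carrier (coind N)"
    then have f: "f \<in> mod_hom C eR N" by simp
    show "\<one> \<odot>\<^bsub>coind N\<^esub> f = f" by (rule ext[OF sm[OF _ f] f]) (use c f in auto)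
  qed
qed

text \<open>Embeds \<open>N\<close> as the part of its coinduced module fixed by \<open>e\<close>;
  evaluation at \<open>e\<close> is the inverse.\<close>

definition ev :: "('a, 'n, 'y) module_scheme \<Rightarrow> 'n \<Rightarrow> 'a \<Rightarrow> 'n" where
  "ev N n = (\<lambda>x\<in>carrier eR. (x \<otimes> e) \<odot>\<^bsub>N\<^esub> n)"

lemma eR_e: "x \<in> carrier eR \<Longrightarrow> x \<otimes> e \<in> carrier C"
  by (auto simp: corner_carrier R.m_assoc simp flip: R.m_assoc) (simp add: R.m_assoc)

lemma ev:
  assumes "left_module C N" "n \<in> carrier N"
  shows "ev N n \<in> mod_hom C eR N" "ev N n e = n"
proof -
  interpret N: left_module C N by fact
  have "lin C eR N (\<lambda>x. (x \<otimes> e) \<odot>\<^bsub>N\<^esub> n)"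
  proof (rule linI)
    fix x y assume "x \<in> carrier eR" "y \<in> carrier eR"
    then show "(x \<oplus>\<^bsub>eR\<^esub> y) \<otimes> e \<odot>\<^bsub>N\<^esub> n = x \<otimes> e \<odot>\<^bsub>N\<^esub> n \<oplus>\<^bsub>N\<^esub> y \<otimes> e \<odot>\<^bsub>N\<^esub> n"
      using assms(2) eR_e[of x] eR_e[of y] N.smult_l_distr[of "x \<otimes> e" "y \<otimes> e" n] by (simp add: R.l_distr)
  next
    fix c x assume c: "c \<in> carrier C" "x \<in> carrier eR"
    then show "(c \<odot>\<^bsub>eR\<^esub> x) \<otimes> e \<odot>\<^bsub>N\<^esub> n = c \<odot>\<^bsub>N\<^esub> (x \<otimes> e \<odot>\<^bsub>N\<^esub> n)"
      using assms(2) eR_e[of x] N.smult_assoc[of c "x \<otimes> e" n] by (simp add: R.m_assoc corner_carrier)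
  qed (use assms(2) eR_e N.smult_closed in blast)
  from lin_mod_hom[OF left_module_eR this] show "ev N n \<in> mod_hom C eR N" by (simp add: ev_def)
  show "ev N n e = n" using N.smult_one[OF assms(2)] by (simp add: ev_def)
qed

lemma e_smult_coind:
  assumes "left_module C N" "g \<in> mod_hom C eR N"
  shows "e \<odot>\<^bsub>coind N\<^esub> g = ev N (g e)"
proof -
  interpret N: left_module C N by fact
  interpret W: left_module R "coind N" by (rule left_module_coind[OF assms(1)])
  have l: "lin C eR N g" using assms(2) by (rule mod_hom_lin)
  have ge: "g e \<in> carrier N" using lin_closed[OF l e_in_eR] .
  have m: "e \<odot>\<^bsub>coind N\<^esub> g \<in> mod_hom C eR N" using W.smult_closed[of e g] assms(2) by (simp del: coind_simps(4))
  show ?thesis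
  proof (rule mod_hom_eqI[OF m ev(1)[OF assms(1) ge]])
    fix x assume x: "x \<in> carrier eR"
    have "g (x \<otimes> e \<otimes> e) = x \<otimes> e \<odot>\<^bsub>N\<^esub> g e" using lin_smult[OF l eR_e[OF x] e_in_eR] by simp
    then show "(e \<odot>\<^bsub>coind N\<^esub> g) x = ev N (g e) x" using x by (simp add: ev_def R.m_assoc)
  qed
qed

section \<open>Intermediate extensions\<close>

definition ie_carrier :: "('a, 'n, 'y) module_scheme \<Rightarrow> ('a \<Rightarrow> 'n) set" where
  "ie_carrier N = \<Inter>{H. submodule H R (coind N) \<and> ev N ` carrier N \<subseteq> H}"

text \<open>This is the intermediate extension of \<open>N\<close>, since \<open>e Hom(eR, N) = N\<close>.\<close>

definition ie :: "('a, 'n, 'y) module_scheme \<Rightarrow> ('a, 'a \<Rightarrow> 'n) module" where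
  "ie N = (coind N)\<lparr>carrier := ie_carrier N\<rparr>"

lemma ie:
  assumes "left_module C N"
  shows "submodule (ie_carrier N) R (coind N)" "left_module R (ie N)"
    "\<And>n. n \<in> carrier N \<Longrightarrow> ev N n \<in> ie_carrier N"
    "\<And>H. submodule H R (ie N) \<Longrightarrow> ev N ` carrier N \<subseteq> H \<Longrightarrow> H = ie_carrier N"
    "ie_carrier N \<subseteq> mod_hom C eR N"
proof -
  note W = left_module_coind[OF assms]
  have sub: "ev N ` carrier N \<subseteq> carrier (coind N)" using ev(1)[OF assms] by auto
  note I = Inter_submodules[OF W sub, folded ie_carrier_def]
  show s: "submodule (ie_carrier N) R (coind N)" by (rule I(1))
  show "left_module R (ie N)" unfolding ie_def by (rule left_module_sub[OF W s])
  show "ev N n \<in> ie_carrier N" if "n \<in> carrier N" for n using I(2) that by auto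
  show "H = ie_carrier N" if "submodule H R (ie N)" "ev N ` carrier N \<subseteq> H" for H
    using that I(3)[of H] by (auto simp: ie_def submodule_sub_iff[OF W s])
  show "ie_carrier N \<subseteq> mod_hom C eR N" using s by (simp add: submodule_iff[OF W])
qed

lemma ie_simps [simp]: "carrier (ie N) = ie_carrier N" "\<zero>\<^bsub>ie N\<^esub> = \<zero>\<^bsub>coind N\<^esub>"
  "f \<oplus>\<^bsub>ie N\<^esub> g = f \<oplus>\<^bsub>coind N\<^esub> g" "b \<odot>\<^bsub>ie N\<^esub> g = b \<odot>\<^bsub>coind N\<^esub> g"
  by (simp_all add: ie_def del: coind_simps)

lemma ev_add:
  assumes "left_module C N" "n \<in> carrier N" "n' \<in> carrier N"
  shows "ev N (n \<oplus>\<^bsub>N\<^esub> n') = ev N n \<oplus>\<^bsub>coind N\<^esub> ev N n'"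
proof -
  interpret N: left_module C N by fact
  show ?thesis using assms(2,3) eR_e by (auto simp: ev_def fun_eq_iff N.smult_r_distr)
qed

lemma ev_smult:
  assumes "left_module C N" "n \<in> carrier N" "c \<in> carrier C"
  shows "ev N (c \<odot>\<^bsub>N\<^esub> n) = c \<odot>\<^bsub>coind N\<^esub> ev N n"
proof -
  interpret N: left_module C N by fact
  have "x \<otimes> e \<odot>\<^bsub>N\<^esub> (c \<odot>\<^bsub>N\<^esub> n) = x \<otimes> c \<otimes> e \<odot>\<^bsub>N\<^esub> n" if "x \<in> carrier eR" for x
    using that assms(2,3) N.smult_assoc[OF eR_e[OF that] assms(3,2)] by (simp add: corner_carrier R.m_assoc)
  then show ?thesis using assms(3) eR_mult by (auto simp: ev_def fun_eq_iff corner_carrier)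
qed

lemma e_smult_ev:
  assumes "left_module C N" "n \<in> carrier N"
  shows "e \<odot>\<^bsub>coind N\<^esub> ev N n = ev N n"
  using e_smult_coind[OF assms(1) ev(1)[OF assms]] ev(2)[OF assms] by simp

text \<open>The elements of \<open>N\<close> that \<open>ev N\<close> sends into a given submodule
  form a submodule over the corner, so generators of \<open>N\<close> suffice.\<close>

lemma ie_fin_gen:
  assumes "left_module C N" "fin_gen C N"
  shows "fin_gen R (ie N)"
proof -
  interpret N: left_module C N by fact
  obtain S where S: "finite S" "S \<subseteq> carrier N"
    and gen: "\<forall>H. submodule H C N \<longrightarrow> S \<subseteq> H \<longrightarrow> H = carrier N"
    by (rule fin_genE[OF assms(2)]) (rule that)
  show ?thesis
  proof (rule fin_genI[of "ev N ` S"])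
    show "ev N ` S \<subseteq> carrier (ie N)" using ie(3)[OF assms(1)] S(2) by auto
    fix H assume H: "submodule H R (ie N)" "ev N ` S \<subseteq> H"
    have Hc: "\<zero>\<^bsub>coind N\<^esub> \<in> H" "\<And>x y. x \<in> H \<Longrightarrow> y \<in> H \<Longrightarrow> x \<oplus>\<^bsub>coind N\<^esub> y \<in> H"
      "\<And>a x. a \<in> carrier R \<Longrightarrow> x \<in> H \<Longrightarrow> a \<odot>\<^bsub>coind N\<^esub> x \<in> H"
      using H(1) by (auto simp: submodule_iff[OF ie(2)[OF assms(1)]] simp del: coind_simps)
    have "submodule {n \<in> carrier N. ev N n \<in> H} C N"
    proof (rule N.submoduleI)
      have "ev N \<zero>\<^bsub>N\<^esub> = \<zero>\<^bsub>coind N\<^esub>" using eR_e by (auto simp: ev_def fun_eq_iff N.smult_zero_r)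
      then show "\<zero>\<^bsub>N\<^esub> \<in> {n \<in> carrier N. ev N n \<in> H}" using Hc(1) by (simp del: coind_simps)
    next
      fix x y assume "x \<in> {n \<in> carrier N. ev N n \<in> H}" "y \<in> {n \<in> carrier N. ev N n \<in> H}"
      then show "x \<oplus>\<^bsub>N\<^esub> y \<in> {n \<in> carrier N. ev N n \<in> H}"
        using Hc(2) by (simp add: ev_add[OF assms(1)] del: coind_simps)
    next
      fix c x assume "c \<in> carrier C" "x \<in> {n \<in> carrier N. ev N n \<in> H}"
      then show "c \<odot>\<^bsub>N\<^esub> x \<in> {n \<in> carrier N. ev N n \<in> H}"
        using Hc(3)[of c "ev N x"] by (simp add: ev_smult[OF assms(1)] del: coind_simps) (simp add: corner_carrier)
    qed auto
    moreover have "S \<subseteq> {n \<in> carrier N. ev N n \<in> H}" using S(2) H(2) by auto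
    ultimately have "{n \<in> carrier N. ev N n \<in> H} = carrier N" using gen by blast
    then have "ev N ` carrier N \<subseteq> H" by blast
    then show "H = carrier (ie N)" using ie(4)[OF assms(1) H(1)] by simp
  qed (use S in simp)
qed

text \<open>Post-composition respects the generators coming from \<open>ev\<close>, so it restricts
  to the submodules generated by them.\<close>

lemma ie_functor:
  assumes "left_module C N" "left_module C N'" "lin C N N' \<phi>"
  shows "lin R (ie N) (ie N') (\<lambda>g. \<lambda>x\<in>carrier eR. \<phi> (g x))"
    "\<And>n. n \<in> carrier N \<Longrightarrow> (\<lambda>x\<in>carrier eR. \<phi> (ev N n x)) = ev N' (\<phi> n)"
proof -
  let ?F = "\<lambda>g. \<lambda>x\<in>carrier eR. \<phi> (g x)"
  have l: "lin C eR N g" if "g \<in> mod_hom C eR N" for g using that by (rule mod_hom_lin)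
  have F: "lin R (coind N) (coind N') ?F"
  proof (rule linI)
    fix g assume "g \<in> carrier (coind N)"
    then show "?F g \<in> carrier (coind N')"
      using lin_mod_hom[OF left_module_eR lin_comp[OF l assms(3)], of g] by simp
  next
    fix f g assume "f \<in> carrier (coind N)" "g \<in> carrier (coind N)"
    then show "?F (f \<oplus>\<^bsub>coind N\<^esub> g) = ?F f \<oplus>\<^bsub>coind N'\<^esub> ?F g"
      using lin_closed[OF l] by (auto simp: fun_eq_iff lin_add[OF assms(3)])
  next
    fix b g assume "b \<in> carrier R" "g \<in> carrier (coind N)"
    then show "?F (b \<odot>\<^bsub>coind N\<^esub> g) = b \<odot>\<^bsub>coind N'\<^esub> ?F g"
      using eR_mult by (auto simp: fun_eq_iff)
  qed
  show ev': "?F (ev N n) = ev N' (\<phi> n)" if "n \<in> carrier N" for n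
    using that lin_smult[OF assms(3) eR_e that] by (auto simp: ev_def fun_eq_iff)
  let ?H = "{g \<in> carrier (coind N). ?F g \<in> ie_carrier N'}"
  have s: "submodule ?H R (coind N)"
    by (rule submodule_vimage[OF left_module_coind[OF assms(1)] left_module_coind[OF assms(2)] F ie(1)[OF assms(2)]])
  have "submodule (ie_carrier N \<inter> ?H) R (ie N)"
    using submodule_Int[OF left_module_coind[OF assms(1)] ie(1)[OF assms(1)] s]
    by (simp add: ie_def submodule_sub_iff[OF left_module_coind[OF assms(1)] ie(1)[OF assms(1)]] del: coind_simps)
  moreover have "ev N ` carrier N \<subseteq> ie_carrier N \<inter> ?H"
    using ie(3)[OF assms(1)] ev(1)[OF assms(1)] ie(3)[OF assms(2)] lin_closed[OF assms(3)] by (auto simp: ev')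
  ultimately have eq: "ie_carrier N \<inter> ?H = ie_carrier N" using ie(4)[OF assms(1)] by blast
  have "?F g \<in> ie_carrier N'" if "g \<in> ie_carrier N" for g
    using that eq by blast
  moreover have sub: "g \<in> carrier (coind N)" if "g \<in> carrier (ie N)" for g
    using that ie(5)[OF assms(1)] by auto
  ultimately show "lin R (ie N) (ie N') ?F"
    by (intro linI) (simp_all only: ie_simps lin_add[OF F sub sub] lin_smult[OF F _ sub])
qed

text \<open>A map of intermediate extensions commutes with \<open>e\<close>, so it carries the copy
  of \<open>N\<close> into the copy of \<open>N'\<close> and is there a map over the corner.\<close>

lemma ie_hom:
  assumes "left_module C N" "left_module C N'" "lin R (ie N) (ie N') F"
  shows "lin C N N' (\<lambda>n. F (ev N n) e)" "\<And>n. n \<in> carrier N \<Longrightarrow> F (ev N n) = ev N' (F (ev N n) e)"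
proof -
  have m: "F (ev N n) \<in> mod_hom C eR N'" if "n \<in> carrier N" for n
    using lin_closed[OF assms(3), of "ev N n"] ie(3)[OF assms(1) that] ie(5)[OF assms(2)] by auto
  have l: "lin C eR N' (F (ev N n))" if "n \<in> carrier N" for n using m[OF that] by (rule mod_hom_lin)
  show "lin C N N' (\<lambda>n. F (ev N n) e)"
  proof (rule linI)
    fix n assume "n \<in> carrier N"
    then show "F (ev N n) e \<in> carrier N'" using lin_closed[OF l e_in_eR] by blast
  next
    fix n n' assume n: "n \<in> carrier N" "n' \<in> carrier N"
    have "F (ev N (n \<oplus>\<^bsub>N\<^esub> n')) = F (ev N n) \<oplus>\<^bsub>coind N'\<^esub> F (ev N n')"
      using lin_add[OF assms(3), of "ev N n" "ev N n'"] ie(3)[OF assms(1)] n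
      by (simp add: ev_add[OF assms(1)] del: coind_simps)
    then show "F (ev N (n \<oplus>\<^bsub>N\<^esub> n')) e = F (ev N n) e \<oplus>\<^bsub>N'\<^esub> F (ev N n') e" by simp
  next
    fix c n assume c: "c \<in> carrier C" "n \<in> carrier N"
    then have cR: "c \<in> carrier R" "e \<otimes> c = c" "c \<otimes> e = c" by (auto simp: corner_carrier)
    have "F (ev N (c \<odot>\<^bsub>N\<^esub> n)) = c \<odot>\<^bsub>coind N'\<^esub> F (ev N n)"
      using lin_smult[OF assms(3) cR(1), of "ev N n"] ie(3)[OF assms(1)] c
      by (simp add: ev_smult[OF assms(1)] del: coind_simps)
    then have "F (ev N (c \<odot>\<^bsub>N\<^esub> n)) e = F (ev N n) c" using cR by simp
    also have "\<dots> = c \<odot>\<^bsub>N'\<^esub> F (ev N n) e" using lin_smult[OF l[OF c(2)] c(1) e_in_eR] cR by simp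
    finally show "F (ev N (c \<odot>\<^bsub>N\<^esub> n)) e = c \<odot>\<^bsub>N'\<^esub> F (ev N n) e" .
  qed
  show "F (ev N n) = ev N' (F (ev N n) e)" if n: "n \<in> carrier N" for n
  proof -
    have "F (ev N n) = F (e \<odot>\<^bsub>coind N\<^esub> ev N n)" by (simp only: e_smult_ev[OF assms(1) n])
    also have "\<dots> = e \<odot>\<^bsub>coind N'\<^esub> F (ev N n)"
      using lin_smult[OF assms(3) e_closed, of "ev N n"] ie(3)[OF assms(1) n] by (simp del: coind_simps)
    also have "\<dots> = ev N' (F (ev N n) e)" by (rule e_smult_coind[OF assms(2) m[OF n]])
    finally show ?thesis .
  qed
qed

text \<open>The copy of \<open>N\<close> generates, so a nonzero endomorphism does not vanish on it
  and induces a bijection of \<open>N\<close>; generation also makes it onto. It is injective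
  because every value \<open>g x\<close> is recovered, inside the copy of \<open>N\<close>, by
  acting on \<open>g\<close> with \<open>x\<close> and then \<open>e\<close>.\<close>

lemma ie_gbrick:
  assumes "gbrick C N"
  shows "gbrick R (ie N)"
proof -
  have N: "left_module C N" "fin_gen C N" using assms by (auto simp: gbrick_def)
  interpret N: left_module C N by (rule N(1))
  note I = ie[OF N(1)]
  have "bij_betw F (carrier (ie N)) (carrier (ie N))"
    if F: "lin R (ie N) (ie N) F" "g \<in> carrier (ie N)" "F g \<noteq> \<zero>\<^bsub>ie N\<^esub>" for F g
  proof -
    let ?f = "\<lambda>n. F (ev N n) e"
    note f = ie_hom[OF N(1) N(1) F(1)]
    have "\<exists>n\<in>carrier N. ?f n \<noteq> \<zero>\<^bsub>N\<^esub>"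
    proof (rule ccontr)
      assume "\<not> (\<exists>n\<in>carrier N. ?f n \<noteq> \<zero>\<^bsub>N\<^esub>)"
      then have z: "F (ev N n) = ev N \<zero>\<^bsub>N\<^esub>" if "n \<in> carrier N" for n using f(2)[OF that] that by simp
      have "ev N \<zero>\<^bsub>N\<^esub> = \<zero>\<^bsub>ie N\<^esub>" using eR_e by (auto simp: ev_def fun_eq_iff N.smult_zero_r)
      then have "ev N ` carrier N \<subseteq> {g \<in> carrier (ie N). F g = \<zero>\<^bsub>ie N\<^esub>}" using z I(3) by auto
      then have "{g \<in> carrier (ie N). F g = \<zero>\<^bsub>ie N\<^esub>} = ie_carrier N"
        by (rule I(4)[OF submodule_ker[OF I(2) I(2) F(1)]])
      then show False using F(2,3) by auto
    qed
    then have b: "bij_betw ?f (carrier N) (carrier N)" using assms f(1) by (auto simp: gbrick_def)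
    have "ev N ` carrier N \<subseteq> F ` carrier (ie N)"
    proof
      fix y assume "y \<in> ev N ` carrier N"
      then obtain n where n: "n \<in> carrier N" "y = ev N n" by blast
      then have "n \<in> ?f ` carrier N" using b by (simp add: bij_betw_def)
      then obtain n' where n': "n = ?f n'" "n' \<in> carrier N" by (rule imageE)
      then have "y = F (ev N n')" using f(2)[OF n'(2)] n(2) by simp
      then show "y \<in> F ` carrier (ie N)" using I(3)[OF n'(2)] by simp
    qed
    then have surj: "F ` carrier (ie N) = ie_carrier N"
      by (rule I(4)[OF submodule_range[OF I(2) I(2) F(1)]])
    have "g = \<zero>\<^bsub>ie N\<^esub>" if g: "g \<in> carrier (ie N)" "F g = \<zero>\<^bsub>ie N\<^esub>" for g
    proof -
      interpret W: left_module R "ie N" by (rule I(2))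
      have gm: "g \<in> mod_hom C eR N" using g(1) I(5) by auto
      have "g x = \<zero>\<^bsub>N\<^esub>" if x: "x \<in> carrier eR" for x
      proof -
        have xR: "x \<in> carrier R" "e \<otimes> x = x" using x by simp_all
        have xg: "x \<odot>\<^bsub>ie N\<^esub> g \<in> carrier (ie N)" using W.smult_closed[OF xR(1) g(1)] .
        have eg: "e \<odot>\<^bsub>ie N\<^esub> (x \<odot>\<^bsub>ie N\<^esub> g) = ev N (g x)"
          using e_smult_coind[OF N(1), of "x \<odot>\<^bsub>ie N\<^esub> g"] xg I(5) xR by auto
        have gx: "g x \<in> carrier N" using lin_closed[OF mod_hom_lin[OF gm] x] .
        have "F (ev N (g x)) = e \<odot>\<^bsub>ie N\<^esub> (x \<odot>\<^bsub>ie N\<^esub> F g)"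
          unfolding eg[symmetric] using lin_smult[OF F(1) e_closed xg] lin_smult[OF F(1) xR(1) g(1)] by (simp only:)
        also have "\<dots> = \<zero>\<^bsub>ie N\<^esub>" by (simp only: g(2) W.smult_zero_r[OF xR(1)] W.smult_zero_r[OF e_closed])
        finally have "?f (g x) = \<zero>\<^bsub>N\<^esub>" by simp
        then show ?thesis using b gx lin_inj_iff[OF N(1) N(1) f(1)] by (auto simp: bij_betw_def)
      qed
      then show ?thesis using mod_hom_eqI[OF gm, of "\<zero>\<^bsub>ie N\<^esub>"] W.M.zero_closed I(5) by auto
    qed
    then have "inj_on F (carrier (ie N))" by (simp only: lin_inj_iff[OF I(2) I(2) F(1)]) blast
    then show ?thesis using surj by (simp add: bij_betw_def)
  qed
  moreover have "\<exists>g\<in>carrier (ie N). g \<noteq> \<zero>\<^bsub>ie N\<^esub>"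
  proof -
    obtain n where n: "n \<in> carrier N" "n \<noteq> \<zero>\<^bsub>N\<^esub>" using assms by (auto simp: gbrick_def)
    then have "ev N n e \<noteq> \<zero>\<^bsub>ie N\<^esub> e" using ev(2)[OF N(1) n(1)] by simp
    then have "ev N n \<noteq> \<zero>\<^bsub>ie N\<^esub>" by metis
    moreover have "ev N n \<in> carrier (ie N)" using I(3)[OF n(1)] by simp
    ultimately show ?thesis by (rule bexI)
  qed
  ultimately show ?thesis using I(2) ie_fin_gen[OF N] unfolding gbrick_def by blast
qed

lemma directed_corner:
  assumes "directed R"
  shows "directed C"
proof (rule directed_transfer[OF assms, of C ie])
  fix N assume "brick C N"
  then show "gbrick R (ie N)" by (intro ie_gbrick) (simp add: brick_iff)
next
  fix N N' assume "brick C N" "brick C N'"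
  then have N: "left_module C N" "left_module C N'" by (auto simp: brickD)
  show "mod_iso C N N'" if iso: "mod_iso R (ie N) (ie N')"
  proof -
    note I = ie[OF N(1)] and I' = ie[OF N(2)]
    obtain F where F: "lin R (ie N) (ie N') F" "bij_betw F (carrier (ie N)) (carrier (ie N'))"
      using iso by (auto simp only: mod_iso_iff[OF I(2)])
    let ?G = "inv_into (carrier (ie N)) F"
    have G: "lin R (ie N') (ie N) ?G" by (rule lin_inv[OF I(2) F])
    note f = ie_hom[OF N F(1)] and g = ie_hom[OF N(2,1) G]
    have fc: "F (ev N n) e \<in> carrier N'" if "n \<in> carrier N" for n using lin_closed[OF f(1) that] .
    have gc: "?G (ev N' n) e \<in> carrier N" if "n \<in> carrier N'" for n using lin_closed[OF g(1) that] .
    have "?G (ev N' (F (ev N n) e)) e = n" if n: "n \<in> carrier N" for n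
    proof -
      have "?G (F (ev N n)) = ev N n" using F(2) I(3)[OF n] by (simp add: bij_betw_def)
      then show ?thesis using f(2)[OF n] ev(2)[OF N(1) n] by metis
    qed
    moreover have "F (ev N (?G (ev N' n) e)) e = n" if n: "n \<in> carrier N'" for n
    proof -
      have "ev N' n \<in> F ` carrier (ie N)" using F(2) I'(3)[OF n] by (simp add: bij_betw_def)
      then have "F (?G (ev N' n)) = ev N' n" by (rule f_inv_into_f)
      then show ?thesis using g(2)[OF n] ev(2)[OF N(2) n] by metis
    qed
    ultimately have "bij_betw (\<lambda>n. F (ev N n) e) (carrier N) (carrier N')"
      using fc gc by (intro bij_betw_byWitness[of _ "\<lambda>n. ?G (ev N' n) e"]) auto
    then show ?thesis using f(1) unfolding mod_iso_iff[OF N(1)] by blast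
  qed
  show "no_hom C N N'" if no: "no_hom R (ie N) (ie N')"
  proof (rule no_hom_I)
    fix \<phi> n assume \<phi>: "lin C N N' \<phi>" and n: "n \<in> carrier N"
    have "ev N' (\<phi> n) = \<zero>\<^bsub>ie N'\<^esub>"
      using no_hom_D[OF no ie_functor(1)[OF N \<phi>], of "ev N n"] ie(3)[OF N(1) n] ie_functor(2)[OF N \<phi> n]
      by (simp del: ie_simps(2) restrict_apply)
    then have "ev N' (\<phi> n) e = \<zero>\<^bsub>N'\<^esub>" by simp
    then show "\<phi> n = \<zero>\<^bsub>N'\<^esub>" using ev(2)[OF N(2) lin_closed[OF \<phi> n]] by simp
  qed
qed

end

section \<open>Spaces of homomorphisms\<close>

definition homK :: "('k \<Rightarrow> 'a) \<Rightarrow> ('a, 'x) ring_scheme \<Rightarrow> ('a, 'm, 'y) module_scheme \<Rightarrow>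
    ('a, 'n, 'z) module_scheme \<Rightarrow> ('k, 'm \<Rightarrow> 'n) module" where
  "homK \<rho> R M N = \<lparr>carrier = mod_hom R M N, mult = undefined, one = undefined,
     zero = (\<lambda>x\<in>carrier M. \<zero>\<^bsub>N\<^esub>), add = (\<lambda>f g. \<lambda>x\<in>carrier M. f x \<oplus>\<^bsub>N\<^esub> g x),
     smult = (\<lambda>c f. \<lambda>x\<in>carrier M. \<rho> c \<odot>\<^bsub>N\<^esub> f x)\<rparr>"

lemma homK_simps [simp]: "carrier (homK \<rho> R M N) = mod_hom R M N"
  "\<zero>\<^bsub>homK \<rho> R M N\<^esub> = (\<lambda>x\<in>carrier M. \<zero>\<^bsub>N\<^esub>)"
  "f \<oplus>\<^bsub>homK \<rho> R M N\<^esub> g = (\<lambda>x\<in>carrier M. f x \<oplus>\<^bsub>N\<^esub> g x)"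
  "c \<odot>\<^bsub>homK \<rho> R M N\<^esub> f = (\<lambda>x\<in>carrier M. \<rho> c \<odot>\<^bsub>N\<^esub> f x)"
  by (simp_all add: homK_def)

lemma central_fd_overD:
  assumes "central_fd_over K R \<rho>"
  shows "field K" "ring K" "ring R" "\<rho> \<in> ring_hom K R" "fd_over K R \<rho>" "artin R"
    "\<And>c x. c \<in> carrier K \<Longrightarrow> x \<in> carrier R \<Longrightarrow> \<rho> c \<otimes>\<^bsub>R\<^esub> x = x \<otimes>\<^bsub>R\<^esub> \<rho> c"
    "\<And>c. c \<in> carrier K \<Longrightarrow> \<rho> c \<in> carrier R"
  using assms fd_over_artin[of K R \<rho>] ring_hom_closed[of \<rho> K R]
  by (simp_all add: central_fd_over_def fd_over_def field_def domain_def cring_def)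

lemma lin_central_smult:
  assumes "central_fd_over K R \<rho>" "left_module R N" "lin R M N f" "c \<in> carrier K"
  shows "lin R M N (\<lambda>x. \<rho> c \<odot>\<^bsub>N\<^esub> f x)"
proof -
  interpret N: left_module R N by fact
  note D = central_fd_overD[OF assms(1)]
  show ?thesis
  proof (rule linI)
    fix a x assume a: "a \<in> carrier R" "x \<in> carrier M"
    then have "\<rho> c \<odot>\<^bsub>N\<^esub> (a \<odot>\<^bsub>N\<^esub> f x) = (a \<otimes>\<^bsub>R\<^esub> \<rho> c) \<odot>\<^bsub>N\<^esub> f x"
      using D(7,8) assms(4) lin_closed[OF assms(3)] by (simp flip: N.smult_assoc)
    then show "\<rho> c \<odot>\<^bsub>N\<^esub> f (a \<odot>\<^bsub>M\<^esub> x) = a \<odot>\<^bsub>N\<^esub> (\<rho> c \<odot>\<^bsub>N\<^esub> f x)"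
      using a D(8) assms(4) lin_closed[OF assms(3)] by (simp add: lin_smult[OF assms(3)] N.smult_assoc)
  qed (use D(8) assms(3,4) in \<open>simp_all add: lin_def N.smult_r_distr\<close>)
qed

lemma left_module_homK:
  assumes "central_fd_over K R \<rho>" "left_module R M" "left_module R N"
  shows "left_module K (homK \<rho> R M N)"
proof -
  interpret N: left_module R N by fact
  note D = central_fd_overD[OF assms(1)]
  have c: "f x \<in> carrier N" if "f \<in> mod_hom R M N" "x \<in> carrier M" for f x
    using that by (auto dest: mod_hom_lin simp: lin_def)
  have sm: "(\<lambda>x\<in>carrier M. \<rho> c \<odot>\<^bsub>N\<^esub> f x) \<in> mod_hom R M N" if "c \<in> carrier K" "f \<in> mod_hom R M N" for c f
    by (rule lin_mod_hom[OF assms(2) lin_central_smult[OF assms(1,3) mod_hom_lin[OF that(2)] that(1)]])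
  have ag: "abelian_group (homK \<rho> R M N)" by (rule abelian_group_hom_space[OF assms(2,3)]) simp_all
  show ?thesis
  proof (intro left_module.intro left_module_axioms.intro D(2) ag)
    fix f assume f: "f \<in> carrier (homK \<rho> R M N)"
    then have "(\<lambda>x\<in>carrier M. f x) = f" by (auto simp: mod_hom_def PiE_def extensional_restrict)
    moreover have "(\<lambda>x\<in>carrier M. \<rho> \<one>\<^bsub>K\<^esub> \<odot>\<^bsub>N\<^esub> f x) = (\<lambda>x\<in>carrier M. f x)"
      using c f by (auto simp: fun_eq_iff ring_hom_one[OF D(4)])
    ultimately show "\<one>\<^bsub>K\<^esub> \<odot>\<^bsub>homK \<rho> R M N\<^esub> f = f" by simp
  qed (use sm c D(8) in \<open>auto simp: fun_eq_iff ring_hom_add[OF D(4)] ring_hom_mult[OF D(4)]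
    N.smult_l_distr N.smult_r_distr N.smult_assoc\<close>)
qed

lemma lin_eval_homK:
  assumes "x \<in> carrier M"
  shows "lin K (homK \<rho> R M N) (restr \<rho> N) (\<lambda>f. f x)"
  using assms by (auto simp: lin_def dest: mod_hom_lin)

text \<open>A subspace of \<open>Hom(M, N)\<close> is measured along generators \<open>v\<^sub>0, v\<^sub>1, \<dots>\<close> of \<open>M\<close>: the \<open>i\<close>-th
  contribution is the space of values at \<open>v\<^sub>i\<close> of the maps vanishing at the earlier generators.\<close>

lemma FL_homK:
  fixes M :: "('a, 'm, 'y) module_scheme" and N :: "('a, 'n, 'z) module_scheme"
  assumes "central_fd_over K R \<rho>" "left_module R M" "fin_gen R M" "left_module R N" "fin_gen R N"
  shows "FL K (homK \<rho> R M N)"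
proof -
  interpret N: left_module R N by fact
  note D = central_fd_overD[OF assms(1)]
  note lH = left_module_homK[OF assms(1,2,4)]
  interpret HH: left_module K "homK \<rho> R M N" by (rule lH)
  note lN = left_module_restr[OF assms(4) D(2,4)]
  obtain d and n :: nat where d0: "\<forall>H. submodule H K (restr \<rho> N) \<longrightarrow> d H \<le> n"
    "\<forall>H H'. submodule H K (restr \<rho> N) \<longrightarrow> submodule H' K (restr \<rho> N) \<longrightarrow> H \<subset> H' \<longrightarrow> d H < d H'"
    by (rule FL_E[OF fd_over_FL_restr[OF D(5) assms(4,5)]]) (rule that)
  note d = d0(1)[rule_format] d0(2)[rule_format]
  obtain S where S: "finite S" "S \<subseteq> carrier M"
    and gen: "\<forall>H. submodule H R M \<longrightarrow> S \<subseteq> H \<longrightarrow> H = carrier M"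
    by (rule fin_genE[OF assms(3)]) (rule that)
  obtain vs where vs: "set vs = S" using S(1) finite_list by blast
  have v: "vs ! i \<in> carrier M" if "i < length vs" for i using that S(2) vs by auto
  define A where "A H i = {f (vs ! i) | f. f \<in> H \<and> (\<forall>j<i. f (vs ! j) = \<zero>\<^bsub>N\<^esub>)}" for H :: "('m \<Rightarrow> 'n) set" and i
  have AI: "f (vs ! i) \<in> A H i" if "f \<in> H" "\<forall>j<i. f (vs ! j) = \<zero>\<^bsub>N\<^esub>" for f H i
    using that by (auto simp: A_def)
  have subA: "submodule (A H i) K (restr \<rho> N)" if H: "submodule H K (homK \<rho> R M N)" and i: "i < length vs" for H i
  proof -
    have Hc: "H \<subseteq> mod_hom R M N" "\<zero>\<^bsub>homK \<rho> R M N\<^esub> \<in> H"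
      "\<And>f g. f \<in> H \<Longrightarrow> g \<in> H \<Longrightarrow> f \<oplus>\<^bsub>homK \<rho> R M N\<^esub> g \<in> H"
      "\<And>c f. c \<in> carrier K \<Longrightarrow> f \<in> H \<Longrightarrow> c \<odot>\<^bsub>homK \<rho> R M N\<^esub> f \<in> H"
      using H by (auto simp only: submodule_iff[OF lH] homK_simps(1))
    have vj: "vs ! j \<in> carrier M" if "j \<le> i" for j using v i that by simp
    show ?thesis unfolding submodule_iff[OF lN]
    proof (intro conjI ballI)
      show "A H i \<subseteq> carrier (restr \<rho> N)" using Hc(1) vj[of i] by (auto simp: A_def dest!: subsetD mod_hom_lin lin_closed)
      show "\<zero>\<^bsub>restr \<rho> N\<^esub> \<in> A H i" using AI[OF Hc(2), of i] vj by simp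
    next
      fix x y assume "x \<in> A H i" "y \<in> A H i"
      then obtain f g where f: "f \<in> H" "\<forall>j<i. f (vs ! j) = \<zero>\<^bsub>N\<^esub>" "x = f (vs ! i)"
        and g: "g \<in> H" "\<forall>j<i. g (vs ! j) = \<zero>\<^bsub>N\<^esub>" "y = g (vs ! i)" by (auto simp: A_def)
      show "x \<oplus>\<^bsub>restr \<rho> N\<^esub> y \<in> A H i" using AI[OF Hc(3)[OF f(1) g(1)], of i] f g vj by simp
    next
      fix c x assume c: "c \<in> carrier K" "x \<in> A H i"
      then obtain f where f: "f \<in> H" "\<forall>j<i. f (vs ! j) = \<zero>\<^bsub>N\<^esub>" "x = f (vs ! i)" by (auto simp: A_def)
      show "c \<odot>\<^bsub>restr \<rho> N\<^esub> x \<in> A H i"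
        using AI[OF Hc(4)[OF c(1) f(1)], of i] f vj c(1) D(8) by (simp add: N.smult_zero_r)
    qed
  qed
  have mono: "A H i \<subseteq> A H' i" if "H \<subseteq> H'" for H H' i using that by (auto simp: A_def)
  show ?thesis
  proof (rule FL_I[of K _ "\<lambda>H. \<Sum>i<length vs. d (A H i)" "length vs * n"])
    fix H assume H: "submodule H K (homK \<rho> R M N)"
    have "(\<Sum>i<length vs. d (A H i)) \<le> (\<Sum>i<length vs. n)" by (intro sum_mono d(1) subA[OF H]) simp
    then show "(\<Sum>i<length vs. d (A H i)) \<le> length vs * n" by simp
  next
    fix H H' assume H: "submodule H K (homK \<rho> R M N)" "submodule H' K (homK \<rho> R M N)" "H \<subset> H'"
    have Hs: "H' \<subseteq> mod_hom R M N" using H(2) by (simp add: submodule_iff[OF lH])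
    have "\<exists>i<length vs. A H i \<noteq> A H' i"
    proof (rule ccontr)
      assume "\<not> (\<exists>i<length vs. A H i \<noteq> A H' i)"
      then have eq: "A H i = A H' i" if "i < length vs" for i using that by blast
      \<comment> \<open>Elements of \<open>H'\<close> are matched from \<open>H\<close> on longer
        and longer initial segments of the generators. The error vanishes on the earlier generators,
        so its next value is taken by an element of \<open>H\<close> that vanishes there
        too.\<close>
      have ex: "\<exists>h\<in>H. \<forall>j<i. f (vs ! j) = h (vs ! j)" if f: "f \<in> H'" and i: "i \<le> length vs" for f i
        using i
      proof (induction i)
        case 0
        then show ?case using H(1) by (auto simp: submodule_iff[OF lH])
      next
        case (Suc i)
        then obtain h where h: "h \<in> H" "\<forall>j<i. f (vs ! j) = h (vs ! j)" by auto
        let ?g = "f \<ominus>\<^bsub>homK \<rho> R M N\<^esub> h"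
        have fh: "f \<in> carrier (homK \<rho> R M N)" "h \<in> carrier (homK \<rho> R M N)" using f h(1) H Hs by auto
        have g: "?g \<in> H'" using submodule_diff[OF lH H(2) f, of h] h(1) H(3) by blast
        have "?g (vs ! j) = \<zero>\<^bsub>N\<^esub>" if "j < i" for j
          using lin_eq_iff[OF lH lN lin_eval_homK[OF v] fh, of j] h(2) that Suc.prems by simp
        then have "?g (vs ! i) \<in> A H i" using AI[OF g, of i] eq[of i] Suc.prems by simp
        then obtain k where k: "k \<in> H" "\<forall>j<i. k (vs ! j) = \<zero>\<^bsub>N\<^esub>" "?g (vs ! i) = k (vs ! i)" by (auto simp: A_def)
        have hk: "h \<oplus>\<^bsub>homK \<rho> R M N\<^esub> k \<in> H" using H(1) h(1) k(1) by (simp only: submodule_iff[OF lH])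
        have hc: "h (vs ! j) \<in> carrier N" "k (vs ! j) \<in> carrier N" if "j \<le> i" for j
        proof -
          have "h \<in> mod_hom R M N" "k \<in> mod_hom R M N" using h(1) k(1) H(3) Hs by auto
          then show "h (vs ! j) \<in> carrier N" "k (vs ! j) \<in> carrier N"
            using v[of j] that Suc.prems by (auto dest!: mod_hom_lin lin_closed)
        qed
        have "f = ?g \<oplus>\<^bsub>homK \<rho> R M N\<^esub> h" using HH.M.diff_add_cancel_right[OF fh] by simp
        then have "f (vs ! i) = (?g \<oplus>\<^bsub>homK \<rho> R M N\<^esub> h) (vs ! i)" by (rule arg_cong)
        then have "f (vs ! i) = k (vs ! i) \<oplus>\<^bsub>N\<^esub> h (vs ! i)" using v[of i] Suc.prems k(3) by simp
        then have "f (vs ! j) = (h \<oplus>\<^bsub>homK \<rho> R M N\<^esub> k) (vs ! j)" if "j < Suc i" for j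
          using that h(2) k(2) hc[of j] v[of j] Suc.prems by (cases "j = i") (simp_all add: N.M.a_comm)
        then show ?case using hk by blast
      qed
      have "f \<in> H" if f: "f \<in> H'" for f
      proof -
        obtain h where h: "h \<in> H" "\<forall>j<length vs. f (vs ! j) = h (vs ! j)" using ex[OF f order_refl] by blast
        have fh: "f \<in> mod_hom R M N" "h \<in> mod_hom R M N" using f h(1) H(3) Hs by auto
        note fl = mod_hom_lin[OF fh(1)] and hl = mod_hom_lin[OF fh(2)]
        have "submodule {x \<in> carrier M. f x = h x} R M"
          using lin_zero[OF assms(2,4) fl] lin_zero[OF assms(2,4) hl] assms(2)
          by (auto simp: submodule_iff[OF assms(2)] lin_add[OF fl] lin_add[OF hl] lin_smult[OF fl] lin_smult[OF hl]
            left_module.smult_closed abelian_groupE left_module_def)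
        moreover have "S \<subseteq> {x \<in> carrier M. f x = h x}"
          using h(2) S(2) vs by (auto simp: in_set_conv_nth)
        ultimately have "{x \<in> carrier M. f x = h x} = carrier M" using gen by blast
        then have "f = h" by (intro mod_hom_eqI[OF fh]) blast
        then show ?thesis using h(1) by simp
      qed
      then show False using H(3) by blast
    qed
    then obtain i where i: "i < length vs" "A H i \<noteq> A H' i" by blast
    have le: "d (A H j) \<le> d (A H' j)" if "j < length vs" for j
    proof (cases "A H j = A H' j")
      case False
      then have "A H j \<subset> A H' j" using mono[of H H' j] H(3) by blast
      then show ?thesis using d(2)[OF subA[OF H(1) that] subA[OF H(2) that]] by simp
    qed simp
    have "d (A H i) < d (A H' i)" using d(2)[OF subA[OF H(1) i(1)] subA[OF H(2) i(1)]] mono[of H H' i] H(3) i(2) by blast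
    then show "(\<Sum>i<length vs. d (A H i)) < (\<Sum>i<length vs. d (A H' i))"
      using i(1) le by (intro sum_strict_mono_ex1) auto
  qed
qed

text \<open>Enlarge \<open>H\<close> to a maximal proper subspace \<open>H'\<close>; modulo
  \<open>H'\<close> every vector is a unique multiple of a fixed \<open>v\<close>, and the
  coefficient is the functional.\<close>

lemma ex_functional:
  fixes K :: "('k, 'x) ring_scheme" and M :: "('k, 'm, 'y) module_scheme"
  assumes "field K" "left_module K M" "FL K M" "submodule H K M" "H \<noteq> carrier M"
  obtains l where "lin K M (regular_module K) l" "\<forall>h\<in>H. l h = \<zero>\<^bsub>K\<^esub>" "\<exists>x\<in>carrier M. l x \<noteq> \<zero>\<^bsub>K\<^esub>"
proof -
  interpret K: field K by fact
  interpret M: left_module K M by fact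
  obtain H' where H': "submodule H' K M \<and> H \<subseteq> H' \<and> H' \<noteq> carrier M"
    "\<And>H''. submodule H'' K M \<and> H \<subseteq> H'' \<and> H'' \<noteq> carrier M \<Longrightarrow> H' \<subseteq> H'' \<Longrightarrow> H'' = H'"
    by (rule FL_max[OF assms(3), of "\<lambda>H'. submodule H' K M \<and> H \<subseteq> H' \<and> H' \<noteq> carrier M" H])
      (use assms(4,5) in auto)
  have sH: "submodule H' K M" using H'(1) by blast
  have Hc: "H' \<subseteq> carrier M" "\<zero>\<^bsub>M\<^esub> \<in> H'" "\<And>x y. x \<in> H' \<Longrightarrow> y \<in> H' \<Longrightarrow> x \<oplus>\<^bsub>M\<^esub> y \<in> H'"
    "\<And>a x. a \<in> carrier K \<Longrightarrow> x \<in> H' \<Longrightarrow> a \<odot>\<^bsub>M\<^esub> x \<in> H'"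
    using sH by (auto simp: submodule_iff[OF assms(2)])
  obtain v where v: "v \<in> carrier M" "v \<notin> H'" using H'(1) Hc(1) by blast
  let ?A = "{c \<odot>\<^bsub>M\<^esub> v \<oplus>\<^bsub>M\<^esub> m | c m. c \<in> carrier K \<and> m \<in> H'}"
  note A = submodule_adjoin[OF assms(2) sH v(1)]
  have "?A = carrier M"
  proof (rule ccontr)
    assume "?A \<noteq> carrier M"
    then have "?A = H'" using A H'(1) by (intro H'(2)) auto
    then show False using A(2) v(2) by blast
  qed
  then have ex: "\<exists>c m. c \<in> carrier K \<and> m \<in> H' \<and> y = c \<odot>\<^bsub>M\<^esub> v \<oplus>\<^bsub>M\<^esub> m" if "y \<in> carrier M" for y
    using that by blast
  \<comment> \<open>A nonzero difference of coefficients would be invertible and put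
    \<open>v\<close> into \<open>H'\<close>.\<close>
  have uniq: "c = c'" if c: "c \<in> carrier K" "c' \<in> carrier K" "m \<in> H'" "m' \<in> H'"
    "c \<odot>\<^bsub>M\<^esub> v \<oplus>\<^bsub>M\<^esub> m = c' \<odot>\<^bsub>M\<^esub> v \<oplus>\<^bsub>M\<^esub> m'" for c c' m m'
  proof (rule ccontr)
    assume ne: "c \<noteq> c'"
    have mc: "m \<in> carrier M" "m' \<in> carrier M" using c Hc(1) by auto
    have "c \<odot>\<^bsub>M\<^esub> v \<ominus>\<^bsub>M\<^esub> c' \<odot>\<^bsub>M\<^esub> v = m' \<ominus>\<^bsub>M\<^esub> m"
    proof -
      have "c \<odot>\<^bsub>M\<^esub> v = (c' \<odot>\<^bsub>M\<^esub> v \<oplus>\<^bsub>M\<^esub> m') \<ominus>\<^bsub>M\<^esub> m"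
        using c v(1) mc by (simp flip: c(5) add: a_minus_def M.M.a_assoc M.M.r_neg)
      then show ?thesis using c(2) v(1) mc
        by (simp add: a_minus_def M.M.a_ac M.M.r_neg1 M.M.r_neg)
    qed
    moreover have "(c \<ominus>\<^bsub>K\<^esub> c') \<odot>\<^bsub>M\<^esub> v = c \<odot>\<^bsub>M\<^esub> v \<ominus>\<^bsub>M\<^esub> c' \<odot>\<^bsub>M\<^esub> v"
    proof -
      have "(c \<ominus>\<^bsub>K\<^esub> c') \<odot>\<^bsub>M\<^esub> v \<oplus>\<^bsub>M\<^esub> c' \<odot>\<^bsub>M\<^esub> v = c \<odot>\<^bsub>M\<^esub> v"
        using c v(1) by (simp flip: M.smult_l_distr add: K.diff_add_cancel_right)
      then show ?thesis using c v(1)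
        by (metis K.minus_closed M.M.a_inv_closed M.M.add.m_assoc M.M.r_neg M.M.r_zero M.smult_closed a_minus_def)
    qed
    ultimately have "(c \<ominus>\<^bsub>K\<^esub> c') \<odot>\<^bsub>M\<^esub> v \<in> H'" using submodule_diff[OF assms(2) sH c(4,3)] by simp
    moreover have u: "c \<ominus>\<^bsub>K\<^esub> c' \<in> Units K" using ne c by (simp add: K.field_Units K.minus_eq_zero_iff)
    ultimately have "inv\<^bsub>K\<^esub> (c \<ominus>\<^bsub>K\<^esub> c') \<odot>\<^bsub>M\<^esub> ((c \<ominus>\<^bsub>K\<^esub> c') \<odot>\<^bsub>M\<^esub> v) \<in> H'"
      by (intro Hc(4)[OF K.Units_inv_closed])
    moreover have "inv\<^bsub>K\<^esub> (c \<ominus>\<^bsub>K\<^esub> c') \<odot>\<^bsub>M\<^esub> ((c \<ominus>\<^bsub>K\<^esub> c') \<odot>\<^bsub>M\<^esub> v) = v"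
      using M.smult_assoc[OF K.Units_inv_closed[OF u] K.Units_closed[OF u] v(1)] u v(1) by simp
    ultimately show False using v(2) by simp
  qed
  define l where "l y = (THE c. c \<in> carrier K \<and> (\<exists>m\<in>H'. y = c \<odot>\<^bsub>M\<^esub> v \<oplus>\<^bsub>M\<^esub> m))" for y
  have lI: "l y = c" if "c \<in> carrier K" "m \<in> H'" "y = c \<odot>\<^bsub>M\<^esub> v \<oplus>\<^bsub>M\<^esub> m" for y c m
    unfolding l_def using that uniq by (intro the_equality) blast+
  have "lin K M (regular_module K) l"
  proof (rule linI)
    fix y assume "y \<in> carrier M"
    then show "l y \<in> carrier (regular_module K)" using ex[of y] lI by auto
  next
    fix y z assume "y \<in> carrier M" "z \<in> carrier M"
    then obtain c m c' m' where *: "c \<in> carrier K" "m \<in> H'" "y = c \<odot>\<^bsub>M\<^esub> v \<oplus>\<^bsub>M\<^esub> m"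
      "c' \<in> carrier K" "m' \<in> H'" "z = c' \<odot>\<^bsub>M\<^esub> v \<oplus>\<^bsub>M\<^esub> m'" using ex by metis
    have mc: "m \<in> carrier M" "m' \<in> carrier M" using * Hc(1) by auto
    have "y \<oplus>\<^bsub>M\<^esub> z = (c \<oplus>\<^bsub>K\<^esub> c') \<odot>\<^bsub>M\<^esub> v \<oplus>\<^bsub>M\<^esub> (m \<oplus>\<^bsub>M\<^esub> m')"
      using * mc v(1) by (simp add: M.smult_l_distr M.M.a_ac)
    then have "l (y \<oplus>\<^bsub>M\<^esub> z) = c \<oplus>\<^bsub>K\<^esub> c'" using * by (intro lI[OF _ Hc(3)]) simp_all
    then show "l (y \<oplus>\<^bsub>M\<^esub> z) = l y \<oplus>\<^bsub>regular_module K\<^esub> l z" using lI[OF *(1-3)] lI[OF *(4-6)] by simp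
  next
    fix a y assume a: "a \<in> carrier K" and "y \<in> carrier M"
    then obtain c m where *: "c \<in> carrier K" "m \<in> H'" "y = c \<odot>\<^bsub>M\<^esub> v \<oplus>\<^bsub>M\<^esub> m" using ex by metis
    have mc: "m \<in> carrier M" using * Hc(1) by auto
    have "a \<odot>\<^bsub>M\<^esub> y = (a \<otimes>\<^bsub>K\<^esub> c) \<odot>\<^bsub>M\<^esub> v \<oplus>\<^bsub>M\<^esub> a \<odot>\<^bsub>M\<^esub> m"
      using * mc v(1) a by (simp add: M.smult_r_distr M.smult_assoc)
    then have "l (a \<odot>\<^bsub>M\<^esub> y) = a \<otimes>\<^bsub>K\<^esub> c" using * a by (intro lI[OF _ Hc(4)]) simp_all
    then show "l (a \<odot>\<^bsub>M\<^esub> y) = a \<odot>\<^bsub>regular_module K\<^esub> l y" using lI[OF *] by simp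
  qed
  moreover have "l h = \<zero>\<^bsub>K\<^esub>" if "h \<in> H" for h
    using that H'(1) Hc(1) v(1) by (intro lI[of _ h]) (auto simp: M.smult_zero_l)
  moreover have "l v = \<one>\<^bsub>K\<^esub>" using v(1) Hc(2) by (intro lI[of _ "\<zero>\<^bsub>M\<^esub>"]) simp_all
  ultimately show thesis using that[of l] v(1) K.one_not_zero by metis
qed

lemma finsum_restr: "finsum (restr \<rho> M) f I = finsum M f I"
  by (simp add: finsum_def finprod_def restr_def)

section \<open>Direct sums\<close>

lemma direct_sum_simps [simp]: "carrier (direct_sum I X) = (\<Pi>\<^sub>E i\<in>I. carrier (X i))"
  "\<zero>\<^bsub>direct_sum I X\<^esub> = (\<lambda>i\<in>I. \<zero>\<^bsub>X i\<^esub>)" "u \<oplus>\<^bsub>direct_sum I X\<^esub> v = (\<lambda>i\<in>I. u i \<oplus>\<^bsub>X i\<^esub> v i)"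
  "a \<odot>\<^bsub>direct_sum I X\<^esub> u = (\<lambda>i\<in>I. a \<odot>\<^bsub>X i\<^esub> u i)"
  by (simp_all add: direct_sum_def)

lemma direct_sum_mem: "u \<in> carrier (direct_sum I X) \<Longrightarrow> i \<in> I \<Longrightarrow> u i \<in> carrier (X i)"
  by auto

lemma left_module_direct_sum:
  assumes "ring R" "\<And>i. i \<in> I \<Longrightarrow> left_module R (X i)"
  shows "left_module R (direct_sum I X)"
proof -
  note ag = left_module.axioms(2)[OF assms(2)]
  have ext: "u = v" if "u \<in> carrier (direct_sum I X)" "v \<in> carrier (direct_sum I X)" "\<And>i. i \<in> I \<Longrightarrow> u i = v i" for u v
    using that unfolding direct_sum_simps(1) by (rule PiE_ext)
  note mem = direct_sum_mem[of _ I X]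
  have "abelian_group (direct_sum I X)"
  proof (rule abelian_groupI)
    fix u assume u: "u \<in> carrier (direct_sum I X)"
    let ?v = "\<lambda>i\<in>I. \<ominus>\<^bsub>X i\<^esub> u i"
    have "?v \<in> carrier (direct_sum I X)" using abelian_group.a_inv_closed[OF ag mem[OF u]] by simp
    moreover have "?v \<oplus>\<^bsub>direct_sum I X\<^esub> u = \<zero>\<^bsub>direct_sum I X\<^esub>"
      using abelian_group.l_neg[OF ag mem[OF u]] by (simp add: fun_eq_iff)
    ultimately show "\<exists>v\<in>carrier (direct_sum I X). v \<oplus>\<^bsub>direct_sum I X\<^esub> u = \<zero>\<^bsub>direct_sum I X\<^esub>" by blast
    have z: "\<zero>\<^bsub>direct_sum I X\<^esub> \<oplus>\<^bsub>direct_sum I X\<^esub> u \<in> carrier (direct_sum I X)"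
      using abelian_groupE(1,2)[OF ag] mem[OF u] by simp
    show "\<zero>\<^bsub>direct_sum I X\<^esub> \<oplus>\<^bsub>direct_sum I X\<^esub> u = u"
      by (rule ext[OF z u]) (use abelian_groupE(5)[OF ag mem[OF u]] in simp)
    fix v assume v: "v \<in> carrier (direct_sum I X)"
    show "u \<oplus>\<^bsub>direct_sum I X\<^esub> v \<in> carrier (direct_sum I X)"
      using abelian_groupE(1)[OF ag mem[OF u] mem[OF v]] by simp
    show "u \<oplus>\<^bsub>direct_sum I X\<^esub> v = v \<oplus>\<^bsub>direct_sum I X\<^esub> u"
      using abelian_groupE(4)[OF ag mem[OF u] mem[OF v]] by (simp add: fun_eq_iff)
    fix w assume w: "w \<in> carrier (direct_sum I X)"
    show "(u \<oplus>\<^bsub>direct_sum I X\<^esub> v) \<oplus>\<^bsub>direct_sum I X\<^esub> w = u \<oplus>\<^bsub>direct_sum I X\<^esub> (v \<oplus>\<^bsub>direct_sum I X\<^esub> w)"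
      using abelian_groupE(3)[OF ag mem[OF u] mem[OF v] mem[OF w]] by (simp add: fun_eq_iff)
  qed (use abelian_groupE(2)[OF ag] in simp)
  then show ?thesis
  proof (intro left_module.intro left_module_axioms.intro assms(1))
    fix u assume u: "u \<in> carrier (direct_sum I X)"
    have c: "\<one>\<^bsub>R\<^esub> \<odot>\<^bsub>direct_sum I X\<^esub> u \<in> carrier (direct_sum I X)"
      using left_module.smult_one[OF assms(2) mem[OF u]] mem[OF u] by simp
    show "\<one>\<^bsub>R\<^esub> \<odot>\<^bsub>direct_sum I X\<^esub> u = u"
      by (rule ext[OF c u]) (use left_module.smult_one[OF assms(2) mem[OF u]] in simp)
    fix a assume a: "a \<in> carrier R"
    show "a \<odot>\<^bsub>direct_sum I X\<^esub> u \<in> carrier (direct_sum I X)"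
      using left_module.smult_closed[OF assms(2) a mem[OF u]] by simp
    fix v assume v: "v \<in> carrier (direct_sum I X)"
    show "a \<odot>\<^bsub>direct_sum I X\<^esub> (u \<oplus>\<^bsub>direct_sum I X\<^esub> v) =
        a \<odot>\<^bsub>direct_sum I X\<^esub> u \<oplus>\<^bsub>direct_sum I X\<^esub> a \<odot>\<^bsub>direct_sum I X\<^esub> v"
      using left_module.smult_r_distr[OF assms(2) a mem[OF u] mem[OF v]] by (simp add: fun_eq_iff)
  next
    fix a b u assume ab: "a \<in> carrier R" "b \<in> carrier R" and u: "u \<in> carrier (direct_sum I X)"
    show "(a \<oplus>\<^bsub>R\<^esub> b) \<odot>\<^bsub>direct_sum I X\<^esub> u =
        a \<odot>\<^bsub>direct_sum I X\<^esub> u \<oplus>\<^bsub>direct_sum I X\<^esub> b \<odot>\<^bsub>direct_sum I X\<^esub> u"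
      using left_module.smult_l_distr[OF assms(2) ab mem[OF u]] by (simp add: fun_eq_iff)
    show "(a \<otimes>\<^bsub>R\<^esub> b) \<odot>\<^bsub>direct_sum I X\<^esub> u = a \<odot>\<^bsub>direct_sum I X\<^esub> (b \<odot>\<^bsub>direct_sum I X\<^esub> u)"
      using left_module.smult_assoc[OF assms(2) ab mem[OF u]] by (simp add: fun_eq_iff)
  qed
qed

text \<open>The inclusion of the \<open>i\<close>-th summand. Indices come from an arbitrary set, so
  that direct sums may be indexed by sets of generators.\<close>

definition dinc :: "'i set \<Rightarrow> ('i \<Rightarrow> ('a, 'm) module) \<Rightarrow> 'i \<Rightarrow> 'm \<Rightarrow> 'i \<Rightarrow> 'm" where
  "dinc I X i x = (\<lambda>j\<in>I. if j = i then x else \<zero>\<^bsub>X j\<^esub>)"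

lemma lin_proj: "i \<in> I \<Longrightarrow> lin R (direct_sum I X) (X i) (\<lambda>u. u i)"
  by (auto simp: lin_def)

lemma lin_tuple:
  assumes "\<And>i. i \<in> I \<Longrightarrow> lin R M (X i) (f i)"
  shows "lin R M (direct_sum I X) (\<lambda>m. \<lambda>i\<in>I. f i m)"
  using assms by (auto simp: lin_def fun_eq_iff)

lemma lin_dinc:
  assumes "\<And>i. i \<in> I \<Longrightarrow> left_module R (X i)" "i \<in> I"
  shows "lin R (X i) (direct_sum I X) (dinc I X i)"
proof -
  have "lin R (X i) (X j) (\<lambda>x. if j = i then x else \<zero>\<^bsub>X j\<^esub>)" if "j \<in> I" for j
    using lin_id[of R "X i"] lin_const_zero[OF assms(1)[OF that]] by (cases "j = i") simp_all
  from lin_tuple[OF this] show ?thesis by (simp add: dinc_def[abs_def])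
qed

lemma direct_sum_decomp:
  assumes "ring R" "finite I" "\<And>i. i \<in> I \<Longrightarrow> left_module R (X i)" "u \<in> carrier (direct_sum I X)"
  shows "finsum (direct_sum I X) (\<lambda>i. dinc I X i (u i)) I = u"
proof -
  note lD = left_module_direct_sum[OF assms(1,3)]
  interpret D: left_module R "direct_sum I X" by (rule lD) simp
  note u = direct_sum_mem[OF assms(4)]
  have c: "dinc I X i (u i) \<in> carrier (direct_sum I X)" if "i \<in> I" for i
    by (rule lin_closed[OF lin_dinc[of I R X i] u[OF that]]) (use assms(3) that in auto)
  let ?s = "finsum (direct_sum I X) (\<lambda>i. dinc I X i (u i)) I"
  have sc: "?s \<in> carrier (direct_sum I X)" using c by (intro D.M.finsum_closed) auto
  have "?s j = u j" if j: "j \<in> I" for j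
  proof -
    interpret Xj: left_module R "X j" by (rule assms(3)[OF j])
    have "?s j = finsum (X j) (\<lambda>i. dinc I X i (u i) j) I"
      by (rule lin_of_finsum[OF D.left_module_axioms Xj.left_module_axioms lin_proj[OF j] c])
    also have "\<dots> = finsum (X j) (\<lambda>i. if j = i then u i else \<zero>\<^bsub>X j\<^esub>) I"
      using j u by (intro Xj.M.finsum_cong') (auto simp: dinc_def)
    also have "(\<lambda>i. if j = i then u i else \<zero>\<^bsub>X j\<^esub>) =
        (\<lambda>i. if j = i then (if i = j then u i else \<zero>\<^bsub>X j\<^esub>) else \<zero>\<^bsub>X j\<^esub>)" by auto
    also have "finsum (X j) \<dots> I = u j"
      using Xj.M.finsum_singleton[OF j assms(2), of "\<lambda>i. if i = j then u i else \<zero>\<^bsub>X j\<^esub>"] u[OF j] by auto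
    finally show ?thesis .
  qed
  then show ?thesis using sc assms(4) unfolding direct_sum_simps(1) by (rule PiE_ext[rotated 2])
qed

lemma lin_cotuple:
  assumes "ring R" "\<And>i. i \<in> I \<Longrightarrow> left_module R (X i)" "left_module R N" "\<And>i. i \<in> I \<Longrightarrow> lin R (X i) N (f i)"
  shows "lin R (direct_sum I X) N (\<lambda>u. finsum N (\<lambda>i. f i (u i)) I)"
proof -
  have "lin R (direct_sum I X) N (\<lambda>u. f i (u i))" if "i \<in> I" for i
    by (rule lin_comp[of R _ "X i" "\<lambda>u. u i" N "f i"]) (rule lin_proj[OF that], rule assms(4)[OF that])
  moreover have "left_module R (direct_sum I X)" by (rule left_module_direct_sum[OF assms(1,2)])
  ultimately show ?thesis by (intro lin_finsum[of R _ N I "\<lambda>i u. f i (u i)"] assms(3))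
qed

lemma lin_direct_sum_eq:
  assumes "ring R" "finite I" "\<And>i. i \<in> I \<Longrightarrow> left_module R (X i)" "left_module R N"
    "lin R (direct_sum I X) N h" "u \<in> carrier (direct_sum I X)"
  shows "h u = finsum N (\<lambda>i. h (dinc I X i (u i))) I"
proof -
  note lD = left_module_direct_sum[OF assms(1,3)]
  have "dinc I X i (u i) \<in> carrier (direct_sum I X)" if "i \<in> I" for i
    by (rule lin_closed[OF lin_dinc[of I R X i] direct_sum_mem[OF assms(6) that]]) (use assms(3) that in auto)
  then have "h (finsum (direct_sum I X) (\<lambda>i. dinc I X i (u i)) I) = finsum N (\<lambda>i. h (dinc I X i (u i))) I"
    by (intro lin_of_finsum[OF lD assms(4,5)]) auto
  then show ?thesis using direct_sum_decomp[OF assms(1,2,3,6)] by simp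
qed

lemma submodule_finsum:
  assumes "left_module R M" "submodule H R M" "\<And>i. i \<in> I \<Longrightarrow> f i \<in> H"
  shows "finsum M f I \<in> H"
proof -
  interpret M: left_module R M by fact
  have H: "H \<subseteq> carrier M" "\<zero>\<^bsub>M\<^esub> \<in> H" "\<And>x y. x \<in> H \<Longrightarrow> y \<in> H \<Longrightarrow> x \<oplus>\<^bsub>M\<^esub> y \<in> H"
    using assms(2) by (auto simp: submodule_iff[OF assms(1)])
  show ?thesis using assms(3)
  proof (induction I rule: infinite_finite_induct)
    case (insert i I)
    then have "finsum M f (insert i I) = f i \<oplus>\<^bsub>M\<^esub> finsum M f I"
      using H(1) by (intro M.M.finsum_insert) auto
    then show ?case using insert H(3) by simp
  qed (simp_all add: H(2) M.M.finsum_infinite)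
qed

lemma fin_gen_direct_sum:
  assumes "ring R" "finite I" "\<And>i. i \<in> I \<Longrightarrow> left_module R (X i)" "\<And>i. i \<in> I \<Longrightarrow> fin_gen R (X i)"
  shows "fin_gen R (direct_sum I X)"
proof -
  note lD = left_module_direct_sum[OF assms(1,3)]
  have "\<forall>i\<in>I. \<exists>S. finite S \<and> S \<subseteq> carrier (X i) \<and>
     (\<forall>H. submodule H R (X i) \<longrightarrow> S \<subseteq> H \<longrightarrow> H = carrier (X i))"
  proof
    fix i assume "i \<in> I"
    obtain S where "finite S" "S \<subseteq> carrier (X i)" "\<forall>H. submodule H R (X i) \<longrightarrow> S \<subseteq> H \<longrightarrow> H = carrier (X i)"
      by (rule fin_genE[OF assms(4)[OF \<open>i \<in> I\<close>]]) (rule that)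
    then show "\<exists>S. finite S \<and> S \<subseteq> carrier (X i) \<and> (\<forall>H. submodule H R (X i) \<longrightarrow> S \<subseteq> H \<longrightarrow> H = carrier (X i))"
      by blast
  qed
  then obtain S where S: "\<forall>i\<in>I. finite (S i) \<and> S i \<subseteq> carrier (X i) \<and>
     (\<forall>H. submodule H R (X i) \<longrightarrow> S i \<subseteq> H \<longrightarrow> H = carrier (X i))" by (rule bchoice[THEN exE])
  have di: "lin R (X i) (direct_sum I X) (dinc I X i)" if "i \<in> I" for i
    by (rule lin_dinc[of I R X i]) (use assms(3) that in auto)
  show ?thesis
  proof (rule fin_genI[of "\<Union>i\<in>I. dinc I X i ` S i"])
    show "finite (\<Union>i\<in>I. dinc I X i ` S i)" using assms(2) S by simp
    show "(\<Union>i\<in>I. dinc I X i ` S i) \<subseteq> carrier (direct_sum I X)"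
      using S lin_closed[OF di] by blast
  next
    fix H assume H: "submodule H R (direct_sum I X)" "(\<Union>i\<in>I. dinc I X i ` S i) \<subseteq> H"
    have "dinc I X i x \<in> H" if i: "i \<in> I" and x: "x \<in> carrier (X i)" for i x
    proof -
      have "submodule {x \<in> carrier (X i). dinc I X i x \<in> H} R (X i)"
        by (rule submodule_vimage[OF assms(3)[OF i] lD di[OF i] H(1)])
      moreover have "S i \<subseteq> {x \<in> carrier (X i). dinc I X i x \<in> H}" using S i H(2) by blast
      ultimately have "{x \<in> carrier (X i). dinc I X i x \<in> H} = carrier (X i)" using S i by blast
      then show ?thesis using x by blast
    qed
    then have "u \<in> H" if "u \<in> carrier (direct_sum I X)" for u
      using submodule_finsum[OF lD H(1), of I "\<lambda>i. dinc I X i (u i)"] direct_sum_decomp[OF assms(1-3) that] that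
      direct_sum_mem[OF that] by simp
    then show "H = carrier (direct_sum I X)" using H(1) by (auto simp only: submodule_iff[OF lD])
  qed
qed

section \<open>Projective modules\<close>

text \<open>The dual basis criterion for finitely generated projectives. Unlike
  \<open>projective\<close>, which quantifies over modules on lists only, it gives lifts along maps
  between modules of any carrier type.\<close>

definition dual_basis :: "('a, 'x) ring_scheme \<Rightarrow> ('a, 'm, 'y) module_scheme \<Rightarrow> 'i set \<Rightarrow> ('i \<Rightarrow> 'm) \<Rightarrow>
    ('i \<Rightarrow> 'm \<Rightarrow> 'a) \<Rightarrow> bool" where
  "dual_basis R P I p \<phi> \<longleftrightarrow> finite I \<and> (\<forall>i\<in>I. p i \<in> carrier P \<and> lin R P (regular_module R) (\<phi> i)) \<and>
     (\<forall>x\<in>carrier P. finsum P (\<lambda>i. \<phi> i x \<odot>\<^bsub>P\<^esub> p i) I = x)"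

lemma dual_basisD:
  assumes "dual_basis R P I p \<phi>"
  shows "finite I" "\<And>i. i \<in> I \<Longrightarrow> p i \<in> carrier P" "\<And>i. i \<in> I \<Longrightarrow> lin R P (regular_module R) (\<phi> i)"
    "\<And>i x. i \<in> I \<Longrightarrow> x \<in> carrier P \<Longrightarrow> \<phi> i x \<in> carrier R"
    "\<And>x. x \<in> carrier P \<Longrightarrow> finsum P (\<lambda>i. \<phi> i x \<odot>\<^bsub>P\<^esub> p i) I = x"
  using assms lin_closed[of R P "regular_module R"] by (auto simp: dual_basis_def)

lemma lin_smult_const:
  assumes "left_module R M" "x \<in> carrier M" "lin R P (regular_module R) u"
  shows "lin R P M (\<lambda>y. u y \<odot>\<^bsub>M\<^esub> x)"
proof -
  interpret M: left_module R M by fact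
  show ?thesis using assms(2,3) by (auto simp: lin_def M.smult_l_distr M.smult_assoc)
qed

lemma dual_basis_expand:
  assumes "dual_basis R P I p \<phi>" "left_module R P" "left_module R M" "lin R P M h" "x \<in> carrier P"
  shows "h x = finsum M (\<lambda>i. \<phi> i x \<odot>\<^bsub>M\<^esub> h (p i)) I"
proof -
  interpret P: left_module R P by fact
  interpret M: left_module R M by fact
  note D = dual_basisD[OF assms(1)]
  have "h x = h (finsum P (\<lambda>i. \<phi> i x \<odot>\<^bsub>P\<^esub> p i) I)" using D(5)[OF assms(5)] by simp
  also have "\<dots> = finsum M (\<lambda>i. h (\<phi> i x \<odot>\<^bsub>P\<^esub> p i)) I"
    using D(2,4) assms(5) by (intro lin_of_finsum[OF assms(2-4)]) auto
  also have "\<dots> = finsum M (\<lambda>i. \<phi> i x \<odot>\<^bsub>M\<^esub> h (p i)) I"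
    using D(2,4) assms(5) lin_closed[OF assms(4)]
    by (intro M.M.finsum_cong') (auto simp: lin_smult[OF assms(4)])
  finally show ?thesis .
qed

text \<open>The lift is explicit: preimages of the \<open>h (p i)\<close>, combined with the
  coordinates \<open>\<phi> i\<close>. Accordingly only the image of \<open>h\<close> has to be
  covered by \<open>g\<close>.\<close>

lemma dual_basis_lift:
  assumes "dual_basis R P I p \<phi>" "left_module R P" "left_module R M" "left_module R N"
    "lin R M N g" "lin R P N h" "h ` carrier P \<subseteq> g ` carrier M"
  obtains l where "lin R P M l" "\<forall>x\<in>carrier P. g (l x) = h x"
proof -
  interpret M: left_module R M by fact
  interpret N: left_module R N by fact
  note D = dual_basisD[OF assms(1)]
  define m where "m i = inv_into (carrier M) g (h (p i))" for i
  have m: "m i \<in> carrier M" "g (m i) = h (p i)" if "i \<in> I" for i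
  proof -
    have "h (p i) \<in> g ` carrier M" using D(2)[OF that] assms(7) by blast
    then show "m i \<in> carrier M" "g (m i) = h (p i)" unfolding m_def by (simp_all add: inv_into_into f_inv_into_f)
  qed
  let ?l = "\<lambda>x. finsum M (\<lambda>i. \<phi> i x \<odot>\<^bsub>M\<^esub> m i) I"
  have "lin R P M ?l"
    by (intro lin_finsum[of R P M I "\<lambda>i x. \<phi> i x \<odot>\<^bsub>M\<^esub> m i"] lin_smult_const assms(2,3) m(1) D(3))
  moreover have "g (?l x) = h x" if x: "x \<in> carrier P" for x
  proof -
    have "g (?l x) = finsum N (\<lambda>i. g (\<phi> i x \<odot>\<^bsub>M\<^esub> m i)) I"
      using D(4) m x by (intro lin_of_finsum[OF assms(3-5)]) auto
    also have "\<dots> = finsum N (\<lambda>i. \<phi> i x \<odot>\<^bsub>N\<^esub> h (p i)) I"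
      using D(2,4) m x lin_closed[OF assms(6)] by (intro N.M.finsum_cong') (auto simp: lin_smult[OF assms(5)])
    also have "\<dots> = h x" by (rule dual_basis_expand[OF assms(1,2,4,6) x, symmetric])
    finally show ?thesis .
  qed
  ultimately show thesis using that by blast
qed

text \<open>Applied to summands of free modules and to copies of them on lists.\<close>

lemma dual_basis_retract:
  assumes "dual_basis R P I p \<phi>" "left_module R P" "left_module R Q" "lin R P Q r" "lin R Q P s"
    "\<And>x. x \<in> carrier Q \<Longrightarrow> r (s x) = x"
  shows "dual_basis R Q I (\<lambda>i. r (p i)) (\<lambda>i x. \<phi> i (s x))"
proof -
  note D = dual_basisD[OF assms(1)]
  have "finsum Q (\<lambda>i. \<phi> i (s x) \<odot>\<^bsub>Q\<^esub> r (p i)) I = x" if x: "x \<in> carrier Q" for x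
    using dual_basis_expand[OF assms(1-4) lin_closed[OF assms(5) x]] assms(6)[OF x] by simp
  then show ?thesis unfolding dual_basis_def
    using D(1,2) lin_closed[OF assms(4)] lin_comp[OF assms(5) D(3)] by auto
qed

lemma dual_basis_free:
  assumes "ring R" "finite I"
  shows "dual_basis R (direct_sum I (\<lambda>_. regular_module R)) I (\<lambda>i. dinc I (\<lambda>_. regular_module R) i \<one>\<^bsub>R\<^esub>) (\<lambda>i u. u i)"
proof -
  interpret R: ring R by fact
  let ?X = "\<lambda>_. regular_module R" let ?F = "direct_sum I ?X"
  have lr: "left_module R (regular_module R)" by (rule left_module_regular[OF assms(1)])
  have d: "lin R (regular_module R) ?F (dinc I ?X i)" if "i \<in> I" for i
    by (rule lin_dinc[of I R ?X i]) (use lr that in auto)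
  have lF: "left_module R ?F" by (rule left_module_direct_sum[OF assms(1)]) (rule lr)
  interpret F: left_module R ?F by (rule lF)
  have "finsum ?F (\<lambda>i. u i \<odot>\<^bsub>?F\<^esub> dinc I ?X i \<one>\<^bsub>R\<^esub>) I = u" if u: "u \<in> carrier ?F" for u
  proof -
    have ui: "u i \<in> carrier R" if "i \<in> I" for i using direct_sum_mem[OF u that] by simp
    have "finsum ?F (\<lambda>i. u i \<odot>\<^bsub>?F\<^esub> dinc I ?X i \<one>\<^bsub>R\<^esub>) I = finsum ?F (\<lambda>i. dinc I ?X i (u i)) I"
    proof (rule F.M.finsum_cong')
      show "(\<lambda>i. dinc I ?X i (u i)) \<in> I \<rightarrow> carrier ?F" using lin_closed[OF d] ui by (simp del: direct_sum_simps)
      fix i assume i: "i \<in> I"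
      show "u i \<odot>\<^bsub>?F\<^esub> dinc I ?X i \<one>\<^bsub>R\<^esub> = dinc I ?X i (u i)"
        using lin_smult[OF d[OF i], of "u i" "\<one>\<^bsub>R\<^esub>"] ui[OF i] by (simp del: direct_sum_simps)
    qed simp
    also have "\<dots> = u" by (rule direct_sum_decomp[OF assms _ u]) (rule lr)
    finally show ?thesis .
  qed
  moreover have "lin R ?F (regular_module R) (\<lambda>u. u i)" if "i \<in> I" for i using lin_proj[OF that, of R ?X] by simp
  moreover have "dinc I ?X i \<one>\<^bsub>R\<^esub> \<in> carrier ?F" if "i \<in> I" for i
    using lin_closed[OF d[OF that], of "\<one>\<^bsub>R\<^esub>"] by (simp del: direct_sum_simps)
  ultimately show ?thesis using assms(2) unfolding dual_basis_def by blast
qed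

lemma ex_free_cover:
  fixes M :: "('a, 'm, 'y) module_scheme"
  assumes "left_module R M" "fin_gen R M"
  obtains P and I :: "'m set" and p \<phi> g where "P \<in> fgmod R" "dual_basis R P I p \<phi>" "lin R P M g"
    "g ` carrier P = carrier M"
proof -
  interpret M: left_module R M by fact
  obtain S where S: "finite S" "S \<subseteq> carrier M"
    and gen: "\<forall>H. submodule H R M \<longrightarrow> S \<subseteq> H \<longrightarrow> H = carrier M"
    by (rule fin_genE[OF assms(2)]) (rule that)
  let ?X = "\<lambda>_. regular_module R" let ?F = "direct_sum S ?X"
  have lr: "left_module R (regular_module R)" by (rule left_module_regular[OF M.R.ring_axioms])
  have lF: "left_module R ?F" by (rule left_module_direct_sum[OF M.R.ring_axioms]) (rule lr)
  have db: "dual_basis R ?F S (\<lambda>i. dinc S ?X i \<one>\<^bsub>R\<^esub>) (\<lambda>i u. u i)"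
    by (rule dual_basis_free[OF M.R.ring_axioms S(1)])
  have fr: "fin_gen R (regular_module R)"
  proof (rule fin_genI[of "{\<one>\<^bsub>R\<^esub>}"])
    fix H assume H: "submodule H R (regular_module R)" "{\<one>\<^bsub>R\<^esub>} \<subseteq> H"
    then have "\<forall>a\<in>carrier R. \<forall>x\<in>H. a \<otimes>\<^bsub>R\<^esub> x \<in> H" "\<one>\<^bsub>R\<^esub> \<in> H" by (auto simp: submodule_iff[OF lr])
    then have "a \<otimes>\<^bsub>R\<^esub> \<one>\<^bsub>R\<^esub> \<in> H" if "a \<in> carrier R" for a using that by blast
    then have "a \<in> H" if "a \<in> carrier R" for a using that by (metis M.R.r_one)
    then show "H = carrier (regular_module R)" using H(1) by (auto simp: submodule_iff[OF lr])
  qed simp_all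
  have fF: "fin_gen R ?F" by (rule fin_gen_direct_sum[OF M.R.ring_axioms S(1)]) (rule lr fr)+
  let ?g = "\<lambda>u. finsum M (\<lambda>s. u s \<odot>\<^bsub>M\<^esub> s) S"
  have g: "lin R ?F M ?g"
    using S(2) by (intro lin_finsum[of R ?F M S "\<lambda>s u. u s \<odot>\<^bsub>M\<^esub> s"] lF assms(1) lin_smult_const)
      (auto simp: lin_def)
  have "s \<in> ?g ` carrier ?F" if s: "s \<in> S" for s
  proof
    show "dinc S ?X s \<one>\<^bsub>R\<^esub> \<in> carrier ?F" by (rule dual_basisD(2)[OF db s])
    have "?g (dinc S ?X s \<one>\<^bsub>R\<^esub>) = finsum M (\<lambda>t. if s = t then t else \<zero>\<^bsub>M\<^esub>) S"
      using S(2) by (intro M.M.finsum_cong') (auto simp: dinc_def M.smult_zero_l)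
    also have "\<dots> = s" using M.M.finsum_singleton[OF s S(1), of "\<lambda>t. t"] S(2) by auto
    finally show "s = ?g (dinc S ?X s \<one>\<^bsub>R\<^esub>)" by simp
  qed
  then have gs: "?g ` carrier ?F = carrier M"
    using gen submodule_range[OF lF assms(1) g] by blast
  obtain P :: "('a, 'a list) module" and h where P: "P \<in> fgmod R" "left_module R P"
    "lin R ?F P h" "bij_betw h (carrier ?F) (carrier P)" by (rule ex_fgmod[OF lF fF]) (rule that)
  let ?k = "inv_into (carrier ?F) h"
  have k: "lin R P ?F ?k" "?k ` carrier P = carrier ?F" "\<And>x. x \<in> carrier P \<Longrightarrow> h (?k x) = x"
    using lin_inv[OF lF P(3,4)] bij_betw_inv_into[OF P(4)] P(4) by (auto simp: bij_betw_def f_inv_into_f)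
  have "dual_basis R P S (\<lambda>i. h (dinc S ?X i \<one>\<^bsub>R\<^esub>)) (\<lambda>i x. ?k x i)"
    by (rule dual_basis_retract[OF db lF P(2,3) k(1)]) (rule k(3))
  moreover have "lin R P M (\<lambda>x. ?g (?k x))" by (rule lin_comp[OF k(1) g])
  moreover have "(\<lambda>x. ?g (?k x)) ` carrier P = ?g ` ?k ` carrier P" by (simp only: image_image)
  then have "(\<lambda>x. ?g (?k x)) ` carrier P = carrier M" by (simp only: k(2) gs)
  ultimately show thesis using P(1) that by blast
qed

lemma dual_basis_projective:
  assumes "P \<in> fgmod R" "dual_basis R P I p \<phi>"
  shows "projective R P"
  unfolding projective_def
proof (intro conjI ballI impI assms(1))
  fix M N g h assume M: "M \<in> fgmod R" "N \<in> fgmod R" and g: "g \<in> mod_hom R M N" and h: "h \<in> mod_hom R P N"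
    and s: "g ` carrier M = carrier N"
  note l = fgmodD(1)[OF assms(1)] fgmodD(1)[OF M(1)] fgmodD(1)[OF M(2)]
  have "h ` carrier P \<subseteq> g ` carrier M" using lin_closed[OF mod_hom_lin[OF h]] s by auto
  then obtain k where k: "lin R P M k" "\<forall>x\<in>carrier P. g (k x) = h x"
    by (rule dual_basis_lift[OF assms(2) l mod_hom_lin[OF g] mod_hom_lin[OF h]])
  have "compose (carrier P) g (restrict k (carrier P)) = h"
    using k(2) h by (auto simp: compose_def mod_hom_def PiE_def intro!: extensionalityI[of _ "carrier P"])
  then show "\<exists>l\<in>mod_hom R P M. compose (carrier P) g l = h" using lin_mod_hom[OF l(1) k(1)] by blast
qed

lemma projective_dual_basis:
  assumes "projective R P"
  obtains I :: "'a list set" and p \<phi> where "dual_basis (R :: ('a, 'x) ring_scheme) P I p \<phi>"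
proof -
  have P: "P \<in> fgmod R" and lift: "\<forall>M\<in>fgmod R. \<forall>N\<in>fgmod R. \<forall>g\<in>mod_hom R M N. \<forall>h\<in>mod_hom R P N.
        g ` carrier M = carrier N \<longrightarrow> (\<exists>l\<in>mod_hom R P M. compose (carrier P) g l = h)"
    using assms unfolding projective_def by (rule conjunct1, rule conjunct2)
  note lP = fgmodD[OF P]
  obtain F and I :: "'a list set" and p \<phi> g where F: "F \<in> fgmod R" "dual_basis R F I p \<phi>" "lin R F P g"
    "g ` carrier F = carrier P" by (rule ex_free_cover[OF lP]) (rule that)
  note lF = fgmodD(1)[OF F(1)]
  have g: "restrict g (carrier F) \<in> mod_hom R F P" by (rule lin_mod_hom[OF lF F(3)])
  have id: "(\<lambda>x\<in>carrier P. x) \<in> mod_hom R P P" by (rule lin_mod_hom[OF lP(1) lin_id])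
  obtain l where l: "l \<in> mod_hom R P F" "compose (carrier P) (restrict g (carrier F)) l = (\<lambda>x\<in>carrier P. x)"
    using lift[rule_format, OF F(1) P g id] F(4) by auto
  have "g (l x) = x" if x: "x \<in> carrier P" for x
    using fun_cong[OF l(2), of x] x lin_closed[OF mod_hom_lin[OF l(1)] x] by (simp add: compose_def)
  then have "dual_basis R P I (\<lambda>i. g (p i)) (\<lambda>i x. \<phi> i (l x))"
    by (rule dual_basis_retract[OF F(2) lF lP(1) F(3) mod_hom_lin[OF l(1)]])
  then show thesis by (rule that)
qed

text \<open>Among the endomorphisms of a projective module over \<open>M\<close>, one with minimal image cuts out a
  projective cover.\<close>

lemma ex_projective_cover:
  assumes "artin R" "M \<in> fgmod R"
  obtains P g where "projective_cover R P g M"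
proof -
  note lM = fgmodD[OF assms(2)]
  obtain F and I :: "'a list set" and p \<phi> g where F: "F \<in> fgmod R" "dual_basis R F I p \<phi>" "lin R F M g"
    "g ` carrier F = carrier M" by (rule ex_free_cover[OF lM]) (rule that)
  note lF = fgmodD(1)[OF F(1)]
  have FLF: "FL R F" using assms(1) F(1) by (simp add: artin_def)
  let ?L = "\<lambda>l. lin R F F l \<and> (\<forall>x\<in>carrier F. g (l x) = g x)"
  obtain Q where "\<exists>l. ?L l \<and> Q = l ` carrier F"
    and min: "\<And>Q'. \<exists>l. ?L l \<and> Q' = l ` carrier F \<Longrightarrow> Q' \<subseteq> Q \<Longrightarrow> Q' = Q"
    by (rule FL_min[OF FLF, of "\<lambda>Q. \<exists>l. ?L l \<and> Q = l ` carrier F" "(\<lambda>x. x) ` carrier F"])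
      (use lin_id submodule_range[OF lF lF] in blast)+
  then obtain l where l: "lin R F F l" "\<forall>x\<in>carrier F. g (l x) = g x" and Q: "Q = l ` carrier F" by blast
  have sQ: "submodule Q R F" unfolding Q by (rule submodule_range[OF lF lF l(1)])
  have Qc: "Q \<subseteq> carrier F" using sQ by (simp add: submodule_iff[OF lF])
  let ?Q = "F\<lparr>carrier := Q\<rparr>"
  have fQ: "?Q \<in> fgmod R" by (rule fgmod_sub[OF assms(1) F(1) sQ])
  note lQ = fgmodD(1)[OF fQ]
  \<comment> \<open>The square of \<open>l\<close> also lies over \<open>M\<close>, so by minimality
    \<open>l\<close> maps \<open>Q\<close> onto itself, hence bijectively; its inverse there turns
    \<open>l\<close> into a projection of \<open>F\<close> onto \<open>Q\<close>.\<close>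
  have ll: "lin R F F (\<lambda>x. l (l x))" by (rule lin_comp[OF l(1) l(1)])
  have "(\<lambda>x. l (l x)) ` carrier F = Q"
  proof (rule min)
    show "\<exists>k. ?L k \<and> (\<lambda>x. l (l x)) ` carrier F = k ` carrier F"
      using ll l(2) lin_closed[OF l(1)] by (intro exI[of _ "\<lambda>x. l (l x)"]) simp
    show "(\<lambda>x. l (l x)) ` carrier F \<subseteq> Q" using lin_closed[OF l(1)] by (auto simp: Q)
  qed
  then have "l ` Q = Q" by (simp add: Q image_image)
  moreover have lQQ: "lin R ?Q ?Q l" using l(1) Qc by (auto simp: lin_def Q)
  ultimately have bij: "bij_betw l Q Q"
    using FL_surj_bij[OF lQ FL_sub[OF lF sQ FLF] lQQ] by simp
  let ?k = "inv_into Q l"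
  have k: "lin R ?Q ?Q ?k" using lin_inv[OF lQ lQQ] bij by simp
  have kl: "?k (l x) = x" if "x \<in> Q" for x using bij that by (simp add: bij_betw_def)
  have lFQ: "lin R F ?Q l" using l(1) by (simp add: lin_def Q)
  have inc: "lin R ?Q F (\<lambda>x. x)" using Qc by (auto simp: lin_def)
  have "dual_basis R ?Q I (\<lambda>i. ?k (l (p i))) (\<lambda>i x. \<phi> i x)"
    by (rule dual_basis_retract[OF F(2) lF lQ lin_comp[OF lFQ k] inc]) (simp add: kl)
  then have proj: "projective R ?Q" by (rule dual_basis_projective[OF fQ])
  have gQ: "lin R ?Q M g" using lin_comp[OF inc F(3)] by simp
  have gQs: "g ` Q = carrier M" using l(2) F(4) by (force simp: Q image_image)
  \<comment> \<open>If \<open>H\<close> and the kernel span \<open>Q\<close>, then \<open>H\<close>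
    already maps onto \<open>M\<close>. Lifting \<open>g\<close> through \<open>H\<close> gives an
    endomorphism over \<open>M\<close> with image in \<open>H\<close>, and minimality
    applies.\<close>
  have "H = Q" if H: "submodule H R ?Q" and sum: "H <+>\<^bsub>?Q\<^esub> a_kernel ?Q M (restrict g Q) = Q" for H
  proof -
    have sH: "submodule H R F" "H \<subseteq> Q" using H by (simp_all add: submodule_sub_iff[OF lF sQ])
    note lH = left_module_sub[OF lF sH(1)]
    have "lin R (F\<lparr>carrier := H\<rparr>) ?Q (\<lambda>x. x)" using sH(2) by (auto simp: lin_def)
    from lin_comp[OF this gQ] have lHM: "lin R (F\<lparr>carrier := H\<rparr>) M g" .
    have "g x \<in> g ` H" if x: "x \<in> carrier F" for x
    proof -
      have "l x \<in> H <+>\<^bsub>?Q\<^esub> a_kernel ?Q M (restrict g Q)" using sum x by (simp add: Q)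
      then obtain y z where y: "y \<in> H" and z: "z \<in> Q" "restrict g Q z = \<zero>\<^bsub>M\<^esub>" and eq: "l x = y \<oplus>\<^bsub>F\<^esub> z"
        by (auto simp: set_add_def' a_kernel_def')
      interpret M: left_module R M by (rule lM(1))
      have "g (l x) = g y \<oplus>\<^bsub>M\<^esub> \<zero>\<^bsub>M\<^esub>" using eq lin_add[OF F(3), of y z] y z sH(2) Qc by auto
      then have "g x = g y" using l(2) x y sH(2) Qc lin_closed[OF F(3), of y] by auto
      then show ?thesis using y by blast
    qed
    then have "g ` carrier F \<subseteq> g ` carrier (F\<lparr>carrier := H\<rparr>)" by auto
    then obtain l' where l': "lin R F (F\<lparr>carrier := H\<rparr>) l'" "\<forall>x\<in>carrier F. g (l' x) = g x"
      by (rule dual_basis_lift[OF F(2) lF lH lM(1) lHM F(3)])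
    have HF: "H \<subseteq> carrier F" using sH(2) Qc by blast
    have "lin R F F l'" using l'(1) HF by (auto simp: lin_def)
    moreover have im: "l' ` carrier F \<subseteq> H" using lin_closed[OF l'(1)] by auto
    ultimately have "l' ` carrier F = Q" using l'(2) sH(2) by (intro min) auto
    then show "H = Q" using im sH(2) by blast
  qed
  then have "projective_cover R ?Q (restrict g Q) M"
    unfolding projective_cover_def using proj lin_mod_hom[OF lQ gQ] gQs by simp
  then show thesis by (rule that)
qed

lemma ex_minimal_projective_presentation:
  assumes "artin R" "M \<in> fgmod R"
  shows "\<exists>P1 f P0 g. minimal_projective_presentation R P1 f P0 g M"
proof -
  note lM = fgmodD(1)[OF assms(2)]
  obtain P0 g where g: "projective_cover R P0 g M" by (rule ex_projective_cover[OF assms])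
  then have P0: "P0 \<in> fgmod R" "g \<in> mod_hom R P0 M" by (simp_all add: projective_cover_def projective_def)
  have "submodule (a_kernel P0 M g) R P0"
    using submodule_ker[OF fgmodD(1)[OF P0(1)] lM mod_hom_lin[OF P0(2)]] by (simp add: a_kernel_def')
  then have "P0\<lparr>carrier := a_kernel P0 M g\<rparr> \<in> fgmod R" by (rule fgmod_sub[OF assms(1) P0(1)])
  then obtain P1 f where "projective_cover R P1 f (P0\<lparr>carrier := a_kernel P0 M g\<rparr>)"
    by (rule ex_projective_cover[OF assms(1)])
  then show ?thesis using g unfolding minimal_projective_presentation_def by blast
qed

lemma minimal_projective_presentationD:
  assumes "minimal_projective_presentation R P1 f P0 g M"
  shows "projective R P1" "projective R P0" "lin R P1 P0 f" "lin R P0 M g"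
    "f ` carrier P1 = {x \<in> carrier P0. g x = \<zero>\<^bsub>M\<^esub>}" "g ` carrier P0 = carrier M"
proof -
  have g: "projective R P0" "g \<in> mod_hom R P0 M" "g ` carrier P0 = carrier M"
    and f: "projective R P1" "f \<in> mod_hom R P1 (P0\<lparr>carrier := a_kernel P0 M g\<rparr>)"
      "f ` carrier P1 = a_kernel P0 M g"
    using assms by (simp_all add: minimal_projective_presentation_def projective_cover_def)
  show "projective R P1" "projective R P0" "lin R P0 M g" "g ` carrier P0 = carrier M"
    using f g by (simp_all add: mod_hom_lin)
  show "f ` carrier P1 = {x \<in> carrier P0. g x = \<zero>\<^bsub>M\<^esub>}" using f(3) by (simp add: a_kernel_def')
  show "lin R P1 P0 f" using mod_hom_lin[OF f(2)] by (auto simp: lin_def a_kernel_def')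
qed

section \<open>Homomorphisms into the Auslander--Reiten translate\<close>

text \<open>Elements of the translate are functions on cosets and are handled on representatives;
  these are the rules for computing with cosets.\<close>

lemma quotient_module:
  assumes "left_module R M" "submodule H R M"
  shows "carrier (quotient_module M H) = (\<lambda>x. H +>\<^bsub>M\<^esub> x) ` carrier M"
    "\<And>x y. x \<in> carrier M \<Longrightarrow> y \<in> carrier M \<Longrightarrow>
       (H +>\<^bsub>M\<^esub> x) \<oplus>\<^bsub>quotient_module M H\<^esub> (H +>\<^bsub>M\<^esub> y) = H +>\<^bsub>M\<^esub> (x \<oplus>\<^bsub>M\<^esub> y)"
    "\<And>a x. a \<in> carrier R \<Longrightarrow> x \<in> carrier M \<Longrightarrow>
       a \<odot>\<^bsub>quotient_module M H\<^esub> (H +>\<^bsub>M\<^esub> x) = H +>\<^bsub>M\<^esub> (a \<odot>\<^bsub>M\<^esub> x)"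
    "\<And>x y. x \<in> carrier M \<Longrightarrow> y \<in> carrier M \<Longrightarrow> H +>\<^bsub>M\<^esub> x = H +>\<^bsub>M\<^esub> y \<Longrightarrow> \<exists>d\<in>H. x = d \<oplus>\<^bsub>M\<^esub> y"
    "\<And>d. d \<in> H \<Longrightarrow> H +>\<^bsub>M\<^esub> d = H +>\<^bsub>M\<^esub> \<zero>\<^bsub>M\<^esub>"
proof -
  interpret M: left_module R M by fact
  have sg: "subgroup H (add_monoid M)" using assms(2) by (rule submodule.axioms)
  interpret H: abelian_subgroup H M
    by (rule abelian_subgroupI3[OF additive_subgroupI[OF sg] M.M.abelian_group_axioms])
  have Hc: "H \<subseteq> carrier M" "\<zero>\<^bsub>M\<^esub> \<in> H" "\<And>a x. a \<in> carrier R \<Longrightarrow> x \<in> H \<Longrightarrow> a \<odot>\<^bsub>M\<^esub> x \<in> H"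
    using assms(2) by (auto simp: submodule_iff[OF assms(1)])
  have eq: "H +>\<^bsub>M\<^esub> (d \<oplus>\<^bsub>M\<^esub> y) = H +>\<^bsub>M\<^esub> y" if "d \<in> H" "y \<in> carrier M" for d y
  proof -
    have "d \<oplus>\<^bsub>M\<^esub> y \<in> H +>\<^bsub>M\<^esub> y" using that by (auto simp: a_r_coset_def')
    then show ?thesis using M.M.a_repr_independence[OF _ that(2) sg] by simp
  qed
  show "carrier (quotient_module M H) = (\<lambda>x. H +>\<^bsub>M\<^esub> x) ` carrier M"
    by (auto simp: quotient_module_def A_RCOSETS_def')
  show "(H +>\<^bsub>M\<^esub> x) \<oplus>\<^bsub>quotient_module M H\<^esub> (H +>\<^bsub>M\<^esub> y) = H +>\<^bsub>M\<^esub> (x \<oplus>\<^bsub>M\<^esub> y)"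
    if "x \<in> carrier M" "y \<in> carrier M" for x y
    using H.a_rcos_sum[OF that] by (simp add: quotient_module_def)
  show "\<exists>d\<in>H. x = d \<oplus>\<^bsub>M\<^esub> y" if "x \<in> carrier M" "y \<in> carrier M" "H +>\<^bsub>M\<^esub> x = H +>\<^bsub>M\<^esub> y" for x y
  proof -
    have "\<zero>\<^bsub>M\<^esub> \<oplus>\<^bsub>M\<^esub> x \<in> H +>\<^bsub>M\<^esub> x" using Hc(2) unfolding a_r_coset_def' by blast
    then have "x \<in> H +>\<^bsub>M\<^esub> y" using that by simp
    then show ?thesis by (auto simp: a_r_coset_def')
  qed
  show "H +>\<^bsub>M\<^esub> d = H +>\<^bsub>M\<^esub> \<zero>\<^bsub>M\<^esub>" if "d \<in> H" for d
    using eq[OF that M.M.zero_closed] that Hc(1) by auto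
  show "a \<odot>\<^bsub>quotient_module M H\<^esub> (H +>\<^bsub>M\<^esub> x) = H +>\<^bsub>M\<^esub> (a \<odot>\<^bsub>M\<^esub> x)" if a: "a \<in> carrier R" "x \<in> carrier M" for a x
  proof -
    have "H +>\<^bsub>M\<^esub> (a \<odot>\<^bsub>M\<^esub> z) = H +>\<^bsub>M\<^esub> (a \<odot>\<^bsub>M\<^esub> x)" if z: "z \<in> H +>\<^bsub>M\<^esub> x" for z
    proof -
      obtain d where d: "d \<in> H" "z = d \<oplus>\<^bsub>M\<^esub> x" using z by (auto simp: a_r_coset_def')
      then have "a \<odot>\<^bsub>M\<^esub> z = a \<odot>\<^bsub>M\<^esub> d \<oplus>\<^bsub>M\<^esub> a \<odot>\<^bsub>M\<^esub> x" using a Hc(1) by (auto simp: M.smult_r_distr)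
      then show ?thesis using eq[OF Hc(3)[OF a(1) d(1)], of "a \<odot>\<^bsub>M\<^esub> x"] a by simp
    qed
    then have "(\<Union>z\<in>H +>\<^bsub>M\<^esub> x. H +>\<^bsub>M\<^esub> (a \<odot>\<^bsub>M\<^esub> z)) = H +>\<^bsub>M\<^esub> (a \<odot>\<^bsub>M\<^esub> x)"
      using H.a_rcos_self[OF a(2)] by (intro UN_constant_eq ballI)
    then show ?thesis by (simp add: quotient_module_def)
  qed
qed

lemma ring_opposite_ring:
  assumes "ring R"
  shows "ring (opposite_ring R)"
proof -
  interpret R: ring R by fact
  have "abelian_group (opposite_ring R)"
    by (rule abelian_groupI) (auto simp: opposite_ring_def R.a_ac intro!: bexI[of _ "\<ominus>\<^bsub>R\<^esub> _"] R.l_neg)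
  moreover have "Group.monoid (opposite_ring R)"
    by (rule monoidI) (auto simp: opposite_ring_def R.m_assoc)
  ultimately show ?thesis by (rule ringI) (auto simp: opposite_ring_def R.l_distr R.r_distr)
qed

lemma opposite_ring_simps [simp]: "carrier (opposite_ring R) = carrier R" "\<zero>\<^bsub>opposite_ring R\<^esub> = \<zero>\<^bsub>R\<^esub>"
  "\<one>\<^bsub>opposite_ring R\<^esub> = \<one>\<^bsub>R\<^esub>" "x \<oplus>\<^bsub>opposite_ring R\<^esub> y = x \<oplus>\<^bsub>R\<^esub> y"
  "x \<otimes>\<^bsub>opposite_ring R\<^esub> y = y \<otimes>\<^bsub>R\<^esub> x"
  by (simp_all add: opposite_ring_def)

lemma hom_to_ring_simps [simp]: "carrier (hom_to_ring R P) = mod_hom R P (regular_module R)"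
  "\<zero>\<^bsub>hom_to_ring R P\<^esub> = (\<lambda>p\<in>carrier P. \<zero>\<^bsub>R\<^esub>)"
  "u \<oplus>\<^bsub>hom_to_ring R P\<^esub> v = (\<lambda>p\<in>carrier P. u p \<oplus>\<^bsub>R\<^esub> v p)"
  "a \<odot>\<^bsub>hom_to_ring R P\<^esub> u = (\<lambda>p\<in>carrier P. u p \<otimes>\<^bsub>R\<^esub> a)"
  by (simp_all add: hom_to_ring_def)

lemma left_module_hom_to_ring:
  assumes "left_module R P"
  shows "left_module (opposite_ring R) (hom_to_ring R P)"
proof -
  interpret P: left_module R P by fact
  have c: "u x \<in> carrier R" if "u \<in> mod_hom R P (regular_module R)" "x \<in> carrier P" for u x
    using that by (auto dest: mod_hom_lin simp: lin_def)
  have ag: "abelian_group (hom_to_ring R P)"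
    by (rule abelian_group_hom_space[OF assms left_module_regular[OF P.R.ring_axioms]]) simp_all
  have sm: "(\<lambda>p\<in>carrier P. u p \<otimes>\<^bsub>R\<^esub> a) \<in> mod_hom R P (regular_module R)"
    if "a \<in> carrier R" "u \<in> mod_hom R P (regular_module R)" for a u
  proof -
    have "lin R P (regular_module R) (\<lambda>p. u p \<otimes>\<^bsub>R\<^esub> a)"
      using that mod_hom_lin[OF that(2)] by (auto simp: lin_def P.R.l_distr P.R.m_assoc)
    then show ?thesis by (rule lin_mod_hom[OF assms])
  qed
  show ?thesis
  proof (intro left_module.intro left_module_axioms.intro ring_opposite_ring P.R.ring_axioms ag)
    fix u assume u: "u \<in> carrier (hom_to_ring R P)"
    then have "u \<in> mod_hom R P (regular_module R)" by simp
    then show "\<one>\<^bsub>opposite_ring R\<^esub> \<odot>\<^bsub>hom_to_ring R P\<^esub> u = u"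
      using c sm[OF P.R.one_closed] by (intro mod_hom_eqI[of _ R P "regular_module R"]) simp_all
  qed (use sm c in \<open>auto simp: fun_eq_iff P.R.l_distr P.R.r_distr P.R.m_assoc\<close>)
qed

section \<open>Maps to the translate and functionals on Hom(P1, X)\<close>

locale presentation =
  fixes K :: "('k, 'x) ring_scheme" and A :: "('k, 'a, 'y) module_scheme"
    and P1 f P0 g U
  assumes fd: "fd_algebra K A" and U: "U \<in> fgmod A"
    and pres: "minimal_projective_presentation A P1 f P0 g U"
begin

abbreviation \<rho> where "\<rho> \<equiv> \<lambda>c. c \<odot>\<^bsub>A\<^esub> \<one>\<^bsub>A\<^esub>"

abbreviation H1 where "H1 \<equiv> hom_to_ring A P1"

definition D where "D = (\<lambda>u. compose (carrier P1) u f) ` carrier (hom_to_ring A P0)"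

definition tau where "tau = K_dual K (opposite_ring A) (quotient_module H1 D)"

abbreviation q where "q u \<equiv> D +>\<^bsub>H1\<^esub> u"

text \<open>Surjectivity of Hom(P0, X) -> Hom(P1, X). The space of maps from \<open>X\<close> to the
  translate of \<open>U\<close> is dual to the cokernel; the two implications proved below extract
  from this duality that one vanishes with the other.\<close>

definition extends :: "('a, 'n, 'z) module_scheme \<Rightarrow> bool" where
  "extends X \<longleftrightarrow> (\<forall>h. lin A P1 X h \<longrightarrow> (\<exists>k. lin A P0 X k \<and> (\<forall>x\<in>carrier P1. h x = k (f x))))"

lemmas cf = fd_algebra_central_fd_over[OF fd]
lemmas cfD = central_fd_overD[OF cf]
lemmas presD = minimal_projective_presentationD[OF pres]

lemma proj_fgmod: "P1 \<in> fgmod A" "P0 \<in> fgmod A"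
  using presD(1,2) by (simp_all add: projective_def)

lemmas lP1 = fgmodD(1)[OF proj_fgmod(1)]
lemmas lP0 = fgmodD(1)[OF proj_fgmod(2)]
lemmas lH1 = left_module_hom_to_ring[OF lP1]
lemmas lK = left_module_regular[OF cfD(2)]
lemmas lA = left_module_regular[OF cfD(3)]

lemma f_closed: "x \<in> carrier P1 \<Longrightarrow> f x \<in> carrier P0"
  by (rule lin_closed[OF presD(3)])

lemma submodule_D: "submodule D (opposite_ring A) H1"
  unfolding D_def
proof (rule submodule_range[OF left_module_hom_to_ring[OF lP0] lH1])
  show "lin (opposite_ring A) (hom_to_ring A P0) H1 (\<lambda>u. compose (carrier P1) u f)"
  proof (rule linI)
    fix u assume "u \<in> carrier (hom_to_ring A P0)"
    then show "compose (carrier P1) u f \<in> carrier H1"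
      using lin_mod_hom[OF lP1 lin_comp[OF presD(3) mod_hom_lin[of u A P0 "regular_module A"]]] by (simp add: compose_def)
  qed (use f_closed in \<open>auto simp: fun_eq_iff compose_def\<close>)
qed

lemmas qD = quotient_module[OF lH1 submodule_D]

lemma H1_lin: "u \<in> carrier H1 \<Longrightarrow> lin A P1 (regular_module A) u"
  by (simp add: mod_hom_lin)

lemma H1_val: "u \<in> carrier H1 \<Longrightarrow> y \<in> carrier P1 \<Longrightarrow> u y \<in> carrier A"
  using lin_closed[OF H1_lin, of u y] by simp

text \<open>The image of \<open>u\<close> tensor \<open>x\<close> under the canonical map from the
  tensor product of Hom(P1, A) and X to Hom(P1, X), without forming the tensor product. The rules
  that follow say that it is bilinear and balanced.\<close>

definition gam :: "('a, 'n, 'z) module_scheme \<Rightarrow> ('a list \<Rightarrow> 'a) \<Rightarrow> 'n \<Rightarrow> 'a list \<Rightarrow> 'n" where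
  "gam X u x = (\<lambda>y\<in>carrier P1. u y \<odot>\<^bsub>X\<^esub> x)"

lemma gam_mod_hom:
  assumes "left_module A X" "u \<in> carrier H1" "x \<in> carrier X"
  shows "gam X u x \<in> mod_hom A P1 X"
  unfolding gam_def by (rule lin_mod_hom[OF lP1 lin_smult_const[OF assms(1,3) H1_lin[OF assms(2)]]])

lemma gam_lin_left:
  assumes "left_module A X" "x \<in> carrier X"
  shows "lin K (restr \<rho> H1) (homK \<rho> A P1 X) (\<lambda>u. gam X u x)"
proof -
  interpret X: left_module A X by fact
  show ?thesis
  proof (rule linI)
    fix u assume "u \<in> carrier (restr \<rho> H1)"
    then show "gam X u x \<in> carrier (homK \<rho> A P1 X)" using gam_mod_hom[OF assms(1) _ assms(2), of u] by simp
  next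
    fix u v assume "u \<in> carrier (restr \<rho> H1)" "v \<in> carrier (restr \<rho> H1)"
    then show "gam X (u \<oplus>\<^bsub>restr \<rho> H1\<^esub> v) x = gam X u x \<oplus>\<^bsub>homK \<rho> A P1 X\<^esub> gam X v x"
      using H1_val[of u] H1_val[of v] assms(2) by (auto simp: gam_def fun_eq_iff X.smult_l_distr)
  next
    fix c u assume c: "c \<in> carrier K" "u \<in> carrier (restr \<rho> H1)"
    then have "(u y \<otimes>\<^bsub>A\<^esub> \<rho> c) \<odot>\<^bsub>X\<^esub> x = \<rho> c \<odot>\<^bsub>X\<^esub> (u y \<odot>\<^bsub>X\<^esub> x)" if "y \<in> carrier P1" for y
      using H1_val[of u y] assms(2) that cfD(7)[of c "u y"] cfD(8)[of c] by (simp flip: X.smult_assoc)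
    then show "gam X (c \<odot>\<^bsub>restr \<rho> H1\<^esub> u) x = c \<odot>\<^bsub>homK \<rho> A P1 X\<^esub> gam X u x"
      by (auto simp: gam_def fun_eq_iff)
  qed
qed

lemma gam_add:
  assumes "left_module A X" "u \<in> carrier H1" "x \<in> carrier X" "y \<in> carrier X"
  shows "gam X u (x \<oplus>\<^bsub>X\<^esub> y) = gam X u x \<oplus>\<^bsub>homK \<rho> A P1 X\<^esub> gam X u y"
proof -
  interpret X: left_module A X by fact
  show ?thesis using H1_val[OF assms(2)] assms(3,4) by (auto simp: gam_def fun_eq_iff X.smult_r_distr)
qed

lemma gam_smult:
  assumes "left_module A X" "u \<in> carrier H1" "x \<in> carrier X" "a \<in> carrier A"
  shows "gam X (a \<odot>\<^bsub>H1\<^esub> u) x = gam X u (a \<odot>\<^bsub>X\<^esub> x)"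
proof -
  interpret X: left_module A X by fact
  show ?thesis using H1_val[OF assms(2)] assms(3,4) by (auto simp: gam_def fun_eq_iff X.smult_assoc)
qed

text \<open>Surjectivity of the canonical map: a dual basis of \<open>P1\<close> writes every map as
  a sum of elementary ones.\<close>

lemma gam_expand:
  assumes "left_module A X" "w \<in> mod_hom A P1 X" "dual_basis A P1 I p \<phi>"
  shows "w = finsum (homK \<rho> A P1 X) (\<lambda>i. gam X (restrict (\<phi> i) (carrier P1)) (w (p i))) I"
proof -
  interpret X: left_module A X by fact
  interpret Hm: left_module K "homK \<rho> A P1 X" by (rule left_module_homK[OF cf lP1 assms(1)])
  note B = dual_basisD[OF assms(3)]
  note w = mod_hom_lin[OF assms(2)]
  have g: "gam X (restrict (\<phi> i) (carrier P1)) (w (p i)) \<in> carrier (homK \<rho> A P1 X)" if "i \<in> I" for i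
    using gam_mod_hom[OF assms(1), of "restrict (\<phi> i) (carrier P1)" "w (p i)"] lin_mod_hom[OF lP1 B(3)[OF that]]
      lin_closed[OF w B(2)[OF that]] by simp
  let ?s = "finsum (homK \<rho> A P1 X) (\<lambda>i. gam X (restrict (\<phi> i) (carrier P1)) (w (p i))) I"
  have s: "?s \<in> mod_hom A P1 X" using Hm.M.finsum_closed[of "\<lambda>i. gam X (restrict (\<phi> i) (carrier P1)) (w (p i))" I] g by auto
  show ?thesis
  proof (rule mod_hom_eqI[OF assms(2) s])
    fix y assume y: "y \<in> carrier P1"
    have "?s y = finsum (restr \<rho> X) (\<lambda>i. gam X (restrict (\<phi> i) (carrier P1)) (w (p i)) y) I"
      by (rule lin_of_finsum[OF Hm.left_module_axioms left_module_restr[OF assms(1) cfD(2,4)] lin_eval_homK[OF y] g])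
    also have "\<dots> = finsum X (\<lambda>i. \<phi> i y \<odot>\<^bsub>X\<^esub> w (p i)) I" using y by (simp add: finsum_restr gam_def)
    also have "\<dots> = w y" by (rule dual_basis_expand[OF assms(3) lP1 assms(1) w y, symmetric])
    finally show "w y = ?s y" by simp
  qed
qed

lemma tau_simps:
  "t \<in> carrier tau \<longleftrightarrow> t \<in> carrier (quotient_module H1 D) \<rightarrow>\<^sub>E carrier K \<and>
     (\<forall>u\<in>carrier H1. \<forall>v\<in>carrier H1. t (q (u \<oplus>\<^bsub>H1\<^esub> v)) = t (q u) \<oplus>\<^bsub>K\<^esub> t (q v)) \<and>
     (\<forall>c\<in>carrier K. \<forall>u\<in>carrier H1. t (q (\<rho> c \<odot>\<^bsub>H1\<^esub> u)) = c \<otimes>\<^bsub>K\<^esub> t (q u))"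
  "\<zero>\<^bsub>tau\<^esub> = (\<lambda>C\<in>carrier (quotient_module H1 D). \<zero>\<^bsub>K\<^esub>)"
  "u \<in> carrier H1 \<Longrightarrow> (s \<oplus>\<^bsub>tau\<^esub> t) (q u) = s (q u) \<oplus>\<^bsub>K\<^esub> t (q u)"
  "u \<in> carrier H1 \<Longrightarrow> a \<in> carrier A \<Longrightarrow> (a \<odot>\<^bsub>tau\<^esub> t) (q u) = t (q (a \<odot>\<^bsub>H1\<^esub> u))"
proof -
  have \<rho>: "c \<odot>\<^bsub>opposite_ring A\<^esub> \<one>\<^bsub>opposite_ring A\<^esub> = \<rho> c" for c by (simp add: opposite_ring_def)
  have all: "(\<forall>C\<in>carrier (quotient_module H1 D). P C) \<longleftrightarrow> (\<forall>u\<in>carrier H1. P (q u))" for P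
    unfolding qD(1) by blast
  show "t \<in> carrier tau \<longleftrightarrow> t \<in> carrier (quotient_module H1 D) \<rightarrow>\<^sub>E carrier K \<and>
     (\<forall>u\<in>carrier H1. \<forall>v\<in>carrier H1. t (q (u \<oplus>\<^bsub>H1\<^esub> v)) = t (q u) \<oplus>\<^bsub>K\<^esub> t (q v)) \<and>
     (\<forall>c\<in>carrier K. \<forall>u\<in>carrier H1. t (q (\<rho> c \<odot>\<^bsub>H1\<^esub> u)) = c \<otimes>\<^bsub>K\<^esub> t (q u))"
    unfolding tau_def K_dual_def partial_object.simps mem_Collect_eq all \<rho>
    using cfD(8) by (simp add: qD(2,3) del: hom_to_ring_simps cong: conj_cong)
  show "\<zero>\<^bsub>tau\<^esub> = (\<lambda>C\<in>carrier (quotient_module H1 D). \<zero>\<^bsub>K\<^esub>)" by (simp add: tau_def K_dual_def)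
  assume u: "u \<in> carrier H1"
  then have "q u \<in> carrier (quotient_module H1 D)" by (simp add: qD(1))
  then show "(s \<oplus>\<^bsub>tau\<^esub> t) (q u) = s (q u) \<oplus>\<^bsub>K\<^esub> t (q u)"
    "a \<in> carrier A \<Longrightarrow> (a \<odot>\<^bsub>tau\<^esub> t) (q u) = t (q (a \<odot>\<^bsub>H1\<^esub> u))"
    using u by (simp_all add: tau_def K_dual_def qD(3) del: hom_to_ring_simps)
qed

lemma tau_ext:
  assumes "s \<in> extensional (carrier (quotient_module H1 D))" "t \<in> extensional (carrier (quotient_module H1 D))"
    "\<And>u. u \<in> carrier H1 \<Longrightarrow> s (q u) = t (q u)"
  shows "s = t"
  using assms(1,2) by (rule extensionalityI) (use assms(3) in \<open>auto simp: qD(1)\<close>)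

lemma tau_op_ext:
  "s \<oplus>\<^bsub>tau\<^esub> t \<in> extensional (carrier (quotient_module H1 D))"
  "a \<odot>\<^bsub>tau\<^esub> t \<in> extensional (carrier (quotient_module H1 D))"
  by (simp_all add: tau_def K_dual_def)

lemma lin_zero_tau: "lin A X tau (\<lambda>x. \<zero>\<^bsub>tau\<^esub>)"
proof -
  interpret K: ring K by (rule cfD(2))
  have q: "q u \<in> carrier (quotient_module H1 D)" if "u \<in> carrier H1" for u using that by (simp add: qD(1))
  interpret H: left_module "opposite_ring A" H1 by (rule lH1)
  have z: "\<zero>\<^bsub>tau\<^esub> (q u) = \<zero>\<^bsub>K\<^esub>" if "u \<in> carrier H1" for u using q[OF that] by (simp add: tau_simps(2))
  have e: "\<zero>\<^bsub>tau\<^esub> \<in> extensional (carrier (quotient_module H1 D))" by (simp add: tau_simps(2))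
  have "\<zero>\<^bsub>tau\<^esub> \<in> carrier tau"
    unfolding tau_simps(1) using z H.M.a_closed H.smult_closed cfD(8)
    by (auto simp: tau_simps(2) q simp del: hom_to_ring_simps)
  moreover have "\<zero>\<^bsub>tau\<^esub> = \<zero>\<^bsub>tau\<^esub> \<oplus>\<^bsub>tau\<^esub> \<zero>\<^bsub>tau\<^esub>"
    by (rule tau_ext[OF e tau_op_ext(1)]) (simp add: tau_simps(3) z del: hom_to_ring_simps)
  moreover have "\<zero>\<^bsub>tau\<^esub> = a \<odot>\<^bsub>tau\<^esub> \<zero>\<^bsub>tau\<^esub>" if "a \<in> carrier A" for a
    by (rule tau_ext[OF e tau_op_ext(2)])
      (use that H.smult_closed in \<open>simp add: tau_simps(4) z del: hom_to_ring_simps\<close>)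
  ultimately show ?thesis by (simp add: lin_def)
qed

lemma hom_vanishes_tau:
  assumes "left_module A X"
  shows "hom_vanishes A X tau \<longleftrightarrow> no_hom A X tau"
  by (rule hom_vanishes_iff[OF assms lin_zero_tau])

text \<open>A map \<open>h\<close> to the translate is a balanced pairing \<open>b\<close> that
  vanishes on \<open>D\<close>. The dual basis turns it into a functional \<open>L\<close> on
  Hom(P1, X), and an extension along \<open>f\<close> rewrites each \<open>gam X u x\<close> with
  first arguments in \<open>D\<close>, so \<open>L\<close> vanishes on it.\<close>

lemma extends_imp_no_hom:
  assumes "left_module A X" "extends X"
  shows "no_hom A X tau"
proof (rule no_hom_I)
  fix h x assume h: "lin A X tau h" and x: "x \<in> carrier X"
  interpret X: left_module A X by fact
  interpret K: field K by (rule cfD(1))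
  interpret H: left_module "opposite_ring A" H1 by (rule lH1)
  note lX = left_module_restr[OF assms(1) cfD(2,4)]
  \<comment> \<open>Scalars are central, so they act on right modules as well.\<close>
  have \<rho>o: "\<rho> \<in> ring_hom K (opposite_ring A)"
  proof (rule ring_hom_memI)
    fix c d assume "c \<in> carrier K" "d \<in> carrier K"
    then show "\<rho> (c \<otimes>\<^bsub>K\<^esub> d) = \<rho> c \<otimes>\<^bsub>opposite_ring A\<^esub> \<rho> d"
      using ring_hom_mult[OF cfD(4), of c d] cfD(7)[of c "\<rho> d"] cfD(8)[of d] by simp
  qed (use cfD(8) in \<open>simp_all add: ring_hom_add[OF cfD(4)] ring_hom_one[OF cfD(4)]\<close>)
  note lH = left_module_restr[OF lH1 cfD(2) \<rho>o]
  note lHX = left_module_homK[OF cf lP1 assms(1)]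
  define b where "b u x = h x (q u)" for u x
  have hx: "h x \<in> carrier tau" if "x \<in> carrier X" for x using lin_closed[OF h that] .
  have bc: "b u x \<in> carrier K" if "u \<in> carrier H1" "x \<in> carrier X" for u x
    using hx[OF that(2)] that(1) by (auto simp: b_def tau_simps(1) qD(1))
  have b1: "lin K (restr \<rho> X) (regular_module K) (b u)" if u: "u \<in> carrier H1" for u
    using u bc[OF u] hx lin_add[OF h] lin_smult[OF h cfD(8)] cfD(8)
    by (auto simp: lin_def b_def tau_simps(1,3,4) simp del: hom_to_ring_simps)
  have b2: "lin K (restr \<rho> H1) (regular_module K) (\<lambda>u. b u x)" if x: "x \<in> carrier X" for x
    using bc[OF _ x] hx[OF x] by (auto simp: lin_def b_def tau_simps(1) simp del: hom_to_ring_simps)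
  have b3: "b (a \<odot>\<^bsub>H1\<^esub> u) x = b u (a \<odot>\<^bsub>X\<^esub> x)" if "a \<in> carrier A" "u \<in> carrier H1" "x \<in> carrier X" for a u x
    using that by (simp add: b_def lin_smult[OF h] tau_simps(4) del: hom_to_ring_simps)
  have b4: "b u x = \<zero>\<^bsub>K\<^esub>" if "u \<in> D" "x \<in> carrier X" for u x
    using lin_zero[OF lH lK b2[OF that(2)]] qD(5)[OF that(1)] by (simp add: b_def del: hom_to_ring_simps)
  obtain I :: "'a list set" and p \<phi> where B: "dual_basis A P1 I p \<phi>" by (rule projective_dual_basis[OF presD(1)])
  obtain J :: "'a list set" and p' \<psi> where B': "dual_basis A P0 J p' \<psi>" by (rule projective_dual_basis[OF presD(2)])
  note BD = dual_basisD[OF B] and BD' = dual_basisD[OF B']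
  let ?\<phi> = "\<lambda>i. restrict (\<phi> i) (carrier P1)"
  have \<phi>: "?\<phi> i \<in> carrier H1" if "i \<in> I" for i using lin_mod_hom[OF lP1 BD(3)[OF that]] by simp
  \<comment> \<open>The value forced by expanding a map along the dual basis. That \<open>L\<close>
    restores \<open>b\<close> on elementary maps uses the expansion of \<open>u\<close> itself and
    balancedness.\<close>
  define L where "L w = finsum (regular_module K) (\<lambda>i. b (?\<phi> i) (w (p i))) I" for w
  have L: "lin K (homK \<rho> A P1 X) (regular_module K) L"
    unfolding L_def
    by (rule lin_finsum[OF lHX lK lin_comp[OF lin_eval_homK[OF BD(2)] b1[OF \<phi>]]])
  have Lg: "L (gam X u x) = b u x" if u: "u \<in> carrier H1" and x: "x \<in> carrier X" for u x
  proof -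
    have up: "u (p i) \<in> carrier A" if "i \<in> I" for i using H1_val[OF u BD(2)[OF that]] .
    let ?F = "\<lambda>i. u (p i) \<odot>\<^bsub>H1\<^esub> ?\<phi> i"
    have F: "?F i \<in> carrier (restr \<rho> H1)" if "i \<in> I" for i
      using H.smult_closed[of "u (p i)" "?\<phi> i"] up \<phi> that by simp
    \<comment> \<open>The dual basis also expands the functional \<open>u\<close>; the coefficients,
      acting on the right, are its values at the \<open>p i\<close>.\<close>
    have uF: "u = finsum H1 ?F I"
    proof -
      have s: "finsum (restr \<rho> H1) ?F I \<in> mod_hom A P1 (regular_module A)"
        using abelian_group.axioms(1)[OF left_module.axioms(2)[OF lH]] F
        by (auto dest!: abelian_monoid.finsum_closed[of _ ?F I])
      have "u = finsum (restr \<rho> H1) ?F I"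
      proof (rule mod_hom_eqI[OF _ s])
        show "u \<in> mod_hom A P1 (regular_module A)" using u by simp
        fix y assume y: "y \<in> carrier P1"
        have "lin K (restr \<rho> H1) (restr \<rho> (regular_module A)) (\<lambda>u. u y)"
          using y H1_val[OF _ y] cfD(7) by (auto simp: lin_def)
        then have "finsum (restr \<rho> H1) ?F I y = finsum (restr \<rho> (regular_module A)) (\<lambda>i. ?F i y) I"
          by (rule lin_of_finsum[OF lH left_module_restr[OF lA cfD(2,4)]]) (rule F)
        also have "\<dots> = finsum (regular_module A) (\<lambda>i. \<phi> i y \<odot>\<^bsub>regular_module A\<^esub> u (p i)) I"
          using y by (simp add: finsum_restr)
        also have "\<dots> = u y" by (rule dual_basis_expand[OF B lP1 lA H1_lin[OF u] y, symmetric])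
        finally show "u y = finsum (restr \<rho> H1) ?F I y" by simp
      qed
      then show ?thesis by (simp only: finsum_restr)
    qed
    have "b u x = b (finsum (restr \<rho> H1) ?F I) x" using uF by (simp only: finsum_restr)
    also have "\<dots> = finsum (regular_module K) (\<lambda>i. b (?F i) x) I"
      by (rule lin_of_finsum[OF lH lK b2[OF x] F])
    also have "\<dots> = L (gam X u x)"
      unfolding L_def
    proof (rule abelian_monoid.finsum_cong')
      show "abelian_monoid (regular_module K)" by (rule abelian_group.axioms(1)[OF left_module.axioms(2)[OF lK]])
      show "(\<lambda>i. b (?\<phi> i) (gam X u x (p i))) \<in> I \<rightarrow> carrier (regular_module K)"
        using bc[OF \<phi>] lin_closed[OF mod_hom_lin[OF gam_mod_hom[OF assms(1) u x]] BD(2)] by simp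
      fix i assume i: "i \<in> I"
      show "b (?F i) x = b (?\<phi> i) (gam X u x (p i))"
        using b3[OF up[OF i] \<phi>[OF i] x] BD(2)[OF i] by (simp add: gam_def)
    qed simp
    finally show ?thesis by simp
  qed
  have "b u x = \<zero>\<^bsub>K\<^esub>" if u: "u \<in> carrier H1" for u
  proof -
    have gm: "gam X u x \<in> mod_hom A P1 X" by (rule gam_mod_hom[OF assms(1) u x])
    obtain k where k: "lin A P0 X k" "\<forall>y\<in>carrier P1. gam X u x y = k (f y)"
      using assms(2) mod_hom_lin[OF gm] unfolding extends_def by blast
    \<comment> \<open>Coordinate functionals of \<open>P0\<close> composed with \<open>f\<close>,
      which lie in \<open>D\<close> by its definition.\<close>
    let ?u = "\<lambda>j. compose (carrier P1) (restrict (\<psi> j) (carrier P0)) f"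
    have uj: "?u j \<in> D" "?u j \<in> carrier H1" if "j \<in> J" for j
      using lin_mod_hom[OF lP0 BD'(3)[OF that]] submodule_D
      by (auto simp: D_def submodule_iff[OF lH1])
    have kp: "k (p' j) \<in> carrier X" if "j \<in> J" for j using lin_closed[OF k(1) BD'(2)[OF that]] .
    let ?G = "\<lambda>j. gam X (?u j) (k (p' j))"
    have G: "?G j \<in> carrier (homK \<rho> A P1 X)" if "j \<in> J" for j
      using gam_mod_hom[OF assms(1) uj(2)[OF that] kp[OF that]] by simp
    have s: "finsum (homK \<rho> A P1 X) ?G J \<in> mod_hom A P1 X"
      using abelian_group.axioms(1)[OF left_module.axioms(2)[OF lHX]] G
      by (auto dest!: abelian_monoid.finsum_closed[of _ ?G J])
    have "gam X u x = finsum (homK \<rho> A P1 X) ?G J"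
    proof (rule mod_hom_eqI[OF gm s])
      fix y assume y: "y \<in> carrier P1"
      have "finsum (homK \<rho> A P1 X) ?G J y = finsum (restr \<rho> X) (\<lambda>j. ?G j y) J"
        by (rule lin_of_finsum[OF lHX lX lin_eval_homK[OF y] G])
      also have "\<dots> = finsum X (\<lambda>j. \<psi> j (f y) \<odot>\<^bsub>X\<^esub> k (p' j)) J"
        using y f_closed[OF y] by (simp add: finsum_restr gam_def compose_def)
      also have "\<dots> = k (f y)" by (rule dual_basis_expand[OF B' lP0 assms(1) k(1) f_closed[OF y], symmetric])
      finally show "gam X u x y = finsum (homK \<rho> A P1 X) ?G J y" using k(2) y by simp
    qed
    then have "L (gam X u x) = L (finsum (homK \<rho> A P1 X) ?G J)" by simp
    also have "\<dots> = finsum (regular_module K) (\<lambda>j. L (?G j)) J" by (rule lin_of_finsum[OF lHX lK L G])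
    also have "\<dots> = finsum (regular_module K) (\<lambda>j. \<zero>\<^bsub>K\<^esub>) J"
      using Lg[OF uj(2) kp] b4[OF uj(1) kp]
      by (intro abelian_monoid.finsum_cong'[OF abelian_group.axioms(1)[OF left_module.axioms(2)[OF lK]]]) auto
    also have "\<dots> = \<zero>\<^bsub>K\<^esub>"
      using abelian_monoid.finsum_zero[OF abelian_group.axioms(1)[OF left_module.axioms(2)[OF lK]], of J] by simp
    finally show ?thesis using Lg[OF u x] by simp
  qed
  then have "h x (q u) = \<zero>\<^bsub>tau\<^esub> (q u)" if "u \<in> carrier H1" for u
    using that by (simp add: b_def tau_simps(2) qD(1))
  moreover have "h x \<in> extensional (carrier (quotient_module H1 D))" using hx[OF x] by (auto simp: tau_simps(1) PiE_def)
  moreover have "\<zero>\<^bsub>tau\<^esub> \<in> extensional (carrier (quotient_module H1 D))" by (simp add: tau_simps(2))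
  ultimately show "h x = \<zero>\<^bsub>tau\<^esub>" by (intro tau_ext)
qed

text \<open>A map without extension leaves a nonzero functional \<open>l\<close> on Hom(P1, X) that
  kills everything factoring through \<open>f\<close>. Sending \<open>x\<close> to the function with
  value \<open>l (gam X u x)\<close> at the coset of \<open>u\<close> defines a map to the
  translate, and it is nonzero because the elementary maps span.\<close>

lemma no_hom_imp_extends:
  assumes "left_module A X" "fin_gen A X" "no_hom A X tau"
  shows "extends X"
proof (rule ccontr)
  assume "\<not> extends X"
  then obtain h0 where h0: "lin A P1 X h0" "\<not> (\<exists>k. lin A P0 X k \<and> (\<forall>x\<in>carrier P1. h0 x = k (f x)))"
    by (auto simp: extends_def)
  interpret X: left_module A X by fact
  interpret K: field K by (rule cfD(1))
  interpret H: left_module "opposite_ring A" H1 by (rule lH1)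
  note lHX = left_module_homK[OF cf lP1 assms(1)] and lHX0 = left_module_homK[OF cf lP0 assms(1)]
  let ?c = "\<lambda>k. compose (carrier P1) k f"
  have c: "lin K (homK \<rho> A P0 X) (homK \<rho> A P1 X) ?c"
  proof (rule linI)
    fix k assume "k \<in> carrier (homK \<rho> A P0 X)"
    then show "?c k \<in> carrier (homK \<rho> A P1 X)"
      using lin_mod_hom[OF lP1 lin_comp[OF presD(3) mod_hom_lin[of k A P0 X]]] by (simp add: compose_def)
  qed (use f_closed in \<open>auto simp: compose_def fun_eq_iff\<close>)
  let ?H = "?c ` carrier (homK \<rho> A P0 X)"
  have sH: "submodule ?H K (homK \<rho> A P1 X)" by (rule submodule_range[OF lHX0 lHX c])
  have "restrict h0 (carrier P1) \<notin> ?H"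
  proof
    assume "restrict h0 (carrier P1) \<in> ?H"
    then obtain k where k: "restrict h0 (carrier P1) = ?c k" "k \<in> mod_hom A P0 X" by auto
    have "h0 x = k (f x)" if "x \<in> carrier P1" for x using fun_cong[OF k(1), of x] that by (simp add: compose_def)
    then show False using h0(2) mod_hom_lin[OF k(2)] by blast
  qed
  moreover have "restrict h0 (carrier P1) \<in> carrier (homK \<rho> A P1 X)" using lin_mod_hom[OF lP1 h0(1)] by simp
  ultimately have "?H \<noteq> carrier (homK \<rho> A P1 X)" by blast
  then obtain l where l: "lin K (homK \<rho> A P1 X) (regular_module K) l" "\<forall>w\<in>?H. l w = \<zero>\<^bsub>K\<^esub>"
    "\<exists>w\<in>carrier (homK \<rho> A P1 X). l w \<noteq> \<zero>\<^bsub>K\<^esub>"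
    by (rule ex_functional[OF cfD(1) lHX FL_homK[OF cf lP1 fgmodD(2)[OF proj_fgmod(1)] assms(1,2)] sH])
  have lg: "lin K (restr \<rho> H1) (regular_module K) (\<lambda>u. l (gam X u x))" if "x \<in> carrier X" for x
    by (rule lin_comp[OF gam_lin_left[OF assms(1) that] l(1)])
  have lD: "l (gam X d x) = \<zero>\<^bsub>K\<^esub>" if d: "d \<in> D" and x: "x \<in> carrier X" for d x
  proof -
    obtain \<psi> where \<psi>: "d = compose (carrier P1) \<psi> f" "\<psi> \<in> mod_hom A P0 (regular_module A)" using d by (auto simp: D_def)
    let ?k = "\<lambda>y\<in>carrier P0. \<psi> y \<odot>\<^bsub>X\<^esub> x"
    have "?k \<in> mod_hom A P0 X" by (rule lin_mod_hom[OF lP0 lin_smult_const[OF assms(1) x mod_hom_lin[OF \<psi>(2)]]])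
    moreover have "gam X d x = ?c ?k" using f_closed by (auto simp: gam_def \<psi>(1) compose_def fun_eq_iff)
    ultimately have "gam X d x \<in> ?H" by auto
    then show ?thesis using l(2) by blast
  qed
  \<comment> \<open>The choice of a representative of the coset is harmless, since \<open>l\<close>
    kills \<open>gam X d x\<close> for \<open>d\<close> in \<open>D\<close>.\<close>
  define \<theta> where "\<theta> x = (\<lambda>C\<in>carrier (quotient_module H1 D). l (gam X (SOME u. u \<in> carrier H1 \<and> C = q u) x))" for x
  have th: "\<theta> x (q u) = l (gam X u x)" if x: "x \<in> carrier X" and u: "u \<in> carrier H1" for x u
  proof -
    let ?v = "SOME v. v \<in> carrier H1 \<and> q u = q v"
    have v: "?v \<in> carrier H1 \<and> q u = q ?v" by (rule someI[of _ u]) (use u in simp)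
    then obtain d where d: "d \<in> D" "?v = d \<oplus>\<^bsub>H1\<^esub> u" using qD(4)[of ?v u] u by auto
    have dc: "d \<in> carrier H1" using d(1) submodule_D by (auto simp only: submodule_iff[OF lH1])
    have "l (gam X ?v x) = l (gam X (d \<oplus>\<^bsub>H1\<^esub> u) x)" using d(2) by simp
    also have "\<dots> = l (gam X d x) \<oplus>\<^bsub>K\<^esub> l (gam X u x)"
      using lin_add[OF lg[OF x], of d u] dc u by (simp del: hom_to_ring_simps)
    also have "\<dots> = l (gam X u x)"
      using lD[OF d(1) x] lin_closed[OF lg[OF x], of u] u by (simp del: hom_to_ring_simps)
    finally show ?thesis using u by (simp add: \<theta>_def qD(1))
  qed
  have te: "\<theta> x \<in> extensional (carrier (quotient_module H1 D))" for x by (simp add: \<theta>_def)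
  have tc: "\<theta> x \<in> carrier tau" if x: "x \<in> carrier X" for x
    unfolding tau_simps(1)
  proof (intro conjI ballI)
    have "\<theta> x C \<in> carrier K" if C: "C \<in> carrier (quotient_module H1 D)" for C
    proof -
      obtain u where u: "u \<in> carrier H1" "C = q u" using C unfolding qD(1) by (elim imageE)
      then show ?thesis using th[OF x u(1)] lin_closed[OF lg[OF x], of u] by (simp del: hom_to_ring_simps)
    qed
    then show "\<theta> x \<in> carrier (quotient_module H1 D) \<rightarrow>\<^sub>E carrier K" using te by (auto simp: PiE_def)
  next
    fix u v assume "u \<in> carrier H1" "v \<in> carrier H1"
    then show "\<theta> x (q (u \<oplus>\<^bsub>H1\<^esub> v)) = \<theta> x (q u) \<oplus>\<^bsub>K\<^esub> \<theta> x (q v)"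
      using th[OF x] H.M.a_closed[of u v] lin_add[OF lg[OF x], of u v] by (simp del: hom_to_ring_simps)
  next
    fix c u assume c: "c \<in> carrier K" "u \<in> carrier H1"
    then show "\<theta> x (q (\<rho> c \<odot>\<^bsub>H1\<^esub> u)) = c \<otimes>\<^bsub>K\<^esub> \<theta> x (q u)"
      using th[OF x] H.smult_closed[of "\<rho> c" u] lin_smult[OF lg[OF x], of c u] cfD(8)[of c]
      by (simp del: hom_to_ring_simps)
  qed
  have "lin A X tau \<theta>"
  proof (rule linI)
    fix x y assume xy: "x \<in> carrier X" "y \<in> carrier X"
    show "\<theta> (x \<oplus>\<^bsub>X\<^esub> y) = \<theta> x \<oplus>\<^bsub>tau\<^esub> \<theta> y"
    proof (rule tau_ext[OF te tau_op_ext(1)])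
      fix u assume u: "u \<in> carrier H1"
      have "gam X u x \<in> carrier (homK \<rho> A P1 X)" "gam X u y \<in> carrier (homK \<rho> A P1 X)"
        using gam_mod_hom[OF assms(1) u] xy by simp_all
      then show "\<theta> (x \<oplus>\<^bsub>X\<^esub> y) (q u) = (\<theta> x \<oplus>\<^bsub>tau\<^esub> \<theta> y) (q u)"
        using xy u lin_add[OF l(1)]
        by (simp add: th tau_simps(3) gam_add[OF assms(1) u xy] del: hom_to_ring_simps homK_simps)
    qed
  next
    fix a x assume a: "a \<in> carrier A" "x \<in> carrier X"
    show "\<theta> (a \<odot>\<^bsub>X\<^esub> x) = a \<odot>\<^bsub>tau\<^esub> \<theta> x"
    proof (rule tau_ext[OF te tau_op_ext(2)])
      fix u assume u: "u \<in> carrier H1"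
      have "a \<odot>\<^bsub>H1\<^esub> u \<in> carrier H1" using H.smult_closed[of a u] a u by simp
      then show "\<theta> (a \<odot>\<^bsub>X\<^esub> x) (q u) = (a \<odot>\<^bsub>tau\<^esub> \<theta> x) (q u)"
        using a u by (simp add: th tau_simps(4) gam_smult[OF assms(1)] del: hom_to_ring_simps)
    qed
  qed (rule tc)
  then have "\<theta> x = \<zero>\<^bsub>tau\<^esub>" if "x \<in> carrier X" for x using no_hom_D[OF assms(3)] that by blast
  then have lz: "l (gam X u x) = \<zero>\<^bsub>K\<^esub>" if "x \<in> carrier X" "u \<in> carrier H1" for x u
    using th[OF that] that by (simp add: tau_simps(2) qD(1))
  obtain w where w: "w \<in> mod_hom A P1 X" "l w \<noteq> \<zero>\<^bsub>K\<^esub>" using l(3) by auto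
  obtain I :: "'a list set" and p \<phi> where B: "dual_basis A P1 I p \<phi>" by (rule projective_dual_basis[OF presD(1)])
  note BD = dual_basisD[OF B]
  have \<phi>: "restrict (\<phi> i) (carrier P1) \<in> carrier H1" if "i \<in> I" for i using lin_mod_hom[OF lP1 BD(3)[OF that]] by simp
  have wp: "w (p i) \<in> carrier X" if "i \<in> I" for i using lin_closed[OF mod_hom_lin[OF w(1)] BD(2)[OF that]] .
  let ?G = "\<lambda>i. gam X (restrict (\<phi> i) (carrier P1)) (w (p i))"
  have G: "?G i \<in> carrier (homK \<rho> A P1 X)" if "i \<in> I" for i
    using gam_mod_hom[OF assms(1) \<phi>[OF that] wp[OF that]] by simp
  have "l w = l (finsum (homK \<rho> A P1 X) ?G I)" using gam_expand[OF assms(1) w(1) B] by simp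
  also have "\<dots> = finsum (regular_module K) (\<lambda>i. l (?G i)) I" by (rule lin_of_finsum[OF lHX lK l(1) G])
  also have "\<dots> = finsum (regular_module K) (\<lambda>i. \<zero>\<^bsub>K\<^esub>) I"
    using lz[OF wp \<phi>] by (intro abelian_monoid.finsum_cong'[OF abelian_group.axioms(1)[OF left_module.axioms(2)[OF lK]]]) auto
  also have "\<dots> = \<zero>\<^bsub>K\<^esub>"
    using abelian_monoid.finsum_zero[OF abelian_group.axioms(1)[OF left_module.axioms(2)[OF lK]], of I] by simp
  finally show False using w(2) by simp
qed

end

text \<open>\<open>transpose_module\<close> picks its presentation with \<open>SOME\<close>;
  existence makes the picked triple an actual minimal presentation, which is then fixed.\<close>

lemma ex_presentation:
  fixes K :: "('k, 'x) ring_scheme" and A :: "('k, 'a, 'y) module_scheme"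
  assumes "fd_algebra K A" "U \<in> fgmod A"
  obtains P1 f P0 g where "presentation K A P1 f P0 g U" "AR_translate K A U = presentation.tau K A P1 f P0"
proof -
  have art: "artin A" using central_fd_overD(6)[OF fd_algebra_central_fd_over[OF assms(1)]] .
  let ?P = "\<lambda>(P1, f, P0). \<exists>g. minimal_projective_presentation A P1 f P0 g U"
  have "\<exists>t. ?P t" using ex_minimal_projective_presentation[OF art assms(2)] by auto
  then have P: "?P (Eps ?P)" by (rule someI_ex)
  obtain P1 f P0 where t: "Eps ?P = (P1, f, P0)" by (rule prod_cases3)
  then obtain g where g: "minimal_projective_presentation A P1 f P0 g U" using P by auto
  then have pr: "presentation K A P1 f P0 g U" using assms by (simp add: presentation_def)
  have "AR_translate K A U = presentation.tau K A P1 f P0"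
    unfolding AR_translate_def transpose_module_def t presentation.tau_def[OF pr] presentation.D_def[OF pr] by simp
  then show thesis using that pr by blast
qed

section \<open>Lifting along pullbacks\<close>

definition pullback :: "('a, 'm, 'y) module_scheme \<Rightarrow> ('a, 'n, 'z) module_scheme \<Rightarrow> ('m \<Rightarrow> 'p) \<Rightarrow> ('n \<Rightarrow> 'p) \<Rightarrow>
    ('a, 'm \<times> 'n) module" where
  "pullback X T c h = \<lparr>carrier = {u. fst u \<in> carrier X \<and> snd u \<in> carrier T \<and> c (fst u) = h (snd u)},
     mult = undefined, one = undefined, zero = (\<zero>\<^bsub>X\<^esub>, \<zero>\<^bsub>T\<^esub>),
     add = (\<lambda>u v. (fst u \<oplus>\<^bsub>X\<^esub> fst v, snd u \<oplus>\<^bsub>T\<^esub> snd v)),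
     smult = (\<lambda>a u. (a \<odot>\<^bsub>X\<^esub> fst u, a \<odot>\<^bsub>T\<^esub> snd u))\<rparr>"

lemma pullback_simps [simp]:
  "u \<in> carrier (pullback X T c h) \<longleftrightarrow> fst u \<in> carrier X \<and> snd u \<in> carrier T \<and> c (fst u) = h (snd u)"
  "\<zero>\<^bsub>pullback X T c h\<^esub> = (\<zero>\<^bsub>X\<^esub>, \<zero>\<^bsub>T\<^esub>)"
  "u \<oplus>\<^bsub>pullback X T c h\<^esub> v = (fst u \<oplus>\<^bsub>X\<^esub> fst v, snd u \<oplus>\<^bsub>T\<^esub> snd v)"
  "a \<odot>\<^bsub>pullback X T c h\<^esub> u = (a \<odot>\<^bsub>X\<^esub> fst u, a \<odot>\<^bsub>T\<^esub> snd u)"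
  by (simp_all add: pullback_def)

lemma left_module_pullback:
  assumes "left_module R X" "left_module R T" "left_module R Y" "lin R X Y c" "lin R T Y h"
  shows "left_module R (pullback X T c h)"
proof -
  interpret X: left_module R X by fact
  interpret T: left_module R T by fact
  have "abelian_group (pullback X T c h)"
  proof (rule abelian_groupI)
    fix u assume u: "u \<in> carrier (pullback X T c h)"
    show "\<exists>v\<in>carrier (pullback X T c h). v \<oplus>\<^bsub>pullback X T c h\<^esub> u = \<zero>\<^bsub>pullback X T c h\<^esub>"
      by (rule bexI[of _ "(\<ominus>\<^bsub>X\<^esub> fst u, \<ominus>\<^bsub>T\<^esub> snd u)"])
        (use u lin_minus[OF assms(1,3,4), of "fst u"] lin_minus[OF assms(2,3,5), of "snd u"]
          in \<open>auto simp: X.M.l_neg T.M.l_neg\<close>)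
  qed (use lin_zero[OF assms(1,3,4)] lin_zero[OF assms(2,3,5)] in
    \<open>auto simp: lin_add[OF assms(4)] lin_add[OF assms(5)] X.M.a_ac T.M.a_ac\<close>)
  then show ?thesis
    by (intro left_module.intro left_module_axioms.intro X.R.ring_axioms)
      (auto simp: lin_smult[OF assms(4)] lin_smult[OF assms(5)] X.smult_l_distr X.smult_r_distr X.smult_assoc
        T.smult_l_distr T.smult_r_distr T.smult_assoc)
qed

text \<open>The pullback of \<open>c\<close> along \<open>h\<close> is an extension of
  \<open>T\<close> by the kernel of \<open>c\<close>, onto \<open>T\<close> because \<open>h\<close>
  lands in the image of \<open>c\<close>; a splitting followed by the first projection is the lift.
  Vanishing of extensions is defined on lists only, so kernel and pullback are replaced by copies,
  and the hypothesis speaks of copies of the kernel.\<close>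

lemma Ext1_lift:
  fixes X :: "('a, 'm, 'y) module_scheme" and Y :: "('a, 'n, 'z) module_scheme"
  assumes art: "artin R" and T: "T \<in> fgmod R"
    and X: "left_module R X" "fin_gen R X" and Y: "left_module R Y" and c: "lin R X Y c"
    and h: "lin R T Y h" "h ` carrier T \<subseteq> c ` carrier X"
    and ext: "\<And>Z. Z \<in> fgmod R \<Longrightarrow> mod_iso R (X\<lparr>carrier := {x \<in> carrier X. c x = \<zero>\<^bsub>Y\<^esub>}\<rparr>) Z \<Longrightarrow> Ext1_vanishes R T Z"
  obtains l where "lin R T X l" "\<forall>t\<in>carrier T. c (l t) = h t"
proof -
  note lT = fgmodD[OF T]
  let ?Z = "X\<lparr>carrier := {x \<in> carrier X. c x = \<zero>\<^bsub>Y\<^esub>}\<rparr>"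
  let ?P = "pullback X T c h"
  have sZ: "submodule {x \<in> carrier X. c x = \<zero>\<^bsub>Y\<^esub>} R X" by (rule submodule_ker[OF X(1) Y c])
  note lZ = left_module_sub[OF X(1) sZ] and fZ = artin_fin_gen_sub[OF art X sZ]
  note lP = left_module_pullback[OF X(1) lT(1) Y c h(1)]
  have pf: "lin R ?P X fst" and ps: "lin R ?P T snd" by (auto simp: lin_def)
  have ps_surj: "snd ` carrier ?P = carrier T"
  proof
    show "carrier T \<subseteq> snd ` carrier ?P"
    proof
      fix t assume t: "t \<in> carrier T"
      then have "h t \<in> c ` carrier X" using h(2) by blast
      then obtain x where "h t = c x" "x \<in> carrier X" by (rule imageE)
      then show "t \<in> snd ` carrier ?P" using t by (intro image_eqI[of _ _ "(x, t)"]) simp_all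
    qed
  qed auto
  have i0: "lin R ?Z ?P (\<lambda>x. (x, \<zero>\<^bsub>T\<^esub>))"
  proof -
    interpret T: left_module R T by (rule lT(1))
    show ?thesis using lin_zero[OF lT(1) Y h(1)] by (auto simp: lin_def T.smult_zero_r)
  qed
  let ?K = "{u \<in> carrier ?P. snd u = \<zero>\<^bsub>T\<^esub>}"
  have i0K: "(\<lambda>x. (x, \<zero>\<^bsub>T\<^esub>)) ` carrier ?Z = ?K"
    using lin_zero[OF lT(1) Y h(1)] lT(1) by (auto simp: image_iff left_module_def abelian_groupE(2) prod_eq_iff)
  have "fin_gen R (?P\<lparr>carrier := (\<lambda>x. (x, \<zero>\<^bsub>T\<^esub>)) ` carrier ?Z\<rparr>)" by (rule fin_gen_sub_surj[OF lZ lP i0 fZ])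
  then have fP: "fin_gen R ?P"
    unfolding i0K by (rule fin_gen_extension[OF lP lT(1) ps ps_surj lT(2)])
  obtain Z0 :: "('a, 'a list) module" and i where Z0: "Z0 \<in> fgmod R" "left_module R Z0"
    "lin R ?Z Z0 i" "bij_betw i (carrier ?Z) (carrier Z0)" by (rule ex_fgmod[OF lZ fZ]) (rule that)
  obtain W :: "('a, 'a list) module" and j where W: "W \<in> fgmod R" "left_module R W"
    "lin R ?P W j" "bij_betw j (carrier ?P) (carrier W)" by (rule ex_fgmod[OF lP fP]) (rule that)
  let ?i = "inv_into (carrier ?Z) i" and ?j = "inv_into (carrier ?P) j"
  have i': "lin R Z0 ?Z ?i" "bij_betw ?i (carrier Z0) (carrier ?Z)"
    using lin_inv[OF lZ Z0(3,4)] bij_betw_inv_into[OF Z0(4)] by auto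
  have j': "lin R W ?P ?j" "bij_betw ?j (carrier W) (carrier ?P)"
    using lin_inv[OF lP W(3,4)] bij_betw_inv_into[OF W(4)] by auto
  have jj: "?j (j u) = u" if "u \<in> carrier ?P" for u using W(4) that by (simp add: bij_betw_def)
  have jj': "j (?j w) = w" if "w \<in> carrier W" for w using W(4) that by (simp add: bij_betw_def f_inv_into_f)
  let ?f = "\<lambda>z. j (?i z, \<zero>\<^bsub>T\<^esub>)" and ?g = "\<lambda>w. snd (?j w)"
  have f: "lin R Z0 W ?f" using lin_comp[OF lin_comp[OF i'(1) i0] W(3)] .
  have g: "lin R W T ?g" using lin_comp[OF j'(1) ps] .
  have fi: "inj_on ?f (carrier Z0)"
  proof (rule inj_onI)
    fix z z' assume z: "z \<in> carrier Z0" "z' \<in> carrier Z0" "?f z = ?f z'"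
    have m: "(?i z, \<zero>\<^bsub>T\<^esub>) \<in> carrier ?P" "(?i z', \<zero>\<^bsub>T\<^esub>) \<in> carrier ?P"
      using lin_closed[OF lin_comp[OF i'(1) i0] z(1)] lin_closed[OF lin_comp[OF i'(1) i0] z(2)] by simp_all
    have "(?i z, \<zero>\<^bsub>T\<^esub>) = ?j (?f z)" by (rule jj[OF m(1), symmetric])
    also have "\<dots> = ?j (?f z')" by (rule arg_cong[OF z(3)])
    also have "\<dots> = (?i z', \<zero>\<^bsub>T\<^esub>)" by (rule jj[OF m(2)])
    finally have "?i z = ?i z'" by simp
    then show "z = z'" using i'(2) z by (auto simp: bij_betw_def inj_on_def)
  qed
  have fk: "?f ` carrier Z0 = {w \<in> carrier W. ?g w = \<zero>\<^bsub>T\<^esub>}"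
  proof -
    have "?f ` carrier Z0 = j ` (\<lambda>x. (x, \<zero>\<^bsub>T\<^esub>)) ` ?i ` carrier Z0" by (simp only: image_image)
    also have "?i ` carrier Z0 = carrier ?Z" using i'(2) by (simp only: bij_betw_def)
    also have "(\<lambda>x. (x, \<zero>\<^bsub>T\<^esub>)) ` carrier ?Z = ?K" by (rule i0K)
    also have "j ` ?K = {w \<in> carrier W. ?g w = \<zero>\<^bsub>T\<^esub>}"
    proof
      show "j ` ?K \<subseteq> {w \<in> carrier W. ?g w = \<zero>\<^bsub>T\<^esub>}" using jj lin_closed[OF W(3)] by auto
      show "{w \<in> carrier W. ?g w = \<zero>\<^bsub>T\<^esub>} \<subseteq> j ` ?K"
      proof
        fix w assume w: "w \<in> {w \<in> carrier W. ?g w = \<zero>\<^bsub>T\<^esub>}"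
        then have "?j w \<in> ?K" using lin_closed[OF j'(1), of w] by auto
        moreover have "w = j (?j w)" using jj'[of w] w by simp
        ultimately show "w \<in> j ` ?K" by (rule rev_image_eqI)
      qed
    qed
    finally show ?thesis .
  qed
  have gs: "?g ` carrier W = carrier T"
  proof -
    have "?g ` carrier W = snd ` ?j ` carrier W" by (simp only: image_image)
    also have "?j ` carrier W = carrier ?P" using j'(2) by (simp only: bij_betw_def)
    finally show ?thesis using ps_surj by simp
  qed
  have "short_exact R Z0 (restrict ?f (carrier Z0)) W (restrict ?g (carrier W)) T"
    unfolding short_exact_def
  proof (intro conjI)
    show "restrict ?f (carrier Z0) \<in> mod_hom R Z0 W" by (rule lin_mod_hom[OF Z0(2) f])
    show "restrict ?g (carrier W) \<in> mod_hom R W T" by (rule lin_mod_hom[OF W(2) g])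
    show "inj_on (restrict ?f (carrier Z0)) (carrier Z0)" using fi by (rule inj_on_cong[THEN iffD1, rotated]) simp
    have "restrict ?f (carrier Z0) ` carrier Z0 = ?f ` carrier Z0" by (rule image_cong) simp_all
    moreover have "a_kernel W T (restrict ?g (carrier W)) = {w \<in> carrier W. ?g w = \<zero>\<^bsub>T\<^esub>}"
      by (auto simp: a_kernel_def')
    ultimately show "restrict ?f (carrier Z0) ` carrier Z0 = a_kernel W T (restrict ?g (carrier W))" using fk by simp
    have "restrict ?g (carrier W) ` carrier W = ?g ` carrier W" by (rule image_cong) simp_all
    then show "restrict ?g (carrier W) ` carrier W = carrier T" using gs by simp
  qed
  moreover have "Ext1_vanishes R T Z0"
    by (rule ext[OF Z0(1)]) (use Z0(3,4) in \<open>auto simp only: mod_iso_iff[OF lZ]\<close>)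
  ultimately obtain s where s: "s \<in> mod_hom R T W"
    "compose (carrier T) (restrict ?g (carrier W)) s = (\<lambda>x\<in>carrier T. x)"
    using W(1) unfolding Ext1_vanishes_def by blast
  note sl = mod_hom_lin[OF s(1)]
  have "c (fst (?j (s t))) = h t" if t: "t \<in> carrier T" for t
  proof -
    have "?g (s t) = t" using fun_cong[OF s(2), of t] t lin_closed[OF sl t] by (simp add: compose_def)
    moreover have "?j (s t) \<in> carrier ?P" using lin_closed[OF lin_comp[OF sl j'(1)] t] .
    ultimately show ?thesis by simp
  qed
  moreover have "lin R T X (\<lambda>t. fst (?j (s t)))" using lin_comp[OF lin_comp[OF sl j'(1)] pf] .
  ultimately show thesis using that by blast
qed

lemma cotuple_dinc:
  assumes "finite I" "i \<in> I" "\<And>j. j \<in> I \<Longrightarrow> left_module R (X j)" "left_module R N" "\<And>j. j \<in> I \<Longrightarrow> lin R (X j) N (f j)"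
    "x \<in> carrier (X i)"
  shows "finsum N (\<lambda>j. f j (dinc I X i x j)) I = f i x"
proof -
  interpret N: left_module R N by fact
  have fx: "f i x \<in> carrier N" by (rule lin_closed[OF assms(5)[OF assms(2)] assms(6)])
  have "finsum N (\<lambda>j. f j (dinc I X i x j)) I = finsum N (\<lambda>j. if i = j then f i x else \<zero>\<^bsub>N\<^esub>) I"
    using fx lin_zero[OF assms(3,4,5)] by (intro N.M.finsum_cong') (auto simp: dinc_def)
  also have "\<dots> = f i x" using N.M.finsum_singleton[OF assms(2,1), of "\<lambda>_. f i x"] fx by auto
  finally show ?thesis .
qed

section \<open>Decomposing idempotents\<close>

text \<open>A substitute for a decomposition into indecomposables: an idempotent is split until its
  image is zero or indecomposable, by induction on the measure of the image. A property that is
  additive in \<open>\<epsilon>\<close> is thereby reduced to indecomposable direct summands of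
  \<open>U\<close>.\<close>

lemma idempotent_induct [consumes 4, case_names zero sum indecomposable]:
  fixes R :: "('a, 'x) ring_scheme" and Q :: "('a list \<Rightarrow> 'a list) \<Rightarrow> bool"
  assumes "artin R" "U \<in> fgmod R" "lin R U U \<epsilon>" "\<forall>x\<in>carrier U. \<epsilon> (\<epsilon> x) = \<epsilon> x"
    and zero: "\<And>\<epsilon>. \<forall>x\<in>carrier U. \<epsilon> x = \<zero>\<^bsub>U\<^esub> \<Longrightarrow> Q \<epsilon>"
    and sum: "\<And>\<epsilon> \<epsilon>1 \<epsilon>2. lin R U U \<epsilon>1 \<Longrightarrow> lin R U U \<epsilon>2 \<Longrightarrow> Q \<epsilon>1 \<Longrightarrow> Q \<epsilon>2 \<Longrightarrow>
      \<forall>x\<in>carrier U. \<epsilon> x = \<epsilon>1 x \<oplus>\<^bsub>U\<^esub> \<epsilon>2 x \<Longrightarrow> Q \<epsilon>"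
    and ind: "\<And>\<epsilon>. lin R U U \<epsilon> \<Longrightarrow> \<forall>x\<in>carrier U. \<epsilon> (\<epsilon> x) = \<epsilon> x \<Longrightarrow>
      indecomposable R (U\<lparr>carrier := \<epsilon> ` carrier U\<rparr>) \<Longrightarrow> Q \<epsilon>"
  shows "Q \<epsilon>"
proof -
  note lU = fgmodD(1)[OF assms(2)]
  interpret U: left_module R U by (rule lU)
  have "FL R U" using assms(1,2) by (simp add: artin_def)
  then obtain d and n :: nat where d0: "\<forall>H. submodule H R U \<longrightarrow> d H \<le> n"
    "\<forall>H H'. submodule H R U \<longrightarrow> submodule H' R U \<longrightarrow> H \<subset> H' \<longrightarrow> d H < d H'"
    by (rule FL_E) (rule that)
  show ?thesis using assms(3,4)
  proof (induction "d (\<epsilon> ` carrier U)" arbitrary: \<epsilon> rule: less_induct)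
    case less
    note \<epsilon> = less.prems(1) and idem = less.prems(2)
    have sN: "submodule (\<epsilon> ` carrier U) R U" by (rule submodule_range[OF lU lU \<epsilon>])
    let ?N = "U\<lparr>carrier := \<epsilon> ` carrier U\<rparr>"
    have N: "?N \<in> fgmod R" by (rule fgmod_sub[OF assms(1,2) sN])
    note lN = fgmodD(1)[OF N]
    have Nc: "\<epsilon> ` carrier U \<subseteq> carrier U" using lin_closed[OF \<epsilon>] by auto
    show ?case
    proof (cases "indecomposable R ?N \<or> carrier ?N = {\<zero>\<^bsub>?N\<^esub>}")
      case True
      then show ?thesis
      proof
        assume "carrier ?N = {\<zero>\<^bsub>?N\<^esub>}"
        then show ?thesis by (intro zero) auto
      qed (rule ind[OF \<epsilon> idem])
    next
      case False
      then obtain Y Z where YZ: "Y \<in> fgmod R" "Z \<in> fgmod R" "mod_iso R ?N (direct_sum2 Y Z)"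
        "carrier Y \<noteq> {\<zero>\<^bsub>Y\<^esub>}" "carrier Z \<noteq> {\<zero>\<^bsub>Z\<^esub>}"
        using N unfolding indecomposable_def by blast
      let ?X = "\<lambda>b. if b then Y else Z" let ?D = "direct_sum UNIV ?X"
      have lX: "left_module R (?X b)" for b using YZ(1,2) by (auto simp: fgmod_def)
      have lD: "left_module R ?D" by (rule left_module_direct_sum[OF U.R.ring_axioms]) (rule lX)
      obtain \<theta> where \<theta>: "lin R ?N ?D \<theta>" "bij_betw \<theta> (carrier ?N) (carrier ?D)"
        using YZ(3) by (auto simp only: mod_iso_iff[OF lN])
      let ?k = "inv_into (carrier ?N) \<theta>"
      have k: "lin R ?D ?N ?k" by (rule lin_inv[OF lN \<theta>])
      have k\<theta>: "?k (\<theta> x) = x" if "x \<in> carrier ?N" for x using \<theta>(2) that by (simp only: bij_betw_def inv_into_f_f)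
      have \<theta>k: "\<theta> (?k v) = v" if "v \<in> carrier ?D" for v using \<theta>(2) that by (simp only: bij_betw_def f_inv_into_f)
      let ?p = "\<lambda>b v. dinc UNIV ?X b (v b)"
      have di: "lin R (?X b) ?D (dinc UNIV ?X b)" for b by (rule lin_dinc[of UNIV R ?X]) (use lX in auto)
      have p: "lin R ?D ?D (?p b)" for b by (rule lin_comp[OF lin_proj[of b UNIV R ?X] di]) simp
      \<comment> \<open>The component of \<open>\<epsilon>\<close> in the summand with index
        \<open>b\<close>.\<close>
      let ?e = "\<lambda>b x. ?k (?p b (\<theta> (\<epsilon> x)))"
      have \<epsilon>N: "lin R U ?N \<epsilon>" using \<epsilon> by (simp add: lin_def)
      have e': "lin R U ?N (?e b)" for b by (rule lin_comp[OF lin_comp[OF lin_comp[OF \<epsilon>N \<theta>(1)] p] k])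
      have e: "lin R U U (?e b)" for b using e' Nc by (auto simp: lin_def)
      have \<epsilon>e: "\<epsilon> (?e b x) = ?e b x" if x: "x \<in> carrier U" for b x
      proof -
        have "?e b x \<in> \<epsilon> ` carrier U" using lin_closed[OF e' x] by simp
        then show ?thesis using idem by auto
      qed
      have \<theta>x: "\<theta> (\<epsilon> x) \<in> carrier ?D" if "x \<in> carrier U" for x using lin_closed[OF lin_comp[OF \<epsilon>N \<theta>(1)] that] .
      have pc: "?p b v \<in> carrier ?D" if "v \<in> carrier ?D" for b v by (rule lin_closed[OF p that])
      have \<theta>e: "\<theta> (?e b x) = ?p b (\<theta> (\<epsilon> x))" if "x \<in> carrier U" for b x by (rule \<theta>k[OF pc[OF \<theta>x[OF that]]])
      have idem_e: "\<forall>x\<in>carrier U. ?e b (?e b x) = ?e b x" for b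
      proof
        fix x assume x: "x \<in> carrier U"
        have "?p b (\<theta> (\<epsilon> (?e b x))) = ?p b (\<theta> (\<epsilon> x))" using \<theta>e[OF x] \<epsilon>e[OF x] by (simp add: dinc_def)
        then show "?e b (?e b x) = ?e b x" by (rule arg_cong)
      qed
      have lt: "d (?e b ` carrier U) < d (\<epsilon> ` carrier U)" for b
      proof (rule d0(2)[rule_format, OF submodule_range[OF lU lU e] sN])
        have "?e b ` carrier U \<subseteq> \<epsilon> ` carrier U" using lin_closed[OF e'] by auto
        moreover have "?e b ` carrier U \<noteq> \<epsilon> ` carrier U"
        proof
          assume eq: "?e b ` carrier U = \<epsilon> ` carrier U"
          have "\<zero>\<^bsub>?X (\<not> b)\<^esub> \<in> carrier (?X (\<not> b))" using abelian_groupE(2)[OF left_module.axioms(2)[OF lX]] .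
          \<comment> \<open>A nonzero element of the other summand yields an element of the larger
            image that the smaller one misses.\<close>
          then obtain z where z: "z \<in> carrier (?X (\<not> b))" "z \<noteq> \<zero>\<^bsub>?X (\<not> b)\<^esub>" using YZ(4,5) by (cases b) auto
          let ?v = "dinc UNIV ?X (\<not> b) z"
          have v: "?v \<in> carrier ?D" by (rule lin_closed[OF di z(1)])
          have "?k ?v \<in> ?e b ` carrier U" using lin_closed[OF k v] eq by simp
          then obtain x where x: "?k ?v = ?e b x" "x \<in> carrier U" by (rule imageE)
          then have "?v = ?p b (\<theta> (\<epsilon> x))" using \<theta>k[OF v] \<theta>e[OF x(2)] by simp
          then have "?v (\<not> b) = ?p b (\<theta> (\<epsilon> x)) (\<not> b)" by simp
          then show False using z(2) by (simp add: dinc_def)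
        qed
        ultimately show "?e b ` carrier U \<subset> \<epsilon> ` carrier U" by blast
      qed
      have "\<epsilon> x = ?e True x \<oplus>\<^bsub>U\<^esub> ?e False x" if x: "x \<in> carrier U" for x
      proof -
        have "\<theta> (\<epsilon> x) = ?p True (\<theta> (\<epsilon> x)) \<oplus>\<^bsub>?D\<^esub> ?p False (\<theta> (\<epsilon> x))"
        proof
          fix b
          have "\<theta> (\<epsilon> x) b \<in> carrier (?X b)" using direct_sum_mem[OF \<theta>x[OF x], of b] by simp
          then show "\<theta> (\<epsilon> x) b = (?p True (\<theta> (\<epsilon> x)) \<oplus>\<^bsub>?D\<^esub> ?p False (\<theta> (\<epsilon> x))) b"
            using abelian_group.r_neg[OF left_module.axioms(2)[OF lX]]
              abelian_groupE(5)[OF left_module.axioms(2)[OF lX[of b]], of "\<theta> (\<epsilon> x) b"]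
              abelian_monoid.r_zero[OF abelian_group.axioms(1)[OF left_module.axioms(2)[OF lX[of b]]], of "\<theta> (\<epsilon> x) b"]
            by (cases b) (simp_all add: dinc_def)
        qed
        then have "?k (\<theta> (\<epsilon> x)) = ?k (?p True (\<theta> (\<epsilon> x)) \<oplus>\<^bsub>?D\<^esub> ?p False (\<theta> (\<epsilon> x)))" by (rule arg_cong)
        also have "\<dots> = ?e True x \<oplus>\<^bsub>?N\<^esub> ?e False x" by (rule lin_add[OF k pc[OF \<theta>x[OF x]] pc[OF \<theta>x[OF x]]])
        finally show ?thesis using k\<theta>[of "\<epsilon> x"] x by simp
      qed
      then show ?thesis
        by (intro sum[OF e e less.hyps[OF lt e idem_e] less.hyps[OF lt e idem_e]]) blast
    qed
  qed
qed

lemma idempotent_direct_summand: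
  assumes "artin R" "U \<in> fgmod R" "lin R U U \<epsilon>" "\<forall>x\<in>carrier U. \<epsilon> (\<epsilon> x) = \<epsilon> x"
  shows "direct_summand R (U\<lparr>carrier := \<epsilon> ` carrier U\<rparr>) U"
proof -
  note lU = fgmodD(1)[OF assms(2)]
  interpret U: left_module R U by (rule lU)
  let ?N = "U\<lparr>carrier := \<epsilon> ` carrier U\<rparr>" and ?Y = "U\<lparr>carrier := {x \<in> carrier U. \<epsilon> x = \<zero>\<^bsub>U\<^esub>}\<rparr>"
  have N: "?N \<in> fgmod R" by (rule fgmod_sub[OF assms(1,2) submodule_range[OF lU lU assms(3)]])
  have Y: "?Y \<in> fgmod R" by (rule fgmod_sub[OF assms(1,2) submodule_ker[OF lU lU assms(3)]])
  have ec: "\<epsilon> x \<in> carrier U" if "x \<in> carrier U" for x by (rule lin_closed[OF assms(3) that])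
  have e0: "\<epsilon> (x \<ominus>\<^bsub>U\<^esub> \<epsilon> x) = \<zero>\<^bsub>U\<^esub>" if "x \<in> carrier U" for x
    using lin_diff[OF lU lU assms(3) that ec[OF that]] assms(4) that ec U.M.minus_eq_zero_iff by simp
  let ?X = "\<lambda>b. if b then ?N else ?Y"
  let ?m = "\<lambda>x. \<lambda>b\<in>UNIV. if b then \<epsilon> x else x \<ominus>\<^bsub>U\<^esub> \<epsilon> x"
  have l1: "lin R U ?N \<epsilon>" using assms(3) by (simp add: lin_def)
  have l2: "lin R U ?Y (\<lambda>x. x \<ominus>\<^bsub>U\<^esub> \<epsilon> x)"
    using lin_difference[OF lU lin_id assms(3)] e0 by (simp add: lin_def)
  have "lin R U (?X b) (\<lambda>x. if b then \<epsilon> x else x \<ominus>\<^bsub>U\<^esub> \<epsilon> x)" for b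
    using l1 l2 by (cases b) simp_all
  then have m: "lin R U (direct_sum UNIV ?X) ?m" by (rule lin_tuple)
  have "bij_betw ?m (carrier U) (carrier (direct_sum UNIV ?X))"
  proof (rule bij_betw_byWitness[of _ "\<lambda>v. v True \<oplus>\<^bsub>U\<^esub> v False"])
    show "\<forall>x\<in>carrier U. ?m x True \<oplus>\<^bsub>U\<^esub> ?m x False = x"
      using ec U.M.diff_add_cancel_right by (simp add: U.M.a_comm)
    show "\<forall>v\<in>carrier (direct_sum UNIV ?X). ?m (v True \<oplus>\<^bsub>U\<^esub> v False) = v"
    proof
      fix v assume v: "v \<in> carrier (direct_sum UNIV ?X)"
      have vT: "v True \<in> \<epsilon> ` carrier U" and vF: "v False \<in> carrier U" "\<epsilon> (v False) = \<zero>\<^bsub>U\<^esub>"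
        using direct_sum_mem[OF v, of True] direct_sum_mem[OF v, of False] by auto
      have vT': "v True \<in> carrier U" "\<epsilon> (v True) = v True" using vT ec assms(4) by auto
      have eq: "\<epsilon> (v True \<oplus>\<^bsub>U\<^esub> v False) = v True" using vT' vF by (simp add: lin_add[OF assms(3)])
      have "(v True \<oplus>\<^bsub>U\<^esub> v False) \<ominus>\<^bsub>U\<^esub> v True = v False"
        using vT' vF by (simp add: a_minus_def U.M.a_ac U.M.r_neg1 U.M.r_neg)
      then show "?m (v True \<oplus>\<^bsub>U\<^esub> v False) = v" unfolding eq by (auto simp: fun_eq_iff)
    qed
    show "?m ` carrier U \<subseteq> carrier (direct_sum UNIV ?X)" using lin_closed[OF m] by blast
    have "v True \<oplus>\<^bsub>U\<^esub> v False \<in> carrier U" if v: "v \<in> carrier (direct_sum UNIV ?X)" for v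
    proof (rule U.M.a_closed)
      show "v True \<in> carrier U" using direct_sum_mem[OF v, of True] by (simp add: image_iff) (metis ec)
      show "v False \<in> carrier U" using direct_sum_mem[OF v, of False] by simp
    qed
    then show "(\<lambda>v. v True \<oplus>\<^bsub>U\<^esub> v False) ` carrier (direct_sum UNIV ?X) \<subseteq> carrier U" by blast
  qed
  then have "mod_iso R U (direct_sum2 ?N ?Y)" using m unfolding mod_iso_iff[OF lU] by blast
  then show ?thesis using N Y unfolding direct_summand_def by blast
qed

lemma direct_summandD:
  fixes N W :: "('a, 'a list) module"
  assumes "direct_summand R N W" "left_module R W"
  obtains a b where "lin R N W a" "lin R W N b" "\<forall>x\<in>carrier N. b (a x) = x"
proof -
  obtain Y where N: "N \<in> fgmod R" and Y: "Y \<in> fgmod R" and iso: "mod_iso R W (direct_sum2 N Y)"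
    using assms(1) by (auto simp: direct_summand_def)
  interpret W: left_module R W by fact
  let ?X = "\<lambda>b. if b then N else Y" let ?D = "direct_sum UNIV ?X"
  obtain \<theta> where \<theta>: "lin R W ?D \<theta>" "bij_betw \<theta> (carrier W) (carrier ?D)"
    using iso by (auto simp only: mod_iso_iff[OF assms(2)])
  have lX: "left_module R (?X b)" for b using N Y by (auto simp: fgmod_def)
  have di: "lin R (?X True) ?D (dinc UNIV ?X True)" by (rule lin_dinc[of UNIV R ?X]) (use lX in auto)
  then have a: "lin R N W (\<lambda>x. inv_into (carrier W) \<theta> (dinc UNIV ?X True x))"
    using lin_comp[OF di lin_inv[OF assms(2) \<theta>]] by simp
  have b: "lin R W N (\<lambda>w. \<theta> w True)" using lin_comp[OF \<theta>(1) lin_proj[of True UNIV R ?X]] by simp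
  have "\<theta> (inv_into (carrier W) \<theta> (dinc UNIV ?X True x)) True = x" if "x \<in> carrier N" for x
  proof -
    have "dinc UNIV ?X True x \<in> carrier ?D" using lin_closed[OF di, of x] that by simp
    then have "\<theta> (inv_into (carrier W) \<theta> (dinc UNIV ?X True x)) = dinc UNIV ?X True x"
      using \<theta>(2) by (simp only: bij_betw_def f_inv_into_f)
    then show ?thesis by (simp add: dinc_def)
  qed
  then show thesis using that a b by blast
qed

section \<open>Modules of homomorphisms over an endomorphism ring\<close>

text \<open>Endomorphisms act by precomposition, which is a left action of the opposite
  ring.\<close>

definition hom_mod :: "('a, 'x) ring_scheme \<Rightarrow> ('a, 'm, 'y) module_scheme \<Rightarrow> ('a, 'n, 'z) module_scheme \<Rightarrow>
    ('m \<Rightarrow> 'm, 'm \<Rightarrow> 'n) module" where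
  "hom_mod R T Y = \<lparr>carrier = mod_hom R T Y, mult = undefined, one = undefined,
     zero = (\<lambda>x\<in>carrier T. \<zero>\<^bsub>Y\<^esub>), add = (\<lambda>f g. \<lambda>x\<in>carrier T. f x \<oplus>\<^bsub>Y\<^esub> g x),
     smult = (\<lambda>k f. compose (carrier T) f k)\<rparr>"

lemma hom_mod_simps [simp]: "carrier (hom_mod R T Y) = mod_hom R T Y"
  "\<zero>\<^bsub>hom_mod R T Y\<^esub> = (\<lambda>x\<in>carrier T. \<zero>\<^bsub>Y\<^esub>)"
  "f \<oplus>\<^bsub>hom_mod R T Y\<^esub> g = (\<lambda>x\<in>carrier T. f x \<oplus>\<^bsub>Y\<^esub> g x)"
  "k \<odot>\<^bsub>hom_mod R T Y\<^esub> f = compose (carrier T) f k"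
  by (simp_all add: hom_mod_def)

lemma compose_mod_hom:
  assumes "left_module R L" "k \<in> mod_hom R L M" "lin R M N f"
  shows "compose (carrier L) f k \<in> mod_hom R L N"
  using lin_mod_hom[OF assms(1) lin_comp[OF mod_hom_lin[OF assms(2)] assms(3)]] by (simp add: compose_def)

lemma left_module_hom_mod:
  assumes "left_module R T" "left_module R Y"
  shows "left_module (opposite_ring (End_ring R T)) (hom_mod R T Y)"
proof -
  interpret Y: left_module R Y by fact
  have c: "f x \<in> carrier Y" if "f \<in> mod_hom R T Y" "x \<in> carrier T" for f x
    by (rule lin_closed[OF mod_hom_lin[OF that(1)] that(2)])
  have k: "k x \<in> carrier T" if "k \<in> mod_hom R T T" "x \<in> carrier T" for k x
    by (rule lin_closed[OF mod_hom_lin[OF that(1)] that(2)])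
  have a: "f (x \<oplus>\<^bsub>T\<^esub> y) = f x \<oplus>\<^bsub>Y\<^esub> f y" if "f \<in> mod_hom R T Y" "x \<in> carrier T" "y \<in> carrier T" for f x y
    by (rule lin_add[OF mod_hom_lin[OF that(1)] that(2,3)])
  have ag: "abelian_group (hom_mod R T Y)" by (rule abelian_group_hom_space[OF assms]) simp_all
  show ?thesis
  proof (intro left_module.intro left_module_axioms.intro ag ring_opposite_ring ring_End_ring[OF assms(1)])
    fix f assume f: "f \<in> carrier (hom_mod R T Y)"
    then have "(\<lambda>x\<in>carrier T. f x) = f" by (auto simp: mod_hom_def PiE_def extensional_restrict)
    moreover have "compose (carrier T) f (\<lambda>x\<in>carrier T. x) = (\<lambda>x\<in>carrier T. f x)" by (auto simp: compose_def fun_eq_iff)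
    ultimately show "\<one>\<^bsub>opposite_ring (End_ring R T)\<^esub> \<odot>\<^bsub>hom_mod R T Y\<^esub> f = f" by simp
  next
    fix k f assume "k \<in> carrier (opposite_ring (End_ring R T))" "f \<in> carrier (hom_mod R T Y)"
    then show "k \<odot>\<^bsub>hom_mod R T Y\<^esub> f \<in> carrier (hom_mod R T Y)"
      using compose_mod_hom[OF assms(1) _ mod_hom_lin] by simp
  qed (use c k a in \<open>auto simp: fun_eq_iff compose_def\<close>)
qed

lemma lin_hom_mod:
  assumes "left_module R T" "lin R X Y h"
  shows "lin (opposite_ring (End_ring R T)) (hom_mod R T X) (hom_mod R T Y) (\<lambda>f. compose (carrier T) h f)"
proof (rule linI)
  fix f assume "f \<in> carrier (hom_mod R T X)"
  then show "compose (carrier T) h f \<in> carrier (hom_mod R T Y)" using compose_mod_hom[OF assms(1) _ assms(2)] by simp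
next
  fix f g assume "f \<in> carrier (hom_mod R T X)" "g \<in> carrier (hom_mod R T X)"
  then show "compose (carrier T) h (f \<oplus>\<^bsub>hom_mod R T X\<^esub> g) =
      compose (carrier T) h f \<oplus>\<^bsub>hom_mod R T Y\<^esub> compose (carrier T) h g"
    using lin_add[OF assms(2)] lin_closed[OF mod_hom_lin[of _ R T X]] by (auto simp: fun_eq_iff compose_def)
next
  fix k f assume "k \<in> carrier (opposite_ring (End_ring R T))"
  then have "k x \<in> carrier T" if "x \<in> carrier T" for x using that lin_closed[OF mod_hom_lin[of k R T T]] by simp
  then show "compose (carrier T) h (k \<odot>\<^bsub>hom_mod R T X\<^esub> f) = k \<odot>\<^bsub>hom_mod R T Y\<^esub> compose (carrier T) h f"
    by (auto simp: fun_eq_iff compose_def)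
qed

section \<open>Closure properties of the extension condition\<close>

context presentation
begin

lemma extends_retract:
  assumes "extends X" "lin A X' X a" "lin A X X' b" "\<forall>x\<in>carrier X'. b (a x) = x"
  shows "extends X'"
  unfolding extends_def
proof (intro allI impI)
  fix h assume h: "lin A P1 X' h"
  obtain k where k: "lin A P0 X k" "\<forall>x\<in>carrier P1. a (h x) = k (f x)"
    using assms(1) lin_comp[OF h assms(2)] unfolding extends_def by blast
  have "h x = b (k (f x))" if "x \<in> carrier P1" for x
    using assms(4) lin_closed[OF h that] k(2) that by metis
  then show "\<exists>k. lin A P0 X' k \<and> (\<forall>x\<in>carrier P1. h x = k (f x))" using lin_comp[OF k(1) assms(3)] by blast
qed

lemma extends_direct_sum:
  assumes "\<And>i. i \<in> I \<Longrightarrow> extends (X i)"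
  shows "extends (direct_sum I X)"
  unfolding extends_def
proof (intro allI impI)
  fix h assume h: "lin A P1 (direct_sum I X) h"
  have "\<forall>i\<in>I. \<exists>k. lin A P0 (X i) k \<and> (\<forall>x\<in>carrier P1. h x i = k (f x))"
    using assms lin_comp[OF h lin_proj] unfolding extends_def by blast
  then obtain k where k: "\<forall>i\<in>I. lin A P0 (X i) (k i) \<and> (\<forall>x\<in>carrier P1. h x i = k i (f x))" by (rule bchoice[THEN exE])
  have "lin A P0 (direct_sum I X) (\<lambda>y. \<lambda>i\<in>I. k i y)" by (rule lin_tuple) (use k in blast)
  moreover have "h x = (\<lambda>i\<in>I. k i (f x))" if "x \<in> carrier P1" for x
  proof (rule extensionalityI[of _ I])
    show "h x \<in> extensional I" using lin_closed[OF h that] by (simp add: PiE_def)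
  qed (use k that in auto)
  ultimately show "\<exists>k. lin A P0 (direct_sum I X) k \<and> (\<forall>x\<in>carrier P1. h x = k (f x))" by blast
qed

text \<open>By way of the translate: the vanishing of maps to it is inherited by quotients.\<close>

lemma extends_surj:
  assumes "left_module A X" "left_module A X'" "fin_gen A X" "lin A X X' s" "s ` carrier X = carrier X'" "extends X"
  shows "extends X'"
  by (rule no_hom_imp_extends[OF assms(2) fin_gen_surj[OF assms(1,2,4,5,3)]
    no_hom_surj[OF assms(4,5) extends_imp_no_hom[OF assms(1,6)]]])

text \<open>
  A homomorphism \<open>P0 \<rightarrow> X\<close> extending a given \<open>P1 \<rightarrow> ker c\<close> induces \<open>U \<rightarrow> Y\<close>; correcting it by a lift
  of the latter makes it land in \<open>ker c\<close>.
\<close>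

lemma extends_kernel:
  assumes X: "left_module A X" and Y: "left_module A Y" and c: "lin A X Y c" and "extends X"
    and lift: "\<And>u. lin A U Y u \<Longrightarrow> \<exists>w. lin A U X w \<and> (\<forall>x\<in>carrier U. c (w x) = u x)"
  shows "extends (X\<lparr>carrier := {x \<in> carrier X. c x = \<zero>\<^bsub>Y\<^esub>}\<rparr>)"
  unfolding extends_def
proof (intro allI impI)
  interpret X: left_module A X by fact
  interpret Y: left_module A Y by fact
  note lU = fgmodD(1)[OF U]
  let ?N = "X\<lparr>carrier := {x \<in> carrier X. c x = \<zero>\<^bsub>Y\<^esub>}\<rparr>"
  fix h assume h: "lin A P1 ?N h"
  then have h': "lin A P1 X h" by (simp add: lin_def)
  then obtain k where k: "lin A P0 X k" "\<forall>x\<in>carrier P1. h x = k (f x)"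
    using assms(4) unfolding extends_def by blast
  have "c (k y) = \<zero>\<^bsub>Y\<^esub>" if "y \<in> carrier P0" "g y = \<zero>\<^bsub>U\<^esub>" for y
  proof -
    have "y \<in> f ` carrier P1" using that presD(5) by blast
    then obtain x where "y = f x" "x \<in> carrier P1" by (rule imageE)
    then show ?thesis using k(2) lin_closed[OF h, of x] by simp
  qed
  then obtain u where u: "lin A U Y u" "\<forall>y\<in>carrier P0. u (g y) = c (k y)"
    by (rule lin_factor[OF lP0 lU Y presD(4,6) lin_comp[OF k(1) c]])
  obtain w where w: "lin A U X w" "\<forall>x\<in>carrier U. c (w x) = u x" using lift[OF u(1)] by blast
  note lw = lin_comp[OF presD(4) w(1)]
  let ?k = "\<lambda>y. k y \<ominus>\<^bsub>X\<^esub> w (g y)"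
  have k': "lin A P0 X ?k" by (rule lin_difference[OF X k(1) lw])
  have "c (?k y) = \<zero>\<^bsub>Y\<^esub>" if y: "y \<in> carrier P0" for y
  proof -
    have "c (?k y) = c (k y) \<ominus>\<^bsub>Y\<^esub> c (w (g y))" by (rule lin_diff[OF X Y c lin_closed[OF k(1) y] lin_closed[OF lw y]])
    also have "c (w (g y)) = c (k y)" using w(2) u(2) y lin_closed[OF presD(4) y] by simp
    finally show ?thesis using lin_closed[OF lin_comp[OF k(1) c] y] by (simp add: a_minus_def Y.M.r_neg)
  qed
  then have "lin A P0 ?N ?k" using k' by (simp add: lin_def)
  moreover have "h x = ?k (f x)" if x: "x \<in> carrier P1" for x
  proof -
    have "f x \<in> f ` carrier P1" using x by blast
    then have "g (f x) = \<zero>\<^bsub>U\<^esub>" unfolding presD(5) by simp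
    then show ?thesis using k(2) x lin_zero[OF lU X w(1)] lin_closed[OF h' x] by simp
  qed
  ultimately show "\<exists>k. lin A P0 ?N k \<and> (\<forall>x\<in>carrier P1. h x = k (f x))" by blast
qed

end

section \<open>The Bongartz completion as a projective object relative to its torsion class\<close>

locale reduction = presentation K A P1 f P0 g U
  for K :: "('k, 'x) ring_scheme" and A :: "('k, 'a, 'y) module_scheme" and P1 f P0 g U +
  fixes T e
  assumes tau: "AR_translate K A U = tau" and completion: "Bongartz_completion K A U T"
    and e: "e \<in> mod_hom A T T" "compose (carrier T) e e = e"
    and summands: "same_indecomposable_summands A (T\<lparr>carrier := e ` carrier T\<rparr>) U"
begin

abbreviation E where "E \<equiv> opposite_ring (End_ring A T)"

abbreviation homT where "homT \<equiv> hom_mod A T"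

lemma T_fgmod: "T \<in> fgmod A" using completion by (simp add: Bongartz_completion_def)

lemmas lT = fgmodD(1)[OF T_fgmod]

lemma lin_e: "lin A T T e" by (rule mod_hom_lin[OF e(1)])

lemma e_idem: "t \<in> carrier T \<Longrightarrow> e (e t) = e t"
  using fun_cong[OF e(2), of t] by (simp add: compose_def)

lemmas lhomT = left_module_hom_mod[OF lT]

lemma T_decomposition:
  obtains n X \<theta> where "\<forall>i<n. X i \<in> fgmod A \<and> extends (X i) \<and>
      (\<forall>Z\<in>fgmod A. no_hom A Z tau \<longrightarrow> Ext1_vanishes A (X i) Z)"
    "lin A T (direct_sum {..<n :: nat} X) \<theta>" "bij_betw \<theta> (carrier T) (carrier (direct_sum {..<n} X))"
proof -
  obtain n X where X: "\<forall>i<n. indecomposable A (X i) \<and> Ext_projective A (left_perp A tau) (X i)"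
    "mod_iso A T (direct_sum {..<n :: nat} X)"
    using completion unfolding Bongartz_completion_def tau Let_def by blast
  obtain \<theta> where \<theta>: "lin A T (direct_sum {..<n} X) \<theta>" "bij_betw \<theta> (carrier T) (carrier (direct_sum {..<n} X))"
    using X(2) unfolding mod_iso_iff[OF lT] by blast
  have lp: "Z \<in> left_perp A tau \<longleftrightarrow> Z \<in> fgmod A \<and> no_hom A Z tau" for Z
    using hom_vanishes_tau[OF fgmodD(1), of Z] by (auto simp: left_perp_def)
  have "X i \<in> fgmod A \<and> extends (X i) \<and> (\<forall>Z\<in>fgmod A. no_hom A Z tau \<longrightarrow> Ext1_vanishes A (X i) Z)"
    if "i < n" for i
  proof -
    have "Ext_projective A (left_perp A tau) (X i)" using X(1) that by blast
    then have "X i \<in> fgmod A" "no_hom A (X i) tau" "\<forall>Z\<in>left_perp A tau. Ext1_vanishes A (X i) Z"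
      unfolding Ext_projective_def lp by auto
    then show ?thesis using no_hom_imp_extends[OF fgmodD, of "X i"] unfolding lp[symmetric] by (simp add: lp)
  qed
  then show thesis using that \<theta> by blast
qed

lemma extends_T: "extends T"
proof -
  obtain n X \<theta> where X: "\<forall>i<n. X i \<in> fgmod A \<and> extends (X i) \<and>
      (\<forall>Z\<in>fgmod A. no_hom A Z tau \<longrightarrow> Ext1_vanishes A (X i) Z)"
    and \<theta>: "lin A T (direct_sum {..<n :: nat} X) \<theta>" "bij_betw \<theta> (carrier T) (carrier (direct_sum {..<n} X))"
    by (rule T_decomposition)
  have "extends (direct_sum {..<n} X)" by (rule extends_direct_sum) (use X in simp)
  then show ?thesis
    by (rule extends_retract[OF _ \<theta>(1) lin_inv[OF lT \<theta>]]) (use \<theta>(2) in \<open>simp add: bij_betw_def\<close>)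
qed

text \<open>Relative projectivity of \<open>T\<close>. The kernel of \<open>c\<close> has no nonzero
  maps to the translate, so extensions of the summands of \<open>T\<close> by it split.
  Ext-projectivity is given for the indecomposable summands, so lifts are found on each of them and
  added up.\<close>

lemma T_lift:
  fixes X :: "('a, 'm, 'b) module_scheme" and Y :: "('a, 'n, 'c) module_scheme"
  assumes X: "left_module A X" "fin_gen A X" and Y: "left_module A Y" and c: "lin A X Y c"
    and h: "lin A T Y h" "h ` carrier T \<subseteq> c ` carrier X"
    and ext: "extends (X\<lparr>carrier := {x \<in> carrier X. c x = \<zero>\<^bsub>Y\<^esub>}\<rparr>)"
  obtains l where "lin A T X l" "\<forall>t\<in>carrier T. c (l t) = h t"
proof -
  obtain n Q \<theta> where Q: "\<forall>i<n. Q i \<in> fgmod A \<and> extends (Q i) \<and>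
      (\<forall>Z\<in>fgmod A. no_hom A Z tau \<longrightarrow> Ext1_vanishes A (Q i) Z)"
    and \<theta>: "lin A T (direct_sum {..<n :: nat} Q) \<theta>" "bij_betw \<theta> (carrier T) (carrier (direct_sum {..<n} Q))"
    by (rule T_decomposition)
  have lQ: "left_module A (Q i)" if "i \<in> {..<n}" for i using Q that by (simp add: fgmodD(1))
  let ?ti = "inv_into (carrier T) \<theta>" and ?D = "direct_sum {..<n} Q"
  let ?N = "X\<lparr>carrier := {x \<in> carrier X. c x = \<zero>\<^bsub>Y\<^esub>}\<rparr>"
  note ti = lin_inv[OF lT \<theta>]
  have lN: "left_module A ?N" by (rule left_module_sub[OF X(1) submodule_ker[OF X(1) Y c]])
  note nN = extends_imp_no_hom[OF lN ext]
  have van: "Ext1_vanishes A (Q i) Z" if i: "i < n" and Z: "Z \<in> fgmod A" "mod_iso A ?N Z" for i Z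
  proof -
    obtain s where s: "lin A ?N Z s" "bij_betw s (carrier ?N) (carrier Z)" using Z(2) unfolding mod_iso_iff[OF lN] by blast
    have "no_hom A Z tau" by (rule no_hom_surj[OF s(1) _ nN]) (use s(2) in \<open>simp only: bij_betw_def\<close>)
    then show ?thesis using Q i Z(1) by blast
  qed
  have ld: "lin A (Q i) ?D (dinc {..<n} Q i)" if "i \<in> {..<n}" for i by (rule lin_dinc[OF lQ that])
  have "\<forall>i\<in>{..<n}. \<exists>l. lin A (Q i) X l \<and> (\<forall>y\<in>carrier (Q i). c (l y) = h (?ti (dinc {..<n} Q i y)))"
  proof
    fix i assume i: "i \<in> {..<n}"
    note d = ld[OF i]
    have hi: "lin A (Q i) Y (\<lambda>y. h (?ti (dinc {..<n} Q i y)))" by (rule lin_comp[OF lin_comp[OF d ti] h(1)])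
    have sub: "(\<lambda>y. h (?ti (dinc {..<n} Q i y))) ` carrier (Q i) \<subseteq> c ` carrier X"
    proof (rule image_subsetI)
      fix y assume "y \<in> carrier (Q i)"
      then have "?ti (dinc {..<n} Q i y) \<in> carrier T" by (rule lin_closed[OF lin_comp[OF d ti]])
      then show "h (?ti (dinc {..<n} Q i y)) \<in> c ` carrier X" using h(2) by blast
    qed
    have Qi: "Q i \<in> fgmod A" using Q i by simp
    show "\<exists>l. lin A (Q i) X l \<and> (\<forall>y\<in>carrier (Q i). c (l y) = h (?ti (dinc {..<n} Q i y)))"
      by (rule Ext1_lift[OF cfD(6) Qi X Y c hi sub van]) (use i in auto)
  qed
  then obtain l where l: "\<forall>i\<in>{..<n}. lin A (Q i) X (l i) \<and> (\<forall>y\<in>carrier (Q i). c (l i y) = h (?ti (dinc {..<n} Q i y)))"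
    by (rule bchoice[THEN exE])
  let ?l = "\<lambda>t. finsum X (\<lambda>i. l i (\<theta> t i)) {..<n}"
  have "lin A ?D X (\<lambda>u. finsum X (\<lambda>i. l i (u i)) {..<n})" by (rule lin_cotuple[OF cfD(3) lQ X(1)]) (use l in auto)
  then have "lin A T X ?l" by (rule lin_comp[OF \<theta>(1)])
  moreover have "c (?l t) = h t" if t: "t \<in> carrier T" for t
  proof -
    note tD = lin_closed[OF \<theta>(1) t]
    have m: "\<theta> t i \<in> carrier (Q i)" if "i \<in> {..<n}" for i by (rule direct_sum_mem[OF tD that])
    have lm: "l i (\<theta> t i) \<in> carrier X" if "i \<in> {..<n}" for i
      by (rule lin_closed[OF _ m[OF that]]) (use l that in blast)
    have "c (?l t) = finsum Y (\<lambda>i. c (l i (\<theta> t i))) {..<n}" by (rule lin_of_finsum[OF X(1) Y c lm])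
    also have "\<dots> = finsum Y (\<lambda>i. h (?ti (dinc {..<n} Q i (\<theta> t i)))) {..<n}"
    proof (rule abelian_monoid.finsum_cong')
      show "abelian_monoid Y" using Y by (simp add: left_module_def abelian_group_def)
      show "(\<lambda>i. h (?ti (dinc {..<n} Q i (\<theta> t i)))) \<in> {..<n} \<rightarrow> carrier Y"
        by (rule Pi_I) (rule lin_closed[OF lin_comp[OF lin_comp[OF ld ti] h(1)] m])
    qed (use l m in auto)
    also have "\<dots> = h (?ti (\<theta> t))"
      by (rule lin_direct_sum_eq[OF cfD(3) _ lQ Y lin_comp[OF ti h(1)] tD, symmetric]) simp
    also have "?ti (\<theta> t) = t" using \<theta>(2) t by (simp add: bij_betw_def)
    finally show ?thesis .
  qed
  ultimately show thesis using that by blast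
qed

end

section \<open>Realising modules over the reduction\<close>

context reduction
begin

section \<open>Presentations over the endomorphism ring by powers of T\<close>

abbreviation TS :: "'n set \<Rightarrow> ('a, 'n \<Rightarrow> 'a list) module" where "TS S \<equiv> direct_sum S (\<lambda>_. T)"

text \<open>The \<open>s\<close>-th component of a map from \<open>T\<close> to its power, as an
  element of \<open>E\<close>; these components exhibit Hom(T, T^S), for finite \<open>S\<close>, as
  a free \<open>E\<close>-module on \<open>S\<close>.\<close>

definition row :: "'n \<Rightarrow> ('a list \<Rightarrow> 'n \<Rightarrow> 'a list) \<Rightarrow> 'a list \<Rightarrow> 'a list" where
  "row s w = (\<lambda>t\<in>carrier T. w t s)"

text \<open>The map from the free \<open>E\<close>-module Hom(T, T^S) to \<open>N\<close> that sends
  the basis element belonging to \<open>s\<close>, the inclusion of a summand, to \<open>s\<close>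
  itself.\<close>

definition ev :: "('a list \<Rightarrow> 'a list, 'n, 'z) module_scheme \<Rightarrow> 'n set \<Rightarrow> ('a list \<Rightarrow> 'n \<Rightarrow> 'a list) \<Rightarrow> 'n" where
  "ev N S w = finsum N (\<lambda>s. row s w \<odot>\<^bsub>N\<^esub> s) S"

lemma lTS: "left_module A (TS S)" by (rule left_module_direct_sum[OF cfD(3) lT])

lemma fin_gen_TS: "finite S \<Longrightarrow> fin_gen A (TS S)"
  by (rule fin_gen_direct_sum[OF cfD(3) _ lT fgmodD(2)[OF T_fgmod]])

lemma row_mod_hom:
  assumes "w \<in> mod_hom A T (TS S)" "s \<in> S"
  shows "row s w \<in> mod_hom A T T"
  unfolding row_def by (rule lin_mod_hom[OF lT lin_comp[OF mod_hom_lin[OF assms(1)] lin_proj[OF assms(2)]]])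

lemma ring_E: "ring E" by (rule ring_opposite_ring[OF ring_End_ring[OF lT]])

lemma lin_row:
  assumes "s \<in> S"
  shows "lin E (homT (TS S)) (regular_module E) (row s)"
proof (rule linI)
  fix w assume "w \<in> carrier (homT (TS S))"
  then show "row s w \<in> carrier (regular_module E)" using row_mod_hom[OF _ assms] by simp
next
  fix k w assume "k \<in> carrier E" "w \<in> carrier (homT (TS S))"
  then have "k t \<in> carrier T" if "t \<in> carrier T" for t using lin_closed[OF mod_hom_lin[of k A T T] that] by simp
  then show "row s (k \<odot>\<^bsub>homT (TS S)\<^esub> w) = k \<odot>\<^bsub>regular_module E\<^esub> row s w"
    by (auto simp: row_def compose_def fun_eq_iff)
qed (use assms in \<open>auto simp: row_def fun_eq_iff\<close>)

lemma lin_ev: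
  assumes "left_module E N" "S \<subseteq> carrier N"
  shows "lin E (homT (TS S)) N (ev N S)"
proof -
  have "lin E (homT (TS S)) N (\<lambda>w. finsum N (\<lambda>s. row s w \<odot>\<^bsub>N\<^esub> s) S)"
    by (rule lin_finsum[OF lhomT[OF lTS] assms(1)]) (use assms(2) in \<open>auto intro: lin_smult_const[OF assms(1) _ lin_row]\<close>)
  then show ?thesis unfolding ev_def[abs_def] .
qed

lemma ev_inclusion:
  assumes "left_module E N" "finite S" "S \<subseteq> carrier N" "s \<in> S"
  shows "ev N S (\<lambda>t\<in>carrier T. dinc S (\<lambda>_. T) s t) = s"
proof -
  interpret N: left_module E N by fact
  let ?w = "\<lambda>t\<in>carrier T. dinc S (\<lambda>_. T) s t"
  have "row j ?w = dinc S (\<lambda>_. regular_module E) s \<one>\<^bsub>E\<^esub> j" if "j \<in> S" for j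
    using that by (auto simp: row_def dinc_def fun_eq_iff)
  then have "ev N S ?w = finsum N (\<lambda>j. dinc S (\<lambda>_. regular_module E) s \<one>\<^bsub>E\<^esub> j \<odot>\<^bsub>N\<^esub> j) S"
  proof (unfold ev_def, intro N.M.finsum_cong')
    show "(\<lambda>j. dinc S (\<lambda>_. regular_module E) s \<one>\<^bsub>E\<^esub> j \<odot>\<^bsub>N\<^esub> j) \<in> S \<rightarrow> carrier N"
    proof (rule Pi_I)
      fix j assume "j \<in> S"
      moreover have "dinc S (\<lambda>_. regular_module E) s \<one>\<^bsub>E\<^esub> j \<in> carrier E"
        using N.R.one_closed N.R.zero_closed \<open>j \<in> S\<close> by (simp add: dinc_def del: opposite_ring_simps)
      ultimately show "dinc S (\<lambda>_. regular_module E) s \<one>\<^bsub>E\<^esub> j \<odot>\<^bsub>N\<^esub> j \<in> carrier N" using assms(3) by blast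
    qed
  qed simp_all
  also have "\<dots> = \<one>\<^bsub>E\<^esub> \<odot>\<^bsub>N\<^esub> s"
    by (rule cotuple_dinc[of S s E "\<lambda>_. regular_module E" N "\<lambda>j a. a \<odot>\<^bsub>N\<^esub> j", OF assms(2,4) left_module_regular[OF ring_E] assms(1)
        lin_smult_const[OF assms(1) _ lin_id]])
      (use assms(3) N.R.one_closed in auto)
  also have "\<dots> = s" using assms(3,4) by (intro N.smult_one) blast
  finally show ?thesis .
qed

lemma ev_surj:
  assumes "left_module E N" "finite S" "S \<subseteq> carrier N"
    and gen: "\<forall>H. submodule H E N \<longrightarrow> S \<subseteq> H \<longrightarrow> H = carrier N"
  shows "ev N S ` mod_hom A T (TS S) = carrier N"
proof -
  have "submodule (ev N S ` carrier (homT (TS S))) E N"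
    by (rule submodule_range[OF lhomT[OF lTS] assms(1) lin_ev[OF assms(1,3)]])
  moreover have "S \<subseteq> ev N S ` carrier (homT (TS S))"
  proof
    fix s assume s: "s \<in> S"
    have "(\<lambda>t\<in>carrier T. dinc S (\<lambda>_. T) s t) \<in> carrier (homT (TS S))"
      using lin_mod_hom[OF lT lin_dinc[of S A "\<lambda>_. T" s, OF lT s]] by simp
    then show "s \<in> ev N S ` carrier (homT (TS S))"
      by (rule rev_image_eqI) (rule ev_inclusion[OF assms(1-3) s, symmetric])
  qed
  ultimately show ?thesis using gen by simp
qed

text \<open>
  The conditions on the quotient \<open>r : T\<^sup>S \<rightarrow> X\<close> say that \<open>Hom(T, r)\<close> is onto \<open>Hom(T, X)\<close>, with the same
  kernel as the map onto \<open>N\<close>, and that \<open>ker r\<close> is generated by the images of the maps in this kernel.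
\<close>

definition realizes :: "('a list \<Rightarrow> 'a list, 'n, 'z) module_scheme \<Rightarrow> 'n set \<Rightarrow>
    (('n \<Rightarrow> 'a list) \<Rightarrow> 'n \<Rightarrow> 'a list) \<Rightarrow> ('a, 'n \<Rightarrow> 'a list) module \<Rightarrow> bool" where
  "realizes N S r X \<longleftrightarrow> left_module E N \<and> finite S \<and> S \<subseteq> carrier N \<and>
     ev N S ` mod_hom A T (TS S) = carrier N \<and> left_module A X \<and> lin A (TS S) X r \<and> r ` carrier (TS S) = carrier X \<and>
     (\<forall>w\<in>mod_hom A T (TS S). ev N S w = \<zero>\<^bsub>N\<^esub> \<longleftrightarrow> (\<forall>t\<in>carrier T. r (w t) = \<zero>\<^bsub>X\<^esub>)) \<and>
     (\<forall>h. lin A T X h \<longrightarrow> (\<exists>w\<in>mod_hom A T (TS S). \<forall>t\<in>carrier T. r (w t) = h t)) \<and>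
     (\<forall>H. submodule H A (TS S) \<longrightarrow> (\<forall>w\<in>mod_hom A T (TS S). ev N S w = \<zero>\<^bsub>N\<^esub> \<longrightarrow> w ` carrier T \<subseteq> H) \<longrightarrow>
        {y \<in> carrier (TS S). r y = \<zero>\<^bsub>X\<^esub>} \<subseteq> H)"

lemma realizesD:
  assumes "realizes N S r X"
  shows "left_module E N" "finite S" "S \<subseteq> carrier N" "ev N S ` mod_hom A T (TS S) = carrier N"
    "left_module A X" "lin A (TS S) X r" "r ` carrier (TS S) = carrier X"
    "\<And>w. w \<in> mod_hom A T (TS S) \<Longrightarrow> ev N S w = \<zero>\<^bsub>N\<^esub> \<longleftrightarrow> (\<forall>t\<in>carrier T. r (w t) = \<zero>\<^bsub>X\<^esub>)"
    "\<And>h. lin A T X h \<Longrightarrow> \<exists>w\<in>mod_hom A T (TS S). \<forall>t\<in>carrier T. r (w t) = h t"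
    "\<And>H y. submodule H A (TS S) \<Longrightarrow> (\<And>w. w \<in> mod_hom A T (TS S) \<Longrightarrow> ev N S w = \<zero>\<^bsub>N\<^esub> \<Longrightarrow> w ` carrier T \<subseteq> H) \<Longrightarrow>
      y \<in> carrier (TS S) \<Longrightarrow> r y = \<zero>\<^bsub>X\<^esub> \<Longrightarrow> y \<in> H"
proof -
  note R = assms[unfolded realizes_def]
  show "left_module E N" "finite S" "S \<subseteq> carrier N" "ev N S ` mod_hom A T (TS S) = carrier N"
    "left_module A X" "lin A (TS S) X r" "r ` carrier (TS S) = carrier X"
    using R by - (elim conjE, assumption)+
  note c = R[THEN conjunct2, THEN conjunct2, THEN conjunct2, THEN conjunct2, THEN conjunct2, THEN conjunct2, THEN conjunct2]
  show "\<And>w. w \<in> mod_hom A T (TS S) \<Longrightarrow> ev N S w = \<zero>\<^bsub>N\<^esub> \<longleftrightarrow> (\<forall>t\<in>carrier T. r (w t) = \<zero>\<^bsub>X\<^esub>)"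
    by (rule c[THEN conjunct1, rule_format])
  show "\<And>h. lin A T X h \<Longrightarrow> \<exists>w\<in>mod_hom A T (TS S). \<forall>t\<in>carrier T. r (w t) = h t"
    by (rule c[THEN conjunct2, THEN conjunct1, rule_format])
  fix H y assume "submodule H A (TS S)" "y \<in> carrier (TS S)" "r y = \<zero>\<^bsub>X\<^esub>"
    and "\<And>w. w \<in> mod_hom A T (TS S) \<Longrightarrow> ev N S w = \<zero>\<^bsub>N\<^esub> \<Longrightarrow> w ` carrier T \<subseteq> H"
  then show "y \<in> H" by (intro subsetD[OF c[THEN conjunct2, THEN conjunct2, rule_format, of H]] CollectI conjI)
qed

text \<open>
  Let \<open>V\<close> be the kernel of \<open>Hom(T, T\<^sup>S) \<rightarrow> N\<close>, generated over \<open>K\<close> by \<open>G\<close>, and \<open>cc : T\<^sup>G \<rightarrow> T\<^sup>S\<close> the map with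
  components in \<open>G\<close>. Since \<open>e\<close> kills \<open>N\<close>, every map \<open>T \<rightarrow> T\<^sup>S\<close> through \<open>e\<close> lies in \<open>V\<close>, hence every map from
  \<open>U\<close> lifts along \<open>cc\<close>. So \<open>extends\<close> holds for \<open>ker cc\<close>, and maps from \<open>T\<close> into the image of \<open>cc\<close> lift
  to \<open>T\<^sup>G\<close>, which puts them in \<open>V\<close>.
\<close>

lemma ex_realizes:
  fixes N :: "('a list \<Rightarrow> 'a list, 'n, 'z) module_scheme"
  assumes N: "left_module E N" "fin_gen E N" and eN: "\<And>n. n \<in> carrier N \<Longrightarrow> e \<odot>\<^bsub>N\<^esub> n = \<zero>\<^bsub>N\<^esub>"
  obtains S r X where "realizes N S r X"
proof -
  interpret N: left_module E N by (rule N(1))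
  obtain S where S: "finite S" "S \<subseteq> carrier N" "\<forall>H. submodule H E N \<longrightarrow> S \<subseteq> H \<longrightarrow> H = carrier N"
    by (rule fin_genE[OF N(2)]) (rule that)
  let ?Y = "TS S" and ?HK = "homK \<rho> A T (TS S)"
  note lY = lTS[of S] and fY = fin_gen_TS[OF S(1)] and ev = lin_ev[OF N(1) S(2)]
  define V where "V = {w \<in> mod_hom A T ?Y. ev N S w = \<zero>\<^bsub>N\<^esub>}"
  have VE: "submodule V E (homT ?Y)" using submodule_ker[OF lhomT[OF lY] N(1) ev] by (simp add: V_def)
  note VE' = VE[unfolded submodule_iff[OF lhomT[OF lY]]]
  note lHK = left_module_homK[OF cf lT lY]
  \<comment> \<open>Scalars act on maps out of \<open>T\<close> by precomposition with scalar
    endomorphisms, so an \<open>E\<close>-submodule is a subspace; finite dimension then supplies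
    the finite set \<open>G\<close>.\<close>
  have VK: "submodule V K ?HK"
    unfolding submodule_iff[OF lHK]
  proof (intro conjI ballI)
    fix c w assume c: "c \<in> carrier K" and w: "w \<in> V"
    then have lw: "lin A T ?Y w" by (intro mod_hom_lin) (simp add: V_def)
    have k: "(\<lambda>t\<in>carrier T. \<rho> c \<odot>\<^bsub>T\<^esub> t) \<in> mod_hom A T T"
      by (rule lin_mod_hom[OF lT lin_central_smult[OF cf lT lin_id c]])
    have "c \<odot>\<^bsub>?HK\<^esub> w = compose (carrier T) w (\<lambda>t\<in>carrier T. \<rho> c \<odot>\<^bsub>T\<^esub> t)"
      using lin_smult[OF lw cfD(8)[OF c]] by (auto simp: compose_def fun_eq_iff)
    then show "c \<odot>\<^bsub>?HK\<^esub> w \<in> V" using VE' k w by simp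
  qed (use VE' in simp_all)
  have "fin_gen K (?HK\<lparr>carrier := V\<rparr>)"
    by (rule FL_fin_gen[OF left_module_sub[OF lHK VK] FL_sub[OF lHK VK
      FL_homK[OF cf lT fgmodD(2)[OF T_fgmod] lY fY]]])
  then obtain G where G: "finite G" "G \<subseteq> V" "\<forall>H. submodule H K (?HK\<lparr>carrier := V\<rparr>) \<longrightarrow> G \<subseteq> H \<longrightarrow> H = V"
    by (rule fin_genE) (use that in simp)
  have VG: "lin A T ?Y v" if "v \<in> V" for v by (rule mod_hom_lin) (use that in \<open>simp add: V_def\<close>)
  let ?M = "TS G"
  note lM = lTS[of G] and fM = fin_gen_TS[OF G(1)]
  define cc where "cc u = finsum ?Y (\<lambda>v. v (u v)) G" for u
  have cc: "lin A ?M ?Y cc"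
    unfolding cc_def[abs_def] by (rule lin_cotuple[OF cfD(3) lT lY]) (use VG G(2) in blast)
  \<comment> \<open>The members of \<open>V\<close> that lift along \<open>cc\<close> form a
    subspace, and each \<open>v\<close> in \<open>G\<close> lifts to the inclusion of its own
    summand.\<close>
  have lift_V: "\<exists>z. lin A T ?M z \<and> (\<forall>t\<in>carrier T. cc (z t) = w t)" if w: "w \<in> V" for w
  proof -
    let ?H = "{w \<in> V. \<exists>z. lin A T ?M z \<and> (\<forall>t\<in>carrier T. cc (z t) = w t)}"
    have "submodule ?H K (?HK\<lparr>carrier := V\<rparr>)"
      unfolding submodule_sub_iff[OF lHK VK] submodule_iff[OF lHK]
    proof (intro conjI ballI)
      show "?H \<subseteq> carrier ?HK" by (auto simp: V_def)
      show "\<zero>\<^bsub>?HK\<^esub> \<in> ?H"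
      proof (rule CollectI, intro conjI exI[of _ "\<lambda>x. \<zero>\<^bsub>?M\<^esub>"] ballI lin_const_zero[OF lM])
        show "\<zero>\<^bsub>?HK\<^esub> \<in> V" using VK unfolding submodule_iff[OF lHK] by blast
        show "cc \<zero>\<^bsub>?M\<^esub> = \<zero>\<^bsub>?HK\<^esub> t" if "t \<in> carrier T" for t unfolding lin_zero[OF lM lY cc] using that by simp
      qed
      fix w w' assume "w \<in> ?H" "w' \<in> ?H"
      then obtain z z' where z: "w \<in> V" "w' \<in> V" "lin A T ?M z" "\<forall>t\<in>carrier T. cc (z t) = w t"
        "lin A T ?M z'" "\<forall>t\<in>carrier T. cc (z' t) = w' t" by blast
      have "w \<oplus>\<^bsub>?HK\<^esub> w' \<in> V" using VK[unfolded submodule_iff[OF lHK]] z(1,2) by blast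
      moreover have "\<forall>t\<in>carrier T. cc (z t \<oplus>\<^bsub>?M\<^esub> z' t) = (w \<oplus>\<^bsub>?HK\<^esub> w') t"
      proof
        fix t assume t: "t \<in> carrier T"
        show "cc (z t \<oplus>\<^bsub>?M\<^esub> z' t) = (w \<oplus>\<^bsub>?HK\<^esub> w') t"
          unfolding lin_add[OF cc lin_closed[OF z(3) t] lin_closed[OF z(5) t]] using z t by simp
      qed
      ultimately show "w \<oplus>\<^bsub>?HK\<^esub> w' \<in> ?H" using lin_sum[OF lM z(3,5)] by blast
    next
      fix c w assume c: "c \<in> carrier K" and "w \<in> ?H"
      then obtain z where z: "w \<in> V" "lin A T ?M z" "\<forall>t\<in>carrier T. cc (z t) = w t" by blast
      have "c \<odot>\<^bsub>?HK\<^esub> w \<in> V" using VK[unfolded submodule_iff[OF lHK]] z(1) c by blast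
      moreover have "\<forall>t\<in>carrier T. cc (\<rho> c \<odot>\<^bsub>?M\<^esub> z t) = (c \<odot>\<^bsub>?HK\<^esub> w) t"
      proof
        fix t assume t: "t \<in> carrier T"
        show "cc (\<rho> c \<odot>\<^bsub>?M\<^esub> z t) = (c \<odot>\<^bsub>?HK\<^esub> w) t"
          unfolding lin_smult[OF cc cfD(8)[OF c] lin_closed[OF z(2) t]] using z t by simp
      qed
      ultimately show "c \<odot>\<^bsub>?HK\<^esub> w \<in> ?H" using lin_central_smult[OF cf lM z(2) c] by blast
    qed blast
    moreover have "G \<subseteq> ?H"
    proof
      fix v assume v: "v \<in> G"
      have "cc (dinc G (\<lambda>_. T) v t) = v t" if "t \<in> carrier T" for t
        unfolding cc_def by (rule cotuple_dinc[of G v A "\<lambda>_. T" ?Y "\<lambda>v. v", OF G(1) v lT lY _ that]) (use VG G(2) in blast)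
      then show "v \<in> ?H" using lin_dinc[of G A "\<lambda>_. T" v, OF lT v] v G(2) by blast
    qed
    ultimately have "?H = V" using G(3) by blast
    then show ?thesis using w by blast
  qed
  \<comment> \<open>A map through \<open>cc\<close> is a sum of members of \<open>G\<close>
    precomposed with endomorphisms of \<open>T\<close>, and \<open>V\<close> is closed under such
    precomposition.\<close>
  have factor_V: "w \<in> V" if w: "w \<in> mod_hom A T ?Y" and z: "lin A T ?M z" "\<forall>t\<in>carrier T. cc (z t) = w t" for w z
  proof -
    let ?f = "\<lambda>v. compose (carrier T) v (row v z)"
    have rz: "restrict z (carrier T) \<in> mod_hom A T ?M" by (rule lin_mod_hom[OF lT z(1)])
    have f: "?f v \<in> V" if v: "v \<in> G" for v
    proof -
      have "row v (restrict z (carrier T)) \<in> carrier E" using row_mod_hom[OF rz v] by simp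
      also have "row v (restrict z (carrier T)) = row v z" by (auto simp: row_def)
      finally show ?thesis using VE' v G(2) by auto
    qed
    have fc: "?f v \<in> carrier ?HK" if "v \<in> G" for v using f[OF that] by (simp add: V_def)
    have fV: "finsum ?HK ?f G \<in> V" by (rule submodule_finsum[OF lHK VK]) (rule f)
    have "w = finsum ?HK ?f G"
    proof (rule mod_hom_eqI[OF w])
      show "finsum ?HK ?f G \<in> mod_hom A T ?Y" using fV by (simp add: V_def)
      fix t assume t: "t \<in> carrier T"
      have lYK: "left_module K (restr \<rho> ?Y)" by (rule left_module_restr[OF lY cfD(2,4)])
      have "finsum ?HK ?f G t = finsum (restr \<rho> ?Y) (\<lambda>v. ?f v t) G"
        by (rule lin_of_finsum[OF lHK lYK lin_eval_homK[OF t] fc])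
      also have "\<dots> = finsum ?Y (\<lambda>v. ?f v t) G" by (rule finsum_restr)
      also have "\<dots> = cc (z t)" using t by (simp add: cc_def compose_def row_def)
      also have "\<dots> = w t" using z(2) t by blast
      finally show "w t = finsum ?HK ?f G t" by simp
    qed
    then show ?thesis using fV by simp
  qed
  \<comment> \<open>\<open>U\<close> itself need not be a summand of \<open>T\<close>, as its
    summands may be repeated. So the claim is reduced to idempotents with indecomposable image, and
    such an image is a summand of the image of \<open>e\<close>.\<close>
  have lift_U: "\<exists>w. lin A U ?M w \<and> (\<forall>x\<in>carrier U. cc (w x) = u x)" if "lin A U ?Y u" for u
  proof -
    have lU: "left_module A U" by (rule fgmodD(1)[OF U])
    have "\<forall>u. lin A U ?Y u \<longrightarrow> (\<exists>w. lin A U ?M w \<and> (\<forall>x\<in>carrier U. cc (w x) = u ((\<lambda>x. x) x)))"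
    proof (rule idempotent_induct[OF cfD(6) U lin_id, where Q = "\<lambda>\<epsilon>. \<forall>u. lin A U ?Y u \<longrightarrow> (\<exists>w. lin A U ?M w \<and> (\<forall>x\<in>carrier U. cc (w x) = u (\<epsilon> x)))"])
      fix \<epsilon> assume z: "\<forall>x\<in>carrier U. \<epsilon> x = \<zero>\<^bsub>U\<^esub>"
      show "\<forall>u. lin A U ?Y u \<longrightarrow> (\<exists>w. lin A U ?M w \<and> (\<forall>x\<in>carrier U. cc (w x) = u (\<epsilon> x)))"
      proof (intro allI impI exI[of _ "\<lambda>x. \<zero>\<^bsub>?M\<^esub>"] conjI ballI)
        fix u x assume "lin A U ?Y u" "x \<in> carrier U"
        then show "cc \<zero>\<^bsub>?M\<^esub> = u (\<epsilon> x)" using z lin_zero[OF lM lY cc] lin_zero[OF lU lY, of u] by simp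
      qed (rule lin_const_zero[OF lM])
    next
      fix \<epsilon> \<epsilon>1 \<epsilon>2 assume l: "lin A U U \<epsilon>1" "lin A U U \<epsilon>2"
        and ih: "\<forall>u. lin A U ?Y u \<longrightarrow> (\<exists>w. lin A U ?M w \<and> (\<forall>x\<in>carrier U. cc (w x) = u (\<epsilon>1 x)))"
          "\<forall>u. lin A U ?Y u \<longrightarrow> (\<exists>w. lin A U ?M w \<and> (\<forall>x\<in>carrier U. cc (w x) = u (\<epsilon>2 x)))"
        and s: "\<forall>x\<in>carrier U. \<epsilon> x = \<epsilon>1 x \<oplus>\<^bsub>U\<^esub> \<epsilon>2 x"
      show "\<forall>u. lin A U ?Y u \<longrightarrow> (\<exists>w. lin A U ?M w \<and> (\<forall>x\<in>carrier U. cc (w x) = u (\<epsilon> x)))"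
      proof (intro allI impI)
        fix u assume u: "lin A U ?Y u"
        obtain w1 where w1: "lin A U ?M w1" "\<forall>x\<in>carrier U. cc (w1 x) = u (\<epsilon>1 x)" using ih(1) u by blast
        obtain w2 where w2: "lin A U ?M w2" "\<forall>x\<in>carrier U. cc (w2 x) = u (\<epsilon>2 x)" using ih(2) u by blast
        have "cc (w1 x \<oplus>\<^bsub>?M\<^esub> w2 x) = u (\<epsilon> x)" if x: "x \<in> carrier U" for x
          unfolding lin_add[OF cc lin_closed[OF w1(1) x] lin_closed[OF w2(1) x]]
            s[rule_format, OF x] lin_add[OF u lin_closed[OF l(1) x] lin_closed[OF l(2) x]]
            w1(2)[rule_format, OF x] w2(2)[rule_format, OF x] ..
        then show "\<exists>w. lin A U ?M w \<and> (\<forall>x\<in>carrier U. cc (w x) = u (\<epsilon> x))"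
          using lin_sum[OF lM w1(1) w2(1)] by blast
      qed
    next
      fix \<epsilon> assume l: "lin A U U \<epsilon>" and id: "\<forall>x\<in>carrier U. \<epsilon> (\<epsilon> x) = \<epsilon> x"
        and ind: "indecomposable A (U\<lparr>carrier := \<epsilon> ` carrier U\<rparr>)"
      let ?N = "U\<lparr>carrier := \<epsilon> ` carrier U\<rparr>" and ?eT = "T\<lparr>carrier := e ` carrier T\<rparr>"
      have "direct_summand A ?N U" by (rule idempotent_direct_summand[OF cfD(6) U l id])
      then have ds: "direct_summand A ?N ?eT" using summands ind by (simp add: same_indecomposable_summands_def)
      have leT: "left_module A ?eT" by (rule left_module_sub[OF lT submodule_range[OF lT lT lin_e]])
      obtain a b where ab: "lin A ?N ?eT a" "lin A ?eT ?N b" "\<forall>x\<in>carrier ?N. b (a x) = x"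
        by (rule direct_summandD[OF ds leT])
      have l1: "lin A U ?N \<epsilon>" using l by (simp add: lin_def)
      have l2: "lin A T ?eT e" using lin_e by (simp add: lin_def)
      have inN: "\<epsilon> ` carrier U \<subseteq> carrier U" using lin_closed[OF l] by blast
      have ineT: "e ` carrier T \<subseteq> carrier T" using lin_closed[OF lin_e] by blast
      have l3: "lin A ?N U (\<lambda>x. x)" using inN by (auto simp: lin_def)
      have l4: "lin A ?eT T (\<lambda>x. x)" using ineT by (auto simp: lin_def)
      show "\<forall>u. lin A U ?Y u \<longrightarrow> (\<exists>w. lin A U ?M w \<and> (\<forall>x\<in>carrier U. cc (w x) = u (\<epsilon> x)))"
      proof (intro allI impI)
        fix u assume u: "lin A U ?Y u"
        define v where "v = (\<lambda>t\<in>carrier T. u (b (e t)))"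
        have v: "v \<in> mod_hom A T ?Y"
          unfolding v_def by (rule lin_mod_hom[OF lT lin_comp[OF lin_comp[OF lin_comp[OF l2 ab(2)] l3] u]])
        \<comment> \<open>\<open>v\<close> factors through \<open>e\<close>, so its value under
          \<open>ev N S\<close> equals \<open>e\<close> times that value, which is zero.\<close>
        have "e \<odot>\<^bsub>homT ?Y\<^esub> v = v" using lin_closed[OF lin_e] by (auto simp: v_def compose_def fun_eq_iff e_idem)
        then have "ev N S v = e \<odot>\<^bsub>N\<^esub> ev N S v" using lin_smult[OF ev, of e v] e(1) v by simp
        also have "\<dots> = \<zero>\<^bsub>N\<^esub>" by (rule eN) (rule lin_closed[OF ev], use v in simp)
        finally have "v \<in> V" using v by (simp add: V_def)
        then obtain z where z: "lin A T ?M z" "\<forall>t\<in>carrier T. cc (z t) = v t" using lift_V by blast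
        have "cc (z (a (\<epsilon> x))) = u (\<epsilon> x)" if x: "x \<in> carrier U" for x
        proof -
          have m: "a (\<epsilon> x) \<in> carrier ?eT" by (rule lin_closed[OF ab(1) lin_closed[OF l1 x]])
          then have m': "a (\<epsilon> x) \<in> carrier T" using ineT by auto
          have "e (a (\<epsilon> x)) = a (\<epsilon> x)" using m e_idem by auto
          then have "v (a (\<epsilon> x)) = u (b (a (\<epsilon> x)))" using m' by (simp add: v_def)
          also have "b (a (\<epsilon> x)) = \<epsilon> x" using ab(3) lin_closed[OF l1 x] by blast
          finally show ?thesis using z(2) m' by simp
        qed
        then show "\<exists>w. lin A U ?M w \<and> (\<forall>x\<in>carrier U. cc (w x) = u (\<epsilon> x))"
          using lin_comp[OF lin_comp[OF lin_comp[OF l1 ab(1)] l4] z(1)] by blast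
      qed
    qed simp
    then show ?thesis using that by simp
  qed
  have extM: "extends ?M" by (rule extends_direct_sum) (rule extends_T)
  have extK: "extends (?M\<lparr>carrier := {x \<in> carrier ?M. cc x = \<zero>\<^bsub>?Y\<^esub>}\<rparr>)"
    by (rule extends_kernel[OF lM lY cc extM lift_U])
  let ?C = "?Y\<lparr>carrier := cc ` carrier ?M\<rparr>"
  note sC = submodule_range[OF lM lY cc]
  \<comment> \<open>The image of \<open>cc\<close> is to be the kernel of \<open>r\<close>: this
    fact lifts maps from \<open>T\<close> along \<open>r\<close>, whereas \<open>extK\<close> lifts
    them along \<open>cc\<close>.\<close>
  have extC: "extends ?C"
    by (rule extends_surj[OF lM left_module_sub[OF lY sC] fM _ _ extM, of cc]) (use cc in \<open>simp_all add: lin_def\<close>)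
  obtain X :: "('a, 'n \<Rightarrow> 'a list) module" and r where X: "left_module A X" and r: "lin A ?Y X r" "r ` carrier ?Y = carrier X"
    and ker: "\<forall>y\<in>carrier ?Y. r y = \<zero>\<^bsub>X\<^esub> \<longleftrightarrow> y \<in> cc ` carrier ?M"
    by (rule ex_quotient[OF lY sC]) (rule that)
  have V_iff: "w \<in> V \<longleftrightarrow> (\<forall>t\<in>carrier T. r (w t) = \<zero>\<^bsub>X\<^esub>)" if w: "w \<in> mod_hom A T ?Y" for w
  proof
    assume "w \<in> V"
    then obtain z where z: "lin A T ?M z" "\<forall>t\<in>carrier T. cc (z t) = w t" using lift_V by blast
    have "w t \<in> cc ` carrier ?M" if t: "t \<in> carrier T" for t
      unfolding z(2)[rule_format, OF t, symmetric] by (rule imageI[OF lin_closed[OF z(1) t]])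
    then show "\<forall>t\<in>carrier T. r (w t) = \<zero>\<^bsub>X\<^esub>" using ker lin_closed[OF mod_hom_lin[OF w]] by blast
  next
    assume "\<forall>t\<in>carrier T. r (w t) = \<zero>\<^bsub>X\<^esub>"
    then have "w ` carrier T \<subseteq> cc ` carrier ?M" using ker lin_closed[OF mod_hom_lin[OF w]] by blast
    then obtain l where "lin A T ?M l" "\<forall>t\<in>carrier T. cc (l t) = w t"
      by (rule T_lift[OF lM fM lY cc mod_hom_lin[OF w] _ extK]) (rule that)
    then show "w \<in> V" by (rule factor_V[OF w])
  qed
  have "realizes N S r X"
    unfolding realizes_def
  proof (intro conjI ballI allI impI N(1) S(1,2) X r ev_surj[OF N(1) S])
    fix w assume w: "w \<in> mod_hom A T ?Y"
    show "ev N S w = \<zero>\<^bsub>N\<^esub> \<longleftrightarrow> (\<forall>t\<in>carrier T. r (w t) = \<zero>\<^bsub>X\<^esub>)" using V_iff[OF w] w by (simp add: V_def)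
  next
    fix h assume h: "lin A T X h"
    have eq: "{y \<in> carrier ?Y. r y = \<zero>\<^bsub>X\<^esub>} = cc ` carrier ?M"
      using ker lin_closed[OF cc] by blast
    have "h ` carrier T \<subseteq> r ` carrier ?Y" using lin_closed[OF h] unfolding r(2) by blast
    then obtain l where l: "lin A T ?Y l" "\<forall>t\<in>carrier T. r (l t) = h t"
      by (rule T_lift[OF lY fY X r(1) h _ extC[folded eq]]) (rule that)
    show "\<exists>w\<in>mod_hom A T ?Y. \<forall>t\<in>carrier T. r (w t) = h t"
      by (rule bexI[OF _ lin_mod_hom[OF lT l(1)]]) (use l(2) in simp)
  next
    fix H assume H: "submodule H A ?Y" and w: "\<forall>w\<in>mod_hom A T ?Y. ev N S w = \<zero>\<^bsub>N\<^esub> \<longrightarrow> w ` carrier T \<subseteq> H"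
    show "{y \<in> carrier ?Y. r y = \<zero>\<^bsub>X\<^esub>} \<subseteq> H"
    proof
      fix y assume "y \<in> {y \<in> carrier ?Y. r y = \<zero>\<^bsub>X\<^esub>}"
      then have "y \<in> cc ` carrier ?M" using ker by blast
      then obtain u where u: "y = cc u" "u \<in> carrier ?M" by (rule imageE)
      have "v (u v) \<in> H" if v: "v \<in> G" for v
      proof -
        have "v ` carrier T \<subseteq> H" using w v G(2) by (auto simp: V_def)
        then show ?thesis using direct_sum_mem[OF u(2) v] by blast
      qed
      then show "y \<in> H" unfolding u(1) cc_def by (rule submodule_finsum[OF lY H])
    qed
  qed
  then show thesis by (rule that)
qed

end

section \<open>Comparing bricks and homomorphisms with their realisations\<close>

context reduction
begin

text \<open>Post-composition with \<open>r\<close> and the map \<open>ev N S\<close> are surjections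
  from the same module with the same kernel.\<close>

lemma realizes_hom_iso:
  assumes "realizes N S r X"
  shows "mod_iso E (homT X) N"
proof -
  note R = realizesD[OF assms]
  note lr = lin_hom_mod[OF lT R(6)] and le = lin_ev[OF R(1,3)]
  note lY = lhomT[OF lTS[of S]] and lX = lhomT[OF R(5)]
  let ?r = "\<lambda>w. compose (carrier T) r w"
  have sr: "?r ` carrier (homT (TS S)) = carrier (homT X)"
  proof
    show "?r ` carrier (homT (TS S)) \<subseteq> carrier (homT X)" using lin_closed[OF lr] by blast
    show "carrier (homT X) \<subseteq> ?r ` carrier (homT (TS S))"
    proof
      fix h assume h: "h \<in> carrier (homT X)"
      then obtain w where w: "w \<in> mod_hom A T (TS S)" "\<forall>t\<in>carrier T. r (w t) = h t"
        using R(9)[OF mod_hom_lin[of h A T X]] by auto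
      have "h = ?r w" by (rule mod_hom_eqI[of _ A T X])
        (use h w lin_closed[OF lr, of w] in \<open>simp_all add: compose_def\<close>)
      then show "h \<in> ?r ` carrier (homT (TS S))" using w(1) by simp
    qed
  qed
  have z: "?r w = \<zero>\<^bsub>homT X\<^esub> \<longleftrightarrow> ev N S w = \<zero>\<^bsub>N\<^esub>" if w: "w \<in> carrier (homT (TS S))" for w
  proof -
    have "?r w = \<zero>\<^bsub>homT X\<^esub> \<longleftrightarrow> (\<forall>t\<in>carrier T. r (w t) = \<zero>\<^bsub>X\<^esub>)" by (auto simp: compose_def fun_eq_iff)
    then show ?thesis using R(8)[of w] w by simp
  qed
  have kz: "ev N S w = \<zero>\<^bsub>N\<^esub>" if "w \<in> carrier (homT (TS S))" "?r w = \<zero>\<^bsub>homT X\<^esub>" for w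
    using z that by blast
  obtain \<nu> where \<nu>: "lin E (homT X) N \<nu>" "\<forall>w\<in>carrier (homT (TS S)). \<nu> (?r w) = ev N S w"
    using kz by (rule lin_factor[OF lY lX R(1) lr sr le])
  have "\<nu> ` carrier (homT X) = ev N S ` carrier (homT (TS S))"
    unfolding sr[symmetric] image_image using \<nu>(2) by simp
  also have "\<dots> = carrier N" using R(4) by simp
  finally have "\<nu> ` carrier (homT X) = carrier N" .
  moreover have "inj_on \<nu> (carrier (homT X))"
    unfolding lin_inj_iff[OF lX R(1) \<nu>(1)]
  proof (intro ballI impI)
    fix h assume h: "h \<in> carrier (homT X)" "\<nu> h = \<zero>\<^bsub>N\<^esub>"
    then obtain w where w: "h = ?r w" "w \<in> carrier (homT (TS S))" unfolding sr[symmetric] by (elim imageE)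
    have "ev N S w = \<zero>\<^bsub>N\<^esub>" using h(2) \<nu>(2) w by simp
    then show "h = \<zero>\<^bsub>homT X\<^esub>" using z[OF w(2)] w(1) by simp
  qed
  ultimately show ?thesis using \<nu>(1) unfolding mod_iso_iff[OF lX] bij_betw_def by blast
qed

text \<open>\<open>X\<close> is a quotient of a power of \<open>T\<close>, so the images of maps
  from \<open>T\<close> generate it.\<close>

lemma realizes_generated:
  assumes "realizes N S r X" "submodule H A X" "\<And>h t. lin A T X h \<Longrightarrow> t \<in> carrier T \<Longrightarrow> h t \<in> H"
  shows "H = carrier X"
proof
  note R = realizesD[OF assms(1)]
  show "H \<subseteq> carrier X" using assms(2) unfolding submodule_iff[OF R(5)] by blast
  show "carrier X \<subseteq> H"
  proof
    fix x assume "x \<in> carrier X"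
    then obtain y where y: "x = r y" "y \<in> carrier (TS S)" unfolding R(7)[symmetric] by (rule imageE)
    have "x = finsum X (\<lambda>s. r (dinc S (\<lambda>_. T) s (y s))) S"
      unfolding y(1) by (rule lin_direct_sum_eq[OF cfD(3) R(2) lT R(5,6) y(2)])
    also have "\<dots> \<in> H"
    proof (rule submodule_finsum[OF R(5) assms(2)])
      fix s assume s: "s \<in> S"
      show "r (dinc S (\<lambda>_. T) s (y s)) \<in> H"
        by (rule assms(3)[OF lin_comp[OF lin_dinc[of S A "\<lambda>_. T" s, OF lT s] R(6)] direct_sum_mem[OF y(2) s]])
    qed
    finally show "x \<in> H" .
  qed
qed

lemma realizes_fin_gen:
  assumes "realizes N S r X"
  shows "fin_gen A X"
  by (rule fin_gen_surj[OF lTS realizesD(5-7)[OF assms] fin_gen_TS[OF realizesD(2)[OF assms]]])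

text \<open>Hom(T, X) is isomorphic to \<open>N\<close>, hence a brick over \<open>E\<close>. A
  nonzero endomorphism of \<open>X\<close> acts on it nontrivially, because maps from
  \<open>T\<close> generate \<open>X\<close>, and therefore bijectively; generation then makes it
  onto, and finite length does the rest.\<close>

lemma realizes_gbrick:
  assumes "realizes N S r X" "gbrick E N"
  shows "gbrick A X"
proof -
  note R = realizesD[OF assms(1)]
  note lX = lhomT[OF R(5)]
  note fX = realizes_fin_gen[OF assms(1)]
  have "gbrick E (homT X)"
    by (rule gbrick_iso[OF assms(2) lX mod_iso_sym[OF lX R(1) realizes_hom_iso[OF assms(1)]]])
  then have b: "\<exists>w\<in>carrier (homT X). w \<noteq> \<zero>\<^bsub>homT X\<^esub>"
    "\<And>h. lin E (homT X) (homT X) h \<Longrightarrow> \<exists>w\<in>carrier (homT X). h w \<noteq> \<zero>\<^bsub>homT X\<^esub> \<Longrightarrow>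
      bij_betw h (carrier (homT X)) (carrier (homT X))"
    unfolding gbrick_def by blast+
  show ?thesis
    unfolding gbrick_def
  proof (intro conjI R(5) fX allI impI)
    obtain w where w: "w \<in> carrier (homT X)" "w \<noteq> \<zero>\<^bsub>homT X\<^esub>" using b(1) by blast
    have "\<not> (\<forall>t\<in>carrier T. w t = \<zero>\<^bsub>X\<^esub>)"
    proof
      assume "\<forall>t\<in>carrier T. w t = \<zero>\<^bsub>X\<^esub>"
      then have "w = \<zero>\<^bsub>homT X\<^esub>"
        by (intro mod_hom_eqI[of _ A T X]) (use w(1) hom_space(1)[OF lT R(5)] in simp_all)
      then show False using w(2) by blast
    qed
    then obtain t where "t \<in> carrier T" "w t \<noteq> \<zero>\<^bsub>X\<^esub>" by blast
    moreover have "w t \<in> carrier X" using lin_closed[OF mod_hom_lin[of w A T X]] w(1) \<open>t \<in> carrier T\<close> by simp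
    ultimately show "\<exists>x\<in>carrier X. x \<noteq> \<zero>\<^bsub>X\<^esub>" by blast
  next
    fix h assume h': "lin A X X h \<and> (\<exists>x\<in>carrier X. h x \<noteq> \<zero>\<^bsub>X\<^esub>)"
    then have h: "lin A X X h" by blast
    let ?h = "\<lambda>w. compose (carrier T) h w"
    note lh = lin_hom_mod[OF lT h]
    have "\<exists>w\<in>carrier (homT X). ?h w \<noteq> \<zero>\<^bsub>homT X\<^esub>"
    proof (rule ccontr)
      assume a: "\<not> (\<exists>w\<in>carrier (homT X). ?h w \<noteq> \<zero>\<^bsub>homT X\<^esub>)"
      have "{x \<in> carrier X. h x = \<zero>\<^bsub>X\<^esub>} = carrier X"
      proof (rule realizes_generated[OF assms(1) submodule_ker[OF R(5,5) h]])
        fix u t assume u: "lin A T X u" and t: "t \<in> carrier T"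
        have "restrict u (carrier T) \<in> carrier (homT X)" using lin_mod_hom[OF lT u] by simp
        then have "?h (restrict u (carrier T)) = \<zero>\<^bsub>homT X\<^esub>" using a by blast
        from fun_cong[OF this, of t] show "u t \<in> {x \<in> carrier X. h x = \<zero>\<^bsub>X\<^esub>}"
          using t lin_closed[OF u t] by (simp add: compose_def)
      qed
      then show False using h' by blast
    qed
    then have bh: "bij_betw ?h (carrier (homT X)) (carrier (homT X))" by (rule b(2)[OF lh])
    have "h ` carrier X = carrier X"
    proof (rule realizes_generated[OF assms(1) submodule_range[OF R(5,5) h]])
      fix u t assume u: "lin A T X u" and t: "t \<in> carrier T"
      have "restrict u (carrier T) \<in> carrier (homT X)" using lin_mod_hom[OF lT u] by simp
      then have "restrict u (carrier T) \<in> ?h ` carrier (homT X)" using bh by (simp only: bij_betw_def)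
      then obtain w where w: "restrict u (carrier T) = ?h w" "w \<in> carrier (homT X)" by (rule imageE)
      have "u t = h (w t)" using fun_cong[OF w(1), of t] t by (simp add: compose_def)
      moreover have "w t \<in> carrier X" using lin_closed[OF mod_hom_lin[of w A T X]] w(2) t by simp
      ultimately show "u t \<in> h ` carrier X" by blast
    qed
    then show "bij_betw h (carrier X) (carrier X)" by (rule FL_surj_bij[OF R(5) artin_FL[OF cfD(6) R(5) fX] h])
  qed
qed

lemma realizes_mod_iso:
  assumes "realizes N S r X" "realizes N' S' r' X'" "mod_iso A X X'"
  shows "mod_iso E N N'"
proof -
  note R = realizesD[OF assms(1)] and R' = realizesD[OF assms(2)]
  note lX = lhomT[OF R(5)] and lX' = lhomT[OF R'(5)]
  obtain h where h: "lin A X X' h" "bij_betw h (carrier X) (carrier X')"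
    using assms(3) unfolding mod_iso_iff[OF R(5)] by blast
  let ?k = "inv_into (carrier X) h"
  note k = lin_inv[OF R(5) h]
  have hk: "h (?k x) = x" if "x \<in> carrier X'" for x using that h(2) by (simp add: bij_betw_def f_inv_into_f)
  have kh: "?k (h x) = x" if "x \<in> carrier X" for x using that h(2) by (simp add: bij_betw_def)
  note lh = lin_hom_mod[OF lT h(1)] and lk = lin_hom_mod[OF lT k]
  have "bij_betw (\<lambda>w. compose (carrier T) h w) (carrier (homT X)) (carrier (homT X'))"
  proof (rule bij_betw_byWitness[of _ "\<lambda>w. compose (carrier T) ?k w"])
    show "\<forall>w\<in>carrier (homT X). compose (carrier T) ?k (compose (carrier T) h w) = w"
    proof
      fix w assume w: "w \<in> carrier (homT X)"
      have "w t \<in> carrier X" if "t \<in> carrier T" for t using lin_closed[OF mod_hom_lin[of w A T X]] w that by simp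
      then show "compose (carrier T) ?k (compose (carrier T) h w) = w"
        by (intro mod_hom_eqI[of _ A T X]) (use w lin_closed[OF lk lin_closed[OF lh w]] kh in \<open>simp_all add: compose_def\<close>)
    qed
    show "\<forall>w\<in>carrier (homT X'). compose (carrier T) h (compose (carrier T) ?k w) = w"
    proof
      fix w assume w: "w \<in> carrier (homT X')"
      have "w t \<in> carrier X'" if "t \<in> carrier T" for t using lin_closed[OF mod_hom_lin[of w A T X']] w that by simp
      then show "compose (carrier T) h (compose (carrier T) ?k w) = w"
        by (intro mod_hom_eqI[of _ A T X']) (use w lin_closed[OF lh lin_closed[OF lk w]] hk in \<open>simp_all add: compose_def\<close>)
    qed
    show "(\<lambda>w. compose (carrier T) h w) ` carrier (homT X) \<subseteq> carrier (homT X')" using lin_closed[OF lh] by blast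
    show "(\<lambda>w. compose (carrier T) ?k w) ` carrier (homT X') \<subseteq> carrier (homT X)" using lin_closed[OF lk] by blast
  qed
  then have "mod_iso E (homT X) (homT X')" unfolding mod_iso_iff[OF lX] using lh by blast
  then have "mod_iso E (homT X) N'" by (rule mod_iso_trans[OF lX lX' _ realizes_hom_iso[OF assms(2)]])
  then show ?thesis by (rule mod_iso_trans[OF R(1) lX mod_iso_sym[OF lX R(1) realizes_hom_iso[OF assms(1)]]])
qed

text \<open>Lifts \<open>w s\<close> of the elements \<open>\<phi> s\<close> assemble to a map
  between powers of \<open>T\<close> that induces \<open>\<phi>\<close> on the presented
  modules.\<close>

lemma ev_functorial:
  assumes N: "left_module E N" "S \<subseteq> carrier N" and N': "left_module E N'" "S' \<subseteq> carrier N'" and \<phi>: "lin E N N' \<phi>"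
    and w: "\<And>s. s \<in> S \<Longrightarrow> w s \<in> mod_hom A T (TS S') \<and> ev N' S' (w s) = \<phi> s" and v: "v \<in> mod_hom A T (TS S)"
  shows "(\<lambda>t\<in>carrier T. finsum (TS S') (\<lambda>s. w s (v t s)) S) \<in> mod_hom A T (TS S')"
    "ev N' S' (\<lambda>t\<in>carrier T. finsum (TS S') (\<lambda>s. w s (v t s)) S) = \<phi> (ev N S v)"
proof -
  interpret N': left_module E N' by fact
  let ?f = "\<lambda>s. row s v \<odot>\<^bsub>homT (TS S')\<^esub> w s" and ?F = "\<lambda>t\<in>carrier T. finsum (TS S') (\<lambda>s. w s (v t s)) S"
  note lY' = lTS[of S']
  have vE: "row s v \<in> carrier E" if "s \<in> S" for s using row_mod_hom[OF v that] by simp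
  have wH: "w s \<in> carrier (homT (TS S'))" if "s \<in> S" for s using w[OF that] by simp
  have f: "?f s \<in> carrier (homT (TS S'))" if "s \<in> S" for s
    by (rule left_module.smult_closed[OF lhomT[OF lY'] vE[OF that] wH[OF that]])
  have lw: "lin A T (TS S') (w s)" if "s \<in> S" for s by (rule mod_hom_lin) (use w[OF that] in blast)
  have lF: "lin A T (TS S') (\<lambda>t. finsum (TS S') (\<lambda>s. w s (v t s)) S)"
  proof (rule lin_comp[OF mod_hom_lin[OF v]])
    show "lin A (TS S) (TS S') (\<lambda>u. finsum (TS S') (\<lambda>s. w s (u s)) S)"
      by (rule lin_cotuple[OF cfD(3) lT lY' lw])
  qed
  show F: "?F \<in> mod_hom A T (TS S')" by (rule lin_mod_hom[OF lT lF])
  have eq: "?F = finsum (homT (TS S')) ?f S"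
  proof (rule mod_hom_eqI[OF F])
    have "finsum (homT (TS S')) ?f S \<in> carrier (homT (TS S'))"
      by (rule abelian_monoid.finsum_closed) (use lhomT[OF lY'] f in \<open>auto simp: left_module_def abelian_group_def\<close>)
    then show "finsum (homT (TS S')) ?f S \<in> mod_hom A T (TS S')" by simp
    fix t assume t: "t \<in> carrier T"
    have hk: "finsum (homT (TS S')) ?f S = finsum (homK \<rho> A T (TS S')) ?f S"
      by (simp add: finsum_def finprod_def hom_mod_def homK_def)
    have "finsum (homK \<rho> A T (TS S')) ?f S t = finsum (restr \<rho> (TS S')) (\<lambda>s. ?f s t) S"
      by (rule lin_of_finsum[OF left_module_homK[OF cf lT lY'] left_module_restr[OF lY' cfD(2,4)] lin_eval_homK[OF t]])
        (use f in simp)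
    also have "\<dots> = finsum (TS S') (\<lambda>s. ?f s t) S" by (rule finsum_restr)
    also have "\<dots> = ?F t" using t by (simp add: compose_def row_def)
    finally show "?F t = finsum (homT (TS S')) ?f S t" unfolding hk ..
  qed
  have "ev N' S' ?F = finsum N' (\<lambda>s. ev N' S' (?f s)) S"
    unfolding eq by (rule lin_of_finsum[OF lhomT[OF lY'] N'(1) lin_ev[OF N'] f])
  also have "\<dots> = finsum N' (\<lambda>s. \<phi> (row s v \<odot>\<^bsub>N\<^esub> s)) S"
  proof (rule N'.M.finsum_cong'[OF refl])
    fix s assume s: "s \<in> S"
    have "ev N' S' (?f s) = row s v \<odot>\<^bsub>N'\<^esub> ev N' S' (w s)" by (rule lin_smult[OF lin_ev[OF N'] vE[OF s] wH[OF s]])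
    also have "\<dots> = \<phi> (row s v \<odot>\<^bsub>N\<^esub> s)" using lin_smult[OF \<phi> vE[OF s], of s] w[OF s] s N(2) by auto
    finally show "ev N' S' (?f s) = \<phi> (row s v \<odot>\<^bsub>N\<^esub> s)" .
  next
    show "(\<lambda>s. \<phi> (row s v \<odot>\<^bsub>N\<^esub> s)) \<in> S \<rightarrow> carrier N'"
      using lin_closed[OF \<phi>] left_module.smult_closed[OF N(1) vE] N(2) by auto
  qed
  also have "\<dots> = \<phi> (ev N S v)"
    unfolding ev_def
    by (rule lin_of_finsum[OF N(1) N'(1) \<phi>, symmetric]) (use left_module.smult_closed[OF N(1) vE] N(2) in auto)
  finally show "ev N' S' ?F = \<phi> (ev N S v)" .
qed

text \<open>\<open>\<phi>\<close> lifts to a map \<open>\<gamma>\<close> between powers of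
  \<open>T\<close>. It descends to a map from \<open>X\<close> to \<open>X'\<close>, because the
  kernel of \<open>r\<close> is generated by images of maps with value zero under
  \<open>ev N S\<close>, and composing with \<open>\<gamma>\<close> turns these into maps with value
  zero again. If the induced map vanishes, so does \<open>\<phi>\<close>.\<close>

lemma realizes_no_hom:
  assumes "realizes N S r X" "realizes N' S' r' X'" "no_hom A X X'"
  shows "no_hom E N N'"
proof (rule no_hom_I)
  note R = realizesD[OF assms(1)] and R' = realizesD[OF assms(2)]
  fix \<phi> n assume \<phi>: "lin E N N' \<phi>" and n: "n \<in> carrier N"
  have "\<forall>s\<in>S. \<exists>w. w \<in> mod_hom A T (TS S') \<and> ev N' S' w = \<phi> s"
  proof
    fix s assume "s \<in> S"
    then have "\<phi> s \<in> carrier N'" using lin_closed[OF \<phi>] R(3) by blast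
    then have "\<phi> s \<in> ev N' S' ` mod_hom A T (TS S')" unfolding R'(4) .
    then obtain w where "\<phi> s = ev N' S' w" "w \<in> mod_hom A T (TS S')" by (rule imageE)
    then show "\<exists>w. w \<in> mod_hom A T (TS S') \<and> ev N' S' w = \<phi> s" by (intro exI[of _ w]) simp
  qed
  then obtain w where w: "\<forall>s\<in>S. w s \<in> mod_hom A T (TS S') \<and> ev N' S' (w s) = \<phi> s" by (rule bchoice[THEN exE])
  have lw: "lin A T (TS S') (w s)" if "s \<in> S" for s by (rule mod_hom_lin) (use w that in blast)
  define \<gamma> where "\<gamma> u = finsum (TS S') (\<lambda>s. w s (u s)) S" for u
  have \<gamma>: "lin A (TS S) (TS S') \<gamma>" unfolding \<gamma>_def[abs_def] by (rule lin_cotuple[OF cfD(3) lT lTS lw])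
  have key: "(\<lambda>t\<in>carrier T. \<gamma> (v t)) \<in> mod_hom A T (TS S')" "ev N' S' (\<lambda>t\<in>carrier T. \<gamma> (v t)) = \<phi> (ev N S v)"
    if "v \<in> mod_hom A T (TS S)" for v
    unfolding \<gamma>_def using ev_functorial[OF R(1,3) R'(1,3) \<phi> w[rule_format] that] by blast+
  note l = lin_comp[OF \<gamma> R'(6)]
  have "r' (\<gamma> y) = \<zero>\<^bsub>X'\<^esub>" if y: "y \<in> carrier (TS S)" "r y = \<zero>\<^bsub>X\<^esub>" for y
  proof -
    have "y \<in> {y \<in> carrier (TS S). r' (\<gamma> y) = \<zero>\<^bsub>X'\<^esub>}"
    proof (rule R(10)[OF submodule_ker[OF lTS R'(5) l] _ y])
      fix v assume v: "v \<in> mod_hom A T (TS S)" "ev N S v = \<zero>\<^bsub>N\<^esub>"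
      have "ev N' S' (\<lambda>t\<in>carrier T. \<gamma> (v t)) = \<zero>\<^bsub>N'\<^esub>"
        unfolding key(2)[OF v(1)] v(2) by (rule lin_zero[OF R(1) R'(1) \<phi>])
      then have "\<forall>t\<in>carrier T. r' (\<gamma> (v t)) = \<zero>\<^bsub>X'\<^esub>" using R'(8)[OF key(1)[OF v(1)]] by simp
      then show "v ` carrier T \<subseteq> {y \<in> carrier (TS S). r' (\<gamma> y) = \<zero>\<^bsub>X'\<^esub>}"
        using lin_closed[OF mod_hom_lin[OF v(1)]] by blast
    qed
    then show ?thesis by blast
  qed
  then obtain F where F: "lin A X X' F" "\<forall>y\<in>carrier (TS S). F (r y) = r' (\<gamma> y)"
    by (rule lin_factor[OF lTS R(5) R'(5) R(6,7) l])
  have z: "r' (\<gamma> y) = \<zero>\<^bsub>X'\<^esub>" if y: "y \<in> carrier (TS S)" for y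
    using no_hom_D[OF assms(3) F(1) lin_closed[OF R(6) y]] F(2) y by simp
  have "n \<in> ev N S ` mod_hom A T (TS S)" using n unfolding R(4) .
  then obtain v where v: "n = ev N S v" "v \<in> mod_hom A T (TS S)" by (rule imageE)
  have "\<forall>t\<in>carrier T. r' ((\<lambda>t\<in>carrier T. \<gamma> (v t)) t) = \<zero>\<^bsub>X'\<^esub>"
    using z lin_closed[OF mod_hom_lin[OF v(2)]] by simp
  then have "ev N' S' (\<lambda>t\<in>carrier T. \<gamma> (v t)) = \<zero>\<^bsub>N'\<^esub>" using R'(8)[OF key(1)[OF v(2)]] by blast
  then show "\<phi> n = \<zero>\<^bsub>N'\<^esub>" using key(2)[OF v(2)] v(1) by simp
qed

section \<open>The quotient by the ideal generated by the idempotent\<close>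

abbreviation I where "I \<equiv> Idl\<^bsub>E\<^esub> {e}"

lemma ideal_I: "ideal I E" by (rule ring.genideal_ideal[OF ring_E]) (use e(1) in simp)

lemma e_in_I: "e \<in> I" by (rule ring.genideal_self'[OF ring_E]) (use e(1) in simp)

lemma directed_reduction:
  assumes "directed A"
  shows "directed (E Quot I)"
proof -
  let ?B = "E Quot I" and ?\<pi> = "\<lambda>a. I +>\<^bsub>E\<^esub> a"
  note \<pi> = quotient_map[OF ideal_I]
  define \<Phi> where "\<Phi> N = (SOME X. \<exists>S r. realizes (restr ?\<pi> N) S r X)"
    for N :: "(('a list \<Rightarrow> 'a list) set, ('a list \<Rightarrow> 'a list) set list) module"
  have \<Phi>: "\<exists>S r. realizes (restr ?\<pi> N) S r (\<Phi> N)" if N: "brick ?B N" for N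
  proof -
    note l = brickD(2)[OF N]
    have eN: "e \<odot>\<^bsub>restr ?\<pi> N\<^esub> n = \<zero>\<^bsub>restr ?\<pi> N\<^esub>" if n: "n \<in> carrier (restr ?\<pi> N)" for n
    proof -
      \<comment> \<open>\<open>e\<close> lies in the ideal, so it acts as zero after inflation;
        under this condition realisations exist.\<close>
      have "?\<pi> e = I" by (rule abelian_subgroup.a_rcos_const[OF _ e_in_I])
        (rule abelian_subgroupI3, use ideal_I ring_E in \<open>auto simp: ideal_def ring_def\<close>)
      then have "?\<pi> e = \<zero>\<^bsub>?B\<^esub>" by (simp add: FactRing_def)
      then show ?thesis using left_module.smult_zero_l[OF l, of n] n by simp
    qed
    obtain S r X where "realizes (restr ?\<pi> N) S r X"
      using eN by (rule ex_realizes[OF left_module_restr[OF l ring_E \<pi>(1)]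
        fin_gen_restr_surj[OF l ring_E \<pi>(1,2) fgmodD(2)[OF brickD(1)[OF N]]]])
    then have "\<exists>X S r. realizes (restr ?\<pi> N) S r X" by blast
    then show ?thesis unfolding \<Phi>_def by (rule someI_ex)
  qed
  show ?thesis
  proof (rule directed_transfer[OF assms, of ?B \<Phi>])
    fix N assume N: "brick ?B N"
    obtain S r where R: "realizes (restr ?\<pi> N) S r (\<Phi> N)" using \<Phi>[OF N] by blast
    have "gbrick ?B N" using N by (simp add: brick_iff)
    from gbrick_restr_surj[OF this ring_E \<pi>(1,2)] show "gbrick A (\<Phi> N)" by (rule realizes_gbrick[OF R])
  next
    fix N N' assume N: "brick ?B N" "brick ?B N'"
    obtain S r where R: "realizes (restr ?\<pi> N) S r (\<Phi> N)" using \<Phi>[OF N(1)] by blast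
    obtain S' r' where R': "realizes (restr ?\<pi> N') S' r' (\<Phi> N')" using \<Phi>[OF N(2)] by blast
    show "mod_iso ?B N N'" if "mod_iso A (\<Phi> N) (\<Phi> N')"
      by (rule mod_iso_restr_surj[OF brickD(2)[OF N(1)] ring_E \<pi>(1,2) realizes_mod_iso[OF R R' that]])
    show "no_hom ?B N N'" if "no_hom A (\<Phi> N) (\<Phi> N')"
      by (rule no_hom_restr[OF \<pi>(1) realizes_no_hom[OF R R' that]])
  qed
qed

text \<open>\<open>E\<close> is finite dimensional because Hom(T, T) is. The scalars act as
  multiplication operators, and as these commute they also respect the opposite
  multiplication.\<close>

lemma artin_reduction: "artin (E Quot I)"
proof -
  note \<pi> = quotient_map[OF ideal_I]
  let ?\<sigma> = "\<lambda>c. \<lambda>t\<in>carrier T. \<rho> c \<odot>\<^bsub>T\<^esub> t"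
  interpret T: left_module A T by (rule lT)
  have "?\<sigma> \<in> ring_hom K E"
  proof (rule ring_hom_memI)
    fix c assume c: "c \<in> carrier K"
    show "?\<sigma> c \<in> carrier E" using lin_mod_hom[OF lT lin_central_smult[OF cf lT lin_id c]] by simp
    fix d assume d: "d \<in> carrier K"
    have "\<rho> (c \<otimes>\<^bsub>K\<^esub> d) = \<rho> d \<otimes>\<^bsub>A\<^esub> \<rho> c" using ring_hom_mult[OF cfD(4) c d] cfD(7)[OF c cfD(8)[OF d]] by simp
    then show "?\<sigma> (c \<otimes>\<^bsub>K\<^esub> d) = ?\<sigma> c \<otimes>\<^bsub>E\<^esub> ?\<sigma> d"
      using cfD(8)[OF c] cfD(8)[OF d] by (auto simp: compose_def fun_eq_iff T.smult_assoc)
    show "?\<sigma> (c \<oplus>\<^bsub>K\<^esub> d) = ?\<sigma> c \<oplus>\<^bsub>E\<^esub> ?\<sigma> d"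
      using cfD(8)[OF c] cfD(8)[OF d] ring_hom_add[OF cfD(4) c d] by (auto simp: fun_eq_iff T.smult_l_distr)
  next
    show "?\<sigma> \<one>\<^bsub>K\<^esub> = \<one>\<^bsub>E\<^esub>" using ring_hom_one[OF cfD(4)] by (auto simp: fun_eq_iff)
  qed
  moreover have "fin_gen K (restr ?\<sigma> (regular_module E))"
  proof (rule fin_gen_surj)
    note lH = left_module_homK[OF cf lT lT]
    show "left_module K (homK \<rho> A T T)" by (rule lH)
    show "fin_gen K (homK \<rho> A T T)" by (rule FL_fin_gen[OF lH FL_homK[OF cf lT fgmodD(2)[OF T_fgmod] lT fgmodD(2)[OF T_fgmod]]])
    show "left_module K (restr ?\<sigma> (regular_module E))"
      by (rule left_module_restr[OF left_module_regular[OF ring_E] cfD(2) calculation])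
    show "lin K (homK \<rho> A T T) (restr ?\<sigma> (regular_module E)) (\<lambda>f. f)"
    proof (rule linI)
      fix c f assume c: "c \<in> carrier K" and f: "f \<in> carrier (homK \<rho> A T T)"
      then have lf: "lin A T T f" by (intro mod_hom_lin) simp
      show "c \<odot>\<^bsub>homK \<rho> A T T\<^esub> f = c \<odot>\<^bsub>restr ?\<sigma> (regular_module E)\<^esub> f"
        using lin_smult[OF lf cfD(8)[OF c]] by (auto simp: compose_def fun_eq_iff)
    qed simp_all
  qed simp_all
  ultimately have "fd_over K E ?\<sigma>" using cfD(1) ring_E by (simp add: fd_over_def)
  from fd_over_artin[OF fd_over_surj[OF this \<pi>(3,1,2)]] show ?thesis .
qed

end

text \<open>Directedness brings brick-finiteness with it, so this applies to the algebras derived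
  from \<open>A\<close>.\<close>

lemma extremal_tors_of_directed:
  assumes "artin R" "directed R"
  shows "extremal_lattice (tors R)"
  using assms extremal_iff_directed[OF assms(1) directed_brick_finite[OF assms(2)]] by blast

theorem corollary1p8:
  fixes K :: "('k, 'x) ring_scheme" and A :: "('k, 'a, 'y) module_scheme"
  assumes "fd_algebra K A" and "brick_finite A"
  shows "(extremal_lattice (tors A) \<longleftrightarrow> left_modular_lattice (tors A)) \<and>
    (extremal_lattice (tors A) \<longrightarrow>
       (\<forall>J. ideal J A \<longrightarrow> extremal_lattice (tors (A Quot J))) \<and>
       (\<forall>e. e \<in> carrier A \<and> e \<otimes>\<^bsub>A\<^esub> e = e \<longrightarrow> extremal_lattice (tors (corner_ring A e))) \<and>
       (\<forall>B. tau_reduction K A B \<longrightarrow> extremal_lattice (tors B)))"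
proof (intro conjI impI allI)
  note cf = fd_algebra_central_fd_over[OF assms(1)]
  note D = central_fd_overD[OF cf]
  note iff = extremal_iff_directed[OF D(6) assms(2)]
  show "extremal_lattice (tors A) \<longleftrightarrow> left_modular_lattice (tors A)"
    unfolding iff left_modular_iff_directed[OF D(6) assms(2)] ..
  assume "extremal_lattice (tors A)"
  then have dir: "directed A" unfolding iff .
  show "extremal_lattice (tors (A Quot J))" if "ideal J A" for J
  proof -
    note q = quotient_map[OF that]
    show ?thesis
      by (rule extremal_tors_of_directed[OF fd_over_artin[OF fd_over_surj[OF D(5) q(3,1,2)]] directed_surj[OF dir D(3) q(1,2)]])
  qed
  show "extremal_lattice (tors (corner_ring A e))" if "e \<in> carrier A \<and> e \<otimes>\<^bsub>A\<^esub> e = e" for e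
  proof -
    interpret corner A e using D(3) that by (simp add: corner_def corner_axioms_def)
    show ?thesis by (rule extremal_tors_of_directed[OF fd_over_artin[OF central_fd_over_corner[OF cf]] directed_corner[OF dir]])
  qed
  show "extremal_lattice (tors B)" if red: "tau_reduction K A B" for B
  proof -
    obtain U T e where U: "tau_rigid K A U" and "Bongartz_completion K A U T" "e \<in> mod_hom A T T"
      "compose (carrier T) e e = e" "same_indecomposable_summands A (T\<lparr>carrier := e ` carrier T\<rparr>) U"
      and B: "B = opposite_ring (End_ring A T) Quot (Idl\<^bsub>opposite_ring (End_ring A T)\<^esub> {e})"
      using red unfolding tau_reduction_def Let_def by blast
    moreover have "U \<in> fgmod A" using U by (simp add: tau_rigid_def)
    then obtain P1 f P0 g where "presentation K A P1 f P0 g U" "AR_translate K A U = presentation.tau K A P1 f P0"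
      by (rule ex_presentation[OF assms(1)])
    ultimately interpret reduction K A P1 f P0 g U T e by (simp add: reduction_def reduction_axioms_def)
    show ?thesis unfolding B by (rule extremal_tors_of_directed[OF artin_reduction directed_reduction[OF dir]])
  qed
qed


end
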